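(* Let $k\in\mathbb{N}$ and $z\in\mathbb{C}$ with $-1<\operatorname{Re}(z)<k$ and $z\ne k-1$, and let $f\in\mathscr{S}(\mathbb{R})$. Then \[ \sum_{n=1}^\infty\sigma_z^{(k)}(n)f(n)=-\frac12\zeta(-z)f(0^+)+\zeta(k-z)\int_0^\infty f(y)\,dy+\frac1kF\Big(\frac{1+z}{k}\Big)\zeta\Big(\frac{1+z}{k}\Big)+\frac{(2\pi)^{(k+1)\frac{1+z}{k}-z}}{\pi^2}\sum_{n=1}^\infty S_z^{(k)}(n)\int_0^\infty H_z^{(k)}\big((2\pi)^{1+\frac1k}(ny)^{\frac1k}\big)y^{\frac{1+z}{k}-1}f(y)\,dy. \] Moreover, when $z=k-1$, \[ \sum_{n=1}^\infty\sigma_{k-1}^{(k)}(n)f(n)=-\frac12\zeta(1-k)f(0^+)+\int_0^\infty f(t)\,\frac{(k+1)\gamma+\log t}{k}\,dt+4\sum_{n=1}^\infty S_{k-1}^{(k)}(n)\int_0^\infty H_{k-1}^{(k)}\big((2\pi)^{1+\frac1k}(ny)^{\frac1k}\big)f(y)\,dy. \]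
   Context: $\mathscr{S}(\mathbb{R})$ is the Schwartz space: $f\in C^\infty(\mathbb{R})$ with $f$ and all its derivatives decaying faster than any power of $|x|$ as $|x|\to\infty$. $F(s):=\int_0^\infty f(x)x^{s-1}\,dx$ is the Mellin transform of $f$ ($\operatorname{Re}s>0$), and $f(0^+)$ is the right limit of $f$ at $0$. $\sigma_z^{(k)}(n):=\sum_{d^k\mid n}d^{z}$, $S_z^{(k)}(n):=\sum_{d_1^kd_2=n}d_2^{\frac{1+z}{k}-1}$, $H_z^{(k)}(x):=\int_0^\infty t^{z-k}\cos(xt)\cos(t^{-k})\,dt$. $\zeta$ is the Riemann zeta function and $\gamma$ Euler's constant. *)

theory Defs
  imports "HOL-Analysis.Analysis"
begin

text \<open>
  Integrals over \<open>(0,\<infinity>)\<close> are Henstock--Kurzweil integrals. By Hake's theorem these agree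
  with improper integrals at both ends, which matters below: the integral defining
  \<open>kernel_H\<close> is in general only conditionally convergent, both at \<open>0\<close> and at \<open>\<infinity>\<close>.
\<close>

definition nth_vderiv :: "nat \<Rightarrow> (real \<Rightarrow> complex) \<Rightarrow> real \<Rightarrow> complex" where
  "nth_vderiv n = (\<lambda>g x. vector_derivative g (at x)) ^^ n"

definition schwartz_space :: "(real \<Rightarrow> complex) set" where
  "schwartz_space = {f.
     (\<forall>n x. nth_vderiv n f differentiable (at x)) \<and>
     (\<forall>n m. ((\<lambda>x. \<bar>x\<bar> ^ m * norm (nth_vderiv n f x)) \<longlongrightarrow> 0) at_infinity)}"

text \<open>
  The analytic continuation of the Dirichlet series to \<open>\<complex> - {1}\<close>. By the identity theorem
  it is uniquely determined there; the value at \<open>1\<close> is unspecified.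
\<close>

definition riemann_zeta :: "complex \<Rightarrow> complex" where
  "riemann_zeta = (SOME g. g holomorphic_on (- {1}) \<and>
     (\<forall>s. Re s > 1 \<longrightarrow> (\<lambda>n. 1 / of_nat (Suc n) powr s) sums g s))"

definition mellin :: "(real \<Rightarrow> complex) \<Rightarrow> complex \<Rightarrow> complex" where
  "mellin f s = integral {0<..} (\<lambda>x. f x * of_real x powr (s - 1))"

definition divisor_sigma :: "nat \<Rightarrow> complex \<Rightarrow> nat \<Rightarrow> complex" where
  "divisor_sigma k z n = (\<Sum>d | d > 0 \<and> d ^ k dvd n. of_nat d powr z)"

definition divisor_S :: "nat \<Rightarrow> complex \<Rightarrow> nat \<Rightarrow> complex" where
  "divisor_S k z n =
     (\<Sum>(d1, d2) | d1 > 0 \<and> d2 > 0 \<and> d1 ^ k * d2 = n. of_nat d2 powr ((1 + z) / of_nat k - 1))"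

definition kernel_H_integrand :: "nat \<Rightarrow> complex \<Rightarrow> real \<Rightarrow> real \<Rightarrow> complex" where
  "kernel_H_integrand k z x t =
     of_real t powr (z - of_nat k) * of_real (cos (x * t)) * of_real (cos (1 / t ^ k))"

definition kernel_H :: "nat \<Rightarrow> complex \<Rightarrow> real \<Rightarrow> complex" where
  "kernel_H k z x = integral {0<..} (kernel_H_integrand k z x)"

definition kernel_arg :: "nat \<Rightarrow> nat \<Rightarrow> real \<Rightarrow> real" where
  "kernel_arg k n y = (2 * pi) powr (1 + 1 / real k) * (real n * y) powr (1 / real k)"

end

theory Submission
  imports Defs "HOL-Complex_Analysis.Complex_Analysis"
begin

text \<open>
  The left-hand side is \<open>\<Sum>d. d\<^sup>z A(d)\<close> with \<open>A(t) = \<Sum>m. f (t\<^sup>k m)\<close>. Poisson summation on the half line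
  in \<open>m\<close> replaces \<open>A(t)\<close> by a main term plus \<open>\<Sum>m. v(t m\<^bsup>-1/k\<^esup>) / m\<close>, where \<open>v(t) = t\<^bsup>-k\<^esup> C(t\<^bsup>-k\<^esup>)\<close> and
  \<open>C\<close> is the cosine transform of \<open>f\<close>; a second Poisson summation, now in \<open>d\<close>, turns each of these terms
  into the cosine integrals \<open>J z (2 \<pi> l m\<^bsup>1/k\<^esup>)\<close>, and the zero frequency is evaluated by Muentz's formula
  for the Mellin transform of \<open>A\<close>. All interchanges are absolutely convergent for \<open>-1 < Re z < 0\<close>.
  Since \<open>J z c = O(c\<^bsup>-Re z-k-1\<^esup>)\<close>, both sides are holomorphic on \<open>-1 < Re z < k\<close> away from \<open>k - 1\<close>, so the
  identity extends there, and the case \<open>z = k - 1\<close> is the limit in which the poles of the two zeta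
  factors cancel. Finally, inserting the definition of \<open>C\<close> into \<open>J\<close> and exchanging the integrals
  identifies \<open>J\<close> with the pairing of \<open>f\<close> and the kernel \<open>H\<close>; as the kernel integral is only
  conditionally convergent, this is done for truncated integrals under a uniform bound.
\<close>

section \<open>Integrals over the positive half line\<close>

text \<open>The decay of \<open>J z c\<close> rests on a closure property: \<open>v j\<close> is
  built from y^j times the j-th derivative of \<open>f\<close>, and t times the derivative of
  \<open>v j\<close> is a combination of \<open>v j\<close> and \<open>v (Suc j)\<close> with no
  loss of decay. Each integration by parts on t >= 1/c therefore gains a factor 1/(c t), while on t
  <= 1/c the trivial bound suffices; both ranges give the same power of c, uniformly for bounded z.
  At c = 2 pi l m^(1/k) the double series over l and m is then dominated by l^-(1+delta) m^-2 on Re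
  z >= -1 + delta, hence holomorphic in the whole strip, and grouping its terms by l^k m = n creates
  \<open>divisor_S\<close>. Negativity of Re z enters the base case mainly in two places: the bound
  for the m-th Poisson difference has size m^(Re z / k - 1), which must be summable, and the
  boundary term at d = N must tend to 0. The kernel needs a further device: one integration by parts
  at 0 costs a factor 1/c, not integrable against \<open>f\<close> at c = 0, and the inequality |sin
  x| <= x^eps buys back c^eps.\<close>

definition two_powr :: "real \<Rightarrow> real \<Rightarrow> real \<Rightarrow> real" where
  "two_powr a b t = (if t \<le> 1 then t powr a else t powr b)"

lemma two_powr_nonneg: "0 \<le> two_powr a b t"
  by (simp add: two_powr_def)

lemma two_powr_mult_powr: "t powr c * two_powr a b t = two_powr (a + c) (b + c) t"
  by (simp add: two_powr_def powr_add mult.commute)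

text \<open>The two exponents are the growth rates at 0 and at infinity, and each has its own side
  of -1 to respect. Most majorants below have this shape, because multiplication by a power of t
  only shifts both exponents.\<close>

lemma two_powr_integrable:
  assumes "a > -1" "b < -1"
  shows "two_powr a b integrable_on {0<..}"
proof -
  have 1: "two_powr a b integrable_on {0..1}"
    using integrable_on_powr_from_0[OF assms(1), of 1]
    by (rule integrable_eq) (auto simp: two_powr_def)
  have 2: "two_powr a b integrable_on {1..}"
  proof (rule integrable_eq)
    show "(\<lambda>x. x powr b) integrable_on {1..}"
      using has_integral_powr_to_inf[OF assms(2), of 1] by (simp add: has_integral_integrable)
  qed (auto simp: two_powr_def not_le dest: antisym)
  have "two_powr a b integrable_on {0..1} \<union> {1..}"
    by (intro integrable_Un[OF _ 1 2]) (auto intro: negligible_subset[of "{1}"])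
  then show ?thesis
    by (rule integrable_spike_set) (auto intro: negligible_subset[of "{0}"])
qed

lemma continuous_on_imp_measurable_Ioi:
  fixes q :: "real \<Rightarrow> 'a::euclidean_space"
  assumes "continuous_on {0<..} q"
  shows "q \<in> borel_measurable (lebesgue_on {0<..})"
  using assms by (intro continuous_imp_measurable_on_sets_lebesgue) auto

lemma absolutely_integrable_Ioi:
  fixes q :: "real \<Rightarrow> 'a::euclidean_space"
  assumes "continuous_on {0<..} q" "\<And>t. 0 < t \<Longrightarrow> norm (q t) \<le> C * two_powr a b t" "a > -1" "b < -1"
  shows "q absolutely_integrable_on {0<..}"
proof (rule measurable_bounded_by_integrable_imp_absolutely_integrable)
  show "q \<in> borel_measurable (lebesgue_on {0<..})"
    by (rule continuous_on_imp_measurable_Ioi) fact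
  show "(\<lambda>t. C * two_powr a b t) integrable_on {0<..}"
    using two_powr_integrable[OF assms(3,4)] by (intro integrable_on_mult_right) auto
qed (use assms in auto)

lemma absolutely_integrable_on_subset_Ioi:
  fixes q :: "real \<Rightarrow> 'a::euclidean_space"
  assumes "q absolutely_integrable_on {0<..}" "S \<subseteq> {0<..}" "S \<in> sets lebesgue"
  shows "q absolutely_integrable_on S"
  using set_integrable_subset assms by blast

lemma integral_norm_le:
  fixes q :: "real \<Rightarrow> 'a::euclidean_space"
  assumes "q absolutely_integrable_on S"
  shows "norm (integral S q) \<le> integral S (\<lambda>x. norm (q x))"
  using assms by (intro integral_norm_bound_integral) (auto simp: absolutely_integrable_on_def)

text \<open>Dominated convergence along a continuous parameter, obtained by testing on all sequences
  that tend to \<open>p0\<close>. It serves differentiation under the integral sign.\<close>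

lemma dominated_convergence_at:
  fixes F :: "'p::first_countable_topology \<Rightarrow> real \<Rightarrow> 'm::euclidean_space"
  assumes F: "\<forall>\<^sub>F p in at p0. F p integrable_on S \<and> (\<forall>x\<in>S. norm (F p x) \<le> h x)"
    and h: "h integrable_on S"
    and lim: "\<And>x. x \<in> S \<Longrightarrow> ((\<lambda>p. F p x) \<longlongrightarrow> g x) (at p0)"
    and nt: "at p0 \<noteq> bot"
  shows "g integrable_on S" "((\<lambda>p. integral S (F p)) \<longlongrightarrow> integral S g) (at p0)"
proof -
  have main: "g integrable_on S \<and> (\<lambda>n. integral S (F (X n))) \<longlonglongrightarrow> integral S g"
    if X: "filterlim X (at p0) sequentially" for X
  proof -
    from X F have "\<forall>\<^sub>F n in sequentially. F (X n) integrable_on S \<and> (\<forall>x\<in>S. norm (F (X n) x) \<le> h x)"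
      by (rule eventually_compose_filterlim[rotated])
    then obtain N where N: "\<And>n. n \<ge> N \<Longrightarrow> F (X n) integrable_on S \<and> (\<forall>x\<in>S. norm (F (X n) x) \<le> h x)"
      by (auto simp: eventually_sequentially)
    have l: "(\<lambda>n. F (X (n + N)) x) \<longlonglongrightarrow> g x" if "x \<in> S" for x
      using LIMSEQ_ignore_initial_segment[OF filterlim_compose[OF lim[OF that] X]] .
    have "g integrable_on S"
      by (rule dominated_convergence(1)[where f = "\<lambda>n. F (X (n + N))", OF _ h _ l]) (use N in auto)
    moreover have "(\<lambda>n. integral S (F (X (n + N)))) \<longlonglongrightarrow> integral S g"
      by (rule dominated_convergence(2)[where f = "\<lambda>n. F (X (n + N))", OF _ h _ l]) (use N in auto)
    ultimately show ?thesis by (auto dest: LIMSEQ_offset)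
  qed
  show "((\<lambda>p. integral S (F p)) \<longlongrightarrow> integral S g) (at p0)"
    unfolding tendsto_at_iff_sequentially
    using main by (auto simp: filterlim_at o_def)
  \<comment> \<open>One sequence avoiding \<open>p0\<close> is enough to see that the limit function
    is integrable.\<close>
  obtain X where "\<And>n::nat. X n \<in> - {p0}" "X \<longlonglongrightarrow> p0"
    using nt islimpt_sequential[of p0 UNIV] by (auto simp: trivial_limit_within)
  then have "filterlim X (at p0) sequentially" by (auto simp: filterlim_at)
  then show "g integrable_on S" using main by blast
qed

text \<open>Hake's theorem at the left end. The primitive based at b extends continuously to 0 by
  its limit, so the fundamental theorem that asks for the derivative only in the interior applies on
  the closed interval.\<close>

lemma improper_integral_to_0:
  fixes f :: "real \<Rightarrow> 'a::euclidean_space"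
  assumes cont: "continuous_on {0<..b} f" and "0 < b"
    and lim: "((\<lambda>a. integral {a..b} f) \<longlongrightarrow> I) (at_right 0)"
  shows "(f has_integral I) {0<..b}"
proof -
  define P where "P t = (if t = 0 then - I else - integral {t..b} f)" for t
  have eq: "P t - P c = integral {c..t} f" if "0 < c" "c \<le> t" "t \<le> b" for c t
  proof -
    have "f integrable_on {c..b}"
      by (intro integrable_continuous_interval continuous_on_subset[OF cont]) (use that in auto)
    from Henstock_Kurzweil_Integration.integral_combine[OF that(2,3) this] show ?thesis
      using that by (simp add: P_def algebra_simps)
  qed
  have der: "(P has_vector_derivative f x) (at x)" if "x \<in> {0<..<b}" for x
  proof -
    have "continuous_on {x/2..b} f"
      by (intro continuous_on_subset[OF cont]) (use that in auto)
    then have "((\<lambda>u. integral {x/2..u} f) has_vector_derivative f x) (at x within {x/2..b})"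
      using that by (intro integral_has_vector_derivative) auto
    then have "((\<lambda>u. integral {x/2..u} f) has_vector_derivative f x) (at x)"
      using that by (subst (asm) at_within_Icc_at) auto
    then have "((\<lambda>u. P (x/2) + integral {x/2..u} f) has_vector_derivative f x) (at x)"
      by (auto intro!: derivative_eq_intros)
    then show ?thesis
    proof (rule has_vector_derivative_transform_within_open[of _ _ _ "{x/2<..<b}"])
      fix u assume "u \<in> {x/2<..<b}"
      then show "P (x/2) + integral {x/2..u} f = P u"
        using eq[of "x/2" u] that by (simp add: algebra_simps)
    qed (use that in auto)
  qed
  have "continuous_on {0..b} P"
  proof (rule continuous_on_eq_continuous_within[THEN iffD2], rule ballI)
    fix x assume x: "x \<in> {0..b}"
    consider "x = 0" | "x \<in> {0<..<b}" | "x = b" "0 < x" using x by fastforce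
    then show "continuous (at x within {0..b}) P"
    proof cases
      case 1
      have "((\<lambda>t. - integral {t..b} f) \<longlongrightarrow> - I) (at_right 0)" by (intro tendsto_intros lim)
      then have "(P \<longlongrightarrow> - I) (at_right 0)"
        by (rule Lim_transform_eventually) (auto simp: P_def eventually_at_right_less eventually_at intro!: exI[of _ 1])
      then show ?thesis using 1 \<open>0 < b\<close>
        by (simp add: continuous_within P_def at_within_Icc_at_right)
    next
      case 2
      then show ?thesis
        using der has_vector_derivative_continuous continuous_at_imp_continuous_at_within by blast
    next
      case 3
      have "continuous_on {b/2..b} f"
        by (intro continuous_on_subset[OF cont]) (use \<open>0 < b\<close> in auto)
      then have "continuous_on {b/2..b} (\<lambda>u. P (b/2) + integral {b/2..u} f)"
        by (intro continuous_intros indefinite_integral_continuous_1 integrable_continuous_interval)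
      then have "continuous_on {b/2..b} P"
      proof (rule continuous_on_eq)
      fix u assume "u \<in> {b/2..b}"
      then show "P (b/2) + integral {b/2..u} f = P u"
        using eq[of "b/2" u] \<open>0 < b\<close> by (auto simp flip: eq)
    qed
      then have "continuous (at b within {b/2..b}) P"
        using \<open>0 < b\<close> unfolding continuous_on_eq_continuous_within by force
      moreover have "at b within {b/2..b} = at b within {0..b}"
        using \<open>0 < b\<close> at_within_Icc_at_left[of "b/2" b] at_within_Icc_at_left[of 0 b] by simp
      ultimately show ?thesis using 3 by simp
    qed
  qed
  then have "(f has_integral (P b - P 0)) {0..b}"
    using der \<open>0 < b\<close> by (intro fundamental_theorem_of_calculus_interior) auto
  then have "(f has_integral I) {0..b}" using \<open>0 < b\<close> by (simp add: P_def)
  then show ?thesis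
    by (subst has_integral_spike_set_eq[of _ "{0..b}"]) (auto intro: negligible_subset[of "{0}"])
qed

lemma improper_integral_to_inf:
  fixes f :: "real \<Rightarrow> 'a::euclidean_space"
  assumes int: "\<And>b. a \<le> b \<Longrightarrow> f integrable_on {a..b}"
    and lim: "((\<lambda>b. integral {a..b} f) \<longlongrightarrow> I) at_top"
  shows "(f has_integral I) {a..}"
proof -
  have "\<exists>B>0. \<forall>c d. ball 0 B \<subseteq> cbox c d \<longrightarrow>
      (\<exists>z. ((\<lambda>x. if x \<in> {a..} then f x else 0) has_integral z) (cbox c d) \<and> norm (z - I) < e)"
    if "0 < e" for e
  proof -
    from that have "\<forall>\<^sub>F b in at_top. norm (integral {a..b} f - I) < e"
      using lim by (simp add: tendsto_iff dist_norm)
    then obtain B where B: "\<And>b. b \<ge> B \<Longrightarrow> norm (integral {a..b} f - I) < e"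
      by (auto simp: eventually_at_top_linorder)
    show ?thesis
    \<comment> \<open>The extra 1 puts the points |a| + |B| and -|a| inside the open ball, so that
      every interval containing the ball reaches from below a to beyond B.\<close>
    proof (intro exI[of _ "\<bar>B\<bar> + \<bar>a\<bar> + 1"] conjI allI impI)
      fix c d :: real assume sub: "ball 0 (\<bar>B\<bar> + \<bar>a\<bar> + 1) \<subseteq> cbox c d"
      have "\<bar>a\<bar> + \<bar>B\<bar> \<in> ball 0 (\<bar>B\<bar> + \<bar>a\<bar> + 1)" "- \<bar>a\<bar> \<in> ball 0 (\<bar>B\<bar> + \<bar>a\<bar> + 1)"
        by (simp_all add: dist_norm)
      then have "\<bar>a\<bar> + \<bar>B\<bar> \<in> cbox c d" "- \<bar>a\<bar> \<in> cbox c d" using sub by blast+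
      then have cd: "c \<le> a" "a \<le> d" "B \<le> d" by auto
      have "((\<lambda>x. if x \<in> {a..d} then f x else 0) has_integral integral {a..d} f) (cbox c d)"
        using cd integrable_integral[OF int[OF cd(2)]] by (subst has_integral_restrict) auto
      then have "((\<lambda>x. if x \<in> {a..} then f x else 0) has_integral integral {a..d} f) (cbox c d)"
        by (rule has_integral_eq[rotated]) auto
      then show "\<exists>z. ((\<lambda>x. if x \<in> {a..} then f x else 0) has_integral z) (cbox c d) \<and> norm (z - I) < e"
        using B[OF cd(3)] by blast
    qed simp
  qed
  moreover have "\<nexists>c d. {a..} = cbox c d"
    by (metis atLeastAtMost_iff atLeast_iff box_real(2) dual_order.refl linorder_linear not_Ici_eq_Icc)
  ultimately show ?thesis by (subst has_integral_alt) simp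
qed

lemma improper_integral_Ioi:
  fixes f :: "real \<Rightarrow> 'a::euclidean_space"
  assumes cont: "continuous_on {0<..} f"
    and 0: "((\<lambda>a. integral {a..1} f) \<longlongrightarrow> I0) (at_right 0)"
    and 1: "((\<lambda>b. integral {1..b} f) \<longlongrightarrow> I1) at_top"
  shows "(f has_integral I0 + I1) {0<..}"
proof -
  have "(f has_integral I0) {0<..1}"
    by (intro improper_integral_to_0 0 continuous_on_subset[OF cont]) auto
  moreover have "(f has_integral I1) {1..}"
    by (intro improper_integral_to_inf 1 integrable_continuous_interval continuous_on_subset[OF cont]) auto
  ultimately have "(f has_integral I0 + I1) ({0<..1} \<union> {1..})"
    by (rule has_integral_Un) (auto intro: negligible_subset[of "{1}"])
  moreover have "{0<..1} \<union> {1..} = {(0::real)<..}" by auto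
  ultimately show ?thesis by simp
qed

text \<open>The form in which integration by parts on the half line is used throughout: only the two
  limits of the primitive matter, and the integral may be conditionally convergent.\<close>

lemma has_integral_FTC_Ioi:
  fixes P :: "real \<Rightarrow> 'a::euclidean_space"
  assumes der: "\<And>t. 0 < t \<Longrightarrow> (P has_vector_derivative P' t) (at t)"
    and cont: "continuous_on {0<..} P'"
    and 0: "(P \<longlongrightarrow> l0) (at_right 0)" and 1: "(P \<longlongrightarrow> l1) at_top"
  shows "(P' has_integral l1 - l0) {0<..}"
proof -
  have eq: "integral {a..b} P' = P b - P a" if "0 < a" "a \<le> b" for a b
    using that by (intro integral_unique fundamental_theorem_of_calculus)
      (auto intro!: has_vector_derivative_at_within[OF der])
  have "((\<lambda>a. P 1 - P a) \<longlongrightarrow> P 1 - l0) (at_right 0)" by (intro tendsto_intros 0)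
  then have 2: "((\<lambda>a. integral {a..1} P') \<longlongrightarrow> P 1 - l0) (at_right 0)"
    by (rule Lim_transform_eventually) (auto simp: eventually_at intro!: exI[of _ 1] eq[symmetric])
  have "((\<lambda>a. P a - P 1) \<longlongrightarrow> l1 - P 1) at_top" by (intro tendsto_intros 1)
  then have 3: "((\<lambda>a. integral {1..a} P') \<longlongrightarrow> l1 - P 1) at_top"
    by (rule Lim_transform_eventually) (auto simp: eventually_at_top_linorder intro!: exI[of _ 1] eq[symmetric])
  show ?thesis using improper_integral_Ioi[OF cont 2 3] by simp
qed

text \<open>The converse of \<open>improper_integral_to_inf\<close>: the radius B given by the
  definition of the integral over an unbounded set is turned into a threshold for the upper
  limit.\<close>

lemma integral_tendsto_at_top_Ici:
  fixes f :: "real \<Rightarrow> 'a::euclidean_space"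
  assumes "f integrable_on {a..}"
  shows "((\<lambda>b. integral {a..b} f) \<longlongrightarrow> integral {a..} f) at_top"
proof (rule tendstoI)
  fix e :: real assume "0 < e"
  have nl: "\<nexists>c d. {a..} = cbox c d"
    by (metis atLeastAtMost_iff atLeast_iff box_real(2) dual_order.refl linorder_linear not_Ici_eq_Icc)
  have "\<forall>e>0. \<exists>B>0. \<forall>c d. ball 0 B \<subseteq> cbox c d \<longrightarrow>
      (\<exists>z. ((\<lambda>x. if x \<in> {a..} then f x else 0) has_integral z) (cbox c d) \<and> norm (z - integral {a..} f) < e)"
    using integrable_integral[OF assms, THEN has_integral_alt[THEN iffD1]] by (simp only: nl if_False)
  then obtain B where B: "B > 0" "\<And>c d. ball 0 B \<subseteq> cbox c d \<Longrightarrow>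
      \<exists>z. ((\<lambda>x. if x \<in> {a..} then f x else 0) has_integral z) (cbox c d) \<and> norm (z - integral {a..} f) < e"
    using \<open>0 < e\<close> by blast
  have "dist (integral {a..b} f) (integral {a..} f) < e" if b: "b \<ge> B + \<bar>a\<bar>" for b
  proof -
    have "ball 0 B \<subseteq> cbox (- (B + \<bar>a\<bar>)) b" using b by (auto simp: dist_norm)
    from B(2)[OF this] obtain z where
      z: "((\<lambda>x. if x \<in> {a..} then f x else 0) has_integral z) (cbox (- (B + \<bar>a\<bar>)) b)"
      "norm (z - integral {a..} f) < e" by blast
    have "((\<lambda>x. if x \<in> {a..b} then f x else 0) has_integral z) (cbox (- (B + \<bar>a\<bar>)) b)"
      by (rule has_integral_eq[OF _ z(1)]) auto
    moreover have "{a..b} \<subseteq> cbox (- (B + \<bar>a\<bar>)) b" using B(1) by auto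
    ultimately have "(f has_integral z) {a..b}" using has_integral_restrict by blast
    then show ?thesis using z(2) by (simp add: integral_unique dist_norm)
  qed
  then show "\<forall>\<^sub>F b in at_top. dist (integral {a..b} f) (integral {a..} f) < e"
    by (auto simp: eventually_at_top_linorder)
qed

lemma integral_tendsto_at_right_Ioc:
  fixes q :: "real \<Rightarrow> 'a::euclidean_space"
  assumes i: "q integrable_on {0<..b}" and "0 < b"
  shows "((\<lambda>a. integral {a..b} q) \<longlongrightarrow> integral {0<..b} q) (at_right 0)"
proof -
  have i0: "q integrable_on {0..b}"
    using i by (rule integrable_spike_set) (auto intro: negligible_subset[of "{0}"])
  have "continuous_on {0..b} (\<lambda>x. integral {x..b} q)"
    using i0 by (rule indefinite_integral_continuous_1')
  then have "((\<lambda>x. integral {x..b} q) \<longlongrightarrow> integral {0..b} q) (at 0 within {0..b})"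
    using assms(2) by (auto simp: continuous_on_def)
  moreover have "integral {0..b} q = integral {0<..b} q"
    by (rule integral_spike_set) (auto intro: negligible_subset[of "{0}"])
  ultimately show ?thesis using assms(2) by (simp add: at_within_Icc_at_right)
qed

lemma integrable_on_Ioi_split:
  fixes g :: "real \<Rightarrow> 'a::euclidean_space"
  assumes "(g has_integral I) {0<..}" and cont: "continuous_on {0<..} g"
  shows "g integrable_on {0<..1}" "g integrable_on {1..}" "I = integral {0<..1} g + integral {1..} g"
proof -
  have g: "g integrable_on {0<..}" using assms by (simp add: has_integral_integrable)
  have "(\<lambda>x. if x \<in> {0<..} then g x else 0) integrable_on UNIV"
    using g integrable_restrict_UNIV by blast
  then have "(\<lambda>x. if x \<in> {0<..} then g x else 0) integrable_on {0..1}"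
    by (rule integrable_on_subinterval) simp
  then have "(\<lambda>x. if x \<in> {0<..} then g x else 0) integrable_on {0<..1}"
    by (rule integrable_spike_set) (auto intro: negligible_subset[of "{0}"])
  then show 1: "g integrable_on {0<..1}"
    by (rule integrable_eq) auto
  have "(\<lambda>x. if x \<in> {0<..} then g x else 0) integrable_on UNIV"
    using g integrable_restrict_UNIV by blast
  moreover have "(\<lambda>x. if x \<in> {0<..1} then g x else 0) integrable_on UNIV"
    using 1 integrable_restrict_UNIV by blast
  ultimately have "(\<lambda>x. (if x \<in> {0<..} then g x else 0) - (if x \<in> {0<..1} then g x else 0)) integrable_on UNIV"
    by (rule Henstock_Kurzweil_Integration.integrable_diff)
  then have "(\<lambda>x. if x \<in> {1<..} then g x else 0) integrable_on UNIV"
    by (rule integrable_eq) auto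
  then have "g integrable_on {1<..}" using integrable_restrict_UNIV by blast
  then show 2: "g integrable_on {1..}"
    by (rule integrable_spike_set) (auto intro: negligible_subset[of "{1}"])
  have "(g has_integral integral {0<..1} g + integral {1..} g) ({0<..1} \<union> {1..})"
    using 1 2 by (intro has_integral_Un integrable_integral) (auto intro: negligible_subset[of "{1}"])
  moreover have "{0<..1} \<union> {1..} = {(0::real)<..}" by auto
  ultimately show "I = integral {0<..1} g + integral {1..} g"
    using assms(1) has_integral_unique by metis
qed

text \<open>If G is the primitive of \<open>g\<close> based at 1, then G composed with the
  substitution is a primitive of the new integrand, and both have the same limits at the ends. This
  covers conditionally convergent integrals, which the cosine and kernel integrals are.\<close>

lemma has_integral_substitution_Ioi:
  fixes g :: "real \<Rightarrow> 'a::euclidean_space"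
  assumes g: "(g has_integral I) {0<..}" and cont: "continuous_on {0<..} g"
    and pos: "\<And>t. 0 < t \<Longrightarrow> 0 < \<phi> t"
    and der: "\<And>t. 0 < t \<Longrightarrow> (\<phi> has_real_derivative \<phi>' t) (at t)"
    and cont': "continuous_on {0<..} \<phi>'"
    and 0: "filterlim \<phi> (at_right 0) (at_right 0)" and inf: "filterlim \<phi> at_top at_top"
  shows "((\<lambda>t. \<phi>' t *\<^sub>R g (\<phi> t)) has_integral I) {0<..}"
proof -
  note sp = integrable_on_Ioi_split[OF g cont]
  define G where "G x = (if 1 \<le> x then integral {1..x} g else - integral {x..1} g)" for x
  have ig: "g integrable_on {a..b}" if "0 < a" for a b
    by (intro integrable_continuous_interval continuous_on_subset[OF cont]) (use that in auto)
  have Geq: "G x = integral {a..x} g - integral {a..1} g" if "0 < a" "a \<le> x" "a \<le> 1" for a x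
  proof (cases "1 \<le> x")
    case True
    then show ?thesis using that Henstock_Kurzweil_Integration.integral_combine[of a 1 x g] ig[of a x]
      by (simp add: G_def algebra_simps)
  next
    case False
    then show ?thesis using that Henstock_Kurzweil_Integration.integral_combine[of a x 1 g] ig[of a 1]
      by (simp add: G_def algebra_simps)
  qed
  have dG: "(G has_vector_derivative g x) (at x)" if x: "0 < x" for x
  proof -
    \<comment> \<open>A base point below both x and 1, so that \<open>Geq\<close> presents G near x
      as an indefinite integral up to a constant.\<close>
    define a where "a = min (x/2) 1"
    have a: "0 < a" "a < x" "a \<le> 1" using x by (auto simp: a_def)
    have "((\<lambda>u. integral {a..u} g) has_vector_derivative g x) (at x within {a..x+1})"
      using a by (intro integral_has_vector_derivative continuous_on_subset[OF cont]) auto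
    then have "((\<lambda>u. integral {a..u} g) has_vector_derivative g x) (at x)"
      using a by (subst (asm) at_within_Icc_at) auto
    then have "((\<lambda>u. integral {a..u} g - integral {a..1} g) has_vector_derivative g x) (at x)"
      by (simp add: has_vector_derivative_diff_const)
    then show ?thesis
      by (rule has_vector_derivative_transform_within_open[of _ _ _ "{a<..}"]) (use a Geq[of a] in auto)
  qed
  have "((\<lambda>t. \<phi>' t *\<^sub>R g (\<phi> t)) has_integral (integral {1..} g) - (- integral {0<..1} g)) {0<..}"
  proof (rule has_integral_FTC_Ioi)
    fix t :: real assume t: "0 < t"
    from vector_diff_chain_at[OF der[OF t, unfolded has_real_derivative_iff_has_vector_derivative] dG[OF pos[OF t]]]
    show "((G \<circ> \<phi>) has_vector_derivative \<phi>' t *\<^sub>R g (\<phi> t)) (at t)" .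
  next
    have "continuous_on {0<..} \<phi>"
      using der by (auto intro!: continuous_at_imp_continuous_on DERIV_isCont)
    then show "continuous_on {0<..} (\<lambda>t. \<phi>' t *\<^sub>R g (\<phi> t))"
      by (intro continuous_intros cont' continuous_on_compose2[OF cont]) (auto intro: pos)
  next
    have "((\<lambda>a. - integral {a..1} g) \<longlongrightarrow> - integral {0<..1} g) (at_right 0)"
      by (intro tendsto_minus integral_tendsto_at_right_Ioc sp) auto
    then have "(G \<longlongrightarrow> - integral {0<..1} g) (at_right 0)"
      by (rule Lim_transform_eventually) (auto simp: G_def eventually_at intro!: exI[of _ 1])
    from filterlim_compose[OF this 0] show "((G \<circ> \<phi>) \<longlongrightarrow> - integral {0<..1} g) (at_right 0)" by (simp add: o_def)
    have "((\<lambda>b. integral {1..b} g) \<longlongrightarrow> integral {1..} g) at_top"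
      by (intro integral_tendsto_at_top_Ici sp)
    then have "(G \<longlongrightarrow> integral {1..} g) at_top"
      by (rule Lim_transform_eventually) (auto simp: G_def eventually_at_top_linorder intro!: exI[of _ 1])
    from filterlim_compose[OF this inf] show "((G \<circ> \<phi>) \<longlongrightarrow> integral {1..} g) at_top" by (simp add: o_def)
  qed
  then show ?thesis using sp(3) by (simp add: add.commute)
qed

lemma has_integral_scale_Ioi:
  fixes g :: "real \<Rightarrow> 'a::euclidean_space"
  assumes "(g has_integral I) {0<..}" "continuous_on {0<..} g" "0 < c"
  shows "((\<lambda>t. g (c * t)) has_integral I /\<^sub>R c) {0<..}"
proof -
  have "((\<lambda>t. c *\<^sub>R g (c * t)) has_integral I) {0<..}"
  proof (rule has_integral_substitution_Ioi[OF assms(1,2)])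
    have "((\<lambda>t. c * t) \<longlongrightarrow> c * 0) (at_right 0)" by (intro tendsto_intros)
    then show "filterlim ((*) c) (at_right 0) (at_right 0)"
      using assms(3) by (auto simp: filterlim_at eventually_at_filter)
    show "filterlim ((*) c) at_top at_top"
      by (rule filterlim_tendsto_pos_mult_at_top[OF tendsto_const assms(3) filterlim_ident])
  qed (use assms in \<open>auto intro!: derivative_eq_intros\<close>)
  from has_integral_cmul[OF this, of "inverse c"] assms(3) show ?thesis by simp
qed

section \<open>The zeta function\<close>

lemma holomorphic_on_suminf:
  fixes f :: "nat \<Rightarrow> complex \<Rightarrow> complex"
  assumes "open S" and hol: "\<And>n. f n holomorphic_on S"
    and bound: "\<And>z. z \<in> S \<Longrightarrow> \<exists>r>0. \<exists>M. summable M \<and> (\<forall>n. \<forall>w\<in>cball z r \<inter> S. norm (f n w) \<le> M n)"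
  shows "(\<lambda>z. \<Sum>n. f n z) holomorphic_on S"
proof (rule holomorphic_uniform_sequence[OF \<open>open S\<close>])
  show "(\<lambda>z. \<Sum>n<N. f n z) holomorphic_on S" for N
    by (intro holomorphic_intros hol)
  fix z assume z: "z \<in> S"
  from bound[OF z] obtain r M where r: "r > 0" "summable M"
    "\<And>n w. w \<in> cball z r \<inter> S \<Longrightarrow> norm (f n w) \<le> M n" by blast
  obtain e where e: "e > 0" "cball z e \<subseteq> S"
    using \<open>open S\<close> z open_contains_cball by blast
  show "\<exists>d>0. cball z d \<subseteq> S \<and> uniform_limit (cball z d) (\<lambda>N z. \<Sum>n<N. f n z) (\<lambda>z. \<Sum>n. f n z) sequentially"
  proof (intro exI[of _ "min r e"] conjI)
    show "uniform_limit (cball z (min r e)) (\<lambda>N z. \<Sum>n<N. f n z) (\<lambda>z. \<Sum>n. f n z) sequentially"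
      by (rule Weierstrass_m_test[OF r(3) r(2)]) (use e in \<open>auto simp: subset_iff\<close>)
  qed (use r e in auto)
qed

lemma cball_Re_ge: "w \<in> cball z r \<Longrightarrow> Re z - r \<le> Re w"
  using abs_Re_le_cmod[of "z - w"] by (simp add: dist_norm)

lemma norm_of_nat_Suc_powr: "norm (of_nat (Suc n) powr s :: complex) = real (Suc n) powr Re s"
proof -
  have "(of_nat (Suc n) :: complex) = of_real (real (Suc n))" by simp
  then show ?thesis by (metis norm_powr_real_powr Re_complex_of_real of_nat_0_le_iff Reals_of_real)
qed

lemma summable_Suc_powr:
  assumes "a < -1" shows "summable (\<lambda>n. real (Suc n) powr a)"
  using assms summable_real_powr_iff[of a] summable_Suc_iff[of "\<lambda>n. real n powr a"] by blast

section \<open>Continuation of zeta by a binomial recurrence\<close>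

definition dirichlet_zeta :: "complex \<Rightarrow> complex" where
  "dirichlet_zeta s = (\<Sum>n. of_nat (Suc n) powr (- s))"

lemma summable_dirichlet_zeta:
  assumes "Re s > 1" shows "summable (\<lambda>n. of_nat (Suc n) powr (- s) :: complex)"
  by (rule summable_norm_cancel, unfold norm_of_nat_Suc_powr, rule summable_Suc_powr) (use assms in auto)

lemma dirichlet_zeta_holomorphic: "dirichlet_zeta holomorphic_on {s. Re s > 1}"
  unfolding dirichlet_zeta_def
proof (rule holomorphic_on_suminf)
  show "open {s. Re s > 1}" by (rule open_halfspace_Re_gt)
  show "(\<lambda>s. of_nat (Suc n) powr (- s) :: complex) holomorphic_on {s. Re s > 1}" for n
    by (intro holomorphic_intros)
  fix z assume z: "z \<in> {s. Re s > 1}"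
  define r where "r = (Re z - 1) / 2"
  show "\<exists>r>0. \<exists>M. summable M \<and> (\<forall>n. \<forall>w\<in>cball z r \<inter> {s. Re s > 1}. norm (of_nat (Suc n) powr (- w) :: complex) \<le> M n)"
  proof (intro exI[of _ r] exI[of _ "\<lambda>n. real (Suc n) powr (- (1 + r))"] conjI allI ballI)
    show "summable (\<lambda>n. real (Suc n) powr (- (1 + r)))" "r > 0"
      using z by (auto intro!: summable_Suc_powr simp: r_def simp del: of_nat_Suc)
    fix n w assume "w \<in> cball z r \<inter> {s. Re s > 1}"
    then have "Re w \<ge> 1 + r" using cball_Re_ge[of w z r] by (auto simp: r_def field_simps)
    then show "norm (of_nat (Suc n) powr (- w) :: complex) \<le> real (Suc n) powr (- (1 + r))"
      unfolding norm_of_nat_Suc_powr by (intro powr_mono) auto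
  qed
qed

text \<open>With N = \<open>Suc n\<close>, the remainder after J terms of the binomial expansion of
  (N+1)^(1-s) - N^(1-s) in powers of 1/N. It has size N^(-Re s - J), so its sum over n converges for
  Re s > 1 - J.\<close>

definition zeta_taylor :: "nat \<Rightarrow> nat \<Rightarrow> complex \<Rightarrow> complex" where
  "zeta_taylor J n s = of_nat (Suc (Suc n)) powr (1 - s) - of_nat (Suc n) powr (1 - s)
     - (\<Sum>j=1..J. ((1 - s) gchoose j) * of_nat (Suc n) powr (1 - s - of_nat j))"

text \<open>Taylor's formula on the segment from 0 to x. The bound on Re a makes the factor
  (1+u)^(a-J-1) of the last derivative at most 1 in norm, and \<open>real (Suc J)\<close> is the
  quotient of the factorial in that derivative by the factorial in the remainder.\<close>

lemma gbinomial_remainder_bound: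
  fixes a :: complex
  assumes "Re a \<le> real (Suc J)" "0 \<le> x"
  shows "norm ((1 + of_real x) powr a - (\<Sum>j\<le>J. (a gchoose j) * of_real x ^ j))
           \<le> norm (a gchoose (Suc J)) * real (Suc J) * x ^ Suc J"
proof -
  define f where "f i w = fact i * (a gchoose i) * (1 + w) powr (a - of_nat i)" for i :: nat and w :: complex
  define B where "B = fact (Suc J) * norm (a gchoose (Suc J))"
  let ?S = "closed_segment 0 (of_real x :: complex)"
  have S: "\<exists>u\<in>{0..x}. w = of_real u" if "w \<in> ?S" for w
    using that assms(2) by (auto simp: closed_segment_of_real[of 0 x, simplified] closed_segment_eq_real_ivl)
  have "cmod (f 0 (of_real x) - (\<Sum>i\<le>J. f i 0 * (of_real x - 0) ^ i / fact i)) \<le> B * cmod (of_real x - 0) ^ Suc J / fact J"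
  proof (rule complex_Taylor[where S = ?S])
    fix i w assume "w \<in> ?S" "i \<le> J"
    then obtain u where u: "u \<ge> 0" "w = of_real u" using S by force
    have n: "1 + w \<notin> \<real>\<^sub>\<le>\<^sub>0" "1 + w \<noteq> 0" using u by (auto simp: complex_nonpos_Reals_iff complex_eq_iff)
    have "(f i has_field_derivative fact i * (a gchoose i) * ((a - of_nat i) * (1 + w) powr (a - of_nat i - 1))) (at w within ?S)"
      unfolding f_def using n by (auto intro!: derivative_eq_intros simp: algebra_simps)
    moreover have "fact i * (a gchoose i) * (a - of_nat i) = fact (Suc i) * (a gchoose Suc i)"
      using gbinomial_mult_1'[of a i] by (simp add: algebra_simps)
    then have "fact i * (a gchoose i) * ((a - of_nat i) * (1 + w) powr (a - of_nat i - 1)) = f (Suc i) w"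
      unfolding f_def by (simp add: diff_diff_eq add.commute[of 1] flip: mult.assoc)
    ultimately show "(f i has_field_derivative f (Suc i) w) (at w within ?S)"
      by simp
  next
    fix w assume "w \<in> ?S"
    then obtain u where u: "u \<ge> 0" "w = of_real u" using S by force
    have "1 + w = of_real (1 + u)" using u by simp
    then have "norm ((1 + w) powr (a - of_nat (Suc J))) = (1 + u) powr (Re a - real (Suc J))"
      using u by (simp only: norm_powr_real_powr) (simp add: norm_powr_real_powr)
    also have "\<dots> \<le> (1 + u) powr 0" using u assms by (intro powr_mono) auto
    finally have "norm ((1 + w) powr (a - of_nat (Suc J))) \<le> 1" using u by simp
    then show "cmod (f (Suc J) w) \<le> B"
      unfolding f_def B_def norm_mult norm_fact by (rule mult_left_le) simp
  qed auto
  moreover have "f 0 (of_real x) = (1 + of_real x) powr a" by (simp add: f_def)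
  moreover have "f i 0 * (of_real x - 0) ^ i / fact i = (a gchoose i) * of_real x ^ i" for i
    by (simp add: f_def)
  moreover have "B * cmod (of_real x - 0) ^ Suc J / fact J = norm (a gchoose (Suc J)) * real (Suc J) * x ^ Suc J"
    using assms(2) by (simp add: B_def norm_power field_simps)
  ultimately show ?thesis by simp
qed

lemma zeta_taylor_bound:
  assumes "Re s \<ge> - real J"
  shows "norm (zeta_taylor J n s) \<le> norm ((1 - s) gchoose (Suc J)) * real (Suc J) * real (Suc n) powr (- Re s - real J)"
proof -
  define N where "N = real (Suc n)"
  have N: "N > 0" by (simp add: N_def)
  define a where "a = 1 - s"
  have c: "of_nat (Suc n) = complex_of_real N" "of_nat (Suc (Suc n)) = complex_of_real (N + 1)"
    by (simp_all add: N_def)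
  have e1: "complex_of_real (N + 1) powr a = of_real N powr a * (1 + of_real (1/N)) powr a"
  proof -
    have "complex_of_real (N + 1) = of_real N * of_real (1 + 1/N)"
      using N by (simp add: field_simps del: of_real_mult flip: of_real_mult)
    then show ?thesis using N by (simp add: powr_times_real)
  qed
  have e2: "of_real N powr (a - of_nat j) = of_real N powr a * complex_of_real (1/N) ^ j" for j
    using N by (simp add: powr_diff powr_nat' power_one_over field_simps)
  have nN: "norm (complex_of_real N powr a) = N powr (1 - Re s)"
    using N by (simp add: norm_powr_real_powr a_def)
  have "zeta_taylor J n s = of_real N powr a * ((1 + of_real (1/N)) powr a - (\<Sum>j\<le>J. (a gchoose j) * of_real (1/N) ^ j))"
  proof -
    have "(\<Sum>j\<le>J. (a gchoose j) * of_real (1/N) ^ j) = 1 + (\<Sum>j=1..J. (a gchoose j) * complex_of_real (1/N) ^ j)"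
      by (simp add: sum.atMost_shift[of _ J] atMost_atLeast0 sum.atLeast_Suc_atMost)
    then show ?thesis
      unfolding zeta_taylor_def c a_def[symmetric] e1 e2
      by (simp add: algebra_simps sum_distrib_left)
  qed
  then have "norm (zeta_taylor J n s) = N powr (1 - Re s) * norm ((1 + of_real (1/N)) powr a - (\<Sum>j\<le>J. (a gchoose j) * of_real (1/N) ^ j))"
    by (simp only: norm_mult nN)
  also have "\<dots> \<le> N powr (1 - Re s) * (norm (a gchoose (Suc J)) * real (Suc J) * (1/N) ^ Suc J)"
    using assms N by (intro mult_left_mono gbinomial_remainder_bound) (auto simp: a_def)
  also have "\<dots> = norm (a gchoose (Suc J)) * real (Suc J) * (N powr (1 - Re s) * (1/N) ^ Suc J)"
    by (simp add: mult_ac)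
  also have "N powr (1 - Re s) * (1/N) ^ Suc J = N powr (- Re s - real J)"
  proof -
    have "(1/N) ^ Suc J = N powr (- real (Suc J))"
      using N by (simp add: powr_minus powr_realpow power_one_over field_simps del: of_nat_Suc power_Suc)
    then have "N powr (1 - Re s) * (1/N) ^ Suc J = N powr ((1 - Re s) + (- real (Suc J)))"
      by (simp only: powr_add)
    then show ?thesis by (simp add: algebra_simps)
  qed
  finally show ?thesis by (simp add: a_def N_def)
qed

lemma gbinomial_holomorphic: "(\<lambda>s. (1 - s :: complex) gchoose j) holomorphic_on S"
  unfolding gbinomial_prod_rev by (intro holomorphic_intros) auto

lemma zeta_taylor_suminf:
  assumes "J \<ge> 1"
  shows "(\<lambda>s. \<Sum>n. zeta_taylor J n s) holomorphic_on {s. Re s > 1 - real J}"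
    and "Re s > 1 - real J \<Longrightarrow> summable (\<lambda>n. zeta_taylor J n s)"
proof -
  have b: "\<exists>r>0. \<exists>M. summable M \<and> (\<forall>n. \<forall>w\<in>cball z r \<inter> {s. Re s > 1 - real J}. norm (zeta_taylor J n w) \<le> M n)"
    if z: "Re z > 1 - real J" for z
  proof -
    \<comment> \<open>Half the distance to the edge of the half-plane: on the ball Re w + J >= 1 +
      r, which leaves a convergent majorant.\<close>
    define r where "r = (Re z - 1 + real J) / 2"
    have "continuous_on (cball z r) (\<lambda>s. (1 - s :: complex) gchoose (Suc J))"
      by (intro holomorphic_on_imp_continuous_on gbinomial_holomorphic)
    then have "bounded ((\<lambda>s. (1 - s :: complex) gchoose (Suc J)) ` cball z r)"
      by (intro compact_imp_bounded compact_continuous_image compact_cball)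
    then obtain B where "\<forall>y\<in>(\<lambda>s. (1 - s :: complex) gchoose (Suc J)) ` cball z r. norm y \<le> B"
      unfolding bounded_iff by (elim exE)
    then have B: "\<And>w. w \<in> cball z r \<Longrightarrow> norm ((1 - w :: complex) gchoose (Suc J)) \<le> B"
      by (simp only: ball_simps)
    show ?thesis
    proof (intro exI[of _ r] exI[of _ "\<lambda>n. B * real (Suc J) * real (Suc n) powr (- (1 + r))"] conjI allI ballI)
      show "summable (\<lambda>n. B * real (Suc J) * real (Suc n) powr (- (1 + r)))" "r > 0"
        using z by (auto intro!: summable_mult summable_Suc_powr simp: r_def simp del: of_nat_Suc)
      fix n w assume w: "w \<in> cball z r \<inter> {s. Re s > 1 - real J}"
      then have R: "Re w + real J \<ge> 1 + r" using cball_Re_ge[of w z r] by (auto simp: r_def field_simps)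
      have "norm (zeta_taylor J n w) \<le> norm ((1 - w) gchoose (Suc J)) * real (Suc J) * real (Suc n) powr (- Re w - real J)"
        using w by (intro zeta_taylor_bound) auto
      also have "\<dots> \<le> B * real (Suc J) * real (Suc n) powr (- (1 + r))"
      proof (rule mult_mono)
        have "norm ((1 - w) gchoose (Suc J)) \<le> B" using B w by blast
        moreover from this have "B \<ge> 0" using norm_ge_zero order_trans by blast
        ultimately show "norm ((1 - w) gchoose (Suc J)) * real (Suc J) \<le> B * real (Suc J)" "0 \<le> B * real (Suc J)"
          by (auto intro: mult_right_mono simp del: of_nat_Suc)
        show "real (Suc n) powr (- Re w - real J) \<le> real (Suc n) powr (- (1 + r))"
          using R by (intro powr_mono) auto
      qed simp
      finally show "norm (zeta_taylor J n w) \<le> B * real (Suc J) * real (Suc n) powr (- (1 + r))" .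
    qed
  qed
  show "(\<lambda>s. \<Sum>n. zeta_taylor J n s) holomorphic_on {s. Re s > 1 - real J}"
  proof (rule holomorphic_on_suminf)
    show "zeta_taylor J n holomorphic_on {s. Re s > 1 - real J}" for n
      unfolding zeta_taylor_def[abs_def] by (intro holomorphic_intros gbinomial_holomorphic)
  qed (use b in \<open>auto intro: open_halfspace_Re_gt\<close>)
  show "summable (\<lambda>n. zeta_taylor J n s)" if "Re s > 1 - real J"
  proof -
    from b[OF that] obtain r M where "r > 0" "summable M"
      "\<forall>n. \<forall>w\<in>cball s r \<inter> {s. Re s > 1 - real J}. norm (zeta_taylor J n w) \<le> M n" by blast
    then have "norm (zeta_taylor J n s) \<le> M n" for n using that by auto
    with \<open>summable M\<close> show ?thesis by (rule summable_comparison_test')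
  qed
qed

text \<open>Sum the binomial expansion of (N+1)^(1-s) - N^(1-s) over all N >= 1. The left side
  telescopes to -1, the term j = 1 is (1-s) zeta(s), and the terms j >= 2 involve zeta only to the
  right of s.\<close>

lemma zeta_recurrence:
  assumes s: "Re s > 1" and J: "J \<ge> 1"
  shows "(s - 1) * dirichlet_zeta s =
     1 + (\<Sum>j=2..J. ((1 - s) gchoose j) * dirichlet_zeta (s - 1 + of_nat j)) + (\<Sum>n. zeta_taylor J n s)"
proof -
  have sm: "(\<lambda>n. of_nat (Suc n) powr (1 - s - of_nat j)) sums dirichlet_zeta (s - 1 + of_nat j)" if "j \<ge> 1" for j
  proof -
    have "Re (s - 1 + of_nat j) > 1" using s that by simp
    from summable_sums[OF summable_dirichlet_zeta[OF this]] show ?thesis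
      by (simp add: dirichlet_zeta_def algebra_simps)
  qed
  have A: "(\<lambda>n. \<Sum>j=1..J. ((1 - s) gchoose j) * of_nat (Suc n) powr (1 - s - of_nat j)) sums
      (\<Sum>j=1..J. ((1 - s) gchoose j) * dirichlet_zeta (s - 1 + of_nat j))"
    by (intro sums_sum sums_mult sm) auto
  have B: "(\<lambda>n. zeta_taylor J n s) sums (\<Sum>n. zeta_taylor J n s)"
    using zeta_taylor_suminf(2)[OF J, of s] s J by (intro summable_sums) auto
  have "of_nat (Suc (Suc n)) powr (1 - s) - of_nat (Suc n) powr (1 - s) =
     (\<Sum>j=1..J. ((1 - s) gchoose j) * of_nat (Suc n) powr (1 - s - of_nat j)) + zeta_taylor J n s" for n
    unfolding zeta_taylor_def by (rule diff_add_cancel[symmetric, THEN trans], rule add.commute)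
  then have "(\<lambda>n. of_nat (Suc (Suc n)) powr (1 - s) - of_nat (Suc n) powr (1 - s)) sums
     ((\<Sum>j=1..J. ((1 - s) gchoose j) * dirichlet_zeta (s - 1 + of_nat j)) + (\<Sum>n. zeta_taylor J n s))"
    using sums_add[OF A B] by presburger
  moreover have "(\<lambda>n. of_nat (Suc (Suc n)) powr (1 - s) - of_nat (Suc n) powr (1 - s)) sums (0 - of_nat (Suc 0) powr (1 - s))"
  proof (rule telescope_sums)
    have "(\<lambda>n. real (Suc n) powr Re (1 - s)) \<longlonglongrightarrow> 0"
      by (rule LIMSEQ_Suc[OF tendsto_neg_powr[OF _ filterlim_real_sequentially]]) (use s in simp)
    then show "(\<lambda>n. of_nat (Suc n) powr (1 - s) :: complex) \<longlonglongrightarrow> 0"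
      unfolding norm_of_nat_Suc_powr[symmetric] by (rule tendsto_norm_zero_cancel)
  qed
  ultimately have "(\<Sum>j=1..J. ((1 - s) gchoose j) * dirichlet_zeta (s - 1 + of_nat j)) + (\<Sum>n. zeta_taylor J n s)
      = 0 - of_nat (Suc 0) powr (1 - s)"
    by (rule sums_unique2)
  also have "\<dots> = -1" by simp
  finally have "(\<Sum>j=1..J. ((1 - s) gchoose j) * dirichlet_zeta (s - 1 + of_nat j)) + (\<Sum>n. zeta_taylor J n s) = -1" .
  moreover have "(\<Sum>j=1..J. ((1 - s) gchoose j) * dirichlet_zeta (s - 1 + of_nat j)) =
     (1 - s) * dirichlet_zeta s + (\<Sum>j=2..J. ((1 - s) gchoose j) * dirichlet_zeta (s - 1 + of_nat j))"
    using J by (simp add: sum.atLeast_Suc_atMost[of "Suc 0" J] numeral_2_eq_2)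
  moreover have "(s - 1) * D = 1 + S + R" if "X + R = -1" "X = (1 - s) * D + S" for X D S R :: complex
    using that by algebra
  ultimately show ?thesis by blast
qed

text \<open>The factor \<open>s - 2 + j\<close> of the binomial coefficient cancels the pole of the \<open>j\<close>-th
  term, so every step of the recurrence widens the half-plane by one without new poles.\<close>

lemma zeta_extension_halfplane:
  "\<exists>\<xi>. \<xi> holomorphic_on {s. Re s > 1 - real N} \<and> (\<forall>s. Re s > 1 \<longrightarrow> \<xi> s = (s - 1) * dirichlet_zeta s)"
proof (induction N)
  case 0
  show ?case
    by (rule exI[of _ "\<lambda>s. (s - 1) * dirichlet_zeta s"])
      (auto intro!: holomorphic_intros dirichlet_zeta_holomorphic)
next
  case (Suc N)
  then obtain \<xi> where \<xi>: "\<xi> holomorphic_on {s. Re s > 1 - real N}"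
    "\<And>s. Re s > 1 \<Longrightarrow> \<xi> s = (s - 1) * dirichlet_zeta s" by blast
  define J where "J = Suc (Suc N)"
  define q where "q j s = - ((1 - s) gchoose (j - 1)) / of_nat j" for j :: nat and s :: complex
  have q: "((1 - s) gchoose j) = q j s * (s - 2 + of_nat j)" if "j \<ge> 2" for j s
    using that gbinomial_mult_1'[of "1 - s" "j - 1"] by (simp add: q_def field_simps of_nat_diff)
  define \<xi>' where "\<xi>' s = 1 + (\<Sum>j=2..J. q j s * \<xi> (s - 1 + of_nat j)) + (\<Sum>n. zeta_taylor J n s)" for s
  have "\<xi>' holomorphic_on {s. Re s > 1 - real (Suc N)}"
    unfolding \<xi>'_def[abs_def]
  proof (intro holomorphic_intros)
    fix j assume j: "j \<in> {2..J}"
    show "q j holomorphic_on {s. Re s > 1 - real (Suc N)}"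
      unfolding q_def by (intro holomorphic_intros gbinomial_holomorphic) (use j in auto)
    have "\<xi> \<circ> (\<lambda>s. s - 1 + of_nat j) holomorphic_on {s. Re s > 1 - real (Suc N)}"
      by (intro holomorphic_on_compose_gen[OF _ \<xi>(1)] holomorphic_intros) (use j in auto)
    then show "(\<lambda>s. \<xi> (s - 1 + of_nat j)) holomorphic_on {s. Re s > 1 - real (Suc N)}"
      by (simp add: o_def)
  next
    show "(\<lambda>s. \<Sum>n. zeta_taylor J n s) holomorphic_on {s. Re s > 1 - real (Suc N)}"
      by (rule holomorphic_on_subset[OF zeta_taylor_suminf(1)]) (auto simp: J_def)
  qed
  moreover have "\<xi>' s = (s - 1) * dirichlet_zeta s" if s: "Re s > 1" for s
  proof -
    have "q j s * \<xi> (s - 1 + of_nat j) = ((1 - s) gchoose j) * dirichlet_zeta (s - 1 + of_nat j)" if "j \<in> {2..J}" for j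
      using that s by (subst \<xi>(2)) (auto simp: q algebra_simps)
    then show ?thesis
      using zeta_recurrence[OF s, of J] by (simp add: \<xi>'_def J_def)
  qed
  ultimately show ?case by blast
qed

text \<open>\<open>riemann_zeta\<close> is a choice, so its defining property is available only
  after some continuation is exhibited. The continuations on the half-planes agree by the identity
  theorem and are glued together.\<close>

lemma zeta_exists:
  "\<exists>g. g holomorphic_on (- {1}) \<and> (\<forall>s. Re s > 1 \<longrightarrow> (\<lambda>n. 1 / of_nat (Suc n) powr s) sums g s)"
proof -
  have "\<forall>N. \<exists>\<xi>. \<xi> holomorphic_on {s. Re s > 1 - real N} \<and> (\<forall>s. Re s > 1 \<longrightarrow> \<xi> s = (s - 1) * dirichlet_zeta s)"
    using zeta_extension_halfplane by blast
  from choice[OF this] obtain \<xi> where \<xi>: "\<And>N. \<xi> N holomorphic_on {s. Re s > 1 - real N}"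
    "\<And>N s. Re s > 1 \<Longrightarrow> \<xi> N s = (s - 1) * dirichlet_zeta s"
    by blast
  have eq: "\<xi> N s = \<xi> M s" if "Re s > 1 - real N" "N \<le> M" for N M s
  proof (rule analytic_continuation_open[where f = "\<xi> N" and g = "\<xi> M" and z = s and s = "{s. Re s > 1}" and s' = "{s. Re s > 1 - real N}"])
    show "connected {s. Re s > 1 - real N}" by (intro convex_connected convex_halfspace_Re_gt)
    have "2 \<in> {s. Re s > 1}" by simp
    then show "{s. Re s > 1} \<noteq> {}" by blast
    show "\<xi> M holomorphic_on {s. Re s > 1 - real N}"
      by (rule holomorphic_on_subset[OF \<xi>(1)]) (use that in auto)
  qed (use \<xi> that in \<open>auto intro: open_halfspace_Re_gt\<close>)
  \<comment> \<open>The index is the first of the chosen form with Re s > 1 - N; by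
    \<open>eq\<close> any larger index gives the same value.\<close>
  define g where "g s = \<xi> (nat \<lceil>2 - Re s\<rceil>) s / (s - 1)" for s
  have g: "g s = \<xi> N s / (s - 1)" if "Re s > 1 - real N" for s N
  proof -
    define M where "M = nat \<lceil>2 - Re s\<rceil>"
    have "Re s > 1 - real M" unfolding M_def by linarith
    then have "\<xi> M s = \<xi> N s"
      using eq[of M s N] eq[of N s M] that nat_le_linear[of M N] by argo
    then show ?thesis unfolding g_def M_def by simp
  qed
  have "g holomorphic_on (- {1})"
  proof -
    have "\<exists>f'. (g has_field_derivative f') (at s)" if s: "s \<in> - {1}" for s
    proof -
    define N where "N = nat \<lceil>2 - Re s\<rceil>"
    let ?A = "{s. Re s > 1 - real N} - {1}"
    have sA: "s \<in> ?A" using s unfolding N_def by auto linarith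
    have o: "open ?A" by (intro open_delete open_halfspace_Re_gt)
    have "(\<lambda>s. \<xi> N s / (s - 1)) holomorphic_on ?A"
      by (intro holomorphic_intros holomorphic_on_subset[OF \<xi>(1)]) auto
    then obtain f' where f': "((\<lambda>s. \<xi> N s / (s - 1)) has_field_derivative f') (at s)"
      using sA o by (auto simp: holomorphic_on_open)
    have "(g has_field_derivative f') (at s)"
      by (rule has_field_derivative_transform_within_open[OF f' o sA]) (simp add: g[of N])
    then show ?thesis by blast
    qed
    then show ?thesis by (subst holomorphic_on_open) auto
  qed
  moreover have "(\<lambda>n. 1 / of_nat (Suc n) powr s) sums g s" if s: "Re s > 1" for s
  proof -
    have "s \<noteq> 1" using s by auto
    then have "g s = dirichlet_zeta s" using g[of 0 s] s \<xi>(2)[of s 0] by simp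
    then show ?thesis
      using summable_sums[OF summable_dirichlet_zeta[OF s]]
      by (simp add: dirichlet_zeta_def powr_minus field_simps del: of_nat_Suc)
  qed
  ultimately show ?thesis by blast
qed

lemma
  shows riemann_zeta_holomorphic: "riemann_zeta holomorphic_on - {1}"
    and riemann_zeta_sums: "Re s > 1 \<Longrightarrow> (\<lambda>n. of_nat (Suc n) powr (- s)) sums riemann_zeta s"
  using someI_ex[OF zeta_exists] unfolding riemann_zeta_def[symmetric]
  by (auto simp: powr_minus field_simps simp del: of_nat_Suc)

section \<open>The regular part of zeta at s = 1\<close>

definition zeta_eta_term :: "nat \<Rightarrow> complex \<Rightarrow> complex" where
  "zeta_eta_term n s = integral {real (Suc n)..real (Suc (Suc n))}
     (\<lambda>x. of_nat (Suc n) powr (- s) - of_real x powr (- s))"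

text \<open>Comparing the Dirichlet series with the integral of x^(-s) piece by piece, this is
  zeta(s) - 1/(s-1), convergent for Re s > 0 and including s = 1.\<close>

definition zeta_eta :: "complex \<Rightarrow> complex" where
  "zeta_eta s = (\<Sum>n. zeta_eta_term n s)"

lemma has_vector_derivative_powr_real:
  assumes "0 < x"
  shows "((\<lambda>x. complex_of_real x powr s) has_vector_derivative s * of_real x powr (s - 1)) (at x within A)"
proof -
  have "((\<lambda>z. z powr s) has_field_derivative s * of_real x powr (s - 1)) (at (complex_of_real x))"
    using assms by (intro has_field_derivative_powr) (auto simp: complex_nonpos_Reals_iff)
  then show ?thesis by (rule has_vector_derivative_real_field)
qed

lemma has_field_derivative_powr_real_exponent:
  assumes "0 < t"
  shows "((\<lambda>s. complex_of_real t powr s) has_field_derivative of_real (ln t) * of_real t powr s) (at s within A)"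
proof -
  have "((\<lambda>s. complex_of_real t powr s) has_field_derivative Ln (of_real t) * of_real t powr s) (at s)"
    by (rule has_field_derivative_powr_right) (use assms in simp)
  then show ?thesis using assms by (simp add: Ln_of_real has_field_derivative_at_within)
qed

lemma continuous_on_powr_real: "continuous_on {0<..} (\<lambda>x. complex_of_real x powr s)"
  by (intro continuous_at_imp_continuous_on ballI has_vector_derivative_continuous[OF has_vector_derivative_powr_real])
    simp

lemma powr_real_integrable: "0 < a \<Longrightarrow> (\<lambda>x. complex_of_real x powr s) integrable_on {a..b}"
  by (intro integrable_continuous_interval continuous_on_subset[OF continuous_on_powr_real]) auto

lemma norm_powr_real: "0 < x \<Longrightarrow> norm (complex_of_real x powr s) = x powr Re s"
  by (simp add: norm_powr_real_powr)

lemma zeta_eta_term_eq: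
  assumes "s \<noteq> 1"
  shows "zeta_eta_term n s = of_nat (Suc n) powr (- s)
    - (of_nat (Suc (Suc n)) powr (1 - s) / (1 - s) - of_nat (Suc n) powr (1 - s) / (1 - s))"
proof -
  have "((\<lambda>x. complex_of_real x powr (- s)) has_integral
     (of_real (real (Suc (Suc n))) powr (1 - s) / (1 - s) - of_real (real (Suc n)) powr (1 - s) / (1 - s)))
     {real (Suc n)..real (Suc (Suc n))}"
  proof (rule fundamental_theorem_of_calculus)
    fix x assume "x \<in> {real (Suc n)..real (Suc (Suc n))}"
    then have "0 < x" by auto
    from has_vector_derivative_divide[OF has_vector_derivative_powr_real[OF this, of "1 - s"], of "1 - s"] assms
    show "((\<lambda>x. complex_of_real x powr (1 - s) / (1 - s)) has_vector_derivative complex_of_real x powr (- s))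
      (at x within {real (Suc n)..real (Suc (Suc n))})" by simp
  qed simp
  then have "integral {real (Suc n)..real (Suc (Suc n))} (\<lambda>x. complex_of_real x powr (- s)) =
     of_nat (Suc (Suc n)) powr (1 - s) / (1 - s) - of_nat (Suc n) powr (1 - s) / (1 - s)"
    by (subst integral_unique) auto
  then show ?thesis
    unfolding zeta_eta_term_def
    by (subst Henstock_Kurzweil_Integration.integral_diff) (auto intro!: powr_real_integrable)
qed

lemma zeta_eta_term_1: "zeta_eta_term n 1 = of_real (inverse (real (Suc n)) + ln (real (Suc n)) - ln (real (Suc (Suc n))))"
proof -
  have "((\<lambda>x. complex_of_real x powr (- 1)) has_integral
     (of_real (ln (real (Suc (Suc n)))) - of_real (ln (real (Suc n))))) {real (Suc n)..real (Suc (Suc n))}"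
  proof (rule fundamental_theorem_of_calculus)
    fix x assume "x \<in> {real (Suc n)..real (Suc (Suc n))}"
    then have x: "0 < x" by auto
    then have "(ln has_real_derivative inverse x) (at x within {real (Suc n)..real (Suc (Suc n))})"
      by (auto intro!: derivative_eq_intros simp: inverse_eq_divide)
    then have "((\<lambda>x. complex_of_real (ln x)) has_vector_derivative of_real (inverse x)) (at x within {real (Suc n)..real (Suc (Suc n))})"
      by (rule has_vector_derivative_of_real)
    then
    show "((\<lambda>x. complex_of_real (ln x)) has_vector_derivative complex_of_real x powr (- 1))
      (at x within {real (Suc n)..real (Suc (Suc n))})" using x by (simp add: powr_minus_divide inverse_eq_divide)
  qed simp
  then have "integral {real (Suc n)..real (Suc (Suc n))} (\<lambda>x. complex_of_real x powr (- 1)) =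
     of_real (ln (real (Suc (Suc n)))) - of_real (ln (real (Suc n)))"
    by (rule integral_unique)
  moreover have "(\<lambda>x. complex_of_real x powr (- 1)) integrable_on {real (Suc n)..real (Suc (Suc n))}"
    by (rule powr_real_integrable) simp
  moreover have "of_nat (Suc n) powr (- 1 :: complex) = of_real (inverse (real (Suc n)))"
    by (simp add: powr_minus_divide inverse_eq_divide)
  moreover have "integral {real (Suc n)..real (Suc (Suc n))} (\<lambda>x. c) = c" for c :: complex
    by simp
  ultimately show ?thesis
    unfolding zeta_eta_term_def
    by (subst Henstock_Kurzweil_Integration.integral_diff) (simp_all del: of_nat_Suc integral_const_real add: integrable_const_ivl)
qed

text \<open>The mean value inequality over a unit interval gains one power of n over the size of the
  summand, which moves the abscissa of convergence from 1 to 0.\<close>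

lemma zeta_eta_term_bound:
  assumes "Re s > 0"
  shows "norm (zeta_eta_term n s) \<le> norm s * real (Suc n) powr (- Re s - 1)"
proof -
  define N where "N = real (Suc n)"
  have N: "N > 0" by (simp add: N_def)
  have "norm (complex_of_real N powr (- s) - of_real x powr (- s)) \<le> norm s * N powr (- Re s - 1)" if x: "x \<in> {N..N+1}" for x
  proof -
    have "norm (complex_of_real x powr (- s) - of_real N powr (- s)) \<le> (norm s * N powr (- Re s - 1)) * norm (x - N)"
    proof (rule differentiable_bound[where S = "{N..x}" and f' = "\<lambda>u h. h *\<^sub>R (- s * of_real u powr (- s - 1))"])
      fix u assume u: "u \<in> {N..x}"
      then have "0 < u" using N by auto
      then show "((\<lambda>x. complex_of_real x powr - s) has_derivative (\<lambda>h. h *\<^sub>R (- s * complex_of_real u powr (- s - 1)))) (at u within {N..x})"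
        using has_vector_derivative_powr_real unfolding has_vector_derivative_def by blast
      have "norm (- s * complex_of_real u powr (- s - 1)) \<le> norm s * N powr (- Re s - 1)"
        using u N assms \<open>0 < u\<close> by (auto simp: norm_mult norm_powr_real intro!: mult_left_mono powr_mono2')
      then show "onorm (\<lambda>h. h *\<^sub>R (- s * complex_of_real u powr (- s - 1))) \<le> norm s * N powr (- Re s - 1)"
        by (intro onorm_le) (auto simp: mult.commute intro!: mult_left_mono)
    qed (use x in auto)
    also have "\<dots> \<le> norm s * N powr (- Re s - 1)"
      using x by (intro mult_left_le) auto
    finally show ?thesis by (simp add: norm_minus_commute)
  qed
  then have "norm (integral {N..N+1} (\<lambda>x. of_real N powr (- s) - of_real x powr (- s))) \<le> (norm s * N powr (- Re s - 1)) * (N + 1 - N)"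
    using N by (intro integral_bound continuous_intros continuous_on_subset[OF continuous_on_powr_real]) auto
  then show ?thesis by (simp add: zeta_eta_term_def N_def add.commute)
qed

lemma
  shows zeta_eta_holomorphic: "zeta_eta holomorphic_on {s. Re s > 0}"
    and zeta_eta_sums: "Re s > 0 \<Longrightarrow> (\<lambda>n. zeta_eta_term n s) sums zeta_eta s"
proof -
  have b: "\<exists>r>0. \<exists>M. summable M \<and> (\<forall>n. \<forall>w\<in>cball z r \<inter> {s. Re s > 0}. norm (zeta_eta_term n w) \<le> M n)"
    if z: "Re z > 0" for z
  proof -
    define r where "r = Re z / 2"
    have r: "r > 0" using z by (simp add: r_def)
    have "norm (zeta_eta_term n w) \<le> (norm z + r) * real (Suc n) powr (- r - 1)"
      if w: "w \<in> cball z r \<inter> {s. Re s > 0}" for n w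
    proof -
      have "norm (zeta_eta_term n w) \<le> norm w * real (Suc n) powr (- Re w - 1)"
        using w by (intro zeta_eta_term_bound) auto
      also have "\<dots> \<le> (norm z + r) * real (Suc n) powr (- r - 1)"
      proof (intro mult_mono powr_mono)
        show "norm w \<le> norm z + r"
          using w norm_triangle_ineq2[of w z] by (auto simp: dist_norm norm_minus_commute)
        show "- Re w - 1 \<le> - r - 1" using w cball_Re_ge[of w z r] by (auto simp: r_def)
      qed (use r in auto)
      finally show ?thesis .
    qed
    moreover have "summable (\<lambda>n. (norm z + r) * real (Suc n) powr (- r - 1))"
      using r by (intro summable_mult summable_Suc_powr) auto
    ultimately show ?thesis using r by blast
  qed
  show "zeta_eta holomorphic_on {s. Re s > 0}"
    unfolding zeta_eta_def
  proof (rule holomorphic_on_suminf)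
    fix n
    define a b where "a = real (Suc n)" and "b = real (Suc (Suc n))"
    have ab: "a > 0" by (simp add: a_def)
    have "(\<lambda>s. integral (cbox a b) (\<lambda>x. complex_of_real a powr (- s) - of_real x powr (- s))) holomorphic_on {s. Re s > 0}"
    proof (rule leibniz_rule_holomorphic)
      fix s :: complex and t assume t: "t \<in> cbox a b"
      then have "0 < t" using ab by auto
      show "((\<lambda>s. complex_of_real a powr (- s) - of_real t powr (- s)) has_field_derivative
          - of_real (ln a) * of_real a powr (- s) + of_real (ln t) * of_real t powr (- s)) (at s within {s. Re s > 0})"
        using DERIV_diff[OF DERIV_chain2[OF has_field_derivative_powr_real_exponent[OF ab] DERIV_minus[OF DERIV_ident]]
          DERIV_chain2[OF has_field_derivative_powr_real_exponent[OF \<open>0 < t\<close>] DERIV_minus[OF DERIV_ident]]] by simp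
    next
      show "(\<lambda>x. complex_of_real a powr (- s) - of_real x powr (- s)) integrable_on cbox a b" for s
        using ab by (auto intro!: Henstock_Kurzweil_Integration.integrable_diff powr_real_integrable simp del: box_real simp: cbox_interval)
      show "continuous_on ({s. Re s > 0} \<times> cbox a b) (\<lambda>(s, t). - complex_of_real (ln a) * complex_of_real a powr (- s)
          + complex_of_real (ln t) * complex_of_real t powr (- s))"
        using ab by (auto simp: case_prod_unfold complex_nonpos_Reals_iff intro!: continuous_intros)
    qed (rule convex_halfspace_Re_gt)
    then show "zeta_eta_term n holomorphic_on {s. Re s > 0}"
      unfolding zeta_eta_term_def[abs_def] a_def b_def box_real by (simp del: of_nat_Suc)
  qed (use b in \<open>auto intro: open_halfspace_Re_gt\<close>)
  show "(\<lambda>n. zeta_eta_term n s) sums zeta_eta s" if "Re s > 0"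
  proof -
    from b[OF that] obtain r M where "r > 0" "summable M"
      "\<forall>n. \<forall>w\<in>cball s r \<inter> {s. Re s > 0}. norm (zeta_eta_term n w) \<le> M n" by blast
    then have "norm (zeta_eta_term n s) \<le> M n" for n using that by auto
    with \<open>summable M\<close> have "summable (\<lambda>n. zeta_eta_term n s)" by (rule summable_comparison_test')
    then show ?thesis unfolding zeta_eta_def by (rule summable_sums)
  qed
qed

text \<open>The constant term of zeta at its pole. This is where Euler's constant enters the formula
  for z = k - 1.\<close>

lemma zeta_eta_1: "zeta_eta 1 = euler_mascheroni"
proof -
  have "(\<lambda>n. zeta_eta_term n 1) sums of_real euler_mascheroni"
    unfolding zeta_eta_term_1 using euler_mascheroni_sum_real
    by (subst sums_of_real_iff) (simp add: add.commute)
  then show ?thesis using sums_unique2[OF zeta_eta_sums[of 1]] by simp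
qed

text \<open>The power N^(1-s)/(1-s) is what the integral of x^(-s) contributes; removing it lets the
  partial sums represent zeta for 0 < Re s < 1. In the base case both zeta(-z) and the zeta factor
  of Muentz's formula arise in this way.\<close>

lemma zeta_partial_sums:
  assumes "Re s > 0" "s \<noteq> 1"
  shows "(\<lambda>N. (\<Sum>n<N. of_nat (Suc n) powr (- s)) - of_nat (Suc N) powr (1 - s) / (1 - s))
     \<longlonglongrightarrow> zeta_eta s + 1 / (s - 1)"
proof -
  have "(\<Sum>n<N. of_nat (Suc n) powr (- s)) - of_nat (Suc N) powr (1 - s) / (1 - s) =
     (\<Sum>n<N. zeta_eta_term n s) + 1 / (s - 1)" for N
  proof (induction N)
    case 0
    show ?case using assms(2) by (simp add: divide_simps)
  next
    case (Suc N)
    then show ?case using zeta_eta_term_eq[OF assms(2), of N] by (simp del: of_nat_Suc add: diff_eq_eq add_ac)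
  qed
  moreover have "(\<lambda>N. (\<Sum>n<N. zeta_eta_term n s) + 1 / (s - 1)) \<longlonglongrightarrow> zeta_eta s + 1 / (s - 1)"
    using zeta_eta_sums[OF assms(1)] unfolding sums_def by (intro tendsto_intros)
  ultimately show ?thesis by simp
qed

lemma riemann_zeta_eq:
  assumes "Re s > 0" "s \<noteq> 1"
  shows "riemann_zeta s = zeta_eta s + 1 / (s - 1)"
proof (rule analytic_continuation_open[where f = riemann_zeta and g = "\<lambda>s. zeta_eta s + 1 / (s - 1)" and z = s
      and s = "{s. Re s > 1}" and s' = "{s. Re s > 0} - {1}"])
  show "connected ({s. Re s > 0} - {1})"
    by (intro connected_open_delete convex_connected convex_halfspace_Re_gt open_halfspace_Re_gt) simp
  have "2 \<in> {s. Re s > 1}" by simp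
  then show "{s. Re s > 1} \<noteq> {}" by blast
  show "riemann_zeta holomorphic_on ({s. Re s > 0} - {1})"
    by (rule holomorphic_on_subset[OF riemann_zeta_holomorphic]) auto
  show "(\<lambda>s. zeta_eta s + 1 / (s - 1)) holomorphic_on ({s. Re s > 0} - {1})"
    by (intro holomorphic_intros holomorphic_on_subset[OF zeta_eta_holomorphic]) auto
  fix z assume z: "z \<in> {s. Re s > 1}"
  have "(\<lambda>N. of_nat (Suc N) powr (1 - z) / (1 - z)) \<longlonglongrightarrow> 0 / (1 - z)"
  proof (intro tendsto_intros)
    have "(\<lambda>n. real (Suc n) powr Re (1 - z)) \<longlonglongrightarrow> 0"
      by (rule LIMSEQ_Suc[OF tendsto_neg_powr[OF _ filterlim_real_sequentially]]) (use z in simp)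
    then show "(\<lambda>n. of_nat (Suc n) powr (1 - z) :: complex) \<longlonglongrightarrow> 0"
      unfolding norm_of_nat_Suc_powr[symmetric] by (rule tendsto_norm_zero_cancel)
  qed (use z in auto)
  then have "(\<lambda>N. (\<Sum>n<N. of_nat (Suc n) powr (- z)) - of_nat (Suc N) powr (1 - z) / (1 - z)) \<longlonglongrightarrow> riemann_zeta z - 0 / (1 - z)"
    using riemann_zeta_sums[of z] z by (intro tendsto_diff) (auto simp: sums_def)
  moreover have "z \<noteq> 1" using z by auto
  ultimately show "riemann_zeta z = zeta_eta z + 1 / (z - 1)"
    using LIMSEQ_unique[OF _ zeta_partial_sums[of z]] z by auto
qed (use assms in \<open>auto intro!: open_delete open_halfspace_Re_gt\<close>)

text \<open>One further summand, which tends to 0, makes the sum and the subtracted power end at the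
  same integer. That is the shape in which Muentz's formula and Poisson summation produce
  it.\<close>

lemma riemann_zeta_partial_sums:
  assumes "Re s > 0" "s \<noteq> 1"
  shows "(\<lambda>N. (\<Sum>n<Suc N. of_nat (Suc n) powr (- s)) - of_nat (Suc N) powr (1 - s) / (1 - s)) \<longlonglongrightarrow> riemann_zeta s"
proof -
  have "(\<lambda>n. real (Suc n) powr Re (- s)) \<longlonglongrightarrow> 0"
    by (rule LIMSEQ_Suc[OF tendsto_neg_powr[OF _ filterlim_real_sequentially]]) (use assms in simp)
  then have "(\<lambda>n. of_nat (Suc n) powr (- s) :: complex) \<longlonglongrightarrow> 0"
    unfolding norm_of_nat_Suc_powr[symmetric] by (rule tendsto_norm_zero_cancel)
  from tendsto_add[OF zeta_partial_sums[OF assms] this] show ?thesis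
    by (simp add: riemann_zeta_eq[OF assms] algebra_simps del: of_nat_Suc)
qed

section \<open>Poisson summation on the half line\<close>

lemma dirichlet_kernel:
  "2 * sin (u / 2) * (1 / 2 + (\<Sum>l<N. cos (real (Suc l) * u))) = sin ((real N + 1 / 2) * u)"
proof (induction N)
  case 0 then show ?case by simp
next
  case (Suc N)
  have "sin ((real (Suc N) + 1/2) * u) - sin ((real N + 1/2) * u) = 2 * sin (u / 2) * cos (real (Suc N) * u)"
  proof -
    have "((real (Suc N) + 1/2) * u - (real N + 1/2) * u) / 2 = u / 2"
      "((real (Suc N) + 1/2) * u + (real N + 1/2) * u) / 2 = real (Suc N) * u" by (simp_all add: algebra_simps add_divide_distrib diff_divide_distrib)
    then show ?thesis unfolding sin_diff_sin by (simp only:)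
  qed
  then show ?case using Suc by (simp add: algebra_simps)
qed

text \<open>The error is an integral of the Dirichlet kernel from x to pi. After one integration by
  parts, recorded in \<open>E\<close>, the derivative is \<open>q' u * cos (M * u) / M\<close>;
  since \<open>q\<close> decreases, both \<open>E + q/M\<close> and \<open>E - q/M\<close> are
  monotone, and \<open>E\<close> vanishes at pi. So |E x| is at most q x / M, and the boundary term
  costs another q x / M.\<close>

lemma sum_sin_approx:
  fixes x :: real
  assumes "0 < x" "x \<le> pi"
  shows "\<bar>(\<Sum>l<N. sin (real (Suc l) * x) / real (Suc l)) - (pi - x) / 2\<bar> \<le> 1 / ((real N + 1 / 2) * sin (x / 2))"
proof -
  define M where "M = real N + 1 / 2"
  have M: "M > 0" by (simp add: M_def)
  define q where "q u = 1 / (2 * sin (u / 2))" for u :: real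
  define q' where "q' u = - cos (u / 2) / (4 * sin (u / 2) ^ 2)" for u :: real
  define E where "E u = (\<Sum>l<N. sin (real (Suc l) * u) / real (Suc l)) - (pi - u) / 2 + q u * cos (M * u) / M" for u
  have s: "sin (u / 2) > 0" "cos (u / 2) \<ge> 0" if "u \<in> {x..pi}" for u
    using that assms by (auto intro!: sin_gt_zero cos_ge_zero)
  have dq: "(q has_real_derivative q' u) (at u)" if "u \<in> {x..pi}" for u
    unfolding q_def q'_def using s[OF that]
    by (auto intro!: derivative_eq_intros simp: power2_eq_square field_simps)
  have dE: "(E has_real_derivative q' u * cos (M * u) / M) (at u)" if u: "u \<in> {x..pi}" for u
  proof -
    have "((\<lambda>u. \<Sum>l<N. sin (real (Suc l) * u) / real (Suc l)) has_real_derivative (\<Sum>l<N. cos (real (Suc l) * u))) (at u)"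
      by (intro DERIV_sum) (auto intro!: derivative_eq_intros simp del: of_nat_Suc)
    moreover have "((\<lambda>u. (pi - u) / 2) has_real_derivative - 1 / 2) (at u)"
      by (auto intro!: derivative_eq_intros)
    moreover have "((\<lambda>u. q u * cos (M * u) / M) has_real_derivative q' u * cos (M * u) / M - q u * sin (M * u)) (at u)"
      using M by (auto intro!: derivative_eq_intros dq[OF u] simp: field_simps)
    ultimately have "(E has_real_derivative (\<Sum>l<N. cos (real (Suc l) * u)) - (- 1 / 2) + (q' u * cos (M * u) / M - q u * sin (M * u))) (at u)"
      unfolding E_def by (intro DERIV_add DERIV_diff)
    moreover have "q u * sin (M * u) = 1 / 2 + (\<Sum>l<N. cos (real (Suc l) * u))"
      using dirichlet_kernel[of u N, symmetric] s[OF u] by (simp add: q_def M_def)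
    ultimately show ?thesis by (simp add: algebra_simps)
  qed
  have "cos (M * pi) = 0"
    unfolding M_def by (simp add: algebra_simps cos_add)
  moreover have "sin (real (Suc l) * pi) = 0" for l by (rule sin_npi)
  ultimately have Epi: "E pi = 0" by (simp add: E_def del: of_nat_Suc)
  have qpi: "q pi \<ge> 0" by (simp add: q_def)
  have q'0: "q' u \<le> 0" if "u \<in> {x..pi}" for u using s[OF that] by (simp add: q'_def)
  have "E x + q x / M \<ge> E pi + q pi / M"
  proof (rule DERIV_nonpos_imp_nonincreasing[OF assms(2)])
    fix u assume u: "x \<le> u" "u \<le> pi"
    have "((\<lambda>u. E u + q u / M) has_real_derivative q' u * cos (M * u) / M + q' u / M) (at u)"
      using u M by (auto intro!: derivative_eq_intros dE dq)
    moreover have "q' u * cos (M * u) / M + q' u / M = q' u * (cos (M * u) + 1) / M" by (simp add: algebra_simps add_divide_distrib)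
    moreover have "q' u * (cos (M * u) + 1) / M \<le> 0"
    proof (intro divide_nonpos_pos mult_nonpos_nonneg)
      show "0 \<le> cos (M * u) + 1" using cos_ge_minus_one[of "M * u"] by linarith
    qed (use q'0[of u] u M in auto)
    ultimately show "\<exists>y. ((\<lambda>u. E u + q u / M) has_real_derivative y) (at u) \<and> y \<le> 0" by auto
  qed
  moreover have "E x - q x / M \<le> E pi - q pi / M"
  proof (rule DERIV_nonneg_imp_nondecreasing[OF assms(2)])
    fix u assume u: "x \<le> u" "u \<le> pi"
    have "((\<lambda>u. E u - q u / M) has_real_derivative q' u * cos (M * u) / M - q' u / M) (at u)"
      using u M by (auto intro!: derivative_eq_intros dE dq)
    moreover have "q' u * cos (M * u) / M - q' u / M = q' u * (cos (M * u) - 1) / M" by (simp add: algebra_simps diff_divide_distrib)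
    moreover have "q' u * (cos (M * u) - 1) / M \<ge> 0"
    proof (intro divide_nonneg_pos mult_nonpos_nonpos)
      show "cos (M * u) - 1 \<le> 0" using cos_le_one[of "M * u"] by linarith
    qed (use q'0[of u] u M in auto)
    ultimately show "\<exists>y. ((\<lambda>u. E u - q u / M) has_real_derivative y) (at u) \<and> y \<ge> 0" by auto
  qed
  moreover have "q pi / M \<ge> 0" using qpi M by simp
  ultimately have Ex: "\<bar>E x\<bar> \<le> q x / M" using Epi by linarith
  have qx: "q x \<ge> 0" using s[of x] assms by (simp add: q_def)
  have "\<bar>q x * cos (M * x) / M\<bar> = q x / M * \<bar>cos (M * x)\<bar>"
    using qx M by (simp add: abs_mult)
  also have "\<dots> \<le> q x / M" using qx M by (intro mult_left_le) auto
  finally have "\<bar>(\<Sum>l<N. sin (real (Suc l) * x) / real (Suc l)) - (pi - x) / 2\<bar> \<le> q x / M + q x / M"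
    using Ex unfolding E_def by linarith
  also have "q x / M + q x / M = 1 / (M * sin (x / 2))"
    using s[of x] assms M by (simp add: q_def field_simps)
  finally show ?thesis by (simp add: M_def)
qed

text \<open>A weak form of Jordan's inequality. Up to pi/3 the derivative of the difference is
  nonnegative because cos is at least 1/2; afterwards sin is at least its value at pi/3, which
  exceeds pi/4.\<close>

lemma sin_ge_half:
  fixes y :: real
  assumes "0 \<le> y" "y \<le> pi / 2"
  shows "y / 2 \<le> sin y"
proof (cases "y \<le> pi / 3")
  case True
  have "sin 0 - 0 / 2 \<le> sin y - y / 2"
  proof (rule DERIV_nonneg_imp_nondecreasing[OF assms(1)])
    fix u assume u: "0 \<le> u" "u \<le> y"
    have "cos (pi / 3) \<le> cos u" using u True by (intro cos_monotone_0_pi_le) auto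
    then have "cos u - 1 / 2 \<ge> 0" by (simp add: cos_60)
    moreover have "((\<lambda>u. sin u - u / 2) has_real_derivative cos u - 1 / 2) (at u)"
      by (auto intro!: derivative_eq_intros)
    ultimately show "\<exists>d. ((\<lambda>u. sin u - u / 2) has_real_derivative d) (at u) \<and> d \<ge> 0" by blast
  qed
  then show ?thesis by simp
next
  case False
  have "sin (pi / 3) \<le> sin y" using False assms by (intro sin_monotone_2pi_le) auto
  moreover have "sin (pi / 3) = sqrt 3 / 2" by (rule sin_60)
  moreover have "pi / 4 \<le> sqrt 3 / 2"
  proof -
    have "(1.7::real) \<le> sqrt 3" by (rule real_le_rsqrt) (simp add: power2_eq_square)
    then show ?thesis using pi_less_4 pi_approx by simp
  qed
  ultimately show ?thesis using assms by linarith
qed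

text \<open>When (N + 1/2) x <= 1 the inequality |sin u| <= |u| bounds the sum. Otherwise the
  approximation error is at most 4, and the limit (pi - x)/2 is at most 2 in absolute value.\<close>

lemma sum_sin_bounded:
  fixes x :: real
  assumes "0 \<le> x" "x \<le> pi"
  shows "\<bar>\<Sum>l<N. sin (real (Suc l) * x) / real (Suc l)\<bar> \<le> 6"
proof (cases "(real N + 1/2) * x \<le> 1")
  case True
  have "\<bar>\<Sum>l<N. sin (real (Suc l) * x) / real (Suc l)\<bar> \<le> (\<Sum>l<N. \<bar>sin (real (Suc l) * x) / real (Suc l)\<bar>)" by (rule sum_abs)
  also have "\<dots> \<le> (\<Sum>l<N. x)"
  proof (rule sum_mono)
    fix l
    have "\<bar>sin (real (Suc l) * x)\<bar> \<le> real (Suc l) * x"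
      using abs_sin_x_le_abs_x[of "real (Suc l) * x"] assms by (simp add: abs_mult)
    then show "\<bar>sin (real (Suc l) * x) / real (Suc l)\<bar> \<le> x"
      by (simp add: field_simps)
  qed
  also have "\<dots> \<le> 6" using True assms by (simp add: algebra_simps)
  finally show ?thesis .
next
  case False
  then have x: "x > 0" using assms by (cases "x = 0") auto
  have "x / 4 \<le> sin (x / 2)" using sin_ge_half[of "x / 2"] assms by simp
  then have "(real N + 1/2) * (x / 4) \<le> (real N + 1/2) * sin (x / 2)" by (intro mult_left_mono) auto
  moreover have "(real N + 1/2) * (x / 4) \<ge> 1 / 4" using False by simp
  ultimately have "(real N + 1/2) * sin (x / 2) \<ge> 1 / 4" by linarith
  then have "1 / ((real N + 1/2) * sin (x / 2)) \<le> 1 / (1 / 4)" by (intro divide_left_mono) auto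
  then have "1 / ((real N + 1/2) * sin (x / 2)) \<le> 4" by simp
  moreover have "\<bar>(pi - x) / 2\<bar> \<le> 2" using assms pi_less_4 by simp
  ultimately show ?thesis using sum_sin_approx[OF x assms(2), of N] by linarith
qed

text \<open>At the integers every term of the sine series vanishes, so the value 0 there makes the
  series converge to this function at every point.\<close>

definition saw :: "real \<Rightarrow> real" where
  "saw t = (if t \<in> \<int> then 0 else frac t - 1 / 2)"

definition saw_sum :: "nat \<Rightarrow> real \<Rightarrow> real" where
  "saw_sum N t = - (\<Sum>l<N. sin (2 * pi * real (Suc l) * t) / (pi * real (Suc l)))"

lemma saw_bound: "\<bar>saw t\<bar> \<le> 1 / 2"
  using frac_lt_1[of t] frac_ge_0[of t] unfolding saw_def by (smt (verit, best) field_sum_of_halves)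

lemma saw_sum_eq: "saw_sum N t = - (\<Sum>l<N. sin (real (Suc l) * (2 * pi * t)) / real (Suc l)) / pi"
  by (simp add: saw_sum_def sum_divide_distrib mult_ac divide_divide_eq_left del: of_nat_Suc)

lemma saw_sum_frac: "saw_sum N t = saw_sum N (frac t)"
proof -
  have "sin (2 * pi * real (Suc l) * t) = sin (2 * pi * real (Suc l) * frac t)" for l
  proof -
    have "2 * pi * real (Suc l) * t = 2 * pi * real (Suc l) * frac t + 2 * pi * of_int (int (Suc l) * \<lfloor>t\<rfloor>)"
      by (simp add: frac_def algebra_simps)
    then show ?thesis
      using sin_cos_eq_iff[of "2 * pi * real (Suc l) * t" "2 * pi * real (Suc l) * frac t"] by blast
  qed
  then show ?thesis by (simp add: saw_sum_def del: of_nat_Suc)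
qed

lemma saw_sum_reflect: "saw_sum N (1 - t) = - saw_sum N t"
proof -
  have "sin (2 * pi * real (Suc l) * (1 - t)) = - sin (2 * pi * real (Suc l) * t)" for l
  proof -
    have "2 * pi * real (Suc l) * (1 - t) = - (2 * pi * real (Suc l) * t) + 2 * pi * of_int (int (Suc l))"
      by (simp add: algebra_simps)
    then have "sin (2 * pi * real (Suc l) * (1 - t)) = sin (- (2 * pi * real (Suc l) * t))"
      using sin_cos_eq_iff[of "2 * pi * real (Suc l) * (1 - t)" "- (2 * pi * real (Suc l) * t)"] by blast
    then show ?thesis by simp
  qed
  then show ?thesis by (simp add: saw_sum_def sum_negf del: of_nat_Suc)
qed

text \<open>Periodicity and reflection reduce to t in [0, 1/2], that is, to an angle in [0, pi].
  Uniformity in N and t is what termwise integration requires.\<close>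

lemma saw_sum_bounded: "\<bar>saw_sum N t\<bar> \<le> 2"
proof -
  have half: "\<bar>saw_sum N t\<bar> \<le> 2" if "0 \<le> t" "t \<le> 1/2" for t
  proof -
    have "\<bar>saw_sum N t\<bar> = \<bar>\<Sum>l<N. sin (real (Suc l) * (2 * pi * t)) / real (Suc l)\<bar> / pi"
      unfolding saw_sum_eq by (simp del: of_nat_Suc)
    also have "\<dots> \<le> 6 / pi" using that by (intro divide_right_mono sum_sin_bounded) auto
    also have "\<dots> \<le> 2" using pi_gt3 by (simp add: divide_le_eq)
    finally show ?thesis .
  qed
  show ?thesis
  proof (cases "frac t \<le> 1/2")
    case True
    then show ?thesis using half[of "frac t"] saw_sum_frac[of N t] by simp
  next
    case False
    then have "\<bar>saw_sum N (1 - frac t)\<bar> \<le> 2" using frac_lt_1[of t] by (intro half) auto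
    then show ?thesis using saw_sum_reflect[of N "frac t"] saw_sum_frac[of N t] by simp
  qed
qed

lemma saw_sum_tendsto: "(\<lambda>N. saw_sum N t) \<longlonglongrightarrow> saw t"
proof -
  have half: "(\<lambda>N. saw_sum N t) \<longlonglongrightarrow> t - 1 / 2" if t: "0 < t" "t \<le> 1/2" for t
  proof -
    let ?S = "\<lambda>N. \<Sum>l<N. sin (real (Suc l) * (2 * pi * t)) / real (Suc l)"
    have "(\<lambda>N. ?S N - (pi - 2 * pi * t) / 2) \<longlonglongrightarrow> 0"
    proof (rule Lim_null_comparison)
      show "\<forall>\<^sub>F N in sequentially. norm (?S N - (pi - 2 * pi * t) / 2) \<le> 1 / ((real N + 1 / 2) * sin (2 * pi * t / 2))"
        using t sum_sin_approx[of "2 * pi * t"] by (intro always_eventually) auto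
      have "sin (2 * pi * t / 2) > 0" using t by (intro sin_gt_zero) auto
      then show "(\<lambda>N. 1 / ((real N + 1 / 2) * sin (2 * pi * t / 2))) \<longlonglongrightarrow> 0"
      proof -
        have "(\<lambda>N. 1 / (real N + 1 / 2)) \<longlonglongrightarrow> 0" by real_asymp
        from tendsto_mult_left_zero[OF this, of "1 / sin (2 * pi * t / 2)"] show ?thesis by simp
      qed
    qed
    from tendsto_add[OF this tendsto_const[of "(pi - 2 * pi * t) / 2"]]
    have "?S \<longlonglongrightarrow> (pi - 2 * pi * t) / 2" by simp
    then have "(\<lambda>N. - ?S N / pi) \<longlonglongrightarrow> - ((pi - 2 * pi * t) / 2) / pi" by (intro tendsto_intros) auto
    moreover have "- ((pi - 2 * pi * t) / 2) / pi = t - 1 / 2" by (simp add: field_simps)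
    ultimately show ?thesis unfolding saw_sum_eq by simp
  qed
  show ?thesis
  proof (cases "t \<in> \<int>")
    case True
    then have "frac t = 0" by simp
    then have "saw_sum N t = saw_sum N 0" for N using saw_sum_frac[of N t] by (simp only:)
    then have "saw_sum N t = 0" for N by (simp add: saw_sum_def)
    then show ?thesis using True by (simp add: saw_def)
  next
    case nt: False
    then have f: "0 < frac t" "frac t < 1" by (auto simp: frac_gt_0_iff frac_lt_1)
    show ?thesis
    proof (cases "frac t \<le> 1 / 2")
      case True
      then show ?thesis using half[of "frac t"] f nt by (subst saw_sum_frac) (simp add: saw_def)
    next
      case False
      have "(\<lambda>N. - saw_sum N (1 - frac t)) \<longlonglongrightarrow> - ((1 - frac t) - 1 / 2)"
        using False f by (intro tendsto_minus half) auto
      then show ?thesis using nt by (subst saw_sum_frac) (simp add: saw_def saw_sum_reflect)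
    qed
  qed
qed

section \<open>Euler-Maclaurin summation with the sawtooth\<close>

locale half_line_function =
  fixes b b' :: "real \<Rightarrow> complex"
  assumes cont: "continuous_on {0..} b"
    and deriv: "\<And>t. 0 < t \<Longrightarrow> (b has_vector_derivative b' t) (at t)"
    and abs_int: "b' absolutely_integrable_on {0<..}"
begin

text \<open>On a unit interval the sawtooth is linear with values -1/2 and 1/2 at the two ends, so
  the product rule for \<open>P\<close> is the trapezoidal formula.\<close>

lemma saw_integral_unit:
  "((\<lambda>t. of_real (saw t) * b' t) has_integral
     (b (real (Suc n)) + b (real n)) / 2 - integral {real n..real (Suc n)} b) {real n..real (Suc n)}"
proof -
  define P where "P t = of_real (t - real n - 1 / 2) * b t" for t
  have c: "continuous_on {real n..real (Suc n)} b" by (rule continuous_on_subset[OF cont]) auto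
  have "((\<lambda>t. b t + of_real (t - real n - 1 / 2) * b' t) has_integral P (real (Suc n)) - P (real n)) {real n..real (Suc n)}"
  proof (rule fundamental_theorem_of_calculus_interior)
    show "continuous_on {real n..real (Suc n)} P"
      unfolding P_def by (intro continuous_intros c)
    fix t assume "t \<in> {real n<..<real (Suc n)}"
    then have "0 < t" by auto
    have "((\<lambda>t. t - real n - 1 / 2) has_real_derivative 1) (at t)"
      by (auto intro!: derivative_eq_intros)
    then have "((\<lambda>t. complex_of_real (t - real n - 1 / 2)) has_vector_derivative of_real 1) (at t)"
      by (rule has_vector_derivative_of_real)
    from has_vector_derivative_mult[OF this deriv[OF \<open>0 < t\<close>]]
    show "(P has_vector_derivative b t + of_real (t - real n - 1 / 2) * b' t) (at t)"
      unfolding P_def by (simp only: of_real_1 mult_1 add.commute)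
  qed simp
  moreover have "(b has_integral integral {real n..real (Suc n)} b) {real n..real (Suc n)}"
    by (intro integrable_integral integrable_continuous_interval c)
  ultimately have "((\<lambda>t. b t + of_real (t - real n - 1 / 2) * b' t - b t) has_integral
      P (real (Suc n)) - P (real n) - integral {real n..real (Suc n)} b) {real n..real (Suc n)}"
    by (rule has_integral_diff)
  then have "((\<lambda>t. of_real (t - real n - 1 / 2) * b' t) has_integral
      P (real (Suc n)) - P (real n) - integral {real n..real (Suc n)} b) {real n..real (Suc n)}"
    by (simp only: add_diff_cancel_left')
  moreover have "P (real (Suc n)) - P (real n) = (b (real (Suc n)) + b (real n)) / 2"
    by (simp add: P_def algebra_simps add_divide_distrib)
  ultimately have "((\<lambda>t. of_real (t - real n - 1 / 2) * b' t) has_integral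
      (b (real (Suc n)) + b (real n)) / 2 - integral {real n..real (Suc n)} b) {real n..real (Suc n)}" by (simp only:)
  then show ?thesis
  \<comment> \<open>At the two end points \<open>saw\<close> is 0 by convention and differs from the
    linear function; these are the exceptional points.\<close>
  proof (rule has_integral_spike_finite[rotated 2])
    fix t assume t: "t \<in> {real n..real (Suc n)} - {real n, real (Suc n)}"
    then have "\<lfloor>t\<rfloor> = int n" by (intro floor_unique) auto
    moreover from this t have "t \<notin> \<int>" by (metis Diff_iff floor_of_int Ints_cases insertCI of_int_of_nat_eq)
    ultimately show "of_real (saw t) * b' t = of_real (t - real n - 1 / 2) * b' t"
      by (simp add: saw_def frac_def)
  qed simp
qed

lemma euler_maclaurin_saw:
  "((\<lambda>t. of_real (saw t) * b' t) has_integral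
     (\<Sum>d<N. b (real (Suc d))) - integral {0..real N} b - (b (real N) - b 0) / 2) {0..real N}"
proof (induction N)
  case 0
  show ?case using has_integral_null[of "0::real" 0 "\<lambda>t. of_real (saw t) * b' t"] by simp
next
  case (Suc N)
  have "((\<lambda>t. of_real (saw t) * b' t) has_integral
     ((\<Sum>d<N. b (real (Suc d))) - integral {0..real N} b - (b (real N) - b 0) / 2) +
     ((b (real (Suc N)) + b (real N)) / 2 - integral {real N..real (Suc N)} b)) {0..real (Suc N)}"
    by (rule has_integral_combine[OF _ _ Suc saw_integral_unit]) auto
  moreover have "integral {0..real N} b + integral {real N..real (Suc N)} b = integral {0..real (Suc N)} b"
    by (intro Henstock_Kurzweil_Integration.integral_combine integrable_continuous_interval continuous_on_subset[OF cont]) auto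
  ultimately show ?case
    by (simp add: algebra_simps add_divide_distrib diff_divide_distrib flip: of_nat_Suc)
qed

definition saw_int :: complex where "saw_int = integral {0<..} (\<lambda>t. of_real (saw t) * b' t)"

lemma saw_sum_integrable: "(\<lambda>t. of_real (sin (c * t)) * b' t) absolutely_integrable_on {0<..}"
proof (rule absolutely_integrable_bounded_measurable_product[OF bilinear_times])
  show "(\<lambda>t. complex_of_real (sin (c * t))) \<in> borel_measurable (lebesgue_on {0<..})"
    by (intro continuous_on_imp_measurable_Ioi continuous_intros)
  show "bounded ((\<lambda>t. complex_of_real (sin (c * t))) ` {0<..})"
    by (rule boundedI[of _ 1]) auto
qed (auto intro: abs_int)

text \<open>Since the partial sums of the sine series are bounded by 2, twice the norm of
  \<open>b'\<close> dominates, and integrable \<open>b'\<close> suffices to integrate the series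
  term by term.\<close>

lemma saw_series:
  "(\<lambda>t. of_real (saw t) * b' t) absolutely_integrable_on {0<..}"
  "(\<lambda>l. - (integral {0<..} (\<lambda>t. of_real (sin (2 * pi * real (Suc l) * t)) * b' t) / of_real (pi * real (Suc l)))) sums saw_int"
proof -
  have i: "((\<lambda>t. of_real (saw_sum N t) * b' t) has_integral
     (\<Sum>l<N. - (integral {0<..} (\<lambda>t. of_real (sin (2 * pi * real (Suc l) * t)) * b' t) / of_real (pi * real (Suc l))))) {0<..}" for N
  proof -
    have "((\<lambda>t. \<Sum>l<N. - (of_real (sin (2 * pi * real (Suc l) * t)) * b' t / of_real (pi * real (Suc l)))) has_integral
     (\<Sum>l<N. - (integral {0<..} (\<lambda>t. of_real (sin (2 * pi * real (Suc l) * t)) * b' t) / of_real (pi * real (Suc l))))) {0<..}"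
      using saw_sum_integrable
      by (intro has_integral_sum has_integral_neg has_integral_divide integrable_integral)
        (auto simp: absolutely_integrable_on_def)
    then show ?thesis
      by (rule has_integral_eq[rotated]) (simp add: saw_sum_def sum_distrib_left sum_distrib_right sum_negf mult_ac del: of_nat_Suc)
  qed
  have n: "(\<lambda>t. 2 * norm (b' t)) integrable_on {0<..}"
    using abs_int by (auto simp: absolutely_integrable_on_def)
  have d: "norm (of_real (saw_sum N t) * b' t) \<le> 2 * norm (b' t)" for N t
    using saw_sum_bounded[of N t] by (auto simp: norm_mult intro: mult_right_mono)
  have l: "(\<lambda>N. of_real (saw_sum N t) * b' t) \<longlonglongrightarrow> of_real (saw t) * b' t" for t
    by (intro tendsto_intros saw_sum_tendsto)
  note dc = dominated_convergence[OF has_integral_integrable[OF i] n d l]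
  show "(\<lambda>t. of_real (saw t) * b' t) absolutely_integrable_on {0<..}"
  proof (rule absolutely_integrable_integrable_bound[OF _ dc(1) n])
    fix t show "norm (of_real (saw t) * b' t) \<le> 2 * norm (b' t)"
      using saw_bound[of t] by (auto simp: norm_mult intro!: mult_right_mono)
  qed
  show "(\<lambda>l. - (integral {0<..} (\<lambda>t. of_real (sin (2 * pi * real (Suc l) * t)) * b' t) / of_real (pi * real (Suc l)))) sums saw_int"
    using dc(2) unfolding sums_def saw_int_def integral_unique[OF i] .
qed

lemma poisson_limit:
  "(\<lambda>N. (\<Sum>d<N. b (real (Suc d))) - integral {0..real N} b - (b (real N) - b 0) / 2) \<longlonglongrightarrow> saw_int"
proof -
  have "(\<lambda>t. of_real (saw t) * b' t) absolutely_integrable_on {0..}"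
    using saw_series(1) by (rule absolutely_integrable_spike_set_eq[THEN iffD1, rotated 2])
      (auto intro: negligible_subset[of "{0}"])
  then have "(\<lambda>t. of_real (saw t) * b' t) integrable_on {0..}" by (simp add: absolutely_integrable_on_def)
  from integral_tendsto_at_top_Ici[OF this]
  have "((\<lambda>x. integral {0..x} (\<lambda>t. of_real (saw t) * b' t)) \<longlongrightarrow> integral {0..} (\<lambda>t. of_real (saw t) * b' t)) at_top" .
  moreover have "integral {0..} (\<lambda>t. of_real (saw t) * b' t) = saw_int"
    unfolding saw_int_def by (rule integral_spike_set) (auto intro: negligible_subset[of "{0}"])
  ultimately have "(\<lambda>N. integral {0..real N} (\<lambda>t. of_real (saw t) * b' t)) \<longlonglongrightarrow> saw_int"
    using filterlim_compose[OF _ filterlim_real_sequentially] by fastforce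
  then show ?thesis unfolding integral_unique[OF euler_maclaurin_saw] .
qed

text \<open>The bound does not depend on N. It is the majorant for the interchange of N to infinity
  with the sum over m in \<open>D_tendsto\<close>, and the source of
  \<open>E_bound_0\<close>.\<close>

lemma poisson_bound:
  "norm ((\<Sum>d<N. b (real (Suc d))) - integral {0..real N} b - (b (real N) - b 0) / 2) \<le> integral {0<..} (\<lambda>t. norm (b' t))"
proof -
  have a: "b' absolutely_integrable_on {0<..real N}"
    by (rule absolutely_integrable_on_subset_Ioi[OF abs_int]) auto
  have "norm (integral {0<..real N} (\<lambda>t. of_real (saw t) * b' t)) \<le> integral {0<..real N} (\<lambda>t. norm (b' t))"
  proof (rule integral_norm_bound_integral)
    show "(\<lambda>t. of_real (saw t) * b' t) integrable_on {0<..real N}"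
      by (intro set_lebesgue_integral_eq_integral(1) absolutely_integrable_on_subset_Ioi[OF saw_series(1)]) auto
    show "norm (of_real (saw t) * b' t) \<le> norm (b' t)" for t
      using saw_bound[of t] by (auto simp: norm_mult intro!: mult_left_le_one_le)
  qed (use a in \<open>auto simp: absolutely_integrable_on_def\<close>)
  also have "\<dots> \<le> integral {0<..} (\<lambda>t. norm (b' t))"
    using a abs_int by (intro integral_subset_le) (auto simp: absolutely_integrable_on_def)
  also have "integral {0<..real N} (\<lambda>t. of_real (saw t) * b' t) = integral {0..real N} (\<lambda>t. of_real (saw t) * b' t)"
    by (rule integral_spike_set) (auto intro: negligible_subset[of "{0}"])
  finally show ?thesis unfolding integral_unique[OF euler_maclaurin_saw] .
qed

end

section \<open>Rapidly decreasing functions and the cosine transform\<close>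

lemma nth_vderiv_Suc: "nth_vderiv (Suc n) f x = vector_derivative (nth_vderiv n f) (at x)"
  by (simp add: nth_vderiv_def)

lemma nth_vderiv_0 [simp]: "nth_vderiv 0 f = f"
  by (simp add: nth_vderiv_def)

lemma schwartz_has_derivative:
  assumes "f \<in> schwartz_space"
  shows "(nth_vderiv n f has_vector_derivative nth_vderiv (Suc n) f x) (at x)"
  using assms by (simp add: schwartz_space_def nth_vderiv_Suc vector_derivative_works)

text \<open>Only the continuity and decay of a Schwartz function are kept. The class contains all
  y^i times derivatives of \<open>f\<close> and their linear combinations; smoothness is handed over
  separately through explicit derivative hypotheses.\<close>

definition rapid :: "(real \<Rightarrow> complex) \<Rightarrow> bool" where
  "rapid g \<longleftrightarrow> continuous_on UNIV g \<and> (\<forall>m. \<exists>C. \<forall>y. \<bar>y\<bar> ^ m * norm (g y) \<le> C)"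

lemma schwartz_rapid:
  assumes "f \<in> schwartz_space" shows "rapid (nth_vderiv n f)"
proof -
  have c: "continuous_on UNIV (nth_vderiv n f)"
    using schwartz_has_derivative[OF assms] by (auto intro!: continuous_at_imp_continuous_on has_vector_derivative_continuous)
  moreover have "\<exists>C. \<forall>y. \<bar>y\<bar> ^ m * norm (nth_vderiv n f y) \<le> C" for m
  proof -
    have "((\<lambda>x. \<bar>x\<bar> ^ m * norm (nth_vderiv n f x)) \<longlongrightarrow> 0) at_infinity"
      using assms by (simp add: schwartz_space_def)
    then have "\<forall>\<^sub>F x in at_infinity. \<bar>x\<bar> ^ m * norm (nth_vderiv n f x) < 1"
      by (rule order_tendstoD) simp
    then obtain b where b: "\<And>x. b \<le> norm x \<Longrightarrow> \<bar>x\<bar> ^ m * norm (nth_vderiv n f x) < 1"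
      by (auto simp: eventually_at_infinity)
    have "continuous_on {-\<bar>b\<bar>..\<bar>b\<bar>} (\<lambda>x. \<bar>x\<bar> ^ m * norm (nth_vderiv n f x))"
      by (intro continuous_intros continuous_on_subset[OF c]) auto
    then have "bounded ((\<lambda>x. \<bar>x\<bar> ^ m * norm (nth_vderiv n f x)) ` {-\<bar>b\<bar>..\<bar>b\<bar>})"
      by (intro compact_imp_bounded compact_continuous_image) auto
    then obtain B where B: "\<forall>x\<in>{-\<bar>b\<bar>..\<bar>b\<bar>}. norm (\<bar>x\<bar> ^ m * norm (nth_vderiv n f x)) \<le> B"
      unfolding bounded_iff by auto
    have "\<bar>y\<bar> ^ m * norm (nth_vderiv n f y) \<le> max 1 B" for y
    proof (cases "b \<le> norm y")
      case True then show ?thesis using b[OF True] by simp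
    next
      case False
      then have "y \<in> {-\<bar>b\<bar>..\<bar>b\<bar>}" by auto
      then show ?thesis using B by fastforce
    qed
    then show ?thesis by blast
  qed
  ultimately show ?thesis by (simp add: rapid_def)
qed

lemma rapid_continuous: "rapid g \<Longrightarrow> continuous_on S g"
  unfolding rapid_def using continuous_on_subset by blast

lemma rapid_add:
  assumes "rapid g" "rapid h" shows "rapid (\<lambda>y. g y + h y)"
proof -
  have "\<exists>C. \<forall>y. \<bar>y\<bar> ^ m * norm (g y + h y) \<le> C" for m
  proof -
    obtain A B where "\<And>y. \<bar>y\<bar> ^ m * norm (g y) \<le> A" "\<And>y. \<bar>y\<bar> ^ m * norm (h y) \<le> B"
      using assms unfolding rapid_def by metis
    then have "\<bar>y\<bar> ^ m * norm (g y + h y) \<le> A + B" for y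
      using mult_left_mono[OF norm_triangle_ineq[of "g y" "h y"], of "\<bar>y\<bar> ^ m"]
      by (simp add: distrib_left) (meson add_mono order_trans)
    then show ?thesis by blast
  qed
  then show ?thesis using assms by (auto simp: rapid_def intro: continuous_intros)
qed

lemma rapid_mult_const:
  assumes "rapid g" shows "rapid (\<lambda>y. c * g y)"
proof -
  have "\<exists>C. \<forall>y. \<bar>y\<bar> ^ m * norm (c * g y) \<le> C" for m
  proof -
    obtain A where "\<And>y. \<bar>y\<bar> ^ m * norm (g y) \<le> A" using assms unfolding rapid_def by metis
    then have "\<bar>y\<bar> ^ m * norm (c * g y) \<le> norm c * A" for y
      using mult_left_mono[of "\<bar>y\<bar> ^ m * norm (g y)" A "norm c"] by (simp add: norm_mult mult_ac)
    then show ?thesis by blast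
  qed
  then show ?thesis using assms by (auto simp: rapid_def intro: continuous_intros)
qed

lemma rapid_power:
  assumes "rapid g" shows "rapid (\<lambda>y. of_real (y ^ j) * g y)"
proof -
  have "\<exists>C. \<forall>y. \<bar>y\<bar> ^ m * norm (of_real (y ^ j) * g y) \<le> C" for m
  proof -
    obtain A where "\<And>y. \<bar>y\<bar> ^ (m + j) * norm (g y) \<le> A" using assms unfolding rapid_def by metis
    then have "\<bar>y\<bar> ^ m * norm (of_real (y ^ j) * g y) \<le> A" for y
      by (simp add: norm_mult power_add mult_ac norm_power)
    then show ?thesis by blast
  qed
  then show ?thesis using assms by (auto simp: rapid_def intro!: continuous_intros)
qed

lemma rapid_bound:
  assumes "rapid g"
  obtains C where "C \<ge> 0" "\<And>y. norm (g y) \<le> C" "\<And>y. 0 < y \<Longrightarrow> norm (g y) \<le> C * two_powr 0 (- real m) y"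
proof -
  obtain A B where A: "\<And>y. \<bar>y\<bar> ^ 0 * norm (g y) \<le> A" and B: "\<And>y. \<bar>y\<bar> ^ m * norm (g y) \<le> B"
    using assms unfolding rapid_def by metis
  have A0: "A \<ge> 0" using A[of 0] order_trans[OF norm_ge_zero, of "g 0" A] by simp
  have "norm (g y) \<le> max A B * two_powr 0 (- real m) y" if y: "0 < y" for y
  proof (cases "y \<le> 1")
    case True
    then show ?thesis using A[of y] y by (simp add: two_powr_def)
  next
    case False
    have "norm (g y) \<le> B / y ^ m" using B[of y] y by (simp add: field_simps)
    also have "\<dots> = B * y powr (- real m)"
      using y by (simp add: powr_minus powr_realpow field_simps)
    also have "\<dots> \<le> max A B * y powr (- real m)" by (intro mult_right_mono) auto
    finally show ?thesis using False by (simp add: two_powr_def)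
  qed
  moreover have "norm (g y) \<le> max A B" for y using A[of y] by simp
  ultimately show ?thesis using that[of "max A B"] A0 by auto
qed

lemma rapid_integrable_powr:
  assumes "rapid g" "a > -1" "continuous_on {0<..} h" "\<And>t. 0 < t \<Longrightarrow> norm (h t) \<le> K * t powr a"
  shows "(\<lambda>t. h t * g t) absolutely_integrable_on {0<..}"
proof -
  define m where "m = nat \<lceil>a + 2\<rceil>"
  have m: "real m \<ge> a + 2" unfolding m_def by linarith
  obtain C where C: "C \<ge> 0" "\<And>y. 0 < y \<Longrightarrow> norm (g y) \<le> C * two_powr 0 (- real m) y"
    using rapid_bound[OF assms(1)] by metis
  have "0 \<le> K" using order_trans[OF norm_ge_zero assms(4)[of 1]] by simp
  show ?thesis
  proof (rule absolutely_integrable_Ioi)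
    show "continuous_on {0<..} (\<lambda>t. h t * g t)"
      by (intro continuous_intros assms(3) rapid_continuous assms(1))
    fix t :: real assume t: "0 < t"
    have "norm (h t * g t) \<le> (K * t powr a) * (C * two_powr 0 (- real m) t)"
      unfolding norm_mult using t C \<open>0 \<le> K\<close> by (intro mult_mono assms(4) mult_nonneg_nonneg) auto
    also have "\<dots> = (K * C) * (t powr a * two_powr 0 (- real m) t)" by (simp only: mult_ac)
    also have "\<dots> = (K * C) * two_powr (0 + a) (- real m + a) t" by (simp only: two_powr_mult_powr)
    finally show "norm (h t * g t) \<le> (K * C) * two_powr a (- real m + a) t" by simp
  qed (use m assms in auto)
qed

lemma rapid_integrable: "rapid g \<Longrightarrow> g absolutely_integrable_on {0<..}"
  using rapid_integrable_powr[of g 0 "\<lambda>_. 1" 1] by auto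

lemma rapid_times_integrable:
  assumes "rapid g" "continuous_on {0<..} h" "\<And>t. 0 < t \<Longrightarrow> norm (h t) \<le> K"
  shows "(\<lambda>t. g t * h t) absolutely_integrable_on {0<..}"
  using rapid_integrable_powr[of g 0 h K] assms by (simp add: mult.commute)

lemma rapid_tendsto_0:
  assumes "rapid g" shows "((\<lambda>t. of_real (t ^ j) * g t) \<longlongrightarrow> 0) at_top"
proof -
  obtain C where C: "\<And>y. 0 < y \<Longrightarrow> norm (of_real (y ^ j) * g y) \<le> C * two_powr 0 (- real 1) y"
    using rapid_bound[OF rapid_power[OF assms, of j], of 1] by metis
  show ?thesis
  proof (rule Lim_null_comparison)
    show "\<forall>\<^sub>F t in at_top. norm (of_real (t ^ j) * g t) \<le> C * (1 / t)"
      using eventually_gt_at_top[of 1]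
    proof eventually_elim
      case (elim t)
      then show ?case using C[of t] by (simp add: two_powr_def powr_minus_divide)
    qed
    show "((\<lambda>t. C * (1 / t)) \<longlongrightarrow> 0) at_top" by real_asymp
  qed
qed

lemma tendsto_mult_bounded_0:
  fixes g h :: "'b \<Rightarrow> complex"
  assumes "(g \<longlongrightarrow> 0) F" "\<And>t. norm (h t) \<le> 1"
  shows "((\<lambda>t. g t * h t) \<longlongrightarrow> 0) F"
proof (rule Lim_null_comparison)
  show "\<forall>\<^sub>F t in F. norm (g t * h t) \<le> norm (g t)"
    using assms(2) by (auto intro!: always_eventually mult_left_le simp: norm_mult)
  show "((\<lambda>t. norm (g t)) \<longlongrightarrow> 0) F" using assms(1) by (simp add: tendsto_norm_zero)
qed

lemma abs_cos_diff_le: "\<bar>cos a - cos b\<bar> \<le> \<bar>a - b\<bar>" for a b :: real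
proof -
  have "\<bar>cos a - cos b\<bar> = 2 * \<bar>sin ((a + b) / 2)\<bar> * \<bar>sin ((b - a) / 2)\<bar>"
    unfolding cos_diff_cos abs_mult by simp
  also have "\<dots> \<le> 2 * 1 * \<bar>(b - a) / 2\<bar>"
    by (intro mult_mono abs_sin_x_le_abs_x) auto
  finally show ?thesis by simp
qed

lemma rapid_tendsto_at_right: "rapid g \<Longrightarrow> (g \<longlongrightarrow> g 0) (at_right 0)"
  using rapid_continuous[of g UNIV] by (auto simp: continuous_on_def intro: tendsto_within_subset)

text \<open>The Fourier transform of the even extension of \<open>g\<close>; the factor 2 leaves
  Poisson summation free of constants.\<close>

definition costr :: "(real \<Rightarrow> complex) \<Rightarrow> real \<Rightarrow> complex" where
  "costr g x = 2 * integral {0<..} (\<lambda>y. g y * of_real (cos (2 * pi * x * y)))"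

lemma costr_integrable: "rapid g \<Longrightarrow> (\<lambda>y. g y * of_real (cos (c * y))) absolutely_integrable_on {0<..}"
  by (rule rapid_times_integrable[where K = 1]) (auto intro!: continuous_intros)

lemma sintr_integrable: "rapid g \<Longrightarrow> (\<lambda>y. g y * of_real (sin (c * y))) absolutely_integrable_on {0<..}"
  by (rule rapid_times_integrable[where K = 1]) (auto intro!: continuous_intros)

lemma costr_lin:
  assumes "rapid g" "rapid h"
  shows "costr (\<lambda>y. a * g y + b * h y) x = a * costr g x + b * costr h x"
proof -
  let ?c = "\<lambda>y. complex_of_real (cos (2 * pi * x * y))"
  have "((\<lambda>y. a * (g y * ?c y) + b * (h y * ?c y)) has_integral
      a * integral {0<..} (\<lambda>y. g y * ?c y) + b * integral {0<..} (\<lambda>y. h y * ?c y)) {0<..}"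
    using costr_integrable[OF assms(1)] costr_integrable[OF assms(2)]
    by (intro has_integral_add has_integral_mult_right integrable_integral) (auto simp: absolutely_integrable_on_def)
  then have "integral {0<..} (\<lambda>y. (a * g y + b * h y) * ?c y) =
      a * integral {0<..} (\<lambda>y. g y * ?c y) + b * integral {0<..} (\<lambda>y. h y * ?c y)"
    by (intro integral_unique) (simp add: algebra_simps)
  then show ?thesis by (simp add: costr_def algebra_simps)
qed

lemma costr_bound: "rapid g \<Longrightarrow> norm (costr g x) \<le> 2 * integral {0<..} (\<lambda>y. norm (g y))"
proof -
  assume g: "rapid g"
  have "norm (integral {0<..} (\<lambda>y. g y * of_real (cos (2 * pi * x * y)))) \<le> integral {0<..} (\<lambda>y. norm (g y))"
    using costr_integrable[OF g] rapid_integrable[OF g]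
    by (intro integral_norm_bound_integral) (auto simp: absolutely_integrable_on_def norm_mult intro!: mult_left_le)
  then show ?thesis by (simp add: costr_def norm_mult)
qed

lemma has_vector_derivative_cos_real [derivative_intros]:
  "((\<lambda>t. complex_of_real (cos (c * t))) has_vector_derivative of_real (- c * sin (c * t))) (at t within S)"
  "((\<lambda>t. complex_of_real (sin (c * t))) has_vector_derivative of_real (c * cos (c * t))) (at t within S)"
  by (intro has_vector_derivative_of_real; auto intro!: derivative_eq_intros)+

text \<open>Two integrations by parts. The even extension of \<open>g\<close> has a corner at 0
  unless \<open>g1 0\<close> vanishes, so a boundary term survives and x^-2 is the decay to be
  expected even for Schwartz functions.\<close>

lemma costr_parts:
  assumes "rapid g" "rapid g1" "rapid g2" "x > 0"
    and d1: "\<And>t. (g has_vector_derivative g1 t) (at t)" and d2: "\<And>t. (g1 has_vector_derivative g2 t) (at t)"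
  shows "of_real ((2 * pi * x) ^ 2) * costr g x = - 2 * g1 0 - costr g2 x"
proof -
  define c where "c = 2 * pi * x"
  have c: "c > 0" using assms by (simp add: c_def)
  define P where "P t = of_real c * (g t * of_real (sin (c * t))) + g1 t * of_real (cos (c * t))" for t
  have "((\<lambda>t. of_real (c ^ 2) * (g t * of_real (cos (c * t))) + g2 t * of_real (cos (c * t))) has_integral 0 - g1 0) {0<..}"
  proof (rule has_integral_FTC_Ioi[where P = P])
    fix t :: real
    have "(P has_vector_derivative of_real c * (g t * of_real (c * cos (c * t)) + g1 t * of_real (sin (c * t)))
       + (g1 t * of_real (- c * sin (c * t)) + g2 t * of_real (cos (c * t)))) (at t)"
      unfolding P_def
      by (intro has_vector_derivative_add has_vector_derivative_mult_right has_vector_derivative_mult d1 d2 has_vector_derivative_cos_real)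
    then show "(P has_vector_derivative of_real (c ^ 2) * (g t * of_real (cos (c * t))) + g2 t * of_real (cos (c * t))) (at t)"
      by (simp add: algebra_simps power2_eq_square)
  next
    show "continuous_on {0<..} (\<lambda>t. of_real (c ^ 2) * (g t * of_real (cos (c * t))) + g2 t * of_real (cos (c * t)))"
      by (intro continuous_intros rapid_continuous assms)
    have "((\<lambda>t. of_real c * (g t * of_real (sin (c * t))) + g1 t * of_real (cos (c * t))) \<longlongrightarrow>
       of_real c * (g 0 * of_real (sin (c * 0))) + g1 0 * of_real (cos (c * 0))) (at_right 0)"
      by (intro tendsto_intros rapid_tendsto_at_right assms)
    then show "(P \<longlongrightarrow> g1 0) (at_right 0)" unfolding P_def by simp
    have "((\<lambda>t. g t * of_real (sin (c * t))) \<longlongrightarrow> 0) at_top" "((\<lambda>t. g1 t * of_real (cos (c * t))) \<longlongrightarrow> 0) at_top"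
      using rapid_tendsto_0[OF assms(1), of 0] rapid_tendsto_0[OF assms(2), of 0]
      by (auto intro!: tendsto_mult_bounded_0)
    from tendsto_add[OF tendsto_mult_left[OF this(1), of "of_real c"] this(2)]
    show "(P \<longlongrightarrow> 0) at_top" unfolding P_def by simp
  qed
  moreover have "((\<lambda>t. of_real (c ^ 2) * (g t * of_real (cos (c * t))) + g2 t * of_real (cos (c * t))) has_integral
      of_real (c ^ 2) * (costr g x / 2) + costr g2 x / 2) {0<..}"
    unfolding costr_def c_def[symmetric]
    using costr_integrable[OF assms(1), of c] costr_integrable[OF assms(3), of c]
    by (intro has_integral_add has_integral_mult_right) (auto simp: absolutely_integrable_on_def integrable_integral)
  ultimately have "of_real (c ^ 2) * (costr g x / 2) + costr g2 x / 2 = 0 - g1 0"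
    using has_integral_unique by blast
  then show ?thesis unfolding c_def[symmetric] by (simp add: field_simps eq_neg_iff_add_eq_0)
qed

lemma costr_decay:
  assumes "rapid g" "rapid g1" "rapid g2"
    and d1: "\<And>t. (g has_vector_derivative g1 t) (at t)" and d2: "\<And>t. (g1 has_vector_derivative g2 t) (at t)"
  obtains K where "K \<ge> 0" "\<And>x. 0 < x \<Longrightarrow> norm (costr g x) \<le> K * two_powr 0 (-2) x"
proof -
  define K where "K = max (2 * integral {0<..} (\<lambda>y. norm (g y))) (2 * norm (g1 0) + 2 * integral {0<..} (\<lambda>y. norm (g2 y)))"
  have K: "norm (costr g x) \<le> K" for x using costr_bound[OF assms(1), of x] by (simp add: K_def)
  moreover have "norm (costr g x) \<le> K * x powr (-2)" if x: "0 < x" for x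
  proof -
    have "x ^ 2 * norm (costr g x) \<le> (2 * pi * x) ^ 2 * norm (costr g x)"
      using x pi_gt3 by (intro mult_right_mono power_mono) auto
    also have "\<dots> = norm (of_real ((2 * pi * x) ^ 2) * costr g x)"
      unfolding norm_mult norm_of_real by simp
    also have "\<dots> \<le> norm (- 2 * g1 0) + norm (costr g2 x)"
      unfolding costr_parts[OF assms(1-3) x d1 d2] by (rule norm_triangle_ineq4)
    also have "\<dots> \<le> K" using costr_bound[OF assms(3), of x] by (simp add: K_def norm_mult)
    finally show ?thesis using x by (simp add: powr_minus field_simps)
  qed
  ultimately show ?thesis using order_trans[OF norm_ge_zero K[of 0]]
    by (intro that[of K]) (auto simp: two_powr_def)
qed

lemma has_vector_derivative_at_0:
  fixes F :: "real \<Rightarrow> 'a::real_normed_vector"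
  assumes "((\<lambda>h. (1 / h) *\<^sub>R (F (x + h) - F x)) \<longlongrightarrow> D) (at 0)"
  shows "(F has_vector_derivative D) (at x)"
  unfolding has_vector_derivative_def has_derivative_at
proof (intro conjI bounded_linear_scaleR_left)
  have "((\<lambda>h. norm ((1 / h) *\<^sub>R (F (x + h) - F x) - D)) \<longlongrightarrow> 0) (at 0)"
    using assms by (simp add: tendsto_norm_zero LIM_zero)
  moreover have "\<forall>\<^sub>F h in at 0. norm ((1 / h) *\<^sub>R (F (x + h) - F x) - D) = norm (F (x + h) - F x - h *\<^sub>R D) / norm h"
  proof -
    have "norm ((1 / h) *\<^sub>R (F (x + h) - F x) - D) = norm (F (x + h) - F x - h *\<^sub>R D) / norm h" if "h \<noteq> 0" for h
    proof -
      have "(1 / h) *\<^sub>R (F (x + h) - F x) - D = (1 / h) *\<^sub>R (F (x + h) - F x - h *\<^sub>R D)"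
        using that by (simp add: scaleR_diff_right)
      then show ?thesis by simp
    qed
    then show ?thesis unfolding eventually_at by (intro exI[of _ 1]) auto
  qed
  ultimately show "((\<lambda>h. norm (F (x + h) - F x - h *\<^sub>R D) / norm h) \<longlongrightarrow> 0) (at 0)"
    by (rule Lim_transform_eventually)
qed

text \<open>Differentiation under the integral gives a sine integral, which an integration by parts
  brings back to cosine transforms. The outcome is that x d/dx on the transform side corresponds to
  minus (1 + y d/dy) on the function.\<close>

lemma costr_derivative:
  assumes "rapid g" "rapid g1" and d1: "\<And>t. (g has_vector_derivative g1 t) (at t)" and "x > 0"
  shows "(costr g has_vector_derivative - (costr g x + costr (\<lambda>y. of_real y * g1 y) x) / of_real x) (at x)"
proof -
  define D where "D y = g y * of_real (- (2 * pi * y) * sin (2 * pi * x * y))" for y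
  define F where "F h y = (1 / h) *\<^sub>R (g y * of_real (cos (2 * pi * (x + h) * y)) - g y * of_real (cos (2 * pi * x * y)))" for h y
  have yg: "rapid (\<lambda>y. of_real y * g y)" "rapid (\<lambda>y. of_real y * g1 y)"
    using rapid_power[OF assms(1), of 1] rapid_power[OF assms(2), of 1] by simp_all
  have Fi: "F h integrable_on {0<..}" for h
    unfolding F_def using costr_integrable[OF assms(1)]
    by (intro integrable_cmul Henstock_Kurzweil_Integration.integrable_diff) (auto simp: absolutely_integrable_on_def)
  have lim: "((\<lambda>h. integral {0<..} (F h)) \<longlongrightarrow> integral {0<..} D) (at 0)"
  proof (rule dominated_convergence_at(2))
    show "(\<lambda>y. 2 * pi * norm (of_real y * g y)) integrable_on {0<..}"
      using rapid_integrable[OF yg(1)] by (intro integrable_on_mult_right) (auto simp: absolutely_integrable_on_def)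
    show "\<forall>\<^sub>F h in at 0. F h integrable_on {0<..} \<and> (\<forall>y\<in>{0<..}. norm (F h y) \<le> 2 * pi * norm (of_real y * g y))"
    proof (intro always_eventually allI conjI ballI Fi)
      fix h y :: real assume y: "y \<in> {0<..}"
      have "\<bar>cos (2 * pi * (x + h) * y) - cos (2 * pi * x * y)\<bar> \<le> \<bar>2 * pi * (x + h) * y - 2 * pi * x * y\<bar>"
        by (rule abs_cos_diff_le)
      then have "\<bar>cos (2 * pi * (x + h) * y) - cos (2 * pi * x * y)\<bar> \<le> 2 * pi * y * \<bar>h\<bar>"
        using y by (simp add: algebra_simps abs_mult)
      then have "norm (F h y) \<le> \<bar>1 / h\<bar> * (norm (g y) * (2 * pi * y * \<bar>h\<bar>))"
        unfolding F_def norm_scaleR by (intro mult_left_mono)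
          (auto simp flip: right_diff_distrib of_real_diff simp: norm_mult intro!: mult_left_mono)
      also have "\<dots> \<le> 2 * pi * norm (of_real y * g y)"
        using y by (cases "h = 0") (auto simp: norm_mult field_simps)
      finally show "norm (F h y) \<le> 2 * pi * norm (of_real y * g y)" .
    qed
    fix y :: real
    have "((\<lambda>x. cos (2 * pi * x * y)) has_real_derivative - (2 * pi * y) * sin (2 * pi * x * y)) (at x)"
      by (auto intro!: derivative_eq_intros)
    then have "((\<lambda>h. (cos (2 * pi * (x + h) * y) - cos (2 * pi * x * y)) / h) \<longlongrightarrow> - (2 * pi * y) * sin (2 * pi * x * y)) (at 0)"
      by (simp add: DERIV_def)
    then have "((\<lambda>h. g y * of_real ((cos (2 * pi * (x + h) * y) - cos (2 * pi * x * y)) / h)) \<longlongrightarrow> D y) (at 0)"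
      unfolding D_def by (intro tendsto_intros)
    then show "((\<lambda>h. F h y) \<longlongrightarrow> D y) (at 0)"
      by (simp add: F_def scaleR_conv_of_real algebra_simps diff_divide_distrib)
  qed simp
  have "integral {0<..} (F h) = (1 / h) *\<^sub>R (costr g (x + h) / 2 - costr g x / 2)" for h
    unfolding F_def costr_def using costr_integrable[OF assms(1)]
    by (subst integral_cmul, subst Henstock_Kurzweil_Integration.integral_diff) (auto simp: absolutely_integrable_on_def)
  with tendsto_mult_left[OF lim, of 2] have "((\<lambda>h. (1 / h) *\<^sub>R (costr g (x + h) - costr g x)) \<longlongrightarrow> 2 * integral {0<..} D) (at 0)"
    by (simp add: scaleR_conv_of_real right_diff_distrib)
  then have der: "(costr g has_vector_derivative 2 * integral {0<..} D) (at x)"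
    by (rule has_vector_derivative_at_0)
  \<comment> \<open>The derivative of t g(t) cos(2 pi x t) integrates to 0; this relation expresses
    the sine integral \<open>D\<close> through cosine transforms.\<close>
  have "((\<lambda>t. (g t + of_real t * g1 t) * of_real (cos (2 * pi * x * t)) + of_real x * D t) has_integral 0 - 0) {0<..}"
  proof (rule has_integral_FTC_Ioi[where P = "\<lambda>t. of_real t * g t * of_real (cos (2 * pi * x * t))"])
    fix t :: real
    have "((\<lambda>t. complex_of_real t) has_vector_derivative of_real 1) (at t)"
      by (rule has_vector_derivative_of_real) (auto intro!: derivative_eq_intros)
    from has_vector_derivative_mult[OF has_vector_derivative_mult[OF this d1[of t]] has_vector_derivative_cos_real(1)]
    show "((\<lambda>t. of_real t * g t * of_real (cos (2 * pi * x * t))) has_vector_derivative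
       (g t + of_real t * g1 t) * of_real (cos (2 * pi * x * t)) + of_real x * D t) (at t)"
      by (rule has_vector_derivative_eq_rhs) (simp add: D_def algebra_simps)
  next
    show "continuous_on {0<..} (\<lambda>t. (g t + of_real t * g1 t) * of_real (cos (2 * pi * x * t)) + of_real x * D t)"
      unfolding D_def by (intro continuous_intros rapid_continuous assms)
    have "((\<lambda>t. of_real t * g t * of_real (cos (2 * pi * x * t))) \<longlongrightarrow> of_real 0 * g 0 * of_real (cos (2 * pi * x * 0))) (at_right 0)"
      by (intro tendsto_intros rapid_tendsto_at_right assms)
    then show "((\<lambda>t. of_real t * g t * of_real (cos (2 * pi * x * t))) \<longlongrightarrow> 0) (at_right 0)" by simp
    show "((\<lambda>t. of_real t * g t * of_real (cos (2 * pi * x * t))) \<longlongrightarrow> 0) at_top"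
      by (rule tendsto_mult_bounded_0[where g = "\<lambda>t. of_real t * g t"])
        (use rapid_tendsto_0[OF assms(1), of 1] in auto)
  qed
  moreover have "((\<lambda>t. (g t + of_real t * g1 t) * of_real (cos (2 * pi * x * t)) + of_real x * D t) has_integral
     (costr (\<lambda>t. 1 * g t + 1 * (of_real t * g1 t)) x / 2) + of_real x * integral {0<..} D) {0<..}"
  proof (intro has_integral_add has_integral_mult_right)
    have "rapid (\<lambda>t. g t + of_real t * g1 t)" by (intro rapid_add assms yg)
    from costr_integrable[OF this]
    show "((\<lambda>t. (g t + of_real t * g1 t) * of_real (cos (2 * pi * x * t))) has_integral
         costr (\<lambda>t. 1 * g t + 1 * (of_real t * g1 t)) x / 2) {0<..}"
      by (auto simp: costr_def absolutely_integrable_on_def integrable_integral)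
    have "(\<lambda>t. - (2 * of_real pi) * ((of_real t * g t) * of_real (sin (2 * pi * x * t)))) integrable_on {0<..}"
      using sintr_integrable[OF yg(1)] by (intro integrable_on_mult_right) (auto simp: absolutely_integrable_on_def)
    then have "D integrable_on {0<..}"
      by (rule integrable_eq) (simp add: D_def algebra_simps)
    then show "(D has_integral integral {0<..} D) {0<..}" by (rule integrable_integral)
  qed
  ultimately have "0 - 0 = costr (\<lambda>t. 1 * g t + 1 * (of_real t * g1 t)) x / 2 + of_real x * integral {0<..} D"
    by (rule has_integral_unique)
  then have "2 * integral {0<..} D = - (costr g x + costr (\<lambda>y. of_real y * g1 y) x) / of_real x"
    unfolding costr_lin[OF assms(1) yg(2)] using \<open>x > 0\<close> by (simp add: field_simps eq_neg_iff_add_eq_0)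
  with der show ?thesis by simp
qed

section \<open>Poisson summation for the dilates of f\<close>

lemma rapid_summable:
  assumes "rapid f" "0 < X"
  shows "summable (\<lambda>d. f (X * real (Suc d)))"
proof -
  obtain C where C: "\<And>y. 0 < y \<Longrightarrow> norm (of_real (y ^ 2) * f y) \<le> C"
    using rapid_bound[OF rapid_power[OF assms(1)], of 2 0] by metis
  show ?thesis
  proof (rule summable_comparison_test')
    show "summable (\<lambda>d. C / X ^ 2 * (1 / real (Suc d) ^ 2))"
      using summable_mult[OF sums_summable[OF inverse_squares_sums], of "C / X ^ 2"] by (simp add: add.commute)
    fix d
    have "(X * real (Suc d)) ^ 2 * norm (f (X * real (Suc d))) \<le> C"
      using C[of "X * real (Suc d)"] assms(2) unfolding norm_mult norm_of_real by simp
    then show "norm (f (X * real (Suc d))) \<le> C / X ^ 2 * (1 / real (Suc d) ^ 2)"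
      using assms(2) by (simp add: field_simps power_mult_distrib del: of_nat_Suc)
  qed
qed

text \<open>The second claim is the invariance of the L1 norm of the derivative under dilation: the
  chain rule factor X cancels the Jacobian. It makes the Poisson error for f(X t) bounded uniformly
  in X.\<close>

lemma schwartz_scaled:
  assumes f: "f \<in> schwartz_space" and X: "0 < X"
  shows "half_line_function (\<lambda>t. f (X * t)) (\<lambda>t. X *\<^sub>R nth_vderiv 1 f (X * t))"
    and "integral {0<..} (\<lambda>t. norm (X *\<^sub>R nth_vderiv 1 f (X * t))) = integral {0<..} (\<lambda>t. norm (nth_vderiv 1 f t))"
    and "((\<lambda>t. f (X * t)) has_vector_derivative X *\<^sub>R nth_vderiv 1 f (X * t)) (at t)"
    and "((\<lambda>t. f (X * t)) has_integral integral {0<..} f /\<^sub>R X) {0<..}"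
proof -
  define f1 where "f1 = nth_vderiv 1 f"
  have d: "(f has_vector_derivative f1 t) (at t)" for t
    using schwartz_has_derivative[OF f, of 0 t] by (simp add: f1_def)
  have r: "rapid f" "rapid f1" using schwartz_rapid[OF f, of 0] schwartz_rapid[OF f, of 1] by (simp_all add: f1_def)
  have dX: "((\<lambda>t. f (X * t)) has_vector_derivative X *\<^sub>R f1 (X * t)) (at t)" for t
    using vector_diff_chain_at[OF _ d, of "\<lambda>t. X * t" X t]
    by (auto simp: o_def has_vector_derivative_mult_right intro!: derivative_eq_intros simp flip: has_real_derivative_iff_has_vector_derivative)
  then show "((\<lambda>t. f (X * t)) has_vector_derivative X *\<^sub>R nth_vderiv 1 f (X * t)) (at t)" by (simp add: f1_def)
  have scale: "((\<lambda>t. g (X * t)) has_integral integral {0<..} g /\<^sub>R X) {0<..}" if "rapid g" for g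
    using rapid_integrable[OF that] rapid_continuous[OF that] X
    by (intro has_integral_scale_Ioi integrable_integral) (auto simp: absolutely_integrable_on_def)
  then show "((\<lambda>t. f (X * t)) has_integral integral {0<..} f /\<^sub>R X) {0<..}" using r by blast
  have n: "((\<lambda>t. norm (f1 (X * t))) has_integral integral {0<..} (\<lambda>t. norm (f1 t)) /\<^sub>R X) {0<..}"
    using rapid_integrable[OF r(2)] rapid_continuous[OF r(2)] X
    by (intro has_integral_scale_Ioi[of "\<lambda>t. norm (f1 t)"] integrable_integral continuous_intros) (auto simp: absolutely_integrable_on_def)
  have n': "((\<lambda>t. norm (X *\<^sub>R f1 (X * t))) has_integral integral {0<..} (\<lambda>t. norm (f1 t))) {0<..}"
    using has_integral_mult_right[OF n, of X] X by (simp flip: mult.assoc)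
  then show "integral {0<..} (\<lambda>t. norm (X *\<^sub>R nth_vderiv 1 f (X * t))) = integral {0<..} (\<lambda>t. norm (nth_vderiv 1 f t))"
    unfolding f1_def by (rule integral_unique)
  show "half_line_function (\<lambda>t. f (X * t)) (\<lambda>t. X *\<^sub>R nth_vderiv 1 f (X * t))"
    unfolding f1_def[symmetric]
  proof
    show "continuous_on {0..} (\<lambda>t. f (X * t))"
      by (intro continuous_on_compose2[OF rapid_continuous[OF r(1), of UNIV]] continuous_intros) auto
    show "(\<lambda>t. X *\<^sub>R f1 (X * t)) absolutely_integrable_on {0<..}"
      using has_integral_integrable[OF scale[OF r(2)]] has_integral_integrable[OF n']
      by (intro absolutely_integrable_onI integrable_cmul)
  qed (rule dX)
qed

text \<open>Classical Poisson summation for the even extension of \<open>f\<close>, folded to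
  positive indices, with f(0)/2 as half of the central term. The value of the sawtooth integral is
  computed twice: from the limit of the sums and from the sine series.\<close>

lemma half_line_poisson:
  assumes f: "f \<in> schwartz_space" and X: "0 < X"
  shows "(\<lambda>l. costr f (real (Suc l) / X) / of_real X) sums
     ((\<Sum>d. f (X * real (Suc d))) - integral {0<..} f / of_real X + f 0 / 2)"
proof -
  define f1 where "f1 = nth_vderiv 1 f"
  have r: "rapid f" "rapid f1" using schwartz_rapid[OF f, of 0] schwartz_rapid[OF f, of 1] by (simp_all add: f1_def)
  note dX = schwartz_scaled(3)[OF f X, folded f1_def] and scale = schwartz_scaled(4)[OF f X]
  interpret half_line_function "\<lambda>t. f (X * t)" "\<lambda>t. X *\<^sub>R f1 (X * t)"
    using schwartz_scaled(1)[OF f X] by (simp add: f1_def)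
  have "(\<lambda>N. (\<Sum>d<N. f (X * real (Suc d))) - integral {0..real N} (\<lambda>t. f (X * t)) - (f (X * real N) - f (X * 0)) / 2)
      \<longlonglongrightarrow> (\<Sum>d. f (X * real (Suc d))) - integral {0<..} f /\<^sub>R X - (0 - f (X * 0)) / 2"
  proof (intro tendsto_intros)
    show "(\<lambda>N. \<Sum>d<N. f (X * real (Suc d))) \<longlonglongrightarrow> (\<Sum>d. f (X * real (Suc d)))"
      using rapid_summable[OF r(1) X] by (rule summable_LIMSEQ)
    have "(\<lambda>t. f (X * t)) integrable_on {0..}"
      using has_integral_integrable[OF scale] by (rule integrable_spike_set) (auto intro: negligible_subset[of "{0}"])
    from filterlim_compose[OF integral_tendsto_at_top_Ici[OF this] filterlim_real_sequentially]
    have "(\<lambda>N. integral {0..real N} (\<lambda>t. f (X * t))) \<longlonglongrightarrow> integral {0..} (\<lambda>t. f (X * t))" .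
    moreover have "integral {0..} (\<lambda>t. f (X * t)) = integral {0<..} (\<lambda>t. f (X * t))"
      by (rule integral_spike_set) (auto intro: negligible_subset[of "{0}"])
    ultimately show "(\<lambda>N. integral {0..real N} (\<lambda>t. f (X * t))) \<longlonglongrightarrow> integral {0<..} f /\<^sub>R X"
      by (simp add: integral_unique[OF scale])
    have "filterlim (\<lambda>N. X * real N) at_top sequentially"
      by (rule filterlim_tendsto_pos_mult_at_top[OF tendsto_const X filterlim_real_sequentially])
    from filterlim_compose[OF rapid_tendsto_0[OF r(1), of 0] this]
    show "(\<lambda>N. f (X * real N)) \<longlonglongrightarrow> 0" by simp
  qed simp
  with poisson_limit have "saw_int = (\<Sum>d. f (X * real (Suc d))) - integral {0<..} f /\<^sub>R X - (0 - f (X * 0)) / 2"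
    by (rule LIMSEQ_unique)
  moreover have "integral {0<..} f /\<^sub>R X = integral {0<..} f / of_real X"
    by (simp add: scaleR_conv_of_real divide_inverse_commute)
  moreover have "(0 - f (X * 0)) / 2 = - (f 0 / 2)" by simp
  ultimately have I: "saw_int = (\<Sum>d. f (X * real (Suc d))) - integral {0<..} f / of_real X + f 0 / 2"
    by (simp only: diff_minus_eq_add)
  \<comment> \<open>The sine coefficient of the derivative is minus the cosine coefficient of the
    function, times the frequency; the boundary terms vanish because of the sine at 0 and the decay
    of \<open>f\<close> at infinity.\<close>
  have trm: "- (integral {0<..} (\<lambda>t. of_real (sin (2 * pi * real (Suc l) * t)) * (X *\<^sub>R f1 (X * t))) / of_real (pi * real (Suc l)))
      = costr f (real (Suc l) / X) / of_real X" for l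
  proof -
    define c where "c = 2 * pi * real (Suc l)"
    have c: "c > 0" unfolding c_def by simp
    define P where "P t = of_real (sin (c * t)) * f (X * t)" for t
    have "((\<lambda>t. of_real (sin (c * t)) * (X *\<^sub>R f1 (X * t)) + of_real (c * cos (c * t)) * f (X * t)) has_integral 0 - 0) {0<..}"
    proof (rule has_integral_FTC_Ioi[where P = P])
      fix t :: real
      from has_vector_derivative_mult[OF has_vector_derivative_cos_real(2) dX[of t]]
      show "(P has_vector_derivative of_real (sin (c * t)) * (X *\<^sub>R f1 (X * t)) + of_real (c * cos (c * t)) * f (X * t)) (at t)"
        unfolding P_def .
    next
      have cg: "continuous_on {0<..} (\<lambda>t. g (X * t))" if "rapid g" for g
        by (intro continuous_on_compose2[OF rapid_continuous[OF that, of UNIV]] continuous_intros) auto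
      show "continuous_on {0<..} (\<lambda>t. of_real (sin (c * t)) * (X *\<^sub>R f1 (X * t)) + of_real (c * cos (c * t)) * f (X * t))"
        by (intro continuous_intros cg r)
      have "isCont (\<lambda>t. f (X * t)) 0"
        using dX[of 0] by (rule has_vector_derivative_continuous)
      then have "((\<lambda>t. f (X * t)) \<longlongrightarrow> f (X * 0)) (at_right 0)"
        unfolding isCont_def by (rule tendsto_within_subset) simp
      then have "((\<lambda>t. of_real (sin (c * t)) * f (X * t)) \<longlongrightarrow> of_real (sin (c * 0)) * f (X * 0)) (at_right 0)"
        by (intro tendsto_intros)
      then show "(P \<longlongrightarrow> 0) (at_right 0)" unfolding P_def[abs_def] by simp
      have "filterlim (\<lambda>t. X * t) at_top at_top"
        by (rule filterlim_tendsto_pos_mult_at_top[OF tendsto_const X filterlim_ident])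
      from filterlim_compose[OF rapid_tendsto_0[OF r(1), of 0] this]
      have "((\<lambda>t. f (X * t) * of_real (sin (c * t))) \<longlongrightarrow> 0) at_top"
        by (intro tendsto_mult_bounded_0) auto
      then show "(P \<longlongrightarrow> 0) at_top" unfolding P_def[abs_def] by (simp add: mult.commute)
    qed
    moreover have "((\<lambda>t. of_real c * (f (X * t) * of_real (cos ((c / X) * (X * t))))) has_integral
       of_real c * ((costr f (real (Suc l) / X) / 2) /\<^sub>R X)) {0<..}"
    proof (intro has_integral_mult_right has_integral_scale_Ioi[of "\<lambda>y. f y * of_real (cos ((c / X) * y))"] X)
      have "((\<lambda>y. f y * of_real (cos ((c / X) * y))) has_integral integral {0<..} (\<lambda>y. f y * of_real (cos ((c / X) * y)))) {0<..}"
        using costr_integrable[OF r(1), of "c / X"] by (intro integrable_integral) (auto simp: absolutely_integrable_on_def)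
      then show "((\<lambda>y. f y * of_real (cos ((c / X) * y))) has_integral costr f (real (Suc l) / X) / 2) {0<..}"
        unfolding costr_def c_def by simp
      show "continuous_on {0<..} (\<lambda>y. f y * of_real (cos ((c / X) * y)))"
        by (intro continuous_intros rapid_continuous r)
    qed
    ultimately have "((\<lambda>t. of_real (sin (c * t)) * (X *\<^sub>R f1 (X * t)) + of_real (c * cos (c * t)) * f (X * t)
         - of_real c * (f (X * t) * of_real (cos ((c / X) * (X * t))))) has_integral
       0 - 0 - of_real c * ((costr f (real (Suc l) / X) / 2) /\<^sub>R X)) {0<..}"
      by (rule has_integral_diff)
    then have "((\<lambda>t. of_real (sin (c * t)) * (X *\<^sub>R f1 (X * t))) has_integral
       - of_real c * ((costr f (real (Suc l) / X) / 2) /\<^sub>R X)) {0<..}"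
      using X by (simp add: mult_ac)
    from integral_unique[OF this] c show ?thesis
      unfolding c_def using X by (simp add: scaleR_conv_of_real field_simps del: of_nat_Suc)
  qed
  show ?thesis using saw_series(2) unfolding trm I .
qed

section \<open>The functions v j and their derivatives\<close>

locale schwartz_function =
  fixes k :: nat and f :: "real \<Rightarrow> complex"
  assumes k: "k \<ge> 1" and schwartz: "f \<in> schwartz_space"
begin

text \<open>This family is stable under the Euler operator: y times the derivative of
  \<open>p j\<close> is j \<open>p j\<close> + \<open>p (Suc j)\<close>.\<close>

definition p :: "nat \<Rightarrow> real \<Rightarrow> complex" where
  "p j y = of_real (y ^ j) * nth_vderiv j f y"

text \<open>For j = 0 this is x C(x) at x = t^(-k), with C the cosine transform of \<open>f\<close>.
  Higher j arise by differentiating in t.\<close>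

definition v :: "nat \<Rightarrow> real \<Rightarrow> complex" where
  "v j t = of_real (t powr (- real k)) * costr (p j) (t powr (- real k))"

lemma monomial_deriv:
  "((\<lambda>y. of_real (y ^ i) * nth_vderiv n f y) has_vector_derivative
     of_nat i * (of_real (y ^ (i - 1)) * nth_vderiv n f y) + 1 * (of_real (y ^ i) * nth_vderiv (Suc n) f y)) (at y)"
proof -
  have "((\<lambda>y. complex_of_real (y ^ i)) has_vector_derivative of_real (real i * y ^ (i - 1))) (at y)"
    by (rule has_vector_derivative_of_real) (auto intro!: derivative_eq_intros)
  from has_vector_derivative_mult[OF this schwartz_has_derivative[OF schwartz]]
  show ?thesis by (rule has_vector_derivative_eq_rhs) (simp add: algebra_simps)
qed

lemma monomial_rapid: "rapid (\<lambda>y. of_real (y ^ i) * nth_vderiv n f y)"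
  by (intro rapid_power schwartz_rapid schwartz)

definition p1 :: "nat \<Rightarrow> real \<Rightarrow> complex" where
  "p1 j y = of_nat j * (of_real (y ^ (j - 1)) * nth_vderiv j f y) + 1 * (of_real (y ^ j) * nth_vderiv (Suc j) f y)"

lemma p_rapid: "rapid (p j)" "rapid (p1 j)"
  unfolding p_def[abs_def] p1_def[abs_def] by (intro rapid_add rapid_mult_const monomial_rapid)+

lemma p_deriv: "(p j has_vector_derivative p1 j y) (at y)"
  unfolding p_def[abs_def] p1_def by (rule monomial_deriv)

lemma p_decay:
  obtains K where "K \<ge> 0" "\<And>x. 0 < x \<Longrightarrow> norm (costr (p j) x) \<le> K * two_powr 0 (-2) x"
proof -
  define p2 where "p2 y =
     of_nat j * (of_nat (j - 1) * (of_real (y ^ (j - 1 - 1)) * nth_vderiv j f y) + 1 * (of_real (y ^ (j - 1)) * nth_vderiv (Suc j) f y))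
     + 1 * (of_nat j * (of_real (y ^ (j - 1)) * nth_vderiv (Suc j) f y) + 1 * (of_real (y ^ j) * nth_vderiv (Suc (Suc j)) f y))" for y
  have d: "(p1 j has_vector_derivative p2 y) (at y)" for y
    unfolding p1_def[abs_def] p2_def by (intro has_vector_derivative_add has_vector_derivative_mult_right monomial_deriv)
  have r: "rapid p2"
    unfolding p2_def[abs_def] by (intro rapid_add rapid_mult_const monomial_rapid)
  obtain K where "K \<ge> 0" "\<And>x. 0 < x \<Longrightarrow> norm (costr (p j) x) \<le> K * two_powr 0 (-2) x"
    using costr_decay[OF p_rapid(1)[of j] p_rapid(2)[of j] r p_deriv d] by blast
  then show ?thesis using that by blast
qed

text \<open>As t tends to 0 the argument t^(-k) is large, and the inverse square decay of the cosine
  transform turns t^(-k) into t^k. For large t the transform is just bounded.\<close>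

lemma v_bound:
  obtains K where "K \<ge> 0" "\<And>t. 0 < t \<Longrightarrow> norm (v j t) \<le> K * two_powr (real k) (- real k) t"
proof -
  obtain K where K: "K \<ge> 0" "\<And>x. 0 < x \<Longrightarrow> norm (costr (p j) x) \<le> K * two_powr 0 (-2) x"
    using p_decay[of j] by blast
  have "norm (v j t) \<le> K * two_powr (real k) (- real k) t" if t: "0 < t" for t
  proof -
    let ?x = "t powr (- real k)"
    have "norm (v j t) \<le> ?x * (K * two_powr 0 (-2) ?x)"
      unfolding v_def norm_mult using K(2)[of ?x] t by (auto intro!: mult_left_mono)
    also have "?x * two_powr 0 (-2) ?x = two_powr (real k) (- real k) t"
    proof (cases "t \<le> 1")
      case True
      show ?thesis
      proof (cases "t = 1")
        case False
        then have "1 < ?x" using t True k powr_less_mono2_neg[of "- real k" t 1] by simp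
        then show ?thesis using t True by (simp add: two_powr_def powr_powr flip: powr_add)
      qed (simp add: two_powr_def)
    next
      case False
      then have "?x \<le> 1" using k by (simp add: powr_minus_divide ge_one_powr_ge_zero)
      then show ?thesis using False t by (simp add: two_powr_def)
    qed
    then have "?x * (K * two_powr 0 (-2) ?x) = K * two_powr (real k) (- real k) t" by (simp add: mult.left_commute)
    finally show ?thesis .
  qed
  with K(1) that show ?thesis by blast
qed

text \<open>With x = t^(-k) one has t d/dt = -k x d/dx. The undifferentiated term in
  \<open>costr_derivative\<close> cancels the derivative of the prefactor x, and the Euler relation
  for \<open>p j\<close> leaves only \<open>v j\<close> and \<open>v (Suc j)\<close>.\<close>

lemma v_deriv:
  assumes t: "0 < t"
  shows "(v j has_vector_derivative (of_nat (k * j) * v j t + of_nat k * v (Suc j) t) / of_real t) (at t)"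
proof -
  define x where "x = t powr (- real k)"
  have x: "x > 0" using t by (simp add: x_def)
  have dx: "((\<lambda>t. t powr (- real k)) has_real_derivative - real k * x / t) (at t)"
    using t by (auto intro!: derivative_eq_intros simp: x_def powr_diff)
  define c where "c j = costr (p j) x" for j
  have yp1: "of_real y * p1 j y = of_nat j * p j y + 1 * p (Suc j) y" for y
    by (cases j) (simp_all add: p1_def p_def algebra_simps)
  have "costr (\<lambda>y. of_real y * p1 j y) x = of_nat j * c j + c (Suc j)"
    unfolding yp1 costr_lin[OF p_rapid(1) p_rapid(1)] by (simp add: c_def)
  with costr_derivative[OF p_rapid p_deriv x, of j]
  have "(costr (p j) has_vector_derivative - (c j + (of_nat j * c j + c (Suc j))) / of_real x) (at x)"
    by (simp add: c_def)
  from vector_diff_chain_at[OF dx[unfolded has_real_derivative_iff_has_vector_derivative] this[unfolded x_def]]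
  have "((\<lambda>t. costr (p j) (t powr (- real k))) has_vector_derivative
      (- real k * x / t) *\<^sub>R (- (c j + (of_nat j * c j + c (Suc j))) / of_real x)) (at t)" by (simp add: o_def x_def)
  from has_vector_derivative_mult[OF has_vector_derivative_of_real[OF dx] this]
  have "(v j has_vector_derivative (of_real x * ((- real k * x / t) *\<^sub>R (- (c j + (of_nat j * c j + c (Suc j))) / of_real x))
      + of_real (- real k * x / t) * c j)) (at t)"
    unfolding v_def[abs_def] by (simp add: x_def c_def)
  moreover have "of_real x * ((- real k * x / t) *\<^sub>R (- (c j + (of_nat j * c j + c (Suc j))) / of_real x))
      + of_real (- real k * x / t) * c j = (of_nat (k * j) * v j t + of_nat k * v (Suc j) t) / of_real t"
    using x t by (simp add: v_def scaleR_conv_of_real c_def[symmetric] x_def[symmetric] field_simps)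
  ultimately show ?thesis by simp
qed

lemma v_continuous: "continuous_on {0<..} (v j)"
  by (intro continuous_at_imp_continuous_on ballI has_vector_derivative_continuous[OF v_deriv]) simp

end

section \<open>The cosine integrals \<open>J\<close>\<close>

lemma norm_exp_minus_1_le: "norm (exp u - 1) \<le> norm u * exp (norm u)" for u :: complex
proof -
  have "norm (exp u - exp 0) \<le> exp (norm u) * norm (u - 0)"
  proof (rule field_differentiable_bound[where S = "cball 0 (norm u)" and f' = exp])
    fix z :: complex assume "z \<in> cball 0 (norm u)"
    then have "norm z \<le> norm u" by simp
    then show "norm (exp z) \<le> exp (norm u)" using norm_exp[of z] by (meson exp_le_cancel_iff order_trans)
  qed (auto intro: derivative_eq_intros)
  then show ?thesis by (simp add: mult.commute)
qed

lemma has_integral_FTC_Ici: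
  fixes P :: "real \<Rightarrow> 'a::euclidean_space"
  assumes der: "\<And>t. a \<le> t \<Longrightarrow> (P has_vector_derivative P' t) (at t)" and "(P \<longlongrightarrow> l) at_top"
  shows "(P' has_integral l - P a) {a..}"
proof (rule improper_integral_to_inf)
  have i: "(P' has_integral P b - P a) {a..b}" if "a \<le> b" for b
    using that by (intro fundamental_theorem_of_calculus) (auto intro!: has_vector_derivative_at_within[OF der])
  then show "\<And>b. a \<le> b \<Longrightarrow> P' integrable_on {a..b}" by (rule has_integral_integrable)
  have "((\<lambda>b. P b - P a) \<longlongrightarrow> l - P a) at_top" by (intro tendsto_intros assms)
  then show "((\<lambda>b. integral {a..b} P') \<longlongrightarrow> l - P a) at_top"
    by (rule Lim_transform_eventually) (auto simp: eventually_at_top_linorder intro!: exI[of _ a] integral_unique[OF i, symmetric])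
qed

lemma powr_one_div: "0 < \<mu> \<Longrightarrow> (1 / \<mu>) powr x = \<mu> powr (- x)" for \<mu> :: real
  by (simp add: powr_divide powr_minus_divide)

lemma two_powr_mult: "two_powr a b t * two_powr c d t = two_powr (a + c) (b + d) t"
  by (simp add: two_powr_def powr_add)

lemma exp_abs_ln: "0 < t \<Longrightarrow> exp (d * \<bar>ln t\<bar>) = two_powr (- d) d t"
  by (auto simp: two_powr_def powr_def abs_if ln_ge_zero_iff)

lemma mellin_integrable:
  fixes q :: "real \<Rightarrow> complex"
  assumes "continuous_on {0<..} q" "\<And>t. 0 < t \<Longrightarrow> norm (q t) \<le> C * two_powr a (- b) t"
    and "- a < Re s" "Re s < b"
  shows "(\<lambda>t. q t * of_real t powr (s - 1)) absolutely_integrable_on {0<..}"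
proof (rule absolutely_integrable_Ioi)
  show "continuous_on {0<..} (\<lambda>t. q t * of_real t powr (s - 1))"
    by (intro continuous_intros assms(1)) (auto simp: complex_nonpos_Reals_iff)
  fix t :: real assume t: "0 < t"
  have "norm (q t * of_real t powr (s - 1)) \<le> (C * two_powr a (- b) t) * t powr (Re s - 1)"
    using t assms(2)[OF t] by (simp add: norm_mult norm_powr_real_powr mult_right_mono)
  also have "\<dots> = C * (t powr (Re s - 1) * two_powr a (- b) t)" by (simp only: mult_ac)
  finally show "norm (q t * of_real t powr (s - 1)) \<le> C * two_powr (a + (Re s - 1)) (- b + (Re s - 1)) t"
    by (simp only: two_powr_mult_powr)
qed (use assms in auto)

text \<open>For |h| <= d the difference quotient of t^h is at most |ln t| exp(d |ln t|), hence at
  most exp(2 d |ln t|)/d, which shifts the exponents at 0 and infinity by 2 d. A quarter of the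
  distance to the edges of the strip leaves room for this.\<close>

lemma mellin_has_derivative:
  fixes q :: "real \<Rightarrow> complex"
  assumes q: "continuous_on {0<..} q" and bound: "\<And>t. 0 < t \<Longrightarrow> norm (q t) \<le> C * two_powr a (- b) t"
    and s: "- a < Re s" "Re s < b"
  shows "((\<lambda>s. integral {0<..} (\<lambda>t. q t * of_real t powr (s - 1))) has_field_derivative
      integral {0<..} (\<lambda>t. q t * of_real t powr (s - 1) * of_real (ln t))) (at s)"
proof -
  define d where "d = min (Re s + a) (b - Re s) / 4"
  have "4 * d \<le> Re s + a" "4 * d \<le> b - Re s" and d0: "d > 0" using s by (auto simp: d_def)
  then have d: "d > 0" "a + Re s - 2 * d > 0" "- b + Re s + 2 * d < 0" and d4: "d < Re s + a" "d < b - Re s" by linarith+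
  have C: "C \<ge> 0" using order_trans[OF norm_ge_zero bound[of 1]] by (simp add: two_powr_def)
  define F where "F h t = (q t * of_real t powr (s + h - 1) - q t * of_real t powr (s - 1)) / h" for h t
  define h0 where "h0 t = C / d * two_powr (a + (Re s - 1) - 2 * d) (- b + (Re s - 1) + 2 * d) t" for t
  have bd: "norm (F h t) \<le> h0 t" if h: "h \<noteq> 0" "norm h \<le> d" and t: "0 < t" for h t
  proof -
    have "of_real t powr (s + h - 1) = of_real t powr (s - 1) * exp (h * of_real (ln t))"
      using t by (simp add: powr_def Ln_of_real algebra_simps exp_add exp_diff)
    then have "F h t = q t * of_real t powr (s - 1) * ((exp (h * of_real (ln t)) - 1) / h)"
      by (simp add: F_def algebra_simps diff_divide_distrib)
    then have "norm (F h t) = norm (q t) * t powr (Re s - 1) * (norm (exp (h * of_real (ln t)) - 1) / norm h)"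
      using t by (simp add: norm_mult norm_divide norm_powr_real_powr)
    also have "norm (exp (h * of_real (ln t)) - 1) / norm h \<le> two_powr (- 2 * d) (2 * d) t / d"
    proof -
      have "norm (exp (h * of_real (ln t)) - 1) \<le> norm h * \<bar>ln t\<bar> * exp (norm h * \<bar>ln t\<bar>)"
        using norm_exp_minus_1_le[of "h * of_real (ln t)"] by (simp add: norm_mult)
      then have "norm (exp (h * of_real (ln t)) - 1) / norm h \<le> \<bar>ln t\<bar> * exp (norm h * \<bar>ln t\<bar>)"
        using h by (simp add: field_simps)
      also have "\<dots> \<le> (exp (d * \<bar>ln t\<bar>) / d) * exp (d * \<bar>ln t\<bar>)"
      proof (intro mult_mono)
        have "d * \<bar>ln t\<bar> \<le> exp (d * \<bar>ln t\<bar>)" using exp_ge_add_one_self[of "d * \<bar>ln t\<bar>"] by linarith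
        then show "\<bar>ln t\<bar> \<le> exp (d * \<bar>ln t\<bar>) / d" using d by (simp add: field_simps)
        show "exp (norm h * \<bar>ln t\<bar>) \<le> exp (d * \<bar>ln t\<bar>)" using h by (simp add: mult_right_mono)
      qed (use d in auto)
      also have "\<dots> = exp (2 * d * \<bar>ln t\<bar>) / d" by (simp flip: exp_add)
      also have "exp (2 * d * \<bar>ln t\<bar>) = two_powr (- 2 * d) (2 * d) t" using exp_abs_ln[OF t, of "2 * d"] by simp
      finally show ?thesis .
    qed
    also have "norm (q t) * t powr (Re s - 1) * (two_powr (- 2 * d) (2 * d) t / d) \<le>
        C * two_powr a (- b) t * t powr (Re s - 1) * (two_powr (- 2 * d) (2 * d) t / d)"
      using bound[OF t] d by (intro mult_right_mono) (auto simp: two_powr_nonneg)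
    also have "\<dots> = h0 t"
    proof -
      have "C * two_powr a (- b) t * t powr (Re s - 1) * (two_powr (- 2 * d) (2 * d) t / d) =
          C / d * (t powr (Re s - 1) * (two_powr a (- b) t * two_powr (- 2 * d) (2 * d) t))" by simp
      also have "\<dots> = h0 t"
        unfolding two_powr_mult two_powr_mult_powr h0_def by (simp add: algebra_simps)
      finally show ?thesis .
    qed
    finally show ?thesis by (simp add: mult_left_mono two_powr_nonneg)
  qed
  have "((\<lambda>h. integral {0<..} (F h)) \<longlongrightarrow> integral {0<..} (\<lambda>t. q t * of_real t powr (s - 1) * of_real (ln t))) (at 0)"
  proof (rule dominated_convergence_at(2))
    show "h0 integrable_on {0<..}"
      unfolding h0_def[abs_def] using d by (intro integrable_on_mult_right two_powr_integrable[unfolded eta_contract_eq]) auto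
    have Fi: "F h integrable_on {0<..}" if "norm h \<le> d" for h
    proof -
      have "\<bar>Re h\<bar> \<le> d" using abs_Re_le_cmod[of h] that by linarith
      then have "- a < Re (s + h)" "Re (s + h) < b" using d4 by auto
      then show ?thesis
        unfolding F_def using mellin_integrable[OF q bound] s
        by (intro integrable_on_divide Henstock_Kurzweil_Integration.integrable_diff) (auto simp: absolutely_integrable_on_def)
    qed
    show "\<forall>\<^sub>F h in at 0. F h integrable_on {0<..} \<and> (\<forall>t\<in>{0<..}. norm (F h t) \<le> h0 t)"
      unfolding eventually_at using d bd Fi by (intro exI[of _ d]) auto
    fix t :: real assume t: "t \<in> {0<..}"
    have "((\<lambda>s. of_real t powr (s - 1)) has_field_derivative of_real t powr (s - 1) * of_real (ln t)) (at s)"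
      using DERIV_chain2[OF has_field_derivative_powr_real_exponent[of t] DERIV_diff[OF DERIV_ident DERIV_const], of 1 s] t
      by (simp add: mult.commute)
    then have "((\<lambda>h. (of_real t powr (s + h - 1) - of_real t powr (s - 1)) / h) \<longlongrightarrow> of_real t powr (s - 1) * of_real (ln t)) (at 0)"
      by (simp add: DERIV_def)
    from tendsto_mult_left[OF this, of "q t"]
    show "((\<lambda>h. F h t) \<longlongrightarrow> q t * of_real t powr (s - 1) * of_real (ln t)) (at 0)"
      by (simp add: F_def algebra_simps)
  qed simp
  moreover have "\<forall>\<^sub>F h in at 0. integral {0<..} (F h) =
     (integral {0<..} (\<lambda>t. q t * of_real t powr (s + h - 1)) - integral {0<..} (\<lambda>t. q t * of_real t powr (s - 1))) / h"
    unfolding eventually_at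
  proof (intro exI[of _ d] conjI ballI impI d)
    fix h :: complex assume "h \<noteq> 0 \<and> dist h 0 < d"
    then have "\<bar>Re h\<bar> \<le> d" using abs_Re_le_cmod[of h] by simp
    then have "- a < Re (s + h)" "Re (s + h) < b" using d4 by auto
    then show "integral {0<..} (F h) =
     (integral {0<..} (\<lambda>t. q t * of_real t powr (s + h - 1)) - integral {0<..} (\<lambda>t. q t * of_real t powr (s - 1))) / h"
      unfolding F_def using mellin_integrable[OF q bound, of "s + h"] mellin_integrable[OF q bound s]
      by (subst integral_divide, subst Henstock_Kurzweil_Integration.integral_diff) (auto simp: absolutely_integrable_on_def)
  qed
  ultimately have "((\<lambda>h. (integral {0<..} (\<lambda>t. q t * of_real t powr (s + h - 1)) - integral {0<..} (\<lambda>t. q t * of_real t powr (s - 1))) / h)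
     \<longlongrightarrow> integral {0<..} (\<lambda>t. q t * of_real t powr (s - 1) * of_real (ln t))) (at 0)"
    by (rule Lim_transform_eventually)
  then show ?thesis by (simp add: DERIV_def)
qed

context schwartz_function
begin

section \<open>Decay of the cosine integrals in the frequency\<close>

lemma has_vector_derivative_exp_i:
  "((\<lambda>t. exp (\<i> * of_real c * of_real t)) has_vector_derivative \<i> * of_real c * exp (\<i> * of_real c * of_real t)) (at t within S)"
  by (rule has_vector_derivative_real_field) (auto intro!: derivative_eq_intros)

text \<open>Exponentials instead of sines keep the recursion closed under integration by parts; the
  sine is restored in \<open>J_bound\<close> from the frequencies c and -c.\<close>

definition tail :: "complex \<Rightarrow> nat \<Rightarrow> real \<Rightarrow> real \<Rightarrow> complex" where
  "tail w j c a = integral {a..} (\<lambda>t. of_real t powr w * v j t * exp (\<i> * of_real c * of_real t))"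

lemma powr_v_bound:
  obtains K where "K \<ge> 0" "\<And>t w. 0 < t \<Longrightarrow> norm (of_real t powr w * v j t) \<le> K * two_powr (real k + Re w) (- real k + Re w) t"
proof -
  obtain K where K: "K \<ge> 0" "\<And>t. 0 < t \<Longrightarrow> norm (v j t) \<le> K * two_powr (real k) (- real k) t"
    using v_bound[of j] by blast
  have "norm (of_real t powr w * v j t) \<le> K * two_powr (real k + Re w) (- real k + Re w) t" if t: "0 < t" for t w
  proof -
    have "norm (of_real t powr w * v j t) \<le> t powr (Re w) * (K * two_powr (real k) (- real k) t)"
      using K(2)[OF t] t by (simp add: norm_mult norm_powr_real_powr mult_left_mono)
    also have "\<dots> = K * (t powr (Re w) * two_powr (real k) (- real k) t)" by (simp only: mult_ac)
    finally show ?thesis by (simp only: two_powr_mult_powr)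
  qed
  with K(1) that show ?thesis by blast
qed

lemma powr_v_continuous: "continuous_on {0<..} (\<lambda>t. of_real t powr w * v j t)"
  by (intro continuous_intros v_continuous) (auto simp: complex_nonpos_Reals_iff)

lemma tail_integrable:
  assumes "Re w < real k - 1" "0 < a"
  shows "(\<lambda>t. of_real t powr w * v j t * exp (\<i> * of_real c * of_real t)) absolutely_integrable_on {a..}"
proof -
  obtain K where K: "K \<ge> 0" "\<And>t w. 0 < t \<Longrightarrow> norm (of_real t powr w * v j t) \<le> K * two_powr (real k + Re w) (- real k + Re w) t"
    using powr_v_bound[of j] by blast
  define B where "B = K * max 1 (a powr (real k + Re w))"
  have A: "(\<lambda>t. of_real t powr w * v j t * exp (\<i> * of_real c * of_real t)) \<in> borel_measurable (lebesgue_on {a..})"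
    using assms(2) by (intro continuous_imp_measurable_on_sets_lebesgue continuous_intros continuous_on_subset[OF powr_v_continuous]) auto
  have B: "(\<lambda>t. K * two_powr (real k + Re w) (- real k + Re w) t) integrable_on {a..}"
  proof (intro integrable_on_mult_right)
    define b where "b = max a 1"
    have "(\<lambda>t. t powr (real k + Re w)) integrable_on {a..1}"
      using assms(2) by (intro integrable_continuous_interval continuous_intros) auto
    then have 1: "two_powr (real k + Re w) (- real k + Re w) integrable_on {a..1}"
      by (rule integrable_eq) (auto simp: two_powr_def)
    have "(\<lambda>t. t powr (- real k + Re w)) integrable_on {b..}"
      by (rule has_integral_integrable[OF has_integral_powr_to_inf]) (use assms in \<open>auto simp: b_def\<close>)
    then have 2: "two_powr (real k + Re w) (- real k + Re w) integrable_on {b..}"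
      by (rule integrable_eq) (auto simp: two_powr_def b_def)
    have "two_powr (real k + Re w) (- real k + Re w) integrable_on ({a..1} \<union> {b..})"
      by (rule integrable_Un[OF _ 1 2]) (auto simp: b_def intro: negligible_subset[of "{1}"])
    moreover have "{a..1} \<union> {b..} = {a..}" by (auto simp: b_def)
    ultimately show "two_powr (real k + Re w) (- real k + Re w) integrable_on {a..}" by simp
  qed
  show ?thesis
    by (rule measurable_bounded_by_integrable_imp_absolutely_integrable[OF A _ B]) (use K assms in \<open>auto simp: norm_mult\<close>)
qed

lemma powr_v_deriv:
  assumes "0 < t"
  shows "((\<lambda>t. of_real t powr w * v j t) has_vector_derivative
     of_real t powr (w - 1) * ((w + of_nat (k * j)) * v j t + of_nat k * v (Suc j) t)) (at t)"
proof -
  have "((\<lambda>t. complex_of_real t powr w) has_vector_derivative w * of_real t powr (w - 1)) (at t)"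
    using assms by (intro has_vector_derivative_real_field has_field_derivative_powr) (auto simp: complex_nonpos_Reals_iff)
  from has_vector_derivative_mult[OF this v_deriv[OF assms, of j]]
  show ?thesis
    by (rule has_vector_derivative_eq_rhs) (use assms in \<open>simp add: powr_diff field_simps\<close>)
qed

lemma powr_v_tendsto_0_at_top:
  assumes "Re w < real k"
  shows "((\<lambda>t. of_real t powr w * v j t) \<longlongrightarrow> 0) at_top"
proof -
  obtain K where K: "K \<ge> 0" "\<And>t w. 0 < t \<Longrightarrow> norm (of_real t powr w * v j t) \<le> K * two_powr (real k + Re w) (- real k + Re w) t"
    using powr_v_bound[of j] by blast
  show ?thesis
  proof (rule Lim_null_comparison)
    show "\<forall>\<^sub>F t in at_top. norm (of_real t powr w * v j t) \<le> K * t powr (- real k + Re w)"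
      using eventually_gt_at_top[of 1]
    proof eventually_elim
      case (elim t)
      then show ?case using K(2)[of t w] by (simp add: two_powr_def)
    qed
    have "((\<lambda>t::real. t powr (- real k + Re w)) \<longlongrightarrow> 0) at_top"
      using assms by (intro tendsto_neg_powr filterlim_ident) auto
    from tendsto_mult_right_zero[OF this] show "((\<lambda>t. K * t powr (- real k + Re w)) \<longlongrightarrow> 0) at_top" .
  qed
qed

lemma powr_v_tendsto_0_at_right:
  assumes "- real k < Re w"
  shows "((\<lambda>t. of_real t powr w * v j t) \<longlongrightarrow> 0) (at_right 0)"
proof -
  obtain K where K: "K \<ge> 0" "\<And>t w. 0 < t \<Longrightarrow> norm (of_real t powr w * v j t) \<le> K * two_powr (real k + Re w) (- real k + Re w) t"
    using powr_v_bound[of j] by blast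
  show ?thesis
  proof (rule Lim_null_comparison)
    show "\<forall>\<^sub>F t in at_right 0. norm (of_real t powr w * v j t) \<le> K * t powr (real k + Re w)"
    proof -
      have "norm (of_real t powr w * v j t) \<le> K * t powr (real k + Re w)" if "0 < t" "t < 1" for t
        using K(2)[of t w] that by (simp add: two_powr_def)
      then show ?thesis unfolding eventually_at by (intro exI[of _ 1]) (auto simp: dist_norm)
    qed
    have "((\<lambda>t::real. t powr (real k + Re w)) \<longlongrightarrow> 0 powr (real k + Re w)) (at_right 0)"
      using assms by (intro tendsto_intros) (auto simp: eventually_at intro!: exI[of _ 1])
    then show "((\<lambda>t. K * t powr (real k + Re w)) \<longlongrightarrow> 0) (at_right 0)" using assms by (auto intro: tendsto_mult_right_zero)
  qed
qed

text \<open>Each step divides by c and lowers the exponent \<open>w\<close> by 1, at the price of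
  also involving \<open>v (Suc j)\<close>.\<close>

lemma tail_parts:
  assumes "Re w < real k - 1" "0 < a" "c \<noteq> 0"
  shows "tail w j c a = - (of_real a powr w * v j a * exp (\<i> * of_real c * of_real a)) / (\<i> * of_real c)
    - ((w + of_nat (k * j)) * tail (w - 1) j c a + of_nat k * tail (w - 1) (Suc j) c a) / (\<i> * of_real c)"
proof -
  define e where "e t = exp (\<i> * of_real c * of_real t)" for t
  define P where "P t = (of_real t powr w * v j t) * e t" for t
  have "((\<lambda>t. of_real t powr w * v j t * (\<i> * of_real c * e t) +
      of_real t powr (w - 1) * ((w + of_nat (k * j)) * v j t + of_nat k * v (Suc j) t) * e t) has_integral 0 - P a) {a..}"
  proof (rule has_integral_FTC_Ici)
    fix t assume "a \<le> t"
    then have "0 < t" using assms by simp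
    from has_vector_derivative_mult[OF powr_v_deriv[OF this] has_vector_derivative_exp_i]
    show "(P has_vector_derivative of_real t powr w * v j t * (\<i> * of_real c * e t) +
      of_real t powr (w - 1) * ((w + of_nat (k * j)) * v j t + of_nat k * v (Suc j) t) * e t) (at t)"
      unfolding P_def e_def .
  next
    show "(P \<longlongrightarrow> 0) at_top"
      unfolding P_def[abs_def] e_def by (intro tendsto_mult_bounded_0 powr_v_tendsto_0_at_top) (use assms in auto)
  qed
  moreover have "((\<lambda>t. (\<i> * of_real c) * (of_real t powr w * v j t * e t) +
      ((w + of_nat (k * j)) * (of_real t powr (w - 1) * v j t * e t) + of_nat k * (of_real t powr (w - 1) * v (Suc j) t * e t))) has_integral
      (\<i> * of_real c) * tail w j c a + ((w + of_nat (k * j)) * tail (w - 1) j c a + of_nat k * tail (w - 1) (Suc j) c a)) {a..}"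
    unfolding tail_def e_def using assms
    by (intro has_integral_add has_integral_mult_right integrable_integral set_lebesgue_integral_eq_integral(1) tail_integrable) auto
  then have "((\<lambda>t. of_real t powr w * v j t * (\<i> * of_real c * e t) +
      of_real t powr (w - 1) * ((w + of_nat (k * j)) * v j t + of_nat k * v (Suc j) t) * e t) has_integral
      (\<i> * of_real c) * tail w j c a + ((w + of_nat (k * j)) * tail (w - 1) j c a + of_nat k * tail (w - 1) (Suc j) c a)) {a..}"
    by (rule has_integral_eq[rotated]) (simp add: algebra_simps)
  ultimately have "0 - P a = (\<i> * of_real c) * tail w j c a + ((w + of_nat (k * j)) * tail (w - 1) j c a + of_nat k * tail (w - 1) (Suc j) c a)"
    by (rule has_integral_unique)
  then have "(\<i> * of_real c) * tail w j c a = - P a - ((w + of_nat (k * j)) * tail (w - 1) j c a + of_nat k * tail (w - 1) (Suc j) c a)"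
    by (simp add: algebra_simps)
  then have "tail w j c a = (- P a - ((w + of_nat (k * j)) * tail (w - 1) j c a + of_nat k * tail (w - 1) (Suc j) c a)) / (\<i> * of_real c)"
    using assms by (simp add: eq_divide_eq mult.commute)
  then show ?thesis by (simp only: diff_divide_distrib P_def e_def)
qed

text \<open>The index N measures how far Re w lies above the range where t^(k + Re w), which
  majorises the integrand up to a constant, is integrable at infinity. One use of
  \<open>tail_parts\<close> lowers Re w by 1, so \<open>R\<close> and \<open>j\<close> must vary in
  the induction. The offset 3/2 keeps k + Re w + 1 <= -1/2 in the base case, where the integral then
  costs at most a factor 2. The power of mu is the one forced by cutting at t = 1/mu.\<close>

lemma tail_bound:
  "\<exists>C\<ge>0. \<forall>w c \<mu>. norm w \<le> R \<longrightarrow> Re w + real k + 3 / 2 \<le> real N \<longrightarrow> Re w < real k - 1 \<longrightarrow> 0 < \<mu> \<longrightarrow> \<bar>c\<bar> = \<mu> \<longrightarrow>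
     norm (tail w j c (1 / \<mu>)) \<le> C * \<mu> powr (- (Re w + real k + 1))"
proof (induction N arbitrary: R j)
  case 0
  obtain K where K: "K \<ge> 0" "\<And>t w. 0 < t \<Longrightarrow> norm (of_real t powr w * v j t) \<le> K * two_powr (real k + Re w) (- real k + Re w) t"
    using powr_v_bound[of j] by blast
  have "norm (tail w j c (1 / \<mu>)) \<le> 2 * K * \<mu> powr (- (Re w + real k + 1))"
    if w: "Re w + real k + 3 / 2 \<le> 0" "0 < \<mu>" for w c \<mu>
  proof -
    let ?e = "real k + Re w"
    have hi: "((\<lambda>t. K * t powr ?e) has_integral K * (- ((1 / \<mu>) powr (?e + 1)) / (?e + 1))) {1/\<mu>..}"
      using w by (intro has_integral_mult_right has_integral_powr_to_inf) auto
    have "norm (tail w j c (1 / \<mu>)) \<le> integral {1/\<mu>..} (\<lambda>t. K * t powr ?e)"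
      unfolding tail_def
    proof (rule integral_norm_bound_integral)
      show "(\<lambda>t. of_real t powr w * v j t * exp (\<i> * of_real c * of_real t)) integrable_on {1/\<mu>..}"
        using tail_integrable[of w "1/\<mu>" j c] w by (auto simp: absolutely_integrable_on_def)
      show "(\<lambda>t. K * t powr ?e) integrable_on {1/\<mu>..}" using hi by (rule has_integral_integrable)
      fix t assume "t \<in> {1/\<mu>..}"
      then have t: "0 < t" using w(2) by (auto intro: less_le_trans[of 0 "1/\<mu>"])
      have "norm (of_real t powr w * v j t * exp (\<i> * of_real c * of_real t)) \<le> K * two_powr ?e (- real k + Re w) t"
        using K(2)[OF t, of w] by (simp add: norm_mult)
      also have "\<dots> \<le> K * t powr ?e"
        using K(1) t by (intro mult_left_mono) (auto simp: two_powr_def intro!: powr_mono)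
      finally show "norm (of_real t powr w * v j t * exp (\<i> * of_real c * of_real t)) \<le> K * t powr ?e" .
    qed
    also have "\<dots> = K * (1 / \<mu>) powr (?e + 1) * (1 / - (?e + 1))"
      unfolding integral_unique[OF hi] by (simp add: minus_divide_right)
    also have "\<dots> \<le> K * (1 / \<mu>) powr (?e + 1) * 2"
      using K(1) w by (intro mult_left_mono) (auto simp: divide_le_eq)
    also have "(1 / \<mu>) powr (?e + 1) = \<mu> powr (- (Re w + real k + 1))"
      using powr_one_div[OF w(2), of "?e + 1"] by (simp add: add_ac)
    finally show ?thesis by (simp add: mult_ac)
  qed
  then show ?case using K(1) by (intro exI[of _ "2 * K"]) auto
next
  case (Suc N)
  obtain K where K: "K \<ge> 0" "\<And>t w. 0 < t \<Longrightarrow> norm (of_real t powr w * v j t) \<le> K * two_powr (real k + Re w) (- real k + Re w) t"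
    using powr_v_bound[of j] by blast
  obtain C0 where C0: "C0 \<ge> 0" "\<forall>w c \<mu>. norm w \<le> R + 1 \<longrightarrow> Re w + real k + 3 / 2 \<le> real N \<longrightarrow> Re w < real k - 1 \<longrightarrow> 0 < \<mu> \<longrightarrow> \<bar>c\<bar> = \<mu> \<longrightarrow>
     norm (tail w j c (1 / \<mu>)) \<le> C0 * \<mu> powr (- (Re w + real k + 1))" using Suc.IH by blast
  obtain C1 where C1: "C1 \<ge> 0" "\<forall>w c \<mu>. norm w \<le> R + 1 \<longrightarrow> Re w + real k + 3 / 2 \<le> real N \<longrightarrow> Re w < real k - 1 \<longrightarrow> 0 < \<mu> \<longrightarrow> \<bar>c\<bar> = \<mu> \<longrightarrow>
     norm (tail w (Suc j) c (1 / \<mu>)) \<le> C1 * \<mu> powr (- (Re w + real k + 1))" using Suc.IH by blast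
  define C where "C = K + ((\<bar>R\<bar> + real (k * j)) * C0 + real k * C1)"
  have "norm (tail w j c (1 / \<mu>)) \<le> C * \<mu> powr (- (Re w + real k + 1))"
    if w: "norm w \<le> R" "Re w + real k + 3 / 2 \<le> real (Suc N)" "Re w < real k - 1" "0 < \<mu>" "\<bar>c\<bar> = \<mu>" for w c \<mu>
  proof -
    \<comment> \<open>Passing from w to w - 1 multiplies the target bound by mu, exactly what the
      division by i c gives back.\<close>
    let ?m = "\<mu> powr (- (Re w + real k + 1))"
    have m: "\<mu> powr (- (Re (w - 1) + real k + 1)) = \<mu> * ?m"
      using w(4) by (simp add: powr_mult_base)
    have "norm (w - 1) \<le> R + 1" using norm_triangle_ineq4[of w 1] w(1) by simp
    then have t0: "norm (tail (w - 1) j c (1 / \<mu>)) \<le> C0 * (\<mu> * ?m)" and t1: "norm (tail (w - 1) (Suc j) c (1 / \<mu>)) \<le> C1 * (\<mu> * ?m)"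
      using C0(2) C1(2) w unfolding m[symmetric] by auto
    have p: "norm (of_real (1/\<mu>) powr w * v j (1/\<mu>)) \<le> K * (\<mu> * ?m)"
    proof -
      have "norm (of_real (1/\<mu>) powr w * v j (1/\<mu>)) \<le> K * two_powr (real k + Re w) (- real k + Re w) (1/\<mu>)"
        using K(2)[of "1/\<mu>" w] w(4) by simp
      also have "\<dots> \<le> K * (1/\<mu>) powr (real k + Re w)"
        using K(1) w(4) by (intro mult_left_mono) (auto simp: two_powr_def intro!: powr_mono simp del: powr_one_eq_one)
      also have "(1/\<mu>) powr (real k + Re w) = \<mu> * ?m"
        using powr_one_div[OF w(4), of "real k + Re w"] unfolding m[symmetric] by (simp add: add_ac)
      finally show ?thesis .
    qed
    have n: "norm (\<i> * complex_of_real c) = \<mu>" using w by (simp add: norm_mult)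
    have "norm (tail w j c (1 / \<mu>)) \<le> norm (of_real (1/\<mu>) powr w * v j (1/\<mu>) * exp (\<i> * of_real c * of_real (1/\<mu>))) / \<mu>
       + norm ((w + of_nat (k * j)) * tail (w - 1) j c (1/\<mu>) + of_nat k * tail (w - 1) (Suc j) c (1/\<mu>)) / \<mu>"
      using w by (subst tail_parts) (auto intro!: order_trans[OF norm_triangle_ineq4] simp: norm_divide n simp del: of_real_divide)
    also have "\<dots> \<le> K * (\<mu> * ?m) / \<mu> + ((\<bar>R\<bar> + real (k * j)) * (C0 * (\<mu> * ?m)) + real k * (C1 * (\<mu> * ?m))) / \<mu>"
    proof (intro add_mono divide_right_mono)
      show "norm (of_real (1/\<mu>) powr w * v j (1/\<mu>) * exp (\<i> * of_real c * of_real (1/\<mu>))) \<le> K * (\<mu> * ?m)"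
        using p by (simp add: norm_mult)
      have "norm ((w + of_nat (k * j)) * tail (w - 1) j c (1/\<mu>) + of_nat k * tail (w - 1) (Suc j) c (1/\<mu>)) \<le>
         norm (w + of_nat (k * j)) * norm (tail (w - 1) j c (1/\<mu>)) + real k * norm (tail (w - 1) (Suc j) c (1/\<mu>))"
        by (intro order_trans[OF norm_triangle_ineq]) (simp add: norm_mult)
      also have "\<dots> \<le> (\<bar>R\<bar> + real (k * j)) * (C0 * (\<mu> * ?m)) + real k * (C1 * (\<mu> * ?m))"
      proof (intro add_mono mult_mono t0 t1)
        show "norm (w + of_nat (k * j)) \<le> \<bar>R\<bar> + real (k * j)"
          using norm_triangle_ineq[of w "of_nat (k * j)"] w(1) by (simp del: of_nat_mult)
      qed auto
      finally show "norm ((w + of_nat (k * j)) * tail (w - 1) j c (1/\<mu>) + of_nat k * tail (w - 1) (Suc j) c (1/\<mu>)) \<le>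
         (\<bar>R\<bar> + real (k * j)) * (C0 * (\<mu> * ?m)) + real k * (C1 * (\<mu> * ?m))" .
    qed (use w in auto)
    also have "\<dots> = C * ?m" using w(4) by (simp add: C_def field_simps)
    finally show ?thesis .
  qed
  moreover have "C \<ge> 0" using K(1) C0(1) C1(1) by (simp add: C_def)
  ultimately show ?case by (intro exI[of _ C]) blast
qed

definition U' :: "complex \<Rightarrow> real \<Rightarrow> complex" where
  "U' z t = of_real t powr (z - 1) * (z * v 0 t + of_nat k * v 1 t)"

lemma U_deriv: "0 < t \<Longrightarrow> ((\<lambda>t. of_real t powr z * v 0 t) has_vector_derivative U' z t) (at t)"
  using powr_v_deriv[of t z 0] by (simp add: U'_def)

lemma U'_continuous: "continuous_on {0<..} (U' z)"
proof -
  have "U' z = (\<lambda>t. z * (of_real t powr (z - 1) * v 0 t) + of_nat k * (of_real t powr (z - 1) * v 1 t))"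
    by (auto simp: U'_def algebra_simps)
  then show ?thesis by (simp only:) (intro continuous_intros powr_v_continuous)
qed

lemma U'_bound:
  obtains K where "K \<ge> 0" "\<And>t z. 0 < t \<Longrightarrow> norm (U' z t) \<le> (norm z + 1) * K * two_powr (real k + Re z - 1) (- real k + Re z - 1) t"
proof -
  obtain K0 where K0: "K0 \<ge> 0" "\<And>t w. 0 < t \<Longrightarrow> norm (of_real t powr w * v 0 t) \<le> K0 * two_powr (real k + Re w) (- real k + Re w) t"
    using powr_v_bound[of 0] by blast
  obtain K1 where K1: "K1 \<ge> 0" "\<And>t w. 0 < t \<Longrightarrow> norm (of_real t powr w * v 1 t) \<le> K1 * two_powr (real k + Re w) (- real k + Re w) t"
    using powr_v_bound[of 1] by blast
  have "norm (U' z t) \<le> (norm z + 1) * (K0 + real k * K1) * two_powr (real k + Re z - 1) (- real k + Re z - 1) t" if t: "0 < t" for t z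
  proof -
    let ?t = "two_powr (real k + Re z - 1) (- real k + Re z - 1) t"
    have "norm (U' z t) \<le> norm (z * (of_real t powr (z - 1) * v 0 t)) + norm (of_nat k * (of_real t powr (z - 1) * v 1 t))"
      unfolding U'_def by (rule order_trans[OF _ norm_triangle_ineq]) (simp add: algebra_simps)
    also have "\<dots> = norm z * norm (of_real t powr (z - 1) * v 0 t) + real k * norm (of_real t powr (z - 1) * v 1 t)"
      by (simp only: norm_mult norm_of_nat)
    also have "\<dots> \<le> norm z * (K0 * ?t) + real k * (K1 * ?t)"
      using K0(2)[OF t, of "z - 1"] K1(2)[OF t, of "z - 1"] by (intro add_mono mult_left_mono) (auto simp: algebra_simps)
    also have "\<dots> \<le> (norm z + 1) * (K0 + real k * K1) * ?t"
      using K0(1) K1(1) two_powr_nonneg[of "real k + Re z - 1" "- real k + Re z - 1" t]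
      by (simp add: algebra_simps add_increasing)
    finally show ?thesis .
  qed
  then show ?thesis using that[of "K0 + real k * K1"] K0(1) K1(1) by simp
qed

lemma U'_integrable:
  assumes "- real k < Re z" "Re z < real k"
  shows "U' z absolutely_integrable_on {0<..}"
proof -
  obtain K where K: "K \<ge> 0" "\<And>t z. 0 < t \<Longrightarrow> norm (U' z t) \<le> (norm z + 1) * K * two_powr (real k + Re z - 1) (- real k + Re z - 1) t"
    using U'_bound by blast
  show ?thesis
    by (rule absolutely_integrable_Ioi[OF U'_continuous K(2)]) (use assms in auto)
qed

text \<open>The cosine integral of t^z \<open>v 0 t\<close> after one integration by parts. In this
  form it converges absolutely for |Re z| < k, whereas the cosine integral itself is in general only
  conditionally convergent for Re z >= k - 1.\<close>

definition J :: "complex \<Rightarrow> real \<Rightarrow> complex" where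
  "J z c = - (integral {0<..} (\<lambda>t. of_real (sin (c * t)) * U' z t)) / of_real c"

lemma J_integrable:
  assumes "- real k < Re z" "Re z < real k"
  shows "(\<lambda>t. of_real (sin (c * t)) * U' z t) absolutely_integrable_on {0<..}"
proof (rule absolutely_integrable_bounded_measurable_product[OF bilinear_times])
  show "(\<lambda>t. complex_of_real (sin (c * t))) \<in> borel_measurable (lebesgue_on {0<..})"
    by (intro continuous_on_imp_measurable_Ioi continuous_intros)
  show "bounded ((\<lambda>t. complex_of_real (sin (c * t))) ` {0<..})"
    by (rule boundedI[of _ 1]) auto
qed (auto intro: U'_integrable assms)

text \<open>The link back to the conditionally convergent cosine integral, used when
  \<open>J\<close> is paired with the kernel.\<close>

lemma J_improper:
  assumes "- real k < Re z" "Re z < real k" "0 < c"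
  shows "((\<lambda>t. of_real t powr z * v 0 t * of_real (cos (c * t))) has_integral J z c) {0<..}"
proof -
  have "((\<lambda>t. of_real t powr z * v 0 t * of_real (c * cos (c * t)) + U' z t * of_real (sin (c * t))) has_integral 0 - 0) {0<..}"
  proof (rule has_integral_FTC_Ioi)
    fix t :: real assume "0 < t"
    from has_vector_derivative_mult[OF U_deriv[OF this] has_vector_derivative_cos_real(2)]
    show "((\<lambda>t. of_real t powr z * v 0 t * of_real (sin (c * t))) has_vector_derivative
      of_real t powr z * v 0 t * of_real (c * cos (c * t)) + U' z t * of_real (sin (c * t))) (at t)" .
  next
    show "continuous_on {0<..} (\<lambda>t. of_real t powr z * v 0 t * of_real (c * cos (c * t)) + U' z t * of_real (sin (c * t)))"
      by (intro continuous_intros powr_v_continuous U'_continuous)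
    show "((\<lambda>t. of_real t powr z * v 0 t * of_real (sin (c * t))) \<longlongrightarrow> 0) (at_right 0)"
      by (intro tendsto_mult_bounded_0 powr_v_tendsto_0_at_right) (use assms in auto)
    show "((\<lambda>t. of_real t powr z * v 0 t * of_real (sin (c * t))) \<longlongrightarrow> 0) at_top"
      by (intro tendsto_mult_bounded_0 powr_v_tendsto_0_at_top) (use assms in auto)
  qed
  moreover have "((\<lambda>t. of_real (sin (c * t)) * U' z t) has_integral - of_real c * J z c) {0<..}"
    using J_integrable[OF assms(1,2), of c] assms(3) by (auto simp: J_def absolutely_integrable_on_def integrable_integral)
  ultimately have "((\<lambda>t. of_real t powr z * v 0 t * of_real (c * cos (c * t)) + U' z t * of_real (sin (c * t))
      - of_real (sin (c * t)) * U' z t) has_integral 0 - 0 - (- of_real c * J z c)) {0<..}"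
    by (rule has_integral_diff)
  from has_integral_mult_right[OF this, of "1 / of_real c"]
  show ?thesis using assms(3) by (simp add: mult_ac)
qed

text \<open>Cut at t = 1/c. Below, the bound t^(k + Re z - 1) for \<open>U'\<close> integrates to
  the required power, and \<open>\<delta>\<close> keeps the denominator k + Re z away from 0; above,
  \<open>tail_bound\<close> applies with w = z - 1. The factor 1/c in \<open>J\<close> supplies the
  last power.\<close>

lemma J_bound:
  assumes "\<delta> > 0"
  shows "\<exists>C\<ge>0. \<forall>z c. norm z \<le> R \<longrightarrow> \<delta> \<le> Re z + real k \<longrightarrow> Re z < real k \<longrightarrow> 0 < c \<longrightarrow>
    norm (J z c) \<le> C * c powr (- (Re z + real k + 1))"
proof -
  obtain K where K: "K \<ge> 0" "\<And>t z. 0 < t \<Longrightarrow> norm (U' z t) \<le> (norm z + 1) * K * two_powr (real k + Re z - 1) (- real k + Re z - 1) t"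
    using U'_bound by blast
  \<comment> \<open>Large enough for the hypothesis of \<open>tail_bound\<close> at w = z - 1 for
    every z with norm at most R.\<close>
  define N where "N = nat \<lceil>\<bar>R\<bar> + real k + 3\<rceil>"
  have N: "\<bar>R\<bar> + real k + 3 \<le> real N" unfolding N_def by linarith
  obtain C0 where C0: "C0 \<ge> 0" "\<forall>w c \<mu>. norm w \<le> R + 1 \<longrightarrow> Re w + real k + 3 / 2 \<le> real N \<longrightarrow> Re w < real k - 1 \<longrightarrow> 0 < \<mu> \<longrightarrow> \<bar>c\<bar> = \<mu> \<longrightarrow>
     norm (tail w 0 c (1 / \<mu>)) \<le> C0 * \<mu> powr (- (Re w + real k + 1))" using tail_bound by blast
  obtain C1 where C1: "C1 \<ge> 0" "\<forall>w c \<mu>. norm w \<le> R + 1 \<longrightarrow> Re w + real k + 3 / 2 \<le> real N \<longrightarrow> Re w < real k - 1 \<longrightarrow> 0 < \<mu> \<longrightarrow> \<bar>c\<bar> = \<mu> \<longrightarrow>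
     norm (tail w 1 c (1 / \<mu>)) \<le> C1 * \<mu> powr (- (Re w + real k + 1))" using tail_bound by blast
  define C where "C = (\<bar>R\<bar> + 1) * K / \<delta> + (\<bar>R\<bar> * C0 + real k * C1)"
  have "norm (J z c) \<le> C * c powr (- (Re z + real k + 1))"
    if z: "norm z \<le> R" "\<delta> \<le> Re z + real k" "Re z < real k" "0 < c" for z c
  proof -
    let ?m = "c powr (- (Re z + real k))"
    have kz: "- real k < Re z" using z(2) assms by simp
    let ?g = "\<lambda>t. complex_of_real (sin (c * t)) * U' z t"
    note ai = J_integrable[OF kz z(3), of c]
    have gi1: "?g absolutely_integrable_on {0<..1/c}" and gi2: "?g absolutely_integrable_on {1/c..}"
      using z(4) by (intro absolutely_integrable_on_subset_Ioi[OF ai]; force intro: less_le_trans[of 0 "1/c"])+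
    have near: "norm (integral {0<..1/c} ?g) \<le> (\<bar>R\<bar> + 1) * K / \<delta> * ?m"
    proof -
      let ?e = "Re z + real k - 1"
      have hi0: "((\<lambda>t. t powr ?e) has_integral ((1/c) powr (?e + 1) / (?e + 1))) {0..1/c}"
        using z(2,4) assms by (intro has_integral_powr_from_0) auto
      have hi1: "((\<lambda>t. t powr ?e) has_integral ((1/c) powr (?e + 1) / (?e + 1))) {0<..1/c}"
        using hi0 by (subst has_integral_spike_set_eq[of _ "{0..1/c}"]) (auto intro: negligible_subset[of "{0}"])
      have hi: "((\<lambda>t. ((\<bar>R\<bar> + 1) * K) * t powr ?e) has_integral ((\<bar>R\<bar> + 1) * K) * ((1/c) powr (?e + 1) / (?e + 1))) {0<..1/c}"
        by (intro has_integral_mult_right hi1)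
      have "norm (integral {0<..1/c} ?g) \<le> integral {0<..1/c} (\<lambda>t. ((\<bar>R\<bar> + 1) * K) * t powr ?e)"
      proof (rule integral_norm_bound_integral)
        show "?g integrable_on {0<..1/c}" using gi1 by (simp add: absolutely_integrable_on_def)
        show "(\<lambda>t. ((\<bar>R\<bar> + 1) * K) * t powr ?e) integrable_on {0<..1/c}" using hi by (rule has_integral_integrable)
        fix t assume "t \<in> {0<..1/c}"
        then have t: "0 < t" by simp
        have "norm (?g t) \<le> 1 * norm (U' z t)" unfolding norm_mult by (intro mult_right_mono) auto
        also have "\<dots> \<le> (norm z + 1) * K * two_powr (real k + Re z - 1) (- real k + Re z - 1) t" using K(2)[OF t] by simp
        also have "\<dots> \<le> ((\<bar>R\<bar> + 1) * K) * t powr ?e"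
        proof (intro mult_mono)
          show "two_powr (real k + Re z - 1) (- real k + Re z - 1) t \<le> t powr ?e"
            using t by (auto simp: two_powr_def add_ac intro!: powr_mono)
        qed (use z K in \<open>auto simp: two_powr_nonneg\<close>)
        finally show "norm (?g t) \<le> ((\<bar>R\<bar> + 1) * K) * t powr ?e" .
      qed
      also have "\<dots> = ((\<bar>R\<bar> + 1) * K) * (?m / (Re z + real k))"
        unfolding integral_unique[OF hi] powr_one_div[OF z(4)] by simp
      also have "\<dots> \<le> ((\<bar>R\<bar> + 1) * K) * (?m / \<delta>)"
        using z(2) assms K(1) by (intro mult_left_mono divide_left_mono) auto
      finally show ?thesis by simp
    qed
    have far: "norm (integral {1/c..} ?g) \<le> (\<bar>R\<bar> * C0 + real k * C1) * ?m"
    proof -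
      define T where "T j d = tail (z - 1) j d (1/c)" for j d
      have "norm (z - 1) \<le> R + 1" using norm_triangle_ineq4[of z 1] z(1) by simp
      moreover have "Re (z - 1) + real k + 3 / 2 \<le> real N" using N z(1) complex_Re_le_cmod[of z] by simp
      ultimately have T0: "norm (T 0 d) \<le> C0 * ?m" and T1: "norm (T 1 d) \<le> C1 * ?m" if "\<bar>d\<bar> = c" for d
        using C0(2) C1(2) z that unfolding T_def by auto
      have "((\<lambda>t. (1 / (2 * \<i>)) * (z * (of_real t powr (z - 1) * v 0 t * exp (\<i> * of_real c * of_real t))
           + of_nat k * (of_real t powr (z - 1) * v 1 t * exp (\<i> * of_real c * of_real t))
           - (z * (of_real t powr (z - 1) * v 0 t * exp (\<i> * of_real (- c) * of_real t))
           + of_nat k * (of_real t powr (z - 1) * v 1 t * exp (\<i> * of_real (- c) * of_real t)))))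
         has_integral (1 / (2 * \<i>)) * (z * T 0 c + of_nat k * T 1 c - (z * T 0 (- c) + of_nat k * T 1 (- c)))) {1/c..}"
        unfolding T_def tail_def using z
        by (intro has_integral_mult_right has_integral_diff has_integral_add integrable_integral set_lebesgue_integral_eq_integral(1) tail_integrable) auto
      then have "(?g has_integral (1 / (2 * \<i>)) * (z * T 0 c + of_nat k * T 1 c - (z * T 0 (- c) + of_nat k * T 1 (- c)))) {1/c..}"
      proof (rule has_integral_eq[rotated])
        fix t
        have "complex_of_real (sin (c * t)) = (exp (\<i> * of_real c * of_real t) - exp (\<i> * of_real (- c) * of_real t)) / (2 * \<i>)"
          by (simp add: sin_of_real[symmetric] sin_exp_eq mult.assoc)
        then show "(1 / (2 * \<i>)) * (z * (of_real t powr (z - 1) * v 0 t * exp (\<i> * of_real c * of_real t))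
           + of_nat k * (of_real t powr (z - 1) * v 1 t * exp (\<i> * of_real c * of_real t))
           - (z * (of_real t powr (z - 1) * v 0 t * exp (\<i> * of_real (- c) * of_real t))
           + of_nat k * (of_real t powr (z - 1) * v 1 t * exp (\<i> * of_real (- c) * of_real t)))) = ?g t"
          by (simp only: U'_def) (simp add: algebra_simps diff_divide_distrib add_divide_distrib)
      qed
      then have "norm (integral {1/c..} ?g) = (1 / 2) * norm (z * T 0 c + of_nat k * T 1 c - (z * T 0 (- c) + of_nat k * T 1 (- c)))"
        by (simp add: integral_unique norm_mult norm_divide)
      also have "\<dots> \<le> (1 / 2) * ((norm z * norm (T 0 c) + real k * norm (T 1 c)) + (norm z * norm (T 0 (- c)) + real k * norm (T 1 (- c))))"
        by (intro mult_left_mono order_trans[OF norm_triangle_ineq4] add_mono order_trans[OF norm_triangle_ineq]) (auto simp: norm_mult)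
      also have "\<dots> \<le> (1 / 2) * ((\<bar>R\<bar> * (C0 * ?m) + real k * (C1 * ?m)) + (\<bar>R\<bar> * (C0 * ?m) + real k * (C1 * ?m)))"
        using T0[of c] T1[of c] T0[of "- c"] T1[of "- c"] z(1,4) by (intro mult_left_mono add_mono mult_mono) auto
      also have "\<dots> = (\<bar>R\<bar> * C0 + real k * C1) * ?m" by (simp add: algebra_simps)
      finally show ?thesis .
    qed
    have "(?g has_integral integral {0<..1/c} ?g + integral {1/c..} ?g) ({0<..1/c} \<union> {1/c..})"
      using gi1 gi2 by (intro has_integral_Un integrable_integral) (auto simp: absolutely_integrable_on_def intro: negligible_subset[of "{1/c}"])
    moreover have "{0<..1/c} \<union> {1/c..} = {0<..}" using z(4) by (auto intro: less_le_trans[of 0 "1/c"])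
    ultimately have "integral {0<..} ?g = integral {0<..1/c} ?g + integral {1/c..} ?g" by (simp add: integral_unique)
    then have "norm (integral {0<..} ?g) \<le> C * ?m"
      using norm_triangle_ineq[of "integral {0<..1/c} ?g" "integral {1/c..} ?g"] near far by (simp add: C_def distrib_right)
    then have "norm (J z c) \<le> C * ?m / c"
      using z(4) by (simp add: J_def norm_divide divide_right_mono)
    also have "?m / c = c powr (- (Re z + real k + 1))"
    proof -
      have "- (Re z + real k) - 1 = - (Re z + real k + 1)" by simp
      then show ?thesis using z(4) powr_diff[of c "- (Re z + real k)" 1] by simp
    qed
    then have "C * ?m / c = C * c powr (- (Re z + real k + 1))" by (simp only: times_divide_eq_right[symmetric])
    finally show ?thesis .
  qed
  moreover have "C \<ge> 0" using assms K(1) C0(1) C1(1) by (simp add: C_def)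
  ultimately show ?thesis by (intro exI[of _ C]) blast
qed

text \<open>Up to the factor -1/c, \<open>J\<close> is a combination of the Mellin transforms of
  sin(c t) \<open>v 0 t\<close> and sin(c t) \<open>v 1 t\<close> with coefficients polynomial in z,
  so differentiation under the integral applies.\<close>

lemma J_holomorphic: "(\<lambda>z. J z c) holomorphic_on {z. - real k < Re z \<and> Re z < real k}"
proof -
  define M where "M j z = integral {0<..} (\<lambda>t. (of_real (sin (c * t)) * v j t) * of_real t powr (z - 1))" for j z
  have cont: "continuous_on {0<..} (\<lambda>t. of_real (sin (c * t)) * v j t)" for j
    by (intro continuous_intros v_continuous)
  have bd: "\<exists>K. \<forall>t>0. norm (of_real (sin (c * t)) * v j t) \<le> K * two_powr (real k) (- real k) t" for j
  proof -
    obtain K where K: "K \<ge> 0" "\<And>t. 0 < t \<Longrightarrow> norm (v j t) \<le> K * two_powr (real k) (- real k) t"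
      using v_bound[of j] by blast
    have "norm (of_real (sin (c * t)) * v j t) \<le> K * two_powr (real k) (- real k) t" if "0 < t" for t
    proof -
      have "norm (of_real (sin (c * t)) * v j t) \<le> 1 * norm (v j t)" unfolding norm_mult by (intro mult_right_mono) auto
      then show ?thesis using K(2)[OF that] by simp
    qed
    then show ?thesis by blast
  qed
  have op: "open {z. - real k < Re z \<and> Re z < real k}"
    by (intro open_Collect_conj open_Collect_less continuous_intros)
  have hol: "M j holomorphic_on {z. - real k < Re z \<and> Re z < real k}" for j
  proof -
    obtain K where "\<And>t. 0 < t \<Longrightarrow> norm (of_real (sin (c * t)) * v j t) \<le> K * two_powr (real k) (- real k) t" using bd by blast
    from mellin_has_derivative[OF cont this]
    show ?thesis unfolding M_def[abs_def] holomorphic_on_open[OF op] by blast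
  qed
  have "J z c = - (z * M 0 z + of_nat k * M 1 z) / of_real c" if "z \<in> {z. - real k < Re z \<and> Re z < real k}" for z
  proof -
    have i: "(\<lambda>t. (of_real (sin (c * t)) * v j t) * of_real t powr (z - 1)) integrable_on {0<..}" for j
    proof -
      obtain K where "\<And>t. 0 < t \<Longrightarrow> norm (of_real (sin (c * t)) * v j t) \<le> K * two_powr (real k) (- real k) t" using bd by blast
      from mellin_integrable[OF cont this] that show ?thesis by (auto simp: absolutely_integrable_on_def)
    qed
    have "((\<lambda>t. z * ((of_real (sin (c * t)) * v 0 t) * of_real t powr (z - 1)) + of_nat k * ((of_real (sin (c * t)) * v 1 t) * of_real t powr (z - 1)))
       has_integral z * M 0 z + of_nat k * M 1 z) {0<..}"
      unfolding M_def by (intro has_integral_add has_integral_mult_right integrable_integral i)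
    then have "((\<lambda>t. of_real (sin (c * t)) * U' z t) has_integral z * M 0 z + of_nat k * M 1 z) {0<..}"
      by (rule has_integral_eq[rotated]) (simp add: U'_def algebra_simps)
    then show ?thesis by (simp add: J_def integral_unique)
  qed
  then have "(\<lambda>z. J z c) holomorphic_on {z. - real k < Re z \<and> Re z < real k} \<longleftrightarrow>
     (\<lambda>z. - (z * M 0 z + of_nat k * M 1 z) * (1 / of_real c)) holomorphic_on {z. - real k < Re z \<and> Re z < real k}"
    by (intro holomorphic_cong) auto
  then show ?thesis by (simp only:) (intro holomorphic_intros hol)
qed

end

section \<open>Muentz's formula\<close>

text \<open>One absolutely convergent double sum read in three ways: along the finite fibres of (d,
  m) -> d^k m, by rows and by columns. The first reading produces the divisor functions, the others
  the two iterated sums.\<close>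

lemma sum_power_regroup:
  fixes F :: "nat \<times> nat \<Rightarrow> complex"
  assumes k: "k \<ge> 1" and sm: "(\<lambda>x. norm (F x)) summable_on {1..} \<times> {1..}"
  shows "(\<lambda>n. \<Sum>x | fst x > 0 \<and> snd x > 0 \<and> fst x ^ k * snd x = Suc n. F x) sums infsum F ({1..} \<times> {1..})"
    and "(\<lambda>d. infsum (\<lambda>m. F (Suc d, m)) {1..}) sums infsum F ({1..} \<times> {1..})"
    and "(\<lambda>m. infsum (\<lambda>d. F (d, Suc m)) {1..}) sums infsum F ({1..} \<times> {1..})"
proof -
  have Suc_image: "Suc ` UNIV = {1..}" by (auto simp: image_iff Suc_le_eq gr0_conv_Suc)
  have to_sums: "(\<lambda>n. h (Suc n)) sums s" if "(h has_sum s) {1..}" for h :: "nat \<Rightarrow> complex" and s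
  proof -
    have "((h \<circ> Suc) has_sum s) UNIV"
      using that by (subst has_sum_reindex[symmetric]) (auto simp: Suc_image)
    then show ?thesis by (auto dest: has_sum_imp_sums simp: o_def)
  qed
  have sF: "F summable_on {1..} \<times> {1..}" using sm by (rule abs_summable_summable)
  then have hF: "(F has_sum infsum F ({1..} \<times> {1..})) ({1..} \<times> {1..})" by (rule has_sum_infsum)
  have sec: "(\<lambda>m. F (d, m)) summable_on {1..}" if "d \<in> {1..}" for d
    using summable_on_SigmaD1[of "\<lambda>d m. F (d, m)" "{1..}" "\<lambda>_. {1..}"] sF that by auto
  have "((\<lambda>d. infsum (\<lambda>m. F (d, m)) {1..}) has_sum infsum F ({1..} \<times> {1..})) {1..}"
    by (rule has_sum_SigmaD[OF hF]) (use sec in \<open>auto intro: has_sum_infsum\<close>)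
  from to_sums[OF this] show "(\<lambda>d. infsum (\<lambda>m. F (Suc d, m)) {1..}) sums infsum F ({1..} \<times> {1..})" .
  have hF': "((\<lambda>(m, d). F (d, m)) has_sum infsum F ({1..} \<times> {1..})) ({1..} \<times> {1..})"
    using hF has_sum_swap by blast
  then have sF': "(\<lambda>(m, d). F (d, m)) summable_on {1..} \<times> {1..}" by (rule has_sum_imp_summable)
  have sec': "(\<lambda>d. F (d, m)) summable_on {1..}" if "m \<in> {1..}" for m
    using summable_on_SigmaD1[of "\<lambda>m d. F (d, m)" "{1..}" "\<lambda>_. {1..}"] sF' that by auto
  have "((\<lambda>m. infsum (\<lambda>d. F (d, m)) {1..}) has_sum infsum F ({1..} \<times> {1..})) {1..}"
    by (rule has_sum_SigmaD[OF hF']) (use sec' in \<open>auto intro: has_sum_infsum\<close>)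
  from to_sums[OF this] show "(\<lambda>m. infsum (\<lambda>d. F (d, Suc m)) {1..}) sums infsum F ({1..} \<times> {1..})" .
  define A where "A n = {x :: nat \<times> nat. fst x > 0 \<and> snd x > 0 \<and> fst x ^ k * snd x = n}" for n
  have finA: "finite (A n)" for n
  proof (rule finite_subset)
    show "A n \<subseteq> {..n} \<times> {..n}"
    proof
      fix x assume x: "x \<in> A n"
      then have "fst x \<le> fst x ^ k" using k by (intro self_le_power) (auto simp: A_def)
      also have "\<dots> \<le> n" using x by (auto simp: A_def)
      finally have "fst x \<le> n" .
      moreover have "snd x \<le> n" using x by (auto simp: A_def)
      ultimately show "x \<in> {..n} \<times> {..n}" by (cases x) auto
    qed
  qed auto
  \<comment> \<open>The fibres partition the pairs of positive integers; the fibre index is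
    recovered from the pair.\<close>
  have bij: "bij_betw snd (Sigma {1..} A) ({1..} \<times> {1..})"
  proof (rule bij_betwI')
    fix x y assume "x \<in> Sigma {1..} A" "y \<in> Sigma {1..} A"
    then show "(snd x = snd y) = (x = y)" by (auto simp: A_def)
  next
    fix x assume "x \<in> Sigma {1..} A"
    then show "snd x \<in> {1..} \<times> {1..}" by (auto simp: A_def)
  next
    fix y :: "nat \<times> nat" assume "y \<in> {1..} \<times> {1..}"
    then show "\<exists>x\<in>Sigma {1..} A. y = snd x"
      by (intro bexI[of _ "(fst y ^ k * snd y, y)"]) (auto simp: A_def Suc_le_eq)
  qed
  have "((\<lambda>x. F (snd x)) has_sum infsum F ({1..} \<times> {1..})) (Sigma {1..} A)"
    using has_sum_reindex_bij_betw[OF bij, of F] hF by blast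
  then have "((\<lambda>n. \<Sum>x\<in>A n. F x) has_sum infsum F ({1..} \<times> {1..})) {1..}"
    by (rule has_sum_SigmaD) (auto intro!: has_sum_finite finA)
  from to_sums[OF this] show "(\<lambda>n. \<Sum>x | fst x > 0 \<and> snd x > 0 \<and> fst x ^ k * snd x = Suc n. F x) sums infsum F ({1..} \<times> {1..})"
    by (simp add: A_def)
qed

lemma summable_on_powr_product:
  assumes "a < -1" "b < -1"
  shows "(\<lambda>x. real (fst x) powr a * real (snd x) powr b) summable_on {1..} \<times> {1..}"
proof -
  have s: "(\<lambda>n. real n powr c) summable_on {1..}" if "c < -1" for c
  proof -
    have "(\<lambda>n. real n powr c) summable_on UNIV"
      using that by (intro norm_summable_imp_summable_on) (simp add: summable_real_powr_iff)
    then show ?thesis by (rule summable_on_subset_banach) auto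
  qed
  show ?thesis
  proof (rule summable_on_SigmaI)
    show "((\<lambda>y. real (fst (x, y)) powr a * real (snd (x, y)) powr b) has_sum (real x powr a * infsum (\<lambda>n. real n powr b) {1..})) {1..}" for x
      using has_sum_cmult_right[OF has_sum_infsum[OF s[OF assms(2)]], of "real x powr a"] by simp
    show "(\<lambda>x. real x powr a * infsum (\<lambda>n. real n powr b) {1..}) summable_on {1..}"
      by (intro summable_on_cmult_left s assms)
  qed auto
qed

context schwartz_function
begin

lemma f_rapid: "rapid f"
  using schwartz_rapid[OF schwartz, of 0] by simp

lemma powr_mult_real: "0 < x \<Longrightarrow> 0 < y \<Longrightarrow> complex_of_real (x * y) powr z = of_real x powr z * of_real y powr z"
  by (simp add: powr_times_real)

lemma powr_powr_real: "0 < x \<Longrightarrow> complex_of_real (x powr a) powr z = of_real x powr (of_real a * z)"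
  by (simp add: powr_def Ln_of_real mult_ac)

text \<open>The main term coming from the double pole of the zeta factors is Muentz's formula
  \<open>\<integral> x\<^sup>s\<^sup>-\<^sup>1 (\<Sum>f(mx) - (\<integral>f)/x) dx = \<zeta>(s) F(s)\<close>, in the variable \<open>x = t\<^sup>k\<close>.\<close>

definition Phi :: "real \<Rightarrow> complex" where "Phi x = integral {0..x} f"

lemma Phi_deriv: "0 < x \<Longrightarrow> (Phi has_vector_derivative f x) (at x)"
proof -
  assume x: "0 < x"
  have "((\<lambda>u. integral {0..u} f) has_vector_derivative f x) (at x within {0..x+1})"
    using x by (intro integral_has_vector_derivative rapid_continuous f_rapid) auto
  then show ?thesis using x unfolding Phi_def[abs_def] by (subst (asm) at_within_Icc_at) auto
qed

lemma Phi_continuous: "continuous_on {0<..} Phi"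
  by (intro continuous_at_imp_continuous_on ballI has_vector_derivative_continuous[OF Phi_deriv]) simp

lemma Phi_bound:
  obtains C where "C \<ge> 0" "\<And>x. 0 < x \<Longrightarrow> norm (Phi x) \<le> C * two_powr 1 0 x" "\<And>x. 0 < x \<Longrightarrow> norm (Phi x) \<le> C"
proof -
  obtain A where A: "A \<ge> 0" "\<And>y. norm (f y) \<le> A" using rapid_bound[OF f_rapid] by metis
  define B where "B = integral {0<..} (\<lambda>y. norm (f y))"
  have ai: "f absolutely_integrable_on {0<..}" by (rule rapid_integrable[OF f_rapid])
  have 1: "norm (Phi x) \<le> A * x" if "0 < x" for x
    unfolding Phi_def using integral_bound[of 0 x f A] that A rapid_continuous[OF f_rapid] by simp
  have 2: "norm (Phi x) \<le> B" if x: "0 < x" for x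
  proof -
    have a: "f absolutely_integrable_on {0<..x}" by (rule absolutely_integrable_on_subset_Ioi[OF ai]) auto
    have "Phi x = integral {0<..x} f"
      unfolding Phi_def by (rule integral_spike_set) (auto intro: negligible_subset[of "{0}"])
    also have "norm \<dots> \<le> integral {0<..x} (\<lambda>y. norm (f y))" by (rule integral_norm_le[OF a])
    also have "\<dots> \<le> B" unfolding B_def using a ai by (intro integral_subset_le) (auto simp: absolutely_integrable_on_def)
    finally show ?thesis .
  qed
  have "B \<ge> 0" using order_trans[OF norm_ge_zero 2[of 1]] by simp
  show ?thesis
  proof (rule that[of "max A B"])
    fix x :: real assume x: "0 < x"
    show "norm (Phi x) \<le> max A B * two_powr 1 0 x"
    proof (cases "x \<le> 1")
      case True
      have "norm (Phi x) \<le> max A B * x" using 1[OF x] x by (meson max.cobounded1 mult_right_mono order_trans less_imp_le)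
      then show ?thesis using True x by (simp add: two_powr_def)
    next
      case False
      then show ?thesis using 2[OF x] x by (simp add: two_powr_def)
    qed
    show "norm (Phi x) \<le> max A B" using 2[OF x] by simp
  qed (use A in auto)
qed

lemma mellin_f_integrable:
  assumes "0 < Re s" shows "(\<lambda>x. f x * of_real x powr (s - 1)) absolutely_integrable_on {0<..}"
proof -
  have "(\<lambda>x. of_real x powr (s - 1) * f x) absolutely_integrable_on {0<..}"
    by (rule rapid_integrable_powr[OF f_rapid, where a = "Re s - 1" and K = 1])
      (use assms in \<open>auto intro!: continuous_intros simp: norm_powr_real complex_nonpos_Reals_iff\<close>)
  then show ?thesis by (simp add: mult.commute)
qed

lemma mellin_f_has_integral:
  assumes "0 < Re s" shows "((\<lambda>x. f x * of_real x powr (s - 1)) has_integral mellin f s) {0<..}"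
  unfolding mellin_def using mellin_f_integrable[OF assms] by (auto simp: absolutely_integrable_on_def integrable_integral)

text \<open>Integration by parts against x^(s-1); since \<open>Phi\<close> is O(x) at 0 and bounded
  at infinity, the boundary terms vanish exactly in 0 < Re s < 1. The factor 1/(1-s) will match the
  subtracted power in the partial sums of zeta.\<close>

lemma mellin_Phi:
  assumes s: "0 < Re s" "Re s < 1"
  shows "((\<lambda>x. of_real x powr (s - 2) * Phi x) has_integral mellin f s / (1 - s)) {0<..}"
proof -
  have s1: "s \<noteq> 1" using s by auto
  obtain C where C: "C \<ge> 0" "\<And>x. 0 < x \<Longrightarrow> norm (Phi x) \<le> C * two_powr 1 0 x" "\<And>x. 0 < x \<Longrightarrow> norm (Phi x) \<le> C"
    using Phi_bound by blast
  have "((\<lambda>x. of_real x powr (s - 1) * f x + (s - 1) * of_real x powr (s - 1 - 1) * Phi x) has_integral 0 - 0) {0<..}"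
  proof (rule has_integral_FTC_Ioi)
    fix t :: real assume t: "0 < t"
    from has_vector_derivative_mult[OF has_vector_derivative_powr_real[OF t] Phi_deriv[OF t]]
    show "((\<lambda>x. of_real x powr (s - 1) * Phi x) has_vector_derivative
       of_real t powr (s - 1) * f t + (s - 1) * of_real t powr (s - 1 - 1) * Phi t) (at t)" .
  next
    show "continuous_on {0<..} (\<lambda>x. of_real x powr (s - 1) * f x + (s - 1) * of_real x powr (s - 1 - 1) * Phi x)"
      by (intro continuous_on_add continuous_on_mult continuous_on_const continuous_on_powr_real rapid_continuous f_rapid Phi_continuous)
    show "((\<lambda>x. of_real x powr (s - 1) * Phi x) \<longlongrightarrow> 0) (at_right 0)"
    proof (rule Lim_null_comparison)
      have "norm (of_real x powr (s - 1) * Phi x) \<le> C * x powr Re s" if "0 < x" "x < 1" for x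
      proof -
        have "norm (of_real x powr (s - 1) * Phi x) \<le> x powr (Re s - 1) * (C * x powr 1)"
          unfolding norm_mult norm_powr_real[OF that(1)] using C(2)[OF that(1)] that
          by (intro mult_mono) (auto simp: two_powr_def)
        also have "\<dots> = C * (x powr (Re s - 1) * x powr 1)" by (simp only: mult_ac)
        also have "\<dots> = C * x powr Re s" unfolding powr_add[symmetric] by simp
        finally show ?thesis .
      qed
      then show "\<forall>\<^sub>F x in at_right 0. norm (of_real x powr (s - 1) * Phi x) \<le> C * x powr Re s"
        unfolding eventually_at by (intro exI[of _ 1]) (auto simp: dist_norm)
      have "((\<lambda>x::real. x powr Re s) \<longlongrightarrow> 0 powr Re s) (at_right 0)"
        using s by (intro tendsto_intros) (auto simp: eventually_at intro!: exI[of _ 1])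
      then show "((\<lambda>x. C * x powr Re s) \<longlongrightarrow> 0) (at_right 0)" by (auto intro: tendsto_mult_right_zero)
    qed
    show "((\<lambda>x. of_real x powr (s - 1) * Phi x) \<longlongrightarrow> 0) at_top"
    proof (rule Lim_null_comparison)
      show "\<forall>\<^sub>F x in at_top. norm (of_real x powr (s - 1) * Phi x) \<le> x powr (Re s - 1) * C"
        using eventually_gt_at_top[of 0]
      proof eventually_elim
        case (elim x)
        then show ?case unfolding norm_mult norm_powr_real[OF elim] using C(3)[OF elim]
          by (intro mult_mono) auto
      qed
      have "((\<lambda>x::real. x powr (Re s - 1)) \<longlongrightarrow> 0) at_top" using s by (intro tendsto_neg_powr filterlim_ident) auto
      from tendsto_mult_left_zero[OF this] show "((\<lambda>x. x powr (Re s - 1) * C) \<longlongrightarrow> 0) at_top" .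
    qed
  qed
  from has_integral_diff[OF this mellin_f_has_integral[OF s(1)]]
  have "((\<lambda>x. (s - 1) * (of_real x powr (s - 2) * Phi x)) has_integral - mellin f s) {0<..}"
    by (simp add: mult_ac)
  from has_integral_mult_right[OF this, of "1 / (s - 1)"]
  have "((\<lambda>x. of_real x powr (s - 2) * Phi x) has_integral (1 / (s - 1)) * (- mellin f s)) {0<..}"
    using s1 by (simp flip: mult.assoc)
  moreover have "(1 / (s - 1)) * (- mellin f s) = mellin f s / (1 - s)"
    using s1 by (simp add: field_simps)
  ultimately show ?thesis by simp
qed

lemma power_substitution:
  fixes g :: "real \<Rightarrow> complex"
  assumes "(g has_integral I) {0<..}" "continuous_on {0<..} g" "0 < M"
  shows "((\<lambda>t. of_real (real k * M * t powr (real k - 1)) * g (M * t powr real k)) has_integral I) {0<..}"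
proof -
  have "((\<lambda>t. (real k * M * t powr (real k - 1)) *\<^sub>R g (M * t powr real k)) has_integral I) {0<..}"
  proof (rule has_integral_substitution_Ioi[OF assms(1,2)])
    show "((\<lambda>t. M * t powr real k) has_real_derivative real k * M * t powr (real k - 1)) (at t)" if "0 < t" for t
      using that by (auto intro!: derivative_eq_intros)
    show "continuous_on {0<..} (\<lambda>t. real k * M * t powr (real k - 1))" by (intro continuous_intros) auto
    have "((\<lambda>t. M * t powr real k) \<longlongrightarrow> M * 0 powr real k) (at_right 0)"
      using k by (intro tendsto_intros) (auto simp: eventually_at intro!: exI[of _ 1])
    then show "filterlim (\<lambda>t. M * t powr real k) (at_right 0) (at_right 0)"
      using assms(3) by (auto simp: filterlim_at eventually_at intro!: exI[of _ 1])
    have "filterlim (\<lambda>t. t powr real k) at_top at_top" using k by real_asymp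
    then show "filterlim (\<lambda>t. M * t powr real k) at_top at_top"
      by (rule filterlim_tendsto_pos_mult_at_top[OF tendsto_const assms(3)])
  qed (use assms in auto)
  then show ?thesis by (simp add: scaleR_conv_of_real)
qed

text \<open>A dilated copy of \<open>f\<close> contributes M^(-s), the dilated primitive
  M^(1-s)/(1-s), with a common factor. Their combination is precisely a regularised partial sum of
  zeta(s).\<close>

lemma muentz_terms:
  assumes z: "-1 < Re z" "Re z < real k - 1" and M: "0 < M"
  defines "s \<equiv> (1 + z) / of_nat k"
  shows "((\<lambda>t. of_real t powr z * f (M * t powr real k)) has_integral of_real M powr (- s) * mellin f s / of_nat k) {0<..}"
    and "((\<lambda>t. of_real t powr (z - of_nat k) * Phi (M * t powr real k)) has_integral
       of_real M powr (1 - s) / (1 - s) * mellin f s / of_nat k) {0<..}"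
proof -
  have k0: "real k > 0" using k by simp
  have s: "0 < Re s" "Re s < 1" using z k0 by (auto simp: s_def Re_divide_of_nat field_simps)
  have ks: "of_nat k * s = 1 + z" using k by (simp add: s_def)
  \<comment> \<open>Powers after the substitution x = M t^k; a = 1 serves \<open>f\<close> and a = 2
    serves \<open>Phi\<close>.\<close>
  have pw: "of_real (real k * M * t powr (real k - 1)) * of_real (M * t powr real k) powr (s - a) =
     of_nat k * of_real M powr (s - a + 1) * of_real t powr (of_nat k - 1 + of_nat k * (s - a))" if t: "0 < t" for t a
  proof -
    have "of_real (M * t powr real k) powr (s - a) = of_real M powr (s - a) * complex_of_real t powr (of_nat k * (s - a))"
      using M t by (simp add: powr_mult_real powr_powr_real del: of_real_mult)
    moreover have "complex_of_real (t powr (real k - 1)) = of_real t powr (of_nat k - 1)"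
      using powr_powr_real[OF t, of "real k - 1" 1] t by simp
    ultimately show ?thesis using M t by (simp add: powr_add)
  qed
  have "((\<lambda>t. of_real (real k * M * t powr (real k - 1)) * (f (M * t powr real k) * of_real (M * t powr real k) powr (s - 1))) has_integral mellin f s) {0<..}"
    by (intro power_substitution[OF mellin_f_has_integral] s M continuous_intros rapid_continuous f_rapid)
      (auto simp: complex_nonpos_Reals_iff)
  then have "((\<lambda>t. (of_nat k * of_real M powr s) * (of_real t powr z * f (M * t powr real k))) has_integral mellin f s) {0<..}"
  proof (rule has_integral_eq[rotated])
    fix t :: real assume "t \<in> {0<..}"
    then have t: "0 < t" by simp
    have "of_real (real k * M * t powr (real k - 1)) * (f (M * t powr real k) * of_real (M * t powr real k) powr (s - 1)) =
       (of_real (real k * M * t powr (real k - 1)) * of_real (M * t powr real k) powr (s - 1)) * f (M * t powr real k)"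
      by (simp only: mult_ac)
    also have "of_nat k - 1 + of_nat k * (s - 1) = z" using ks by (simp add: algebra_simps)
    then have "of_real (real k * M * t powr (real k - 1)) * of_real (M * t powr real k) powr (s - 1) = of_nat k * of_real M powr s * of_real t powr z"
      unfolding pw[OF t] by simp
    finally show "of_real (real k * M * t powr (real k - 1)) * (f (M * t powr real k) * of_real (M * t powr real k) powr (s - 1)) =
       (of_nat k * of_real M powr s) * (of_real t powr z * f (M * t powr real k))" by (simp only: mult_ac)
  qed
  from has_integral_mult_right[OF this, of "1 / (of_nat k * of_real M powr s)"]
  show "((\<lambda>t. of_real t powr z * f (M * t powr real k)) has_integral of_real M powr (- s) * mellin f s / of_nat k) {0<..}"
    using M k by (simp add: powr_minus_divide mult_ac)
  have "((\<lambda>t. of_real (real k * M * t powr (real k - 1)) * (of_real (M * t powr real k) powr (s - 2) * Phi (M * t powr real k))) has_integral mellin f s / (1 - s)) {0<..}"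
    by (intro power_substitution[OF mellin_Phi] s M continuous_intros Phi_continuous)
      (auto simp: complex_nonpos_Reals_iff)
  then have "((\<lambda>t. (of_nat k * of_real M powr (s - 1)) * (of_real t powr (z - of_nat k) * Phi (M * t powr real k))) has_integral mellin f s / (1 - s)) {0<..}"
  proof (rule has_integral_eq[rotated])
    fix t :: real assume "t \<in> {0<..}"
    then have t: "0 < t" by simp
    have s21: "s - 2 + 1 = s - 1" by simp
    have "of_nat k - 1 + of_nat k * (s - 2) = z - of_nat k" using ks by (simp add: algebra_simps)
    then have "of_real (real k * M * t powr (real k - 1)) * of_real (M * t powr real k) powr (s - 2) = of_nat k * of_real M powr (s - 1) * of_real t powr (z - of_nat k)"
      unfolding pw[OF t] by (simp only: s21)
    then show "of_real (real k * M * t powr (real k - 1)) * (of_real (M * t powr real k) powr (s - 2) * Phi (M * t powr real k)) =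
       (of_nat k * of_real M powr (s - 1)) * (of_real t powr (z - of_nat k) * Phi (M * t powr real k))"
      by (simp only: mult.assoc[symmetric])
  qed
  from has_integral_mult_right[OF this, of "1 / (of_nat k * of_real M powr (s - 1))"]
  show "((\<lambda>t. of_real t powr (z - of_nat k) * Phi (M * t powr real k)) has_integral
       of_real M powr (1 - s) / (1 - s) * mellin f s / of_nat k) {0<..}"
    using M k powr_minus_divide[of "complex_of_real M" "s - 1"] by (simp add: mult_ac)
qed

end

lemma rapid_bound_ex:
  assumes "rapid g"
  shows "\<exists>C\<ge>0. (\<forall>y. norm (g y) \<le> C) \<and> (\<forall>y>0. norm (g y) \<le> C * two_powr 0 (- real m) y)"
  by (rule rapid_bound[OF assms, of m]) blast

context schwartz_function
begin

section \<open>Muentz's formula in the variable t\<close>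

definition S :: "real \<Rightarrow> complex" where
  "S t = (\<Sum>d. f (t powr real k * real (Suc d)))"

abbreviation If :: complex where "If \<equiv> integral {0<..} f"

text \<open>The second term is the integral of f(t^k x) over 0 <= x <= M, so this is the M-th sum
  minus its integral. For finite M it can be integrated against t^z term by term, which the infinite
  sum does not allow in 0 < Re s < 1.\<close>

definition E :: "nat \<Rightarrow> real \<Rightarrow> complex" where
  "E M t = (\<Sum>m<M. f (t powr real k * real (Suc m))) - of_real (t powr (- real k)) * Phi (real M * t powr real k)"

text \<open>Half-line Poisson summation bounds the difference by the L1 norm of the derivative,
  which is invariant under the dilation by t^k; hence uniformity in both M and t.\<close>

lemma E_bound_0:
  obtains C where "\<And>M t. 0 < t \<Longrightarrow> norm (E M t) \<le> C"
proof -
  obtain A where A: "A \<ge> 0" "\<And>y. norm (f y) \<le> A" "\<And>y. 0 < y \<Longrightarrow> norm (f y) \<le> A * two_powr 0 (- real 0) y"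
    using rapid_bound_ex[OF f_rapid, of 0] by blast
  have "norm (E M t) \<le> integral {0<..} (\<lambda>t. norm (nth_vderiv 1 f t)) + A" if t: "0 < t" for M t
  proof -
    define X where "X = t powr real k"
    have X: "X > 0" using t by (simp add: X_def)
    interpret half_line_function "\<lambda>t. f (X * t)" "\<lambda>t. X *\<^sub>R nth_vderiv 1 f (X * t)"
      by (rule schwartz_scaled(1)[OF schwartz X])
    have "(f has_integral Phi (real M * X)) {0..real M * X}"
      unfolding Phi_def by (intro integrable_integral integrable_continuous_interval rapid_continuous f_rapid)
    from has_integral_stretch_real[OF this, of X] X
    have "((\<lambda>x. f (X * x)) has_integral (1 / X) *\<^sub>R Phi (real M * X)) {0..real M}" by simp
    then have "E M t = (\<Sum>d<M. f (X * real (Suc d))) - integral {0..real M} (\<lambda>t. f (X * t))"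
      using t by (simp add: integral_unique E_def X_def powr_minus_divide scaleR_conv_of_real)
    then have "E M t = ((\<Sum>d<M. f (X * real (Suc d))) - integral {0..real M} (\<lambda>t. f (X * t)) - (f (X * real M) - f (X * 0)) / 2)
         + (f (X * real M) - f (X * 0)) / 2" by simp
    also have "norm \<dots> \<le> integral {0<..} (\<lambda>t. norm (X *\<^sub>R nth_vderiv 1 f (X * t))) + norm ((f (X * real M) - f (X * 0)) / 2)"
      by (intro order_trans[OF norm_triangle_ineq] add_mono poisson_bound order_refl)
    also have "norm ((f (X * real M) - f (X * 0)) / 2) \<le> A"
      using norm_triangle_ineq4[of "f (X * real M)" "f (X * 0)"] A(2)[of "X * real M"] A(2)[of "X * 0"]
      by (simp add: norm_divide)
    finally show ?thesis unfolding schwartz_scaled(2)[OF schwartz X] by simp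
  qed
  then show ?thesis using that by blast
qed

lemma Phi_bounded: "\<exists>C\<ge>0. \<forall>x>0. norm (Phi x) \<le> C"
  by (rule Phi_bound) blast

text \<open>For t >= 1 no cancellation between sum and integral is needed: the decay of
  \<open>f\<close> makes the sum O(t^(-k)), and the other term carries this factor
  explicitly.\<close>

lemma E_bound_1:
  obtains C where "\<And>M t. 1 \<le> t \<Longrightarrow> norm (E M t) \<le> C * t powr (- real k)"
proof -
  obtain C2 where C2: "C2 \<ge> 0" "\<And>y. norm (f y) \<le> C2" "\<And>y. 0 < y \<Longrightarrow> norm (f y) \<le> C2 * two_powr 0 (- real 2) y"
    using rapid_bound_ex[OF f_rapid, of 2] by blast
  obtain C3 where C3: "C3 \<ge> 0" "\<And>x. 0 < x \<Longrightarrow> norm (Phi x) \<le> C3"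
    using Phi_bounded by blast
  have "norm (E M t) \<le> (C2 * (pi ^ 2 / 6) + C3) * t powr (- real k)" if t: "1 \<le> t" for M t
  proof -
    define X where "X = t powr real k"
    have X: "X \<ge> 1" using t by (simp add: X_def ge_one_powr_ge_zero)
    have ft: "norm (f (X * real (Suc m))) \<le> (C2 / X) * (1 / real (Suc m) ^ 2)" for m
    proof -
      have y: "X * real (Suc m) \<ge> 1" using X mult_mono[of 1 X 1 "real (Suc m)"] by simp
      have "norm (f (X * real (Suc m))) \<le> C2 * two_powr 0 (- real 2) (X * real (Suc m))"
        using y by (intro C2) auto
      also have "two_powr 0 (- real 2) (X * real (Suc m)) = 1 / (X * real (Suc m)) ^ 2"
      proof -
        have "(X * real (Suc m)) powr (- real 2) = 1 / (X * real (Suc m)) ^ 2"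
          using y unfolding powr_minus_divide by (subst powr_realpow) auto
        then show ?thesis using y by (cases "X * real (Suc m) = 1") (auto simp: two_powr_def simp del: of_nat_Suc)
      qed
      also have "\<dots> \<le> (1 / X) * (1 / real (Suc m) ^ 2)"
      proof -
        have "X * 1 \<le> X * X" using X by (intro mult_left_mono) auto
        then have "X * real (Suc m) ^ 2 \<le> (X * real (Suc m)) ^ 2"
          by (simp add: power_mult_distrib power2_eq_square[of X] mult_right_mono del: of_nat_Suc)
        then show ?thesis using X by (simp add: frac_le del: of_nat_Suc)
      qed
      finally show ?thesis using C2(1) by (simp add: mult_left_mono del: of_nat_Suc)
    qed
    have "norm (\<Sum>m<M. f (X * real (Suc m))) \<le> (\<Sum>m<M. (C2 / X) * (1 / real (Suc m) ^ 2))"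
      by (intro sum_norm_le ft)
    also have "\<dots> = (C2 / X) * (\<Sum>m<M. 1 / real (Suc m) ^ 2)" by (simp add: sum_distrib_left)
    also have "\<dots> \<le> (C2 / X) * (pi ^ 2 / 6)"
    proof (rule mult_left_mono)
      show "(\<Sum>m<M. 1 / real (Suc m) ^ 2) \<le> pi ^ 2 / 6"
        using sum_le_suminf[OF sums_summable[OF inverse_squares_sums], of "{..<M}"] sums_unique[OF inverse_squares_sums]
        by (simp add: add.commute)
    qed (use C2(1) X in simp)
    finally have s: "norm (\<Sum>m<M. f (X * real (Suc m))) \<le> (C2 / X) * (pi ^ 2 / 6)" .
    have "norm (Phi (real M * X)) \<le> C3"
      using C3 X by (cases "M = 0") (auto simp: Phi_def)
    then have p: "norm (of_real (1 / X) * Phi (real M * X)) \<le> (1 / X) * C3"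
      unfolding norm_mult norm_of_real using X by (intro mult_mono) auto
    have "E M t = (\<Sum>m<M. f (X * real (Suc m))) - of_real (1 / X) * Phi (real M * X)"
      by (simp add: E_def X_def powr_minus_divide)
    also have "norm \<dots> \<le> (C2 / X) * (pi ^ 2 / 6) + (1 / X) * C3"
      by (intro order_trans[OF norm_triangle_ineq4] add_mono s p)
    also have "\<dots> = (C2 * (pi ^ 2 / 6) + C3) * (1 / X)" by (simp add: add_divide_distrib)
    finally show ?thesis by (simp add: X_def powr_minus_divide)
  qed
  then show ?thesis using that by blast
qed

lemma E_bound:
  obtains C where "C \<ge> 0" "\<And>M t. 0 < t \<Longrightarrow> norm (E M t) \<le> C * two_powr 0 (- real k) t"
proof -
  obtain C0 where C0: "\<And>M t. 0 < t \<Longrightarrow> norm (E M t) \<le> C0" using E_bound_0 by blast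
  obtain C1 where C1: "\<And>M t. 1 \<le> t \<Longrightarrow> norm (E M t) \<le> C1 * t powr (- real k)" using E_bound_1 by blast
  have "norm (E M t) \<le> max C0 C1 * two_powr 0 (- real k) t" if "0 < t" for M t
  proof (cases "t \<le> 1")
    case True
    then show ?thesis using C0[OF that, of M] that by (simp add: two_powr_def)
  next
    case False
    then have "norm (E M t) \<le> C1 * t powr (- real k)" by (intro C1) simp
    also have "\<dots> \<le> max C0 C1 * t powr (- real k)" by (intro mult_right_mono) auto
    finally show ?thesis using False by (simp add: two_powr_def)
  qed
  moreover have "max C0 C1 \<ge> 0" using order_trans[OF norm_ge_zero C0[of 1]] by simp
  ultimately show ?thesis using that by blast
qed

lemma S_sums: "0 < t \<Longrightarrow> (\<lambda>d. f (t powr real k * real (Suc d))) sums S t"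
  unfolding S_def by (intro summable_sums rapid_summable f_rapid) simp

lemma E_tendsto:
  assumes "0 < t"
  shows "(\<lambda>M. E M t) \<longlonglongrightarrow> S t - of_real (t powr (- real k)) * If"
  unfolding E_def
proof (intro tendsto_intros)
  show "(\<lambda>M. \<Sum>m<M. f (t powr real k * real (Suc m))) \<longlonglongrightarrow> S t"
    using S_sums[OF assms] by (simp add: sums_def)
  have "f integrable_on {0<..}" using rapid_integrable[OF f_rapid] by (simp add: absolutely_integrable_on_def)
  then have "f integrable_on {0..}" by (rule integrable_spike_set) (auto intro: negligible_subset[of "{0}"])
  from integral_tendsto_at_top_Ici[OF this] have "(Phi \<longlongrightarrow> integral {0..} f) at_top" by (simp add: Phi_def[abs_def])
  moreover have "integral {0..} f = If" by (rule integral_spike_set) (auto intro: negligible_subset[of "{0}"])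
  moreover have "filterlim (\<lambda>M. real M * t powr real k) at_top sequentially"
    using assms by (intro filterlim_at_top_mult_tendsto_pos[OF tendsto_const _ filterlim_real_sequentially]) simp
  ultimately show "(\<lambda>M. Phi (real M * t powr real k)) \<longlonglongrightarrow> If"
    using filterlim_compose by fastforce
qed

text \<open>Dominated convergence in M. The majorant t^(Re z) times
  \<open>two_powr 0 (- real k) t\<close> is integrable exactly for -1 < Re z < k - 1, and the
  integrals converge by \<open>riemann_zeta_partial_sums\<close>.\<close>

lemma muentz:
  assumes z: "-1 < Re z" "Re z < real k - 1"
  defines "s \<equiv> (1 + z) / of_nat k"
  shows "((\<lambda>t. of_real t powr z * (S t - of_real (t powr (- real k)) * If)) has_integral mellin f s / of_nat k * riemann_zeta s) {0<..}"
proof -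
  have k0: "real k > 0" using k by simp
  have s: "0 < Re s" "Re s < 1" using z k0 by (auto simp: s_def Re_divide_of_nat field_simps)
  have s1: "s \<noteq> 1" using s by auto
  obtain C where C: "C \<ge> 0" "\<And>M t. 0 < t \<Longrightarrow> norm (E M t) \<le> C * two_powr 0 (- real k) t" using E_bound by blast
  define y where "y M = mellin f s / of_nat k * ((\<Sum>n<M. of_nat (Suc n) powr (- s)) - of_nat M powr (1 - s) / (1 - s))" for M
  show ?thesis
  proof (rule has_integral_dominated_convergence)
    \<comment> \<open>The index starts at 1 because \<open>muentz_terms\<close> needs a positive
      dilation factor.\<close>
    show "((\<lambda>t. of_real t powr z * E (Suc M) t) has_integral y (Suc M)) {0<..}" for M
    proof -
      have "((\<lambda>t. (\<Sum>m<Suc M. of_real t powr z * f (real (Suc m) * t powr real k)) - of_real t powr (z - of_nat k) * Phi (real (Suc M) * t powr real k)) has_integral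
        (\<Sum>m<Suc M. of_real (real (Suc m)) powr (- s) * mellin f s / of_nat k) - of_real (real (Suc M)) powr (1 - s) / (1 - s) * mellin f s / of_nat k) {0<..}"
        unfolding s_def by (intro has_integral_diff has_integral_sum muentz_terms z) auto
      moreover have "(\<Sum>m<Suc M. of_real (real (Suc m)) powr (- s) * mellin f s / of_nat k) - of_real (real (Suc M)) powr (1 - s) / (1 - s) * mellin f s / of_nat k = y (Suc M)"
        unfolding y_def of_real_of_nat_eq
        by (simp add: sum_distrib_left sum_divide_distrib algebra_simps diff_divide_distrib add_divide_distrib del: of_nat_Suc)
      ultimately have "((\<lambda>t. (\<Sum>m<Suc M. of_real t powr z * f (real (Suc m) * t powr real k)) - of_real t powr (z - of_nat k) * Phi (real (Suc M) * t powr real k)) has_integral y (Suc M)) {0<..}"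
        by (simp only:)
      then show ?thesis
      proof (rule has_integral_eq[rotated])
        fix t :: real assume "t \<in> {0<..}"
        then have t: "0 < t" by simp
        have "of_real t powr (z - of_nat k) = of_real t powr z * complex_of_real (t powr (- real k))"
          using powr_powr_real[OF t, of "- real k" 1] t powr_add[of "complex_of_real t" z "- of_nat k"] by simp
        then show "(\<Sum>m<Suc M. of_real t powr z * f (real (Suc m) * t powr real k)) - of_real t powr (z - of_nat k) * Phi (real (Suc M) * t powr real k)
           = of_real t powr z * E (Suc M) t"
          by (simp add: E_def right_diff_distrib sum_distrib_left mult_ac del: of_nat_Suc sum.lessThan_Suc)
      qed
    qed
    show "(\<lambda>t. C * two_powr (0 + Re z) (- real k + Re z) t) integrable_on {0<..}"
      using z by (intro integrable_on_mult_right two_powr_integrable) auto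
    show "\<forall>t\<in>{0<..}. norm (of_real t powr z * E (Suc M) t) \<le> C * two_powr (0 + Re z) (- real k + Re z) t" for M
    proof
      fix t :: real assume "t \<in> {0<..}"
      then have t: "0 < t" by simp
      have "norm (of_real t powr z * E (Suc M) t) \<le> t powr Re z * (C * two_powr 0 (- real k) t)"
        unfolding norm_mult norm_powr_real[OF t] by (intro mult_left_mono C t) auto
      also have "\<dots> = C * (t powr Re z * two_powr 0 (- real k) t)" by (simp only: mult_ac)
      finally show "norm (of_real t powr z * E (Suc M) t) \<le> C * two_powr (0 + Re z) (- real k + Re z) t"
        unfolding two_powr_mult_powr .
    qed
    show "\<forall>t\<in>{0<..}. (\<lambda>M. of_real t powr z * E (Suc M) t) \<longlonglongrightarrow> of_real t powr z * (S t - of_real (t powr (- real k)) * If)"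
      by (intro ballI tendsto_intros LIMSEQ_Suc E_tendsto) auto
    show "(\<lambda>M. y (Suc M)) \<longlonglongrightarrow> mellin f s / of_nat k * riemann_zeta s"
      unfolding y_def by (intro tendsto_mult_left riemann_zeta_partial_sums s s1)
  qed
qed

section \<open>The second Poisson summation: the functions B z m\<close>

definition W :: "complex \<Rightarrow> real \<Rightarrow> complex" where "W z t = of_real t powr z * v 0 t"

lemma W_0 [simp]: "W z 0 = 0" by (simp add: W_def)

text \<open>The default \<open>0 powr z = 0\<close> happens to be the continuous extension, so the
  Poisson formula for this function has no boundary term at 0.\<close>

lemma W_continuous:
  assumes "- real k < Re z" shows "continuous_on {0..} (W z)"
proof -
  have "continuous (at t within {0..}) (W z)" if "t \<ge> 0" for t
  proof (cases "t = 0")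
    case True
    have "(W z \<longlongrightarrow> W z 0) (at_right 0)"
      unfolding W_0 unfolding W_def[abs_def] by (rule powr_v_tendsto_0_at_right[OF assms])
    then show ?thesis using True by (simp add: continuous_within at_within_Ici_at_right)
  next
    case False
    then have "isCont (W z) t"
      using that continuous_on_interior[OF powr_v_continuous, of t z 0] by (simp add: W_def[abs_def] interior_open)
    then show ?thesis by (rule continuous_at_imp_continuous_at_within)
  qed
  then show ?thesis by (auto simp: continuous_on_eq_continuous_within)
qed

definition scl :: "nat \<Rightarrow> real" where "scl m = real (Suc m) powr (- (1 / real k))"

definition amp :: "complex \<Rightarrow> nat \<Rightarrow> complex" where
  "amp z m = of_real (1 / real (Suc m)) * of_real (scl m) powr (- z)"

text \<open>The term with index \<open>Suc m\<close> of the first Poisson sum at t, multiplied by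
  t^z; \<open>amp\<close> removes the power of \<open>scl m\<close> that \<open>W\<close> picks up
  under the dilation.\<close>

definition B :: "complex \<Rightarrow> nat \<Rightarrow> real \<Rightarrow> complex" where
  "B z m t = amp z m * W z (scl m * t)"

definition B' :: "complex \<Rightarrow> nat \<Rightarrow> real \<Rightarrow> complex" where
  "B' z m t = amp z m * (scl m *\<^sub>R U' z (scl m * t))"

lemma scl_pos: "scl m > 0" by (simp add: scl_def)

lemma U'_scaled:
  assumes "- real k < Re z" "Re z < real k" "0 < c"
  shows "((\<lambda>t. U' z (c * t)) has_integral integral {0<..} (U' z) /\<^sub>R c) {0<..}"
    and "((\<lambda>t. norm (U' z (c * t))) has_integral integral {0<..} (\<lambda>t. norm (U' z t)) /\<^sub>R c) {0<..}"
proof -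
  have i: "U' z integrable_on {0<..}" "(\<lambda>t. norm (U' z t)) integrable_on {0<..}"
    using U'_integrable[OF assms(1,2)] by (auto simp: absolutely_integrable_on_def)
  show "((\<lambda>t. U' z (c * t)) has_integral integral {0<..} (U' z) /\<^sub>R c) {0<..}"
    by (intro has_integral_scale_Ioi integrable_integral i U'_continuous assms)
  show "((\<lambda>t. norm (U' z (c * t))) has_integral integral {0<..} (\<lambda>t. norm (U' z t)) /\<^sub>R c) {0<..}"
    by (intro has_integral_scale_Ioi[of "\<lambda>t. norm (U' z t)"] integrable_integral i continuous_on_norm U'_continuous assms)
qed

text \<open>Dilation invariance again: the L1 norm of \<open>B'\<close> depends on m only through
  \<open>amp\<close>. This reduces the interchange of sum and limit to the summability of the
  amplitudes.\<close>

lemma B_half_line: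
  assumes z: "- real k < Re z" "Re z < real k"
  shows "half_line_function (B z m) (B' z m)"
    and "integral {0<..} (\<lambda>t. norm (B' z m t)) = norm (amp z m) * integral {0<..} (\<lambda>t. norm (U' z t))"
proof -
  have n: "((\<lambda>t. norm (B' z m t)) has_integral norm (amp z m) * integral {0<..} (\<lambda>t. norm (U' z t))) {0<..}"
  proof -
    have "((\<lambda>t. (norm (amp z m) * scl m) * norm (U' z (scl m * t))) has_integral
       (norm (amp z m) * scl m) * (integral {0<..} (\<lambda>t. norm (U' z t)) /\<^sub>R scl m)) {0<..}"
      by (intro has_integral_mult_right U'_scaled z scl_pos)
    moreover have "(norm (amp z m) * scl m) * (integral {0<..} (\<lambda>t. norm (U' z t)) /\<^sub>R scl m) = norm (amp z m) * integral {0<..} (\<lambda>t. norm (U' z t))"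
      using scl_pos[of m] by simp
    moreover have "norm (B' z m t) = (norm (amp z m) * scl m) * norm (U' z (scl m * t))" for t
      using scl_pos[of m] by (simp add: B'_def norm_mult)
    ultimately show ?thesis by (simp only:)
  qed
  then show "integral {0<..} (\<lambda>t. norm (B' z m t)) = norm (amp z m) * integral {0<..} (\<lambda>t. norm (U' z t))"
    by (rule integral_unique)
  show "half_line_function (B z m) (B' z m)"
  proof
    show "continuous_on {0..} (B z m)"
      unfolding B_def[abs_def] using scl_pos[of m]
      by (intro continuous_intros continuous_on_compose2[OF W_continuous[OF z(1)]]) auto
    show "B' z m absolutely_integrable_on {0<..}"
    proof (rule absolutely_integrable_onI)
      show "B' z m integrable_on {0<..}"
        unfolding B'_def[abs_def] using has_integral_integrable[OF U'_scaled(1)[OF z scl_pos]]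
        by (intro integrable_on_mult_right integrable_cmul)
      show "(\<lambda>t. norm (B' z m t)) integrable_on {0<..}" using n by (rule has_integral_integrable)
    qed
    fix t :: real assume t: "0 < t"
    have "((\<lambda>t. scl m * t) has_vector_derivative scl m) (at t)"
      by (auto intro!: derivative_eq_intros simp flip: has_real_derivative_iff_has_vector_derivative)
    moreover have "(W z has_vector_derivative U' z (scl m * t)) (at (scl m * t))"
      unfolding W_def[abs_def] using t scl_pos[of m] by (intro U_deriv) simp
    ultimately have "((\<lambda>t. W z (scl m * t)) has_vector_derivative scl m *\<^sub>R U' z (scl m * t)) (at t)"
      using vector_diff_chain_at[of "\<lambda>t. scl m * t" "scl m" t "W z"] by (simp add: o_def)
    then show "(B z m has_vector_derivative B' z m t) (at t)"
      unfolding B_def[abs_def] B'_def by (rule has_vector_derivative_mult_right)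
  qed
qed

text \<open>Undoing the dilation moves the frequency 2 pi l to 2 pi l m^(1/k), with l and m counted
  from 1; the factor 2 is the quotient of 2 pi l by the pi l in the sawtooth series.\<close>

lemma B_saw_sums:
  assumes z: "- real k < Re z" "Re z < real k"
  shows "(\<lambda>l. 2 * (amp z m / of_real (scl m) * J z (2 * pi * real (Suc l) / scl m))) sums half_line_function.saw_int (B' z m)"
proof -
  interpret half_line_function "B z m" "B' z m" by (rule B_half_line[OF z])
  have "- (integral {0<..} (\<lambda>t. of_real (sin (2 * pi * real (Suc l) * t)) * B' z m t) / of_real (pi * real (Suc l)))
      = 2 * (amp z m / of_real (scl m) * J z (2 * pi * real (Suc l) / scl m))" for l
  proof -
    define w where "w = 2 * pi * real (Suc l)"
    have w: "w > 0" by (simp add: w_def)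
    let ?c = "scl m"
    have c: "?c > 0" by (rule scl_pos)
    have "((\<lambda>t. of_real (sin ((w / ?c) * t)) * U' z t) has_integral - of_real (w / ?c) * J z (w / ?c)) {0<..}"
      using J_integrable[OF z, of "w / ?c"] w c by (auto simp: J_def absolutely_integrable_on_def integrable_integral)
    then have "((\<lambda>t. of_real (sin ((w / ?c) * (?c * t))) * U' z (?c * t)) has_integral (- of_real (w / ?c) * J z (w / ?c)) /\<^sub>R ?c) {0<..}"
      by (intro has_integral_scale_Ioi[of "\<lambda>t. of_real (sin ((w / ?c) * t)) * U' z t"] continuous_intros U'_continuous c)
    from has_integral_mult_right[OF this, of "amp z m * of_real ?c"]
    have "((\<lambda>t. of_real (sin (w * t)) * B' z m t) has_integral amp z m * of_real ?c * ((- of_real (w / ?c) * J z (w / ?c)) /\<^sub>R ?c)) {0<..}"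
      using c by (simp add: B'_def scaleR_conv_of_real mult_ac)
    then have "integral {0<..} (\<lambda>t. of_real (sin (w * t)) * B' z m t) = - (amp z m * of_real (w / ?c) * J z (w / ?c))"
      using c by (simp add: integral_unique scaleR_conv_of_real divide_inverse mult_ac)
    then have "- (integral {0<..} (\<lambda>t. of_real (sin (w * t)) * B' z m t) / of_real (pi * real (Suc l))) =
        amp z m * (of_real w / of_real ?c) * J z (w / ?c) / of_real (pi * real (Suc l))"
      by (simp del: of_nat_Suc)
    also have "\<dots> = 2 * (amp z m / of_real ?c * J z (w / ?c))"
    proof -
      have "complex_of_real w = 2 * of_real (pi * real (Suc l))" by (simp add: w_def)
      then show ?thesis by (simp del: of_nat_Suc of_real_mult)
    qed
    finally show ?thesis unfolding w_def .
  qed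
  then show ?thesis using saw_series(2) by simp
qed

text \<open>The origin of the exponent in \<open>divisor_S\<close>: 1/m from the first Poisson sum,
  m^(z/k) from the power of t and m^(1/k) from the rescaled integral.\<close>

lemma amp_eq: "amp z m / of_real (scl m) = of_nat (Suc m) powr ((1 + z) / of_nat k - 1)"
proof -
  define M where "M = real (Suc m)"
  have M: "M > 0" by (simp add: M_def)
  have "complex_of_real (scl m) powr (- z) = of_real M powr (z / of_nat k)"
    unfolding scl_def M_def[symmetric] powr_powr_real[OF M] by simp
  moreover have "complex_of_real (scl m) = of_real M powr (- (1 / of_nat k))"
    unfolding scl_def M_def[symmetric] using powr_powr_real[OF M, of "- (1 / real k)" 1] M by simp
  moreover have "complex_of_real (1 / M) = of_real M powr (- 1)" using M by (simp add: powr_minus_divide)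
  ultimately have "amp z m / of_real (scl m) = of_real M powr (- 1) * of_real M powr (z / of_nat k) / of_real M powr (- (1 / of_nat k))"
    unfolding amp_def M_def[symmetric] by simp
  also have "\<dots> = of_real M powr ((- 1 + z / of_nat k) - (- (1 / of_nat k)))"
    by (simp only: powr_add powr_diff)
  also have "(- 1 + z / of_nat k) - (- (1 / of_nat k)) = (1 + z) / of_nat k - 1"
    by (simp add: add_divide_distrib)
  finally show ?thesis by (simp add: M_def)
qed

lemma norm_amp: "norm (amp z m) = real (Suc m) powr (Re z / real k - 1)"
proof -
  have "norm (amp z m) = real (Suc m) powr (- 1) * scl m powr (- Re z)"
    using scl_pos[of m] by (simp add: amp_def norm_mult norm_powr_real powr_minus_divide norm_divide del: of_nat_Suc)
  also have "\<dots> = real (Suc m) powr (Re z / real k - 1)"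
  proof -
    have "scl m powr (- Re z) = real (Suc m) powr (- (1 / real k) * - Re z)"
      by (simp only: scl_def powr_powr)
    moreover have "- 1 + - (1 / real k) * - Re z = Re z / real k - 1" by simp
    ultimately show ?thesis by (simp only: powr_add[symmetric])
  qed
  finally show ?thesis .
qed

text \<open>The behaviour t^(k + Re z) near 0 is used for all t. It makes the exponent of m equal to
  -2 whatever z is, at the price of growth in t, so it serves on bounded intervals.\<close>

lemma B_bound:
  obtains K where "K \<ge> 0" "\<And>m t. 0 < t \<Longrightarrow> norm (B z m t) \<le> K * t powr (real k + Re z) * (1 / real (Suc m) ^ 2)"
proof -
  obtain K where K: "K \<ge> 0" "\<And>t w. 0 < t \<Longrightarrow> norm (of_real t powr w * v 0 t) \<le> K * two_powr (real k + Re w) (- real k + Re w) t"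
    using powr_v_bound[of 0] by blast
  have "norm (B z m t) \<le> K * t powr (real k + Re z) * (1 / real (Suc m) ^ 2)" if t: "0 < t" for m t
  proof -
    let ?x = "scl m * t"
    have x: "?x > 0" using t scl_pos by simp
    have "norm (W z ?x) \<le> K * two_powr (real k + Re z) (- real k + Re z) ?x" unfolding W_def by (rule K(2)[OF x])
    also have "\<dots> \<le> K * ?x powr (real k + Re z)"
      using K(1) x by (intro mult_left_mono) (auto simp: two_powr_def intro!: powr_mono)
    finally have "norm (B z m t) \<le> norm (amp z m) * (K * ?x powr (real k + Re z))"
      unfolding B_def norm_mult by (intro mult_left_mono) auto
    also have "\<dots> = K * t powr (real k + Re z) * (real (Suc m) powr (Re z / real k - 1) * scl m powr (real k + Re z))"
      using t scl_pos[of m] by (simp add: norm_amp powr_mult)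
    also have "real (Suc m) powr (Re z / real k - 1) * scl m powr (real k + Re z) = real (Suc m) powr (Re z / real k - 1 + - (1 / real k) * (real k + Re z))"
    proof -
      have "scl m powr (real k + Re z) = real (Suc m) powr (- (1 / real k) * (real k + Re z))"
        by (simp only: scl_def powr_powr)
      then show ?thesis by (simp only: powr_add[symmetric])
    qed
    also have "Re z / real k - 1 + - (1 / real k) * (real k + Re z) = - 2" using k by (simp add: field_simps)
    also have "real (Suc m) powr (- 2) = 1 / real (Suc m) ^ 2"
      by (simp add: powr_minus_divide)
    finally show ?thesis .
  qed
  with K(1) that show ?thesis by blast
qed

text \<open>By \<open>half_line_poisson\<close> with X = t^k, the sum of \<open>B z m t\<close> over
  all m.\<close>

definition Bs :: "complex \<Rightarrow> real \<Rightarrow> complex" where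
  "Bs z t = of_real t powr z * (S t - of_real (t powr (- real k)) * If + f 0 / 2)"

lemma B_sums:
  assumes t: "0 < t" shows "(\<lambda>m. B z m t) sums Bs z t"
proof -
  have X: "0 < t powr real k" using t by simp
  from sums_mult[OF half_line_poisson[OF schwartz X], of "of_real t powr z"]
  have "(\<lambda>m. of_real t powr z * (costr f (real (Suc m) / t powr real k) / of_real (t powr real k))) sums Bs z t"
    by (simp add: Bs_def S_def powr_minus_divide)
  moreover have "of_real t powr z * (costr f (real (Suc m) / t powr real k) / of_real (t powr real k)) = B z m t" for m
  proof -
    have kk: "- (1 / real k) * (- real k) = 1" using k by simp
    have "(scl m * t) powr (- real k) = scl m powr (- real k) * t powr (- real k)"
      using t scl_pos[of m] by (simp add: powr_mult)
    also have "scl m powr (- real k) = real (Suc m)"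
      unfolding scl_def powr_powr kk by simp
    finally have x: "(scl m * t) powr (- real k) = real (Suc m) / t powr real k" by (simp add: powr_minus_divide)
    have "p 0 = f" by (auto simp: p_def)
    then have "v 0 (scl m * t) = of_real (real (Suc m) / t powr real k) * costr f (real (Suc m) / t powr real k)"
      unfolding v_def x by simp
    moreover have "W z (scl m * t) = of_real (scl m) powr z * of_real t powr z * v 0 (scl m * t)"
      unfolding W_def using powr_mult_real[OF scl_pos t, of m z] by simp
    ultimately have "B z m t = (1 / of_nat (Suc m)) * (of_real (scl m) powr (- z) * of_real (scl m) powr z) * of_real t powr z
       * (of_nat (Suc m) / of_real (t powr real k) * costr f (real (Suc m) / t powr real k))"
      unfolding B_def amp_def by (simp add: mult_ac del: of_nat_Suc)
    also have "of_real (scl m) powr (- z) * of_real (scl m) powr z = (1::complex)"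
      using scl_pos[of m] by (simp add: powr_minus)
    finally show ?thesis by (simp del: of_nat_Suc)
  qed
  ultimately show ?thesis by simp
qed

lemma B_integral_sums:
  assumes z: "- real k < Re z" "Re z < real k"
  shows "Bs z integrable_on {0..real N}" "(\<lambda>m. integral {0..real N} (B z m)) sums integral {0..real N} (Bs z)"
proof -
  obtain K where K: "K \<ge> 0" "\<And>m t. 0 < t \<Longrightarrow> norm (B z m t) \<le> K * t powr (real k + Re z) * (1 / real (Suc m) ^ 2)"
    using B_bound by blast
  have i: "B z m integrable_on {0..real N}" for m
    using half_line_function.cont[OF B_half_line(1)[OF z, of m]]
    by (intro integrable_continuous_interval) (auto intro: continuous_on_subset)
  \<comment> \<open>At t = 0 all terms and the limit vanish, by the convention for
    \<open>0 powr z\<close>.\<close>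
  have l: "(\<lambda>M. \<Sum>m<M. B z m t) \<longlonglongrightarrow> Bs z t" if "t \<in> {0..real N}" for t
  proof (cases "t = 0")
    case True then show ?thesis by (simp add: B_def Bs_def)
  next
    case False then show ?thesis using B_sums[of t z] that by (simp add: sums_def)
  qed
  have b: "norm (\<Sum>m<M. B z m t) \<le> K * real N powr (real k + Re z) * (pi ^ 2 / 6)" if t: "t \<in> {0..real N}" for M t
  proof (cases "t = 0")
    case True then show ?thesis using K(1) by (simp add: B_def)
  next
    case False
    then have t0: "0 < t" using t by simp
    have "norm (\<Sum>m<M. B z m t) \<le> (\<Sum>m<M. K * t powr (real k + Re z) * (1 / real (Suc m) ^ 2))"
      by (intro sum_norm_le K t0)
    also have "\<dots> = K * t powr (real k + Re z) * (\<Sum>m<M. 1 / real (Suc m) ^ 2)" by (simp add: sum_distrib_left)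
    also have "\<dots> \<le> K * real N powr (real k + Re z) * (pi ^ 2 / 6)"
    proof (intro mult_mono powr_mono2)
      show "(\<Sum>m<M. 1 / real (Suc m) ^ 2) \<le> pi ^ 2 / 6"
        using sum_le_suminf[OF sums_summable[OF inverse_squares_sums], of "{..<M}"] sums_unique[OF inverse_squares_sums]
        by (simp add: add.commute)
    qed (use K t z in \<open>auto intro: sum_nonneg\<close>)
    finally show ?thesis .
  qed
  have i': "(\<lambda>t. \<Sum>m<M. B z m t) integrable_on {0..real N}" for M
    by (intro integrable_sum i) auto
  show "Bs z integrable_on {0..real N}"
    by (rule dominated_convergence(1)[OF i' integrable_const_ivl b l])
  have "(\<lambda>M. integral {0..real N} (\<lambda>t. \<Sum>m<M. B z m t)) \<longlonglongrightarrow> integral {0..real N} (Bs z)"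
    by (rule dominated_convergence(2)[OF i' integrable_const_ivl b l])
  then show "(\<lambda>m. integral {0..real N} (B z m)) sums integral {0..real N} (Bs z)"
    unfolding sums_def by (subst (asm) Henstock_Kurzweil_Integration.integral_sum) (auto intro: i)
qed

section \<open>The double series of cosine integrals\<close>

definition F :: "complex \<Rightarrow> nat \<times> nat \<Rightarrow> complex" where
  "F z x = of_nat (snd x) powr ((1 + z) / of_nat k - 1) * J z (2 * pi * real (fst x) * real (snd x) powr (1 / real k))"

text \<open>The pair is (l, m), with l the frequency of the second Poisson summation and m that of
  the first. Inserting \<open>J_bound\<close>, the exponent of m is (1 + Re z)/k - 1 - (Re z + k +
  1)/k = -2, and that of l is at most -(1 + delta) because k >= 1.\<close>

lemma F_bound:
  assumes "\<delta> > 0"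
  shows "\<exists>C\<ge>0. \<forall>z l m. norm z \<le> R \<longrightarrow> -1 + \<delta> \<le> Re z \<longrightarrow> Re z < real k \<longrightarrow> l \<ge> 1 \<longrightarrow> m \<ge> 1 \<longrightarrow>
    norm (F z (l, m)) \<le> C * (real l powr (- (1 + \<delta>)) * real m powr (- 2))"
proof -
  obtain C where C: "C \<ge> 0" "\<And>z c. norm z \<le> R \<Longrightarrow> \<delta> \<le> Re z + real k \<Longrightarrow> Re z < real k \<Longrightarrow> 0 < c \<Longrightarrow>
    norm (J z c) \<le> C * c powr (- (Re z + real k + 1))" using J_bound[OF assms, of R] by blast
  have "norm (F z (l, m)) \<le> C * (real l powr (- (1 + \<delta>)) * real m powr (- 2))"
    if z: "norm z \<le> R" "-1 + \<delta> \<le> Re z" "Re z < real k" and lm: "l \<ge> 1" "m \<ge> 1" for z l m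
  proof -
    let ?e = "- (Re z + real k + 1)"
    let ?c = "2 * pi * real l * real m powr (1 / real k)"
    have c: "?c > 0" using lm by simp
    have k1: "real k \<ge> 1" using k by simp
    have "norm (F z (l, m)) = real m powr ((1 + Re z) / real k - 1) * norm (J z ?c)"
      using lm norm_powr_real[of "real m" "(1 + z) / of_nat k - 1"]
      by (simp add: F_def norm_mult Re_divide_of_nat)
    also have "\<dots> \<le> real m powr ((1 + Re z) / real k - 1) * (C * ?c powr ?e)"
      using z c k1 by (intro mult_left_mono C) auto
    also have "?c powr ?e = (2 * pi) powr ?e * real l powr ?e * real m powr (1 / real k * ?e)"
      using lm by (simp add: powr_mult powr_powr)
    also have "real m powr ((1 + Re z) / real k - 1) * (C * ((2 * pi) powr ?e * real l powr ?e * real m powr (1 / real k * ?e)))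
       = C * ((2 * pi) powr ?e * real l powr ?e * (real m powr ((1 + Re z) / real k - 1) * real m powr (1 / real k * ?e)))"
      by (simp only: mult_ac)
    also have "real m powr ((1 + Re z) / real k - 1) * real m powr (1 / real k * ?e) = real m powr (- 2)"
    proof -
      have "(1 + Re z) / real k - 1 + 1 / real k * ?e = - 2" using k1 by (simp add: field_simps)
      then show ?thesis by (simp only: powr_add[symmetric])
    qed
    also have "C * ((2 * pi) powr ?e * real l powr ?e * real m powr (- 2)) \<le> C * (1 * real l powr (- (1 + \<delta>)) * real m powr (- 2))"
    proof (intro mult_left_mono mult_right_mono mult_mono)
      have "(2 * pi) powr ?e \<le> (2 * pi) powr 0" using z assms k1 pi_gt3 by (intro powr_mono) auto
      then show "(2 * pi) powr ?e \<le> 1" by simp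
      show "real l powr ?e \<le> real l powr (- (1 + \<delta>))" using z k1 lm by (intro powr_mono) auto
    qed (use C in auto)
    finally show ?thesis by simp
  qed
  with C(1) show ?thesis by blast
qed

lemma F_summable:
  assumes "-1 < Re z" "Re z < real k"
  shows "(\<lambda>x. norm (F z x)) summable_on {1..} \<times> {1..}"
proof -
  define d where "d = Re z + 1"
  have d: "d > 0" using assms by (simp add: d_def)
  from F_bound[OF d, of "norm z"] obtain C where C: "C \<ge> 0" "\<And>l m. l \<ge> 1 \<Longrightarrow> m \<ge> 1 \<Longrightarrow>
    norm (F z (l, m)) \<le> C * (real l powr (- (1 + d)) * real m powr (- 2))" using assms by (auto simp: d_def)
  have "(\<lambda>x. C * (real (fst x) powr (- (1 + d)) * real (snd x) powr (- 2))) summable_on {1..} \<times> {1..}"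
    using d by (intro summable_on_cmult_right summable_on_powr_product) auto
  then show ?thesis
    by (rule Infinite_Sum.abs_summable_on_comparison_test') (use C in auto)
qed

text \<open>On the fibre l^k m = n the argument l m^(1/k) equals n^(1/k), so \<open>J\<close> is
  constant there and only the powers of m add up to \<open>divisor_S\<close>.\<close>

lemma F_regroup:
  assumes "-1 < Re z" "Re z < real k"
  shows "(\<lambda>n. divisor_S k z (Suc n) * J z (2 * pi * real (Suc n) powr (1 / real k))) sums infsum (F z) ({1..} \<times> {1..})"
proof -
  have "(\<Sum>x | fst x > 0 \<and> snd x > 0 \<and> fst x ^ k * snd x = Suc n. F z x) =
     divisor_S k z (Suc n) * J z (2 * pi * real (Suc n) powr (1 / real k))" for n
  proof -
    have "F z x = of_nat (snd x) powr ((1 + z) / of_nat k - 1) * J z (2 * pi * real (Suc n) powr (1 / real k))"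
      if x: "fst x > 0" "snd x > 0" "fst x ^ k * snd x = Suc n" for x
    proof -
      have "real (Suc n) = real (fst x) powr real k * real (snd x)"
        using x by (simp add: powr_realpow flip: x(3))
      then have "real (Suc n) powr (1 / real k) = real (fst x) * real (snd x) powr (1 / real k)"
        using x(1,2) k by (simp add: powr_mult powr_powr)
      then show ?thesis by (simp only: F_def mult.assoc)
    qed
    then have "(\<Sum>x | fst x > 0 \<and> snd x > 0 \<and> fst x ^ k * snd x = Suc n. F z x) =
      (\<Sum>x | fst x > 0 \<and> snd x > 0 \<and> fst x ^ k * snd x = Suc n. of_nat (snd x) powr ((1 + z) / of_nat k - 1) * J z (2 * pi * real (Suc n) powr (1 / real k)))"
      by (intro sum.cong) auto
    also have "\<dots> = divisor_S k z (Suc n) * J z (2 * pi * real (Suc n) powr (1 / real k))"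
      unfolding divisor_S_def sum_distrib_right by (intro sum.cong) auto
    finally show ?thesis .
  qed
  with sum_power_regroup(1)[OF k F_summable[OF assms]] show ?thesis by simp
qed

end

section \<open>The identity for negative real part\<close>

lemma has_sum_Suc_sums:
  fixes h :: "nat \<Rightarrow> complex"
  assumes "(h has_sum s) {1..}" shows "(\<lambda>n. h (Suc n)) sums s"
proof -
  have "Suc ` UNIV = {1..}" by (auto simp: image_iff Suc_le_eq gr0_conv_Suc)
  then have "((h \<circ> Suc) has_sum s) UNIV"
    using assms by (subst has_sum_reindex[symmetric]) auto
  then show ?thesis by (auto dest: has_sum_imp_sums simp: o_def)
qed

lemma product_section_sums:
  fixes F :: "nat \<times> nat \<Rightarrow> complex"
  assumes sm: "(\<lambda>x. norm (F x)) summable_on {1..} \<times> {1..}"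
  shows "d \<ge> 1 \<Longrightarrow> (\<lambda>m. F (d, Suc m)) sums infsum (\<lambda>m. F (d, m)) {1..}"
    and "m \<ge> 1 \<Longrightarrow> (\<lambda>d. F (Suc d, m)) sums infsum (\<lambda>d. F (d, m)) {1..}"
proof -
  have sF: "F summable_on {1..} \<times> {1..}" using sm by (rule abs_summable_summable)
  show "(\<lambda>m. F (d, Suc m)) sums infsum (\<lambda>m. F (d, m)) {1..}" if "d \<ge> 1"
    using summable_on_SigmaD1[of "\<lambda>d m. F (d, m)" "{1..}" "\<lambda>_. {1..}" d] sF that
    by (intro has_sum_Suc_sums has_sum_infsum) auto
  have "(F has_sum infsum F ({1..} \<times> {1..})) ({1..} \<times> {1..})" using sF by (rule has_sum_infsum)
  then have "((\<lambda>(m, d). F (d, m)) has_sum infsum F ({1..} \<times> {1..})) ({1..} \<times> {1..})"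
    using has_sum_swap by blast
  then have sF': "(\<lambda>(m, d). F (d, m)) summable_on {1..} \<times> {1..}" by (rule has_sum_imp_summable)
  show "(\<lambda>d. F (Suc d, m)) sums infsum (\<lambda>d. F (d, m)) {1..}" if "m \<ge> 1"
    using summable_on_SigmaD1[of "\<lambda>m d. F (d, m)" "{1..}" "\<lambda>_. {1..}" m] sF' that
    by (intro has_sum_Suc_sums has_sum_infsum) auto
qed

lemma has_integral_powr_complex_from_0:
  assumes "Re z > -1" "0 \<le> x"
  shows "((\<lambda>t. complex_of_real t powr z) has_integral of_real x powr (z + 1) / (z + 1)) {0..x}"
proof (cases "x > 0")
  case True
  have z: "z + 1 \<noteq> 0" using assms by (auto simp: complex_eq_iff)
  have "((\<lambda>t. complex_of_real t powr z) has_integral of_real x powr (z + 1) / (z + 1)) {0<..x}"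
  proof (rule improper_integral_to_0)
    show "continuous_on {0<..x} (\<lambda>t. complex_of_real t powr z)"
      by (rule continuous_on_subset[OF continuous_on_powr_real]) auto
    have "((\<lambda>a. complex_of_real a powr (z + 1)) \<longlongrightarrow> 0) (at_right 0)"
    proof (rule Lim_null_comparison)
      show "\<forall>\<^sub>F a in at_right 0. norm (complex_of_real a powr (z + 1)) \<le> a powr (Re z + 1)"
        unfolding eventually_at by (intro exI[of _ 1]) (auto simp: norm_powr_real)
      have "((\<lambda>x::real. x powr (Re z + 1)) \<longlongrightarrow> 0 powr (Re z + 1)) (at_right 0)"
        using assms by (intro tendsto_intros) (auto simp: eventually_at intro!: exI[of _ 1])
      then show "((\<lambda>a::real. a powr (Re z + 1)) \<longlongrightarrow> 0) (at_right 0)" by simp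
    qed
    from tendsto_divide[OF tendsto_diff[OF tendsto_const this] tendsto_const z, of "of_real x powr (z + 1)"]
    have "((\<lambda>a. (of_real x powr (z + 1) - of_real a powr (z + 1)) / (z + 1)) \<longlongrightarrow> of_real x powr (z + 1) / (z + 1)) (at_right 0)" by simp
    then show "((\<lambda>a. integral {a..x} (\<lambda>t. complex_of_real t powr z)) \<longlongrightarrow> of_real x powr (z + 1) / (z + 1)) (at_right 0)"
    proof (rule Lim_transform_eventually)
      have "((\<lambda>t. complex_of_real t powr z) has_integral of_real x powr (z + 1) / (z + 1) - of_real a powr (z + 1) / (z + 1)) {a..x}"
        if "0 < a" "a \<le> x" for a
      proof (rule fundamental_theorem_of_calculus)
        fix t assume "t \<in> {a..x}"
        then have "0 < t" using that by auto
        from has_vector_derivative_divide[OF has_vector_derivative_powr_real[OF this, of "z + 1" "{a..x}"], of "z + 1"] z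
        show "((\<lambda>t. complex_of_real t powr (z + 1) / (z + 1)) has_vector_derivative complex_of_real t powr z) (at t within {a..x})"
          by simp
      qed (use that in auto)
      then have "(of_real x powr (z + 1) - of_real a powr (z + 1)) / (z + 1) = integral {a..x} (\<lambda>t. complex_of_real t powr z)"
        if "0 < a" "a \<le> x" for a
        unfolding diff_divide_distrib by (rule integral_unique[symmetric]) (use that in auto)
      then show "\<forall>\<^sub>F a in at_right 0. (of_real x powr (z + 1) - of_real a powr (z + 1)) / (z + 1) = integral {a..x} (\<lambda>t. complex_of_real t powr z)"
        unfolding eventually_at using True by (intro exI[of _ x]) (auto simp: dist_norm)
    qed
  qed (rule True)
  then show ?thesis
    by (subst has_integral_spike_set_eq[of _ "{0<..x}"]) (auto intro: negligible_subset[of "{0}"])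
next
  case False
  then have "x = 0" using assms(2) by simp
  then show ?thesis using has_integral_null[of "0::real" 0 "\<lambda>t. complex_of_real t powr z"] by simp
qed

context schwartz_function
begin

abbreviation G :: "complex \<Rightarrow> complex" where "G z \<equiv> infsum (F z) ({1..} \<times> {1..})"

lemma saw_int_sums:
  assumes z: "-1 < Re z" "Re z < real k"
  shows "(\<lambda>m. half_line_function.saw_int (B' z m)) sums (2 * G z)"
proof -
  have z': "- real k < Re z" using z k by simp
  have "half_line_function.saw_int (B' z m) = 2 * infsum (\<lambda>l. F z (l, Suc m)) {1..}" for m
  proof -
    have "2 * pi * real (Suc l) / scl m = 2 * pi * real (Suc l) * real (Suc m) powr (1 / real k)" for l
      by (simp add: scl_def powr_minus_divide del: of_nat_Suc)
    then have "(\<lambda>l. 2 * F z (Suc l, Suc m)) sums half_line_function.saw_int (B' z m)"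
      using B_saw_sums[OF z' z(2), of m] by (simp add: F_def amp_eq del: of_nat_Suc)
    moreover have "(\<lambda>l. 2 * F z (Suc l, Suc m)) sums (2 * infsum (\<lambda>l. F z (l, Suc m)) {1..})"
      by (intro sums_mult product_section_sums(2) F_summable z) auto
    ultimately show ?thesis by (rule sums_unique2)
  qed
  then show ?thesis
    using sums_mult[OF sum_power_regroup(3)[OF k F_summable[OF z]], of 2] by simp
qed

text \<open>The Poisson difference of \<open>Bs z\<close> up to N; since \<open>Bs z\<close>
  vanishes at 0, only half of the value at N is subtracted.\<close>

definition D :: "complex \<Rightarrow> nat \<Rightarrow> complex" where
  "D z N = (\<Sum>d<N. Bs z (real (Suc d))) - integral {0..real N} (Bs z) - Bs z (real N) / 2"

text \<open>Tannery's theorem in m: every \<open>B z m\<close> satisfies its own Poisson limit,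
  dominated by a multiple of m^(Re z / k - 1). This majorant is summable because Re z < 0.\<close>

lemma D_tendsto:
  assumes z: "-1 < Re z" "Re z < 0"
  shows "(\<lambda>N. D z (Suc N)) \<longlonglongrightarrow> 2 * G z"
proof -
  have z': "- real k < Re z" "Re z < real k" using z k by simp_all
  define T where "T m N = (\<Sum>d<N. B z m (real (Suc d))) - integral {0..real N} (B z m) - (B z m (real N) - B z m 0) / 2" for m N
  define N0 where "N0 = integral {0<..} (\<lambda>t. norm (U' z t))"
  have "((\<lambda>N. \<Sum>m. T m N) \<longlongrightarrow> (\<Sum>m. half_line_function.saw_int (B' z m))) sequentially"
  proof (rule tannerys_theorem[THEN conjunct2, THEN conjunct2])
    show "(\<lambda>N. T m N) \<longlonglongrightarrow> half_line_function.saw_int (B' z m)" for m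
      unfolding T_def by (rule half_line_function.poisson_limit[OF B_half_line(1)[OF z']])
    have "norm (T m N) \<le> norm (amp z m) * N0" for m N
      unfolding T_def N0_def B_half_line(2)[OF z', symmetric]
      by (rule half_line_function.poisson_bound[OF B_half_line(1)[OF z']])
    then show "\<forall>\<^sub>F (m, N) in sequentially \<times>\<^sub>F sequentially. norm (T m N) \<le> norm (amp z m) * N0"
      by (intro always_eventually) auto
    have "Re z / real k - 1 < -1" using z k by (simp add: divide_neg_pos)
    then show "summable (\<lambda>m. norm (amp z m) * N0)"
      unfolding norm_amp by (intro summable_mult2 summable_Suc_powr)
  qed simp
  moreover have "(\<Sum>m. half_line_function.saw_int (B' z m)) = 2 * G z"
    using saw_int_sums[OF z(1) z'(2)] by (simp add: sums_iff)
  ultimately have "(\<lambda>N. \<Sum>m. T m N) \<longlonglongrightarrow> 2 * G z" by (simp only:)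
  then have "(\<lambda>N. \<Sum>m. T m (Suc N)) \<longlonglongrightarrow> 2 * G z" by (rule LIMSEQ_Suc)
  moreover have "(\<Sum>m. T m (Suc N)) = D z (Suc N)" for N
  proof -
    have "(\<lambda>m. T m (Suc N)) sums ((\<Sum>d<Suc N. Bs z (real (Suc d))) - integral {0..real (Suc N)} (Bs z) - (Bs z (real (Suc N)) - 0) / 2)"
      unfolding T_def
      by (intro sums_diff sums_divide sums_sum B_sums B_integral_sums(2) z') (simp_all add: B_def)
    then show ?thesis by (simp add: sums_iff D_def)
  qed
  ultimately show ?thesis by simp
qed

section \<open>The divisor sum as a double series\<close>

definition Q :: "complex \<Rightarrow> nat \<times> nat \<Rightarrow> complex" where
  "Q z x = of_nat (fst x) powr z * f (real (fst x ^ k * snd x))"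

text \<open>For negative Re z the powers of d are at most 1, and f(y) = O(y^-2) together with d^k >=
  d gives d^-2 m^-2.\<close>

lemma Q_summable:
  assumes "Re z < 0" shows "(\<lambda>x. norm (Q z x)) summable_on {1..} \<times> {1..}"
proof -
  obtain C where C: "C \<ge> 0" "\<And>y. 0 < y \<Longrightarrow> norm (f y) \<le> C * two_powr 0 (- real 2) y"
    using rapid_bound_ex[OF f_rapid, of 2] by blast
  have "norm (Q z (d, m)) \<le> C * (real d powr (- 2) * real m powr (- 2))" if dm: "d \<ge> 1" "m \<ge> 1" for d m
  proof -
    have y: "real (d ^ k * m) \<ge> 1" using dm by (simp add: Suc_le_eq flip: of_nat_mult)
    have "norm (f (real (d ^ k * m))) \<le> C * two_powr 0 (- real 2) (real (d ^ k * m))"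
      using y by (intro C) auto
    also have "two_powr 0 (- real 2) (real (d ^ k * m)) = real (d ^ k * m) powr (- 2)"
      using y by (cases "real (d ^ k * m) = 1") (auto simp: two_powr_def)
    also have "\<dots> \<le> (real d * real m) powr (- 2)"
    proof (rule powr_mono2')
      have "d \<le> d ^ k" using dm k by (intro self_le_power) auto
      then show "real d * real m \<le> real (d ^ k * m)"
        by (simp flip: of_nat_mult of_nat_power)
    qed (use dm in auto)
    also have "\<dots> = real d powr (- 2) * real m powr (- 2)" by (simp add: powr_mult)
    finally have 1: "norm (f (real (d ^ k * m))) \<le> C * (real d powr (- 2) * real m powr (- 2))"
      using C(1) by (simp add: mult_left_mono)
    have "norm (of_nat d powr z) = real d powr Re z" using norm_powr_real[of "real d" z] dm by simp
    also have "\<dots> \<le> real d powr 0" using dm assms by (intro powr_mono) auto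
    finally have "norm (of_nat d powr z) \<le> 1" using dm by simp
    then show ?thesis unfolding Q_def fst_conv snd_conv norm_mult
      using mult_mono[OF _ 1, of "norm (of_nat d powr z)" 1] C(1) by simp
  qed
  moreover have "(\<lambda>x. C * (real (fst x) powr (- 2) * real (snd x) powr (- 2))) summable_on {1..} \<times> {1..}"
    by (intro summable_on_cmult_right summable_on_powr_product) auto
  ultimately show ?thesis
    by (intro Infinite_Sum.abs_summable_on_comparison_test'[of "\<lambda>x. C * (real (fst x) powr (- 2) * real (snd x) powr (- 2))"]) auto
qed

definition Lsum :: "complex \<Rightarrow> complex" where
  "Lsum z = (\<Sum>n. divisor_sigma k z (Suc n) * f (real (Suc n)))"

lemma Q_regroup:
  assumes "Re z < 0"
  shows "Lsum z = infsum (Q z) ({1..} \<times> {1..})"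
proof -
  have "(\<Sum>x | fst x > 0 \<and> snd x > 0 \<and> fst x ^ k * snd x = Suc n. Q z x) = divisor_sigma k z (Suc n) * f (real (Suc n))" for n
  proof -
    have "(\<Sum>x | fst x > 0 \<and> snd x > 0 \<and> fst x ^ k * snd x = Suc n. Q z x) =
      (\<Sum>d | d > 0 \<and> d ^ k dvd Suc n. of_nat d powr z * f (real (Suc n)))"
    proof (rule sum.reindex_bij_witness[of _ "\<lambda>d. (d, Suc n div d ^ k)" fst])
      fix x assume "x \<in> {x. fst x > 0 \<and> snd x > 0 \<and> fst x ^ k * snd x = Suc n}"
      then have x: "fst x > 0" "snd x > 0" "fst x ^ k * snd x = Suc n" by auto
      have "Suc n div fst x ^ k = snd x" unfolding x(3)[symmetric] using x(1) by simp
      then show "(fst x, Suc n div fst x ^ k) = x" by simp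
      show "fst x \<in> {d. d > 0 \<and> d ^ k dvd Suc n}" using x by (metis (mono_tags, lifting) dvd_triv_left mem_Collect_eq)
      show "of_nat (fst x) powr z * f (real (Suc n)) = Q z x" by (simp only: Q_def x(3))
    next
      fix d assume "d \<in> {d. d > 0 \<and> d ^ k dvd Suc n}"
      then have d: "d > 0" "d ^ k dvd Suc n" by auto
      then show "fst (d, Suc n div d ^ k) = d"
        and "(d, Suc n div d ^ k) \<in> {x. fst x > 0 \<and> snd x > 0 \<and> fst x ^ k * snd x = Suc n}"
        by (auto simp: dvd_div_eq_0_iff intro!: Nat.gr0I)
    qed
    then show ?thesis by (simp add: divisor_sigma_def sum_distrib_right)
  qed
  with sum_power_regroup(1)[OF k Q_summable[OF assms]] show ?thesis
    by (simp add: Lsum_def sums_iff)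
qed

lemma S_series:
  assumes "Re z < 0"
  shows "(\<lambda>d. of_nat (Suc d) powr z * S (real (Suc d))) sums Lsum z"
proof -
  have "infsum (\<lambda>m. Q z (Suc d, m)) {1..} = of_nat (Suc d) powr z * S (real (Suc d))" for d
  proof -
    have "(\<lambda>m. of_nat (Suc d) powr z * f (real (Suc d) powr real k * real (Suc m))) sums (of_nat (Suc d) powr z * S (real (Suc d)))"
      by (intro sums_mult S_sums) simp
    moreover have "real (Suc d) powr real k * real (Suc m) = real (Suc d ^ k * Suc m)" for m
      by (simp only: of_nat_mult of_nat_power powr_realpow of_nat_0_less_iff zero_less_Suc)
    ultimately have "(\<lambda>m. Q z (Suc d, Suc m)) sums (of_nat (Suc d) powr z * S (real (Suc d)))"
      by (simp add: Q_def del: of_nat_Suc of_nat_mult of_nat_power mult_Suc_right mult_Suc)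
    moreover have "(\<lambda>m. Q z (Suc d, Suc m)) sums infsum (\<lambda>m. Q z (Suc d, m)) {1..}"
      by (intro product_section_sums(1) Q_summable assms) simp
    ultimately show ?thesis using sums_unique2 by blast
  qed
  with sum_power_regroup(2)[OF k Q_summable[OF assms]] show ?thesis
    by (simp add: Q_regroup[OF assms])
qed

text \<open>The limit of \<open>D z\<close> is computed a second time by expanding
  \<open>Bs\<close>. The sum of the d^z \<open>S\<close> terms gives \<open>Lsum\<close>, the powers
  d^(z-k) give zeta(k-z), the half-value f(0)/2 gives zeta(-z), and the integral of \<open>q\<close>
  is Muentz's formula.\<close>

lemma base_identity:
  assumes z: "-1 < Re z" "Re z < 0"
  defines "s \<equiv> (1 + z) / of_nat k"
  shows "Lsum z = riemann_zeta (of_nat k - z) * If - 1 / 2 * riemann_zeta (- z) * f 0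
     + 1 / of_nat k * mellin f s * riemann_zeta s + 2 * G z"
proof -
  have z': "- real k < Re z" "Re z < real k" "Re z < real k - 1" using z k by simp_all
  define q where "q t = of_real t powr z * (S t - of_real (t powr (- real k)) * If)" for t
  have qi: "(q has_integral mellin f s / of_nat k * riemann_zeta s) {0<..}"
    unfolding q_def[abs_def] s_def by (rule muentz[OF z(1) z'(3)])
  have z1: "1 + z \<noteq> 0" "z + 1 \<noteq> 0" using z by (auto simp: complex_eq_iff)
  have pz: "((\<lambda>t. f 0 / 2 * complex_of_real t powr z) has_integral f 0 / 2 * (of_real x powr (z + 1) / (z + 1))) {0..x}" if "0 \<le> x" for x
    using that by (intro has_integral_mult_right has_integral_powr_complex_from_0 z)
  have Bq: "Bs z t = q t + f 0 / 2 * of_real t powr z" for t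
    by (simp add: Bs_def q_def algebra_simps)
  \<comment> \<open>The part t^z f(0)/2 of \<open>Bs\<close> is not integrable over the half line;
    its integral up to N is split off as the power that regularises the sum of the d^z.\<close>
  have Bint: "integral {0..real N} (Bs z) = integral {0..real N} q + f 0 / 2 * (of_nat N powr (z + 1) / (z + 1))" for N
  proof -
    have "(Bs z has_integral integral {0..real N} (Bs z)) {0..real N}"
      using B_integral_sums(1)[OF z'(1,2)] by (rule integrable_integral)
    from has_integral_diff[OF this pz[OF of_nat_0_le_iff]]
    have "(q has_integral integral {0..real N} (Bs z) - f 0 / 2 * (of_nat N powr (z + 1) / (z + 1))) {0..real N}"
      by (simp add: Bq)
    then show ?thesis by (simp add: integral_unique)
  qed
  have pw: "of_nat (Suc d) powr z * complex_of_real (real (Suc d) powr (- real k)) = of_nat (Suc d) powr (- (of_nat k - z))" for d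
    using powr_powr_real[of "real (Suc d)" "- real k" 1] powr_add[of "of_nat (Suc d) :: complex" z "- of_nat k"]
    by (simp del: of_nat_Suc)
  have Bsum: "(\<Sum>d<N. Bs z (real (Suc d))) = (\<Sum>d<N. of_nat (Suc d) powr z * S (real (Suc d)))
      - If * (\<Sum>d<N. of_nat (Suc d) powr (- (of_nat k - z))) + f 0 / 2 * (\<Sum>d<N. of_nat (Suc d) powr (- (- z)))" for N
    unfolding sum_distrib_left sum_subtractf[symmetric] sum.distrib[symmetric]
  proof (rule sum.cong[OF refl])
    fix d
    show "Bs z (real (Suc d)) = of_nat (Suc d) powr z * S (real (Suc d)) - If * of_nat (Suc d) powr (- (of_nat k - z)) + f 0 / 2 * of_nat (Suc d) powr (- (- z))"
      unfolding pw[symmetric] by (simp add: Bs_def algebra_simps del: of_nat_Suc)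
  qed
  \<comment> \<open>The terms of \<open>D z N\<close> are grouped so that each of them converges;
    the bracket with f(0)/2 combines two divergent quantities.\<close>
  define R where "R N = (\<Sum>d<N. of_nat (Suc d) powr z * S (real (Suc d))) - If * (\<Sum>d<N. of_nat (Suc d) powr (- (of_nat k - z)))
     + f 0 / 2 * ((\<Sum>d<N. of_nat (Suc d) powr (- (- z))) - of_nat N powr (1 - (- z)) / (1 - (- z))) - integral {0..real N} q - Bs z (real N) / 2" for N
  have "D z N = R N" for N
    unfolding D_def R_def Bsum Bint by (simp add: algebra_simps)
  moreover have "(\<lambda>N. R (Suc N)) \<longlonglongrightarrow> Lsum z - If * riemann_zeta (of_nat k - z) + f 0 / 2 * riemann_zeta (- z)
      - mellin f s / of_nat k * riemann_zeta s - 0 / 2"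
    unfolding R_def
  proof (intro tendsto_add tendsto_diff tendsto_mult_left tendsto_divide tendsto_const)
    show "(\<lambda>N. \<Sum>d<Suc N. of_nat (Suc d) powr z * S (real (Suc d))) \<longlonglongrightarrow> Lsum z"
      using S_series[OF z(2)] unfolding sums_def by (rule LIMSEQ_Suc)
    show "(\<lambda>N. \<Sum>d<Suc N. of_nat (Suc d) powr (- (of_nat k - z))) \<longlonglongrightarrow> riemann_zeta (of_nat k - z)"
      using riemann_zeta_sums[of "of_nat k - z"] z k unfolding sums_def by (intro LIMSEQ_Suc) auto
    show "(\<lambda>N. (\<Sum>d<Suc N. of_nat (Suc d) powr (- (- z))) - of_nat (Suc N) powr (1 - (- z)) / (1 - (- z))) \<longlonglongrightarrow> riemann_zeta (- z)"
      using z z1 by (intro riemann_zeta_partial_sums) (auto simp: complex_eq_iff)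
    have "q integrable_on {0<..}" using qi by (rule has_integral_integrable)
    then have "q integrable_on {0..}" by (rule integrable_spike_set) (auto intro: negligible_subset[of "{0}"])
    from filterlim_compose[OF integral_tendsto_at_top_Ici[OF this] filterlim_real_sequentially]
    have "(\<lambda>N. integral {0..real N} q) \<longlonglongrightarrow> integral {0..} q" .
    moreover have "integral {0..} q = integral {0<..} q" by (rule integral_spike_set) (auto intro: negligible_subset[of "{0}"])
    ultimately show "(\<lambda>N. integral {0..real (Suc N)} q) \<longlonglongrightarrow> mellin f s / of_nat k * riemann_zeta s"
      using integral_unique[OF qi] LIMSEQ_Suc[of "\<lambda>N. integral {0..real N} q"] by simp
    obtain C where C: "C \<ge> 0" "\<And>M t. 0 < t \<Longrightarrow> norm (E M t) \<le> C * two_powr 0 (- real k) t" using E_bound by blast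
    show "(\<lambda>N. Bs z (real (Suc N))) \<longlonglongrightarrow> 0"
    proof (rule Lim_null_comparison)
      have "norm (Bs z (real (Suc N))) \<le> real (Suc N) powr Re z * (C + norm (f 0 / 2))" for N
      proof -
        let ?t = "real (Suc N)"
        have "norm (S ?t - of_real (?t powr (- real k)) * If) \<le> C"
        proof (rule tendsto_upperbound[OF tendsto_norm[OF E_tendsto]])
          have "norm (E M ?t) \<le> C" for M
          proof -
            have "norm (E M ?t) \<le> C * two_powr 0 (- real k) ?t" by (intro C) simp
            also have "\<dots> \<le> C * 1"
              using C(1) powr_mono[of "- real k" 0 "real (Suc N)"] by (intro mult_left_mono) (auto simp: two_powr_def)
            finally show ?thesis by simp
          qed
          then show "\<forall>\<^sub>F M in sequentially. norm (E M ?t) \<le> C" by simp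
        qed auto
        then have "norm (S ?t - of_real (?t powr (- real k)) * If + f 0 / 2) \<le> C + norm (f 0 / 2)"
          by (intro order_trans[OF norm_triangle_ineq]) simp
        then show ?thesis unfolding Bs_def norm_mult norm_powr_real[of "real (Suc N)", OF of_nat_0_less_iff[THEN iffD2, OF zero_less_Suc]]
          by (intro mult_left_mono) auto
      qed
      then show "\<forall>\<^sub>F N in sequentially. norm (Bs z (real (Suc N))) \<le> real (Suc N) powr Re z * (C + norm (f 0 / 2))" by simp
      have "(\<lambda>N. real (Suc N) powr Re z) \<longlonglongrightarrow> 0"
        by (rule LIMSEQ_Suc[OF tendsto_neg_powr[OF _ filterlim_real_sequentially]]) (use z in simp)
      from tendsto_mult_left_zero[OF this] show "(\<lambda>N. real (Suc N) powr Re z * (C + norm (f 0 / 2))) \<longlonglongrightarrow> 0" .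
    qed
  qed simp
  ultimately have "Lsum z - If * riemann_zeta (of_nat k - z) + f 0 / 2 * riemann_zeta (- z)
      - mellin f s / of_nat k * riemann_zeta s - 0 / 2 = 2 * G z"
    using LIMSEQ_unique[OF _ D_tendsto[OF z]] by simp
  then show ?thesis by (simp add: algebra_simps)
qed

end

section \<open>Analytic continuation\<close>

context schwartz_function
begin

lemma divisor_sigma_bound:
  assumes "Re z \<le> real k" "n \<ge> 1"
  shows "norm (divisor_sigma k z n) \<le> real n ^ (k + 1)"
proof -
  have dn: "d \<le> n" if "d ^ k dvd n" for d
  proof (cases "d = 0")
    case False
    then have "d \<le> d ^ k" using k by (intro self_le_power) auto
    also have "\<dots> \<le> n" using that assms(2) by (intro dvd_imp_le) auto
    finally show ?thesis .
  qed simp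
  have "norm (divisor_sigma k z n) \<le> (\<Sum>d | d > 0 \<and> d ^ k dvd n. real n ^ k)"
    unfolding divisor_sigma_def
  proof (rule sum_norm_le)
    fix d assume "d \<in> {d. d > 0 \<and> d ^ k dvd n}"
    then have d: "d > 0" "d \<le> n" using dn by auto
    have "norm (of_nat d powr z) = real d powr Re z" using norm_powr_real[of "real d" z] d by simp
    also have "\<dots> \<le> real d powr real k" using d assms by (intro powr_mono) auto
    also have "\<dots> = real d ^ k" using d by (simp add: powr_realpow)
    also have "\<dots> \<le> real n ^ k" using d by (intro power_mono) auto
    finally show "norm (of_nat d powr z) \<le> real n ^ k" .
  qed
  also have "\<dots> = real (card {d. d > 0 \<and> d ^ k dvd n}) * real n ^ k" by simp
  also have "\<dots> \<le> real n * real n ^ k"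
  proof (intro mult_right_mono)
    have "{d. d > 0 \<and> d ^ k dvd n} \<subseteq> {1..n}" using dn by auto
    from card_mono[OF _ this] show "real (card {d. d > 0 \<and> d ^ k dvd n}) \<le> real n" by simp
  qed simp
  finally show ?thesis by simp
qed

lemma Lsum_term_bound:
  obtains C where "C \<ge> 0" "\<And>z n. Re z \<le> real k \<Longrightarrow> norm (divisor_sigma k z (Suc n) * f (real (Suc n))) \<le> C * (1 / real (Suc n) ^ 2)"
proof -
  \<comment> \<open>Decay of order k + 3 absorbs the bound n^(k+1) for \<open>divisor_sigma\<close>
    on Re z <= k and leaves n^-2.\<close>
  obtain C where C: "C \<ge> 0" "\<And>y. 0 < y \<Longrightarrow> norm (f y) \<le> C * two_powr 0 (- real (k + 3)) y"
    using rapid_bound_ex[OF f_rapid, of "k + 3"] by blast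
  have "norm (divisor_sigma k z (Suc n) * f (real (Suc n))) \<le> C * (1 / real (Suc n) ^ 2)" if z: "Re z \<le> real k" for z n
  proof -
    let ?n = "real (Suc n)"
    have "norm (f ?n) \<le> C * two_powr 0 (- real (k + 3)) ?n" by (intro C) simp
    also have "two_powr 0 (- real (k + 3)) ?n = 1 / ?n ^ (k + 3)"
    proof -
      have "?n powr (- real (k + 3)) = 1 / ?n ^ (k + 3)"
        unfolding powr_minus_divide by (subst powr_realpow) auto
      then show ?thesis by (cases n) (simp_all add: two_powr_def)
    qed
    finally have "norm (divisor_sigma k z (Suc n) * f ?n) \<le> ?n ^ (k + 1) * (C * (1 / ?n ^ (k + 3)))"
      unfolding norm_mult using divisor_sigma_bound[OF z, of "Suc n"] by (intro mult_mono) auto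
    also have "\<dots> = C * (1 / ?n ^ 2)"
    proof -
      have "k + 3 = (k + 1) + 2" by simp
      then have "?n ^ (k + 3) = ?n ^ (k + 1) * ?n ^ 2" by (simp only: power_add)
      then show ?thesis by (simp del: of_nat_Suc)
    qed
    finally show ?thesis .
  qed
  with C(1) that show ?thesis by blast
qed

lemma Lsum_sums:
  assumes "Re z \<le> real k"
  shows "(\<lambda>n. divisor_sigma k z (Suc n) * f (real (Suc n))) sums Lsum z"
proof -
  obtain C where C: "C \<ge> 0" "\<And>z n. Re z \<le> real k \<Longrightarrow> norm (divisor_sigma k z (Suc n) * f (real (Suc n))) \<le> C * (1 / real (Suc n) ^ 2)"
    using Lsum_term_bound by blast
  have "summable (\<lambda>n. C * (1 / real (Suc n) ^ 2))"
    using summable_mult[OF sums_summable[OF inverse_squares_sums], of C] by (simp add: add.commute)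
  then have "summable (\<lambda>n. divisor_sigma k z (Suc n) * f (real (Suc n)))"
    by (rule summable_comparison_test') (use C assms in auto)
  then show ?thesis unfolding Lsum_def by (rule summable_sums)
qed

abbreviation strip :: "complex set" where "strip \<equiv> {z. -1 < Re z \<and> Re z < real k}"

lemma open_strip: "open strip"
  by (intro open_Collect_conj open_Collect_less continuous_intros)

lemma Lsum_holomorphic: "Lsum holomorphic_on strip"
  unfolding Lsum_def[abs_def]
proof (rule holomorphic_on_suminf[OF open_strip])
  show "(\<lambda>z. divisor_sigma k z (Suc n) * f (real (Suc n))) holomorphic_on strip" for n
    unfolding divisor_sigma_def by (intro holomorphic_intros)
  fix z
  obtain C where C: "C \<ge> 0" "\<And>z n. Re z \<le> real k \<Longrightarrow> norm (divisor_sigma k z (Suc n) * f (real (Suc n))) \<le> C * (1 / real (Suc n) ^ 2)"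
    using Lsum_term_bound by blast
  have "summable (\<lambda>n. C * (1 / real (Suc n) ^ 2))"
    using summable_mult[OF sums_summable[OF inverse_squares_sums], of C] by (simp add: add.commute)
  then show "\<exists>r>0. \<exists>M. summable M \<and> (\<forall>n. \<forall>w\<in>cball z r \<inter> strip. norm (divisor_sigma k w (Suc n) * f (real (Suc n))) \<le> M n)"
    using C(2) by (intro exI[of _ 1] exI[of _ "\<lambda>n. C * (1 / real (Suc n) ^ 2)"]) auto
qed

lemma G_eq_suminf:
  assumes "z \<in> strip"
  shows "G z = (\<Sum>n. \<Sum>x | fst x > 0 \<and> snd x > 0 \<and> fst x ^ k * snd x = Suc n. F z x)"
  using sum_power_regroup(1)[OF k F_summable[of z]] assms by (simp add: sums_iff)

text \<open>\<open>G\<close> is an unordered sum; grouping by n turns it into an ordinary series of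
  finite sums, to which the local M-test applies. The majorant is grouped in the same way, on a ball
  of half the distance to the line Re z = -1.\<close>

lemma G_holomorphic: "G holomorphic_on strip"
proof -
  have "(\<lambda>z. \<Sum>n. \<Sum>x | fst x > 0 \<and> snd x > 0 \<and> fst x ^ k * snd x = Suc n. F z x) holomorphic_on strip"
  proof (rule holomorphic_on_suminf[OF open_strip])
    have "strip \<subseteq> {z. - real k < Re z \<and> Re z < real k}" using k by auto
    then have "(\<lambda>z. J z c) holomorphic_on strip" for c
      using J_holomorphic holomorphic_on_subset by blast
    then show "(\<lambda>z. \<Sum>x | fst x > 0 \<and> snd x > 0 \<and> fst x ^ k * snd x = Suc n. F z x) holomorphic_on strip" for n
      unfolding F_def using k by (intro holomorphic_intros) auto
    fix z assume z: "z \<in> strip"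
    define r where "r = (Re z + 1) / 2"
    have r: "r > 0" using z by (simp add: r_def)
    obtain C where C: "C \<ge> 0" "\<And>w l m. norm w \<le> norm z + r \<Longrightarrow> -1 + r \<le> Re w \<Longrightarrow> Re w < real k \<Longrightarrow> l \<ge> 1 \<Longrightarrow> m \<ge> 1 \<Longrightarrow>
      norm (F w (l, m)) \<le> C * (real l powr (- (1 + r)) * real m powr (- 2))"
      using F_bound[OF r, of "norm z + r"] by blast
    define M0 where "M0 x = C * (real (fst x) powr (- (1 + r)) * real (snd x) powr (- 2))" for x :: "nat \<times> nat"
    have "M0 summable_on {1..} \<times> {1..}"
      unfolding M0_def[abs_def] using r by (intro summable_on_cmult_right summable_on_powr_product) auto
    moreover have "norm (complex_of_real (M0 x)) = M0 x" for x
      unfolding norm_of_real using C(1) by (simp add: M0_def)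
    \<comment> \<open>The real majorant is embedded into the complex numbers because
      \<open>sum_power_regroup\<close> is stated there.\<close>
    ultimately have "(\<lambda>x. norm (complex_of_real (M0 x))) summable_on {1..} \<times> {1..}"
      by (simp only:)
    from sum_power_regroup(1)[OF k this]
    have "summable (\<lambda>n. \<Sum>x | fst x > 0 \<and> snd x > 0 \<and> fst x ^ k * snd x = Suc n. complex_of_real (M0 x))"
      by (rule sums_summable)
    then have sM: "summable (\<lambda>n. \<Sum>x | fst x > 0 \<and> snd x > 0 \<and> fst x ^ k * snd x = Suc n. M0 x)"
      by (simp only: of_real_sum[symmetric] summable_complex_of_real)
    have "norm (\<Sum>x | fst x > 0 \<and> snd x > 0 \<and> fst x ^ k * snd x = Suc n. F w x) \<le> (\<Sum>x | fst x > 0 \<and> snd x > 0 \<and> fst x ^ k * snd x = Suc n. M0 x)"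
      if w: "w \<in> cball z r \<inter> strip" for n w
    proof (rule sum_norm_le)
      fix x assume "x \<in> {x. fst x > 0 \<and> snd x > 0 \<and> fst x ^ k * snd x = Suc n}"
      moreover have "-1 + r \<le> Re w" using cball_Re_ge[of w z r] w by (simp add: r_def field_simps)
      moreover have "norm w \<le> norm z + r" using w norm_triangle_ineq2[of w z] by (auto simp: dist_norm norm_minus_commute)
      ultimately show "norm (F w x) \<le> M0 x"
        using C(2)[of w "fst x" "snd x"] w by (auto simp: M0_def)
    qed
    then show "\<exists>r>0. \<exists>M. summable M \<and> (\<forall>n. \<forall>w\<in>cball z r \<inter> strip.
        norm (\<Sum>x | fst x > 0 \<and> snd x > 0 \<and> fst x ^ k * snd x = Suc n. F w x) \<le> M n)"
      using r sM by blast
  qed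
  then show ?thesis by (rule holomorphic_transform) (rule G_eq_suminf[symmetric])
qed

section \<open>The terms singular at z = k - 1\<close>

lemma mellin_f_derivative:
  assumes "0 < Re s"
  shows "(mellin f has_field_derivative integral {0<..} (\<lambda>t. f t * of_real t powr (s - 1) * of_real (ln t))) (at s)"
proof -
  define b where "b = nat \<lceil>Re s + 1\<rceil>"
  have b: "Re s < real b" unfolding b_def by linarith
  obtain C where C: "C \<ge> 0" "\<And>y. 0 < y \<Longrightarrow> norm (f y) \<le> C * two_powr 0 (- real b) y"
    using rapid_bound_ex[OF f_rapid, of b] by blast
  show ?thesis
    unfolding mellin_def[abs_def]
    by (rule mellin_has_derivative[OF rapid_continuous[OF f_rapid] C(2)]) (use assms b in auto)
qed

lemma mellin_f_holomorphic: "mellin f holomorphic_on {s. 0 < Re s}"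
proof -
  have "open {s. 0 < Re s}" by (intro open_Collect_less continuous_intros)
  then show ?thesis using mellin_f_derivative by (auto simp: holomorphic_on_open)
qed

abbreviation sk :: "complex \<Rightarrow> complex" where "sk z \<equiv> (1 + z) / of_nat k"

lemma Re_sk: "-1 < Re z \<Longrightarrow> 0 < Re (sk z)"
  using k by (simp add: Re_divide_of_nat)

text \<open>The two terms that may be singular at z = k - 1; everything else in the identity is
  holomorphic on the whole strip.\<close>

definition poles :: "complex \<Rightarrow> complex" where
  "poles z = riemann_zeta (of_nat k - z) * If + 1 / of_nat k * mellin f (sk z) * riemann_zeta (sk z)"

lemma sk_eq_1: "sk z = 1 \<longleftrightarrow> z = of_nat k - 1"
  using k by (auto simp: field_simps)

lemma poles_holomorphic: "poles holomorphic_on (strip - {of_nat k - 1})"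
proof -
  have 1: "(\<lambda>z. riemann_zeta (of_nat k - z)) holomorphic_on (strip - {of_nat k - 1})"
  proof -
    have "riemann_zeta \<circ> (\<lambda>z. of_nat k - z) holomorphic_on (strip - {of_nat k - 1})"
      by (rule holomorphic_on_compose_gen[OF _ riemann_zeta_holomorphic]) (auto intro!: holomorphic_intros simp: algebra_simps)
    then show ?thesis by (simp add: o_def)
  qed
  have 2: "(\<lambda>z. riemann_zeta (sk z)) holomorphic_on (strip - {of_nat k - 1})"
  proof -
    have "riemann_zeta \<circ> sk holomorphic_on (strip - {of_nat k - 1})"
    proof (rule holomorphic_on_compose_gen[OF _ riemann_zeta_holomorphic])
      show "sk holomorphic_on (strip - {of_nat k - 1})" by (intro holomorphic_intros) (use k in auto)
      show "sk ` (strip - {of_nat k - 1}) \<subseteq> - {1}" by (auto simp only: sk_eq_1 Compl_iff singleton_iff)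
    qed
    then show ?thesis by (simp add: o_def)
  qed
  have 3: "(\<lambda>z. mellin f (sk z)) holomorphic_on (strip - {of_nat k - 1})"
  proof -
    have "mellin f \<circ> sk holomorphic_on (strip - {of_nat k - 1})"
    proof (rule holomorphic_on_compose_gen[OF _ mellin_f_holomorphic])
      show "sk holomorphic_on (strip - {of_nat k - 1})" by (intro holomorphic_intros) (use k in auto)
      show "sk ` (strip - {of_nat k - 1}) \<subseteq> {s. 0 < Re s}" using Re_sk by blast
    qed
    then show ?thesis by (simp add: o_def)
  qed
  show ?thesis unfolding poles_def[abs_def] by (intro holomorphic_intros 1 2 3)
qed

lemma zeta_minus_holomorphic: "(\<lambda>z. riemann_zeta (- z)) holomorphic_on strip"
proof -
  have "riemann_zeta \<circ> uminus holomorphic_on strip"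
    by (rule holomorphic_on_compose_gen[OF _ riemann_zeta_holomorphic]) (auto intro!: holomorphic_intros dest: arg_cong[of _ _ Re])
  then show ?thesis by (simp add: o_def)
qed

lemma voronoi_identity:
  assumes "z \<in> strip" "z \<noteq> of_nat k - 1"
  shows "Lsum z = poles z - 1 / 2 * riemann_zeta (- z) * f 0 + 2 * G z"
proof (rule analytic_continuation_open[where f = Lsum and g = "\<lambda>z. poles z - 1 / 2 * riemann_zeta (- z) * f 0 + 2 * G z"
      and z = z and s = "{z. -1 < Re z \<and> Re z < 0}" and s' = "strip - {of_nat k - 1}"])
  show "open {z. -1 < Re z \<and> Re z < 0}" by (intro open_Collect_conj open_Collect_less continuous_intros)
  show "open (strip - {of_nat k - 1})" by (intro open_delete open_strip)
  have "- (1 / 2) \<in> {z. -1 < Re z \<and> Re z < 0}" by simp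
  then show "{z. -1 < Re z \<and> Re z < 0} \<noteq> {}" by blast
  have "strip = {z. Re z > -1} \<inter> {z. Re z < real k}" by auto
  then have "convex strip" by (simp only:) (intro convex_Int convex_halfspace_Re_gt convex_halfspace_Re_lt)
  then show "connected (strip - {of_nat k - 1})"
    by (intro connected_open_delete convex_connected open_strip) auto
  show "{z. -1 < Re z \<and> Re z < 0} \<subseteq> strip - {of_nat k - 1}" using k by auto
  show "Lsum holomorphic_on (strip - {of_nat k - 1})"
    by (rule holomorphic_on_subset[OF Lsum_holomorphic]) auto
  have "G holomorphic_on (strip - {of_nat k - 1})" "(\<lambda>z. riemann_zeta (- z)) holomorphic_on (strip - {of_nat k - 1})"
    by (rule holomorphic_on_subset[OF G_holomorphic] holomorphic_on_subset[OF zeta_minus_holomorphic]; auto)+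
  then show "(\<lambda>z. poles z - 1 / 2 * riemann_zeta (- z) * f 0 + 2 * G z) holomorphic_on (strip - {of_nat k - 1})"
    by (intro holomorphic_intros poles_holomorphic)
  fix z assume "z \<in> {z. -1 < Re z \<and> Re z < 0}"
  then show "Lsum z = poles z - 1 / 2 * riemann_zeta (- z) * f 0 + 2 * G z"
    using base_identity[of z] by (simp add: poles_def)
qed (use assms in auto)

text \<open>With s = (1+z)/k one has k - z - 1 = -k (s - 1), and the Mellin transform at 1 is the
  integral of \<open>f\<close>. So the two polar parts combine to the difference quotient (F(s) -
  F(1))/(s - 1) divided by k, whose limit is the integral of f(t) ln t over k; the regular parts
  contribute Euler's constant twice.\<close>

lemma poles_tendsto:
  "(poles \<longlongrightarrow> (euler_mascheroni * If + (1 / of_nat k) * (euler_mascheroni * If + integral {0<..} (\<lambda>t. f t * of_real (ln t)))))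
     (at (of_nat k - 1))"
proof -
  have k0: "of_nat k \<noteq> (0 :: complex)" using k by simp
  define z1 :: complex where "z1 = of_nat k - 1"
  have z1: "z1 \<in> strip" using k by (simp add: z1_def)
  have sk1: "sk z1 = 1" using sk_eq_1[of z1] by (simp add: z1_def)
  have m1: "mellin f 1 = If" by (simp add: mellin_def) (rule integral_cong, auto)
  have etac: "isCont zeta_eta 1"
    using holomorphic_on_imp_continuous_on[OF zeta_eta_holomorphic]
    by (intro continuous_on_interior[of "{s. Re s > 0}"]) (auto simp: interior_open open_halfspace_Re_gt)
  have skt: "(sk \<longlongrightarrow> 1) (at z1)"
    using tendsto_divide[OF tendsto_add[OF tendsto_const tendsto_ident_at] tendsto_const k0, of 1 z1 UNIV] sk1 by simp
  have ev: "\<forall>\<^sub>F z in at z1. z \<in> strip - {z1}"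
    using eventually_at_in_open[OF open_strip z1] .
  have "\<forall>\<^sub>F z in at z1. sk z \<noteq> 1"
    using ev by eventually_elim (use sk_eq_1 in \<open>auto simp: z1_def\<close>)
  with skt have skf: "filterlim sk (at 1) (at z1)" by (simp add: filterlim_at)
  have ln: "integral {0<..} (\<lambda>t. f t * of_real t powr (1 - 1) * of_real (ln t)) = integral {0<..} (\<lambda>t. f t * of_real (ln t))"
    by (rule integral_cong) auto
  have "((\<lambda>s. (mellin f s - mellin f 1) / (s - 1)) \<longlongrightarrow> integral {0<..} (\<lambda>t. f t * of_real (ln t))) (at 1)"
    using mellin_f_derivative[of 1] unfolding ln by (simp add: has_field_derivative_iff)
  from filterlim_compose[OF this skf]
  have L1: "((\<lambda>z. (mellin f (sk z) - If) / (sk z - 1)) \<longlongrightarrow> integral {0<..} (\<lambda>t. f t * of_real (ln t))) (at z1)" by (simp add: m1)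
  have "isCont (mellin f) 1" using mellin_f_derivative[of 1] by (intro DERIV_isCont) auto
  then have L2: "((\<lambda>z. mellin f (sk z)) \<longlongrightarrow> If) (at z1)"
    using isCont_tendsto_compose[OF _ skt] m1 by fastforce
  have L3: "((\<lambda>z. zeta_eta (sk z)) \<longlongrightarrow> euler_mascheroni) (at z1)"
    using isCont_tendsto_compose[OF etac skt] by (simp add: zeta_eta_1)
  have "((\<lambda>z. of_nat k - z) \<longlongrightarrow> of_nat k - z1) (at z1)" by (intro tendsto_intros)
  then have "((\<lambda>z. of_nat k - z) \<longlongrightarrow> 1) (at z1)" by (simp add: z1_def)
  from isCont_tendsto_compose[OF etac this]
  have L4: "((\<lambda>z. zeta_eta (of_nat k - z)) \<longlongrightarrow> euler_mascheroni) (at z1)" by (simp add: zeta_eta_1)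
  have "((\<lambda>z. zeta_eta (of_nat k - z) * If + (1 / of_nat k) * (zeta_eta (sk z) * mellin f (sk z) + (mellin f (sk z) - If) / (sk z - 1)))
     \<longlongrightarrow> euler_mascheroni * If + (1 / of_nat k) * (euler_mascheroni * If + integral {0<..} (\<lambda>t. f t * of_real (ln t)))) (at z1)"
    by (intro tendsto_intros L1 L2 L3 L4)
  then show ?thesis
    unfolding z1_def[symmetric]
  proof (rule Lim_transform_eventually)
    show "\<forall>\<^sub>F z in at z1. zeta_eta (of_nat k - z) * If + (1 / of_nat k) * (zeta_eta (sk z) * mellin f (sk z) + (mellin f (sk z) - If) / (sk z - 1)) = poles z"
      using ev
    proof eventually_elim
      case (elim z)
      then have z: "-1 < Re z" "Re z < real k" "z \<noteq> of_nat k - 1" by (auto simp: z1_def)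
      have a: "riemann_zeta (of_nat k - z) = zeta_eta (of_nat k - z) + 1 / (of_nat k - z - 1)"
        using z by (intro riemann_zeta_eq) (auto simp: algebra_simps)
      have b: "riemann_zeta (sk z) = zeta_eta (sk z) + 1 / (sk z - 1)"
        using z Re_sk sk_eq_1 by (intro riemann_zeta_eq) auto
      have w: "of_nat k - z - 1 = - (of_nat k * (sk z - 1))" proof -
        have "of_nat k * sk z = 1 + z" using k0 by simp
        then show ?thesis by (simp only: right_diff_distrib) simp
      qed
      define w where "w = sk z - 1"
      have c: "1 / (- (of_nat k * w)) = - (1 / of_nat k) * (1 / w)" by simp
      show ?case unfolding poles_def a b w w_def[symmetric] c
        by (simp add: algebra_simps diff_divide_distrib add_divide_distrib)
    qed
  qed
qed

lemma voronoi_identity_double_pole: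
  defines "z1 \<equiv> of_nat k - 1"
  shows "Lsum z1 = euler_mascheroni * If + (1 / of_nat k) * (euler_mascheroni * If + integral {0<..} (\<lambda>t. f t * of_real (ln t)))
     - 1 / 2 * riemann_zeta (- z1) * f 0 + 2 * G z1"
proof -
  have z1: "z1 \<in> strip" using k by (simp add: z1_def)
  have ct: "(g \<longlongrightarrow> g z1) (at z1)" if "g holomorphic_on strip" for g
    using continuous_on_interior[OF holomorphic_on_imp_continuous_on[OF that], of z1] z1 open_strip
    by (simp add: interior_open isCont_def)
  have "((\<lambda>z. poles z - 1 / 2 * riemann_zeta (- z) * f 0 + 2 * G z) \<longlongrightarrow>
    euler_mascheroni * If + (1 / of_nat k) * (euler_mascheroni * If + integral {0<..} (\<lambda>t. f t * of_real (ln t)))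
     - 1 / 2 * riemann_zeta (- z1) * f 0 + 2 * G z1) (at z1)"
    using ct[OF G_holomorphic] ct[OF zeta_minus_holomorphic]
    by (intro tendsto_intros poles_tendsto[folded z1_def]) auto
  moreover have "\<forall>\<^sub>F z in at z1. poles z - 1 / 2 * riemann_zeta (- z) * f 0 + 2 * G z = Lsum z"
    using eventually_at_in_open[OF open_strip z1] by eventually_elim (use voronoi_identity in \<open>auto simp: z1_def\<close>)
  ultimately have "(Lsum \<longlongrightarrow> euler_mascheroni * If + (1 / of_nat k) * (euler_mascheroni * If + integral {0<..} (\<lambda>t. f t * of_real (ln t)))
     - 1 / 2 * riemann_zeta (- z1) * f 0 + 2 * G z1) (at z1)"
    by (rule Lim_transform_eventually)
  with ct[OF Lsum_holomorphic] show ?thesis using tendsto_unique[of "at z1"] by auto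
qed

end

section \<open>The conditionally convergent kernel integral\<close>

locale voronoi_kernel =
  fixes k :: nat and z :: complex and lam :: real
  assumes k: "k \<ge> 1" and z: "-1 < Re z" "Re z < real k" and lam: "0 < lam"
begin

text \<open>The frequency \<open>c\<close> will be 2 pi y with y the variable of \<open>f\<close>,
  while \<open>lam\<close> is 2 pi n^(1/k) and stays fixed. A dilation of t carries this integrand
  to that of \<open>kernel_H\<close>.\<close>

definition g :: "real \<Rightarrow> real \<Rightarrow> complex" where
  "g c t = of_real t powr (z - of_nat k) * of_real (cos (lam * t)) * of_real (cos (c * t powr (- real k)))"

lemma g_continuous: "continuous_on {0<..} (g c)"
  unfolding g_def by (intro continuous_intros) (auto simp: complex_nonpos_Reals_iff)

text \<open>The integration by parts near 0 produces a factor 1/c. By |sin x| <= x^eps, valid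
  because eps <= 1, it improves to c^(eps-1), integrable at c = 0; the cost t^(-k eps) is harmless
  at t = 0 because k eps < Re z + 1.\<close>

definition eps :: real where "eps = min 1 ((Re z + 1) / (2 * real k))"

lemma eps: "0 < eps" "eps \<le> 1" "real k * eps < Re z + 1"
proof -
  show "0 < eps" "eps \<le> 1" using z k by (auto simp: eps_def)
  have "real k * eps \<le> real k * ((Re z + 1) / (2 * real k))" by (intro mult_left_mono) (auto simp: eps_def)
  also have "\<dots> = (Re z + 1) / 2" using k by simp
  finally have "real k * eps \<le> (Re z + 1) / 2" .
  moreover have "(Re z + 1) / 2 < Re z + 1" using z by simp
  ultimately show "real k * eps < Re z + 1" by (rule le_less_trans)
qed

lemma abs_sin_le_powr: "0 < x \<Longrightarrow> \<bar>sin x\<bar> \<le> x powr eps" for x :: real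
proof (cases "x \<le> 1")
  case True
  assume x: "0 < x"
  have "\<bar>sin x\<bar> \<le> x powr 1" using abs_sin_x_le_abs_x[of x] x by simp
  also have "\<dots> \<le> x powr eps" using True x eps by (intro powr_mono') auto
  finally show ?thesis .
next
  case False
  have "1 \<le> x powr eps" using False eps by (intro ge_one_powr_ge_zero) auto
  then show ?thesis using abs_sin_le_one[of x] by linarith
qed

lemma abs_sin_le_powr_scaled:
  assumes "0 < c" "0 < t" shows "\<bar>sin (c * t powr (- real k))\<bar> \<le> c powr eps * t powr (- real k * eps)"
  using abs_sin_le_powr[of "c * t powr (- real k)"] assms by (simp add: powr_mult powr_powr)

text \<open>The derivative of t^(z+1) cos(lam t). That function remains when t^(-k-1) cos(c t^(-k))
  is recognised as -1/(c k) times the derivative of sin(c t^(-k)).\<close>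

definition u' :: "real \<Rightarrow> complex" where
  "u' t = (z + 1) * of_real t powr z * of_real (cos (lam * t)) + of_real t powr (z + 1) * of_real (- lam * sin (lam * t))"

text \<open>Both ends of the kernel integral converge only conditionally: near \<open>0\<close> one integrates
  \<open>cos (c t\<^sup>-\<^sup>k)\<close> by parts, near \<open>\<infinity>\<close> the factor \<open>cos (lam t)\<close>.\<close>

definition r0 :: "real \<Rightarrow> real \<Rightarrow> complex" where
  "r0 c t = of_real (1 / (c * real k)) * (u' t * of_real (sin (c * t powr (- real k))))"

definition Q0 :: "real \<Rightarrow> real \<Rightarrow> complex" where
  "Q0 c t = - (of_real (1 / (c * real k)) * (of_real t powr (z + 1) * of_real (cos (lam * t)) * of_real (sin (c * t powr (- real k)))))"

lemma sin_scaled_deriv: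
  assumes "0 < t"
  shows "((\<lambda>t. complex_of_real (sin (c * t powr (- real k)))) has_vector_derivative
      of_real (- c * real k * t powr (- real k - 1) * cos (c * t powr (- real k)))) (at t)"
    and "((\<lambda>t. complex_of_real (cos (c * t powr (- real k)))) has_vector_derivative
      of_real (c * real k * t powr (- real k - 1) * sin (c * t powr (- real k)))) (at t)"
  using assms by (intro has_vector_derivative_of_real; auto intro!: derivative_eq_intros)+

lemma powr_real_mult:
  assumes "0 < t" shows "complex_of_real t powr (z + 1) * of_real (t powr (- real k - 1)) = of_real t powr (z - of_nat k)"
proof -
  have "complex_of_real (t powr (- real k - 1)) = of_real t powr (- of_nat k - 1)"
    using powr_of_real[of t "- real k - 1"] assms by simp
  then have "complex_of_real t powr (z + 1) * of_real (t powr (- real k - 1)) = of_real t powr ((z + 1) + (- of_nat k - 1))"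
    by (simp only: powr_add)
  then show ?thesis by simp
qed

lemma Q0_deriv:
  assumes c: "0 < c" and t: "0 < t"
  shows "(Q0 c has_vector_derivative g c t - r0 c t) (at t)"
proof -
  let ?S = "\<lambda>t. complex_of_real (sin (c * t powr (- real k)))" and ?C = "complex_of_real (cos (c * t powr (- real k)))"
  have ck: "c * real k \<noteq> 0" using c k by simp
  have "((\<lambda>t. complex_of_real t powr (z + 1)) has_vector_derivative (z + 1) * of_real t powr (z + 1 - 1)) (at t)"
    by (rule has_vector_derivative_powr_real[OF t])
  from has_vector_derivative_mult[OF this has_vector_derivative_cos_real(1)]
  have "((\<lambda>t. of_real t powr (z + 1) * of_real (cos (lam * t))) has_vector_derivative u' t) (at t)"
    by (rule has_vector_derivative_eq_rhs) (simp add: u'_def)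
  from has_vector_derivative_mult[OF this sin_scaled_deriv(1)[OF t, of c]]
  have "(Q0 c has_vector_derivative - (of_real (1 / (c * real k)) *
      (of_real t powr (z + 1) * of_real (cos (lam * t)) * of_real (- c * real k * t powr (- real k - 1) * cos (c * t powr (- real k))) + u' t * ?S t))) (at t)"
    unfolding Q0_def[abs_def] by (intro has_vector_derivative_minus has_vector_derivative_mult_right)
  moreover have "- (of_real (1 / (c * real k)) *
      (of_real t powr (z + 1) * of_real (cos (lam * t)) * of_real (- c * real k * t powr (- real k - 1) * cos (c * t powr (- real k))) + u' t * ?S t))
      = g c t - r0 c t"
  proof -
    have "of_real (- c * real k * t powr (- real k - 1) * cos (c * t powr (- real k))) = - (of_real (c * real k) * (of_real (t powr (- real k - 1)) * ?C))"
      by simp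
    moreover have "g c t = (of_real t powr (z + 1) * of_real (t powr (- real k - 1))) * of_real (cos (lam * t)) * ?C"
      unfolding g_def powr_real_mult[OF t] ..
    moreover have "complex_of_real (1 / (c * real k)) * of_real (c * real k) = 1"
      using ck by (simp flip: of_real_mult)
    ultimately show ?thesis unfolding r0_def by algebra
  qed
  ultimately show ?thesis by simp
qed

definition K0 :: real where "K0 = (norm (z + 1) + lam) / real k"

lemma r0_bound:
  assumes c: "0 < c" and t: "0 < t" "t \<le> 1"
  shows "norm (r0 c t) \<le> K0 * c powr (eps - 1) * t powr (Re z - real k * eps)"
proof -
  have "norm (u' t) \<le> norm (z + 1) * t powr Re z * 1 + t powr (Re z + 1) * lam"
    unfolding u'_def
  proof (rule order_trans[OF norm_triangle_ineq], rule add_mono)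
    show "norm ((z + 1) * of_real t powr z * of_real (cos (lam * t))) \<le> norm (z + 1) * t powr Re z * 1"
      unfolding norm_mult norm_powr_real[OF t(1)] by (intro mult_left_mono) auto
    show "norm (of_real t powr (z + 1) * of_real (- lam * sin (lam * t))) \<le> t powr (Re z + 1) * lam"
      unfolding norm_mult norm_powr_real[OF t(1)] using lam by (auto intro!: mult_left_mono mult_left_le simp: norm_mult)
  qed
  also have "\<dots> \<le> norm (z + 1) * t powr Re z * 1 + t powr Re z * lam"
    using t lam by (intro add_mono mult_right_mono powr_mono') auto
  also have "\<dots> = (norm (z + 1) + lam) * t powr Re z" by (simp add: algebra_simps)
  finally have u: "norm (u' t) \<le> (norm (z + 1) + lam) * t powr Re z" .
  have "norm (r0 c t) = 1 / (c * real k) * (norm (u' t) * \<bar>sin (c * t powr (- real k))\<bar>)"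
    using c k by (simp add: r0_def norm_mult norm_divide)
  also have "\<dots> \<le> 1 / (c * real k) * (((norm (z + 1) + lam) * t powr Re z) * (c powr eps * t powr (- real k * eps)))"
    using c t k lam by (intro mult_left_mono mult_mono u abs_sin_le_powr_scaled) auto
  also have "\<dots> = K0 * (c powr eps / c) * (t powr Re z * t powr (- real k * eps))"
    by (simp add: K0_def mult_ac)
  also have "c powr eps / c = c powr (eps - 1)" using c by (simp add: powr_diff)
  also have "t powr Re z * t powr (- real k * eps) = t powr (Re z - real k * eps)" by (simp flip: powr_add)
  finally show ?thesis .
qed

lemma Q0_bound:
  assumes c: "0 < c" and t: "0 < t"
  shows "norm (Q0 c t) \<le> c powr (eps - 1) / real k * t powr (Re z + 1 - real k * eps)"
proof -
  have "norm (Q0 c t) = 1 / (c * real k) * (t powr (Re z + 1) * \<bar>cos (lam * t)\<bar> * \<bar>sin (c * t powr (- real k))\<bar>)"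
    using c k t by (simp add: Q0_def norm_mult norm_divide norm_powr_real)
  also have "\<dots> \<le> 1 / (c * real k) * (t powr (Re z + 1) * 1 * (c powr eps * t powr (- real k * eps)))"
    using c t k by (intro mult_left_mono mult_mono abs_sin_le_powr_scaled) auto
  also have "\<dots> = (c powr eps / c) / real k * (t powr (Re z + 1) * t powr (- real k * eps))" by simp
  also have "c powr eps / c = c powr (eps - 1)" using c by (simp add: powr_diff)
  also have "t powr (Re z + 1) * t powr (- real k * eps) = t powr (Re z + 1 - real k * eps)" by (simp flip: powr_add)
  finally show ?thesis .
qed

lemma r0_continuous: "continuous_on {0<..} (r0 c)"
  unfolding r0_def u'_def by (intro continuous_intros) (auto simp: complex_nonpos_Reals_iff)

lemma r0_integrable:
  assumes c: "0 < c"
  shows "r0 c absolutely_integrable_on {0<..1}"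
    and "integral {0<..1} (\<lambda>t. norm (r0 c t)) \<le> K0 * c powr (eps - 1) * (1 / (Re z - real k * eps + 1))"
proof -
  let ?e = "Re z - real k * eps"
  have hi0: "((\<lambda>t. t powr ?e) has_integral (1 powr (?e + 1) / (?e + 1))) {0..1}"
    using eps by (intro has_integral_powr_from_0) auto
  have "((\<lambda>t. t powr ?e) has_integral (1 / (?e + 1))) {0<..1}"
    using hi0 by (subst has_integral_spike_set_eq[of _ "{0..1}"]) (auto intro: negligible_subset[of "{0}"])
  then have hi: "((\<lambda>t. K0 * c powr (eps - 1) * t powr ?e) has_integral K0 * c powr (eps - 1) * (1 / (?e + 1))) {0<..1}"
    by (rule has_integral_mult_right)
  have "r0 c \<in> borel_measurable (lebesgue_on {0<..1})"
    by (intro continuous_imp_measurable_on_sets_lebesgue continuous_on_subset[OF r0_continuous]) auto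
  then show ai: "r0 c absolutely_integrable_on {0<..1}"
    by (rule measurable_bounded_by_integrable_imp_absolutely_integrable[OF _ _ has_integral_integrable[OF hi]])
      (use r0_bound[OF c] in auto)
  show "integral {0<..1} (\<lambda>t. norm (r0 c t)) \<le> K0 * c powr (eps - 1) * (1 / (?e + 1))"
    unfolding integral_unique[OF hi, symmetric]
    using ai has_integral_integrable[OF hi] r0_bound[OF c]
    by (intro integral_le) (auto simp: absolutely_integrable_on_def)
qed

lemma near_eq:
  assumes c: "0 < c" and a: "0 < a" "a \<le> 1"
  shows "integral {a..1} (g c) = Q0 c 1 - Q0 c a + integral {a..1} (r0 c)"
proof -
  have "((\<lambda>t. g c t - r0 c t) has_integral Q0 c 1 - Q0 c a) {a..1}"
    using a by (intro fundamental_theorem_of_calculus has_vector_derivative_at_within[OF Q0_deriv[OF c]]) auto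
  moreover have "(r0 c has_integral integral {a..1} (r0 c)) {a..1}"
    using a by (intro integrable_integral integrable_continuous_interval continuous_on_subset[OF r0_continuous]) auto
  ultimately have "((\<lambda>t. g c t - r0 c t + r0 c t) has_integral Q0 c 1 - Q0 c a + integral {a..1} (r0 c)) {a..1}"
    by (rule has_integral_add)
  then show ?thesis by (simp add: integral_unique)
qed

text \<open>What the integration by parts at infinity leaves: the derivative of t^(z-k) cos(c
  t^(-k)) times sin(lam t)/lam. It gains one power of t over \<open>g\<close>.\<close>

definition r1 :: "real \<Rightarrow> real \<Rightarrow> complex" where
  "r1 c t = ((z - of_nat k) * of_real t powr (z - of_nat k - 1) * of_real (cos (c * t powr (- real k))) +
     of_real t powr (z - of_nat k) * of_real (c * real k * t powr (- real k - 1) * sin (c * t powr (- real k)))) * of_real (sin (lam * t) / lam)"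

definition Q1 :: "real \<Rightarrow> real \<Rightarrow> complex" where
  "Q1 c t = of_real t powr (z - of_nat k) * of_real (cos (c * t powr (- real k))) * of_real (sin (lam * t) / lam)"

lemma Q1_deriv:
  assumes t: "0 < t"
  shows "(Q1 c has_vector_derivative g c t + r1 c t) (at t)"
proof -
  have s: "((\<lambda>t. complex_of_real (sin (lam * t) / lam)) has_vector_derivative of_real (cos (lam * t))) (at t)"
    using lam by (intro has_vector_derivative_of_real) (auto intro!: derivative_eq_intros)
  from has_vector_derivative_mult[OF has_vector_derivative_mult[OF has_vector_derivative_powr_real[OF t, of "z - of_nat k"] sin_scaled_deriv(2)[OF t, of c]] s]
  show ?thesis unfolding Q1_def[abs_def]
    by (rule has_vector_derivative_eq_rhs) (simp add: g_def r1_def algebra_simps)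
qed

definition K1 :: "real \<Rightarrow> real" where "K1 c = (norm (z - of_nat k) + c * real k) / lam"

lemma r1_bound:
  assumes c: "0 < c" and t: "1 \<le> t"
  shows "norm (r1 c t) \<le> K1 c * t powr (Re z - real k - 1)"
proof -
  have t0: "0 < t" using t by simp
  let ?a = "(z - of_nat k) * of_real t powr (z - of_nat k - 1) * of_real (cos (c * t powr (- real k)))"
  let ?b = "of_real t powr (z - of_nat k) * of_real (c * real k * t powr (- real k - 1) * sin (c * t powr (- real k)))"
  have 1: "norm ?a \<le> norm (z - of_nat k) * t powr (Re z - real k - 1) * 1"
    unfolding norm_mult norm_powr_real[OF t0] by (intro mult_mono) auto
  have "norm ?b \<le> t powr (Re z - real k) * (c * real k * t powr (- real k - 1) * 1)"
    unfolding norm_mult norm_powr_real[OF t0] norm_of_real abs_mult using c t0 by (intro mult_mono) auto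
  also have "\<dots> = c * real k * (t powr (Re z - real k) * t powr (- real k - 1))" by simp
  also have "t powr (Re z - real k) * t powr (- real k - 1) \<le> t powr (Re z - real k - 1)"
    unfolding powr_add[symmetric] using t by (intro powr_mono) auto
  finally have 2: "norm ?b \<le> c * real k * t powr (Re z - real k - 1)" using c by (simp add: mult_left_mono)
  have "norm (r1 c t) = norm (?a + ?b) * (\<bar>sin (lam * t)\<bar> / lam)"
    unfolding r1_def norm_mult[of "?a + ?b"] using lam by (simp add: norm_divide)
  also have "\<dots> \<le> (norm ?a + norm ?b) * (1 / lam)"
    using lam by (intro mult_mono norm_triangle_ineq divide_right_mono) auto
  also have "\<dots> \<le> (norm (z - of_nat k) * t powr (Re z - real k - 1) * 1 + c * real k * t powr (Re z - real k - 1)) * (1 / lam)"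
    using lam by (intro mult_right_mono add_mono 1 2) auto
  also have "\<dots> = K1 c * t powr (Re z - real k - 1)" by (simp add: K1_def algebra_simps add_divide_distrib)
  finally show ?thesis .
qed

lemma Q1_bound:
  assumes t: "0 < t" shows "norm (Q1 c t) \<le> t powr (Re z - real k) / lam"
proof -
  have "norm (Q1 c t) = t powr (Re z - real k) * \<bar>cos (c * t powr (- real k))\<bar> * (\<bar>sin (lam * t)\<bar> / lam)"
    using lam t by (simp add: Q1_def norm_mult norm_divide norm_powr_real)
  also have "\<dots> \<le> t powr (Re z - real k) * 1 * (1 / lam)"
    using lam by (intro mult_mono divide_right_mono) auto
  finally show ?thesis by simp
qed

lemma r1_continuous: "continuous_on {0<..} (r1 c)"
  unfolding r1_def using lam by (intro continuous_intros) (auto simp: complex_nonpos_Reals_iff)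

lemma r1_integrable:
  assumes c: "0 < c"
  shows "r1 c absolutely_integrable_on {1..}"
    and "integral {1..} (\<lambda>t. norm (r1 c t)) \<le> K1 c * (1 / (real k - Re z))"
proof -
  let ?e = "Re z - real k - 1"
  have "((\<lambda>t. t powr ?e) has_integral - (1 powr (?e + 1)) / (?e + 1)) {1..}"
    using z by (intro has_integral_powr_to_inf) auto
  moreover have "- (1 powr (?e + 1)) / (?e + 1) = 1 / (real k - Re z)"
    using minus_divide_right[of 1 "Re z - real k"] by simp
  ultimately have "((\<lambda>t. t powr ?e) has_integral 1 / (real k - Re z)) {1..}" by (simp only:)
  then have hi: "((\<lambda>t. K1 c * t powr ?e) has_integral K1 c * (1 / (real k - Re z))) {1..}"
    by (rule has_integral_mult_right)
  have "r1 c \<in> borel_measurable (lebesgue_on {1..})"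
    by (intro continuous_imp_measurable_on_sets_lebesgue continuous_on_subset[OF r1_continuous]) auto
  then show ai: "r1 c absolutely_integrable_on {1..}"
    by (rule measurable_bounded_by_integrable_imp_absolutely_integrable[OF _ _ has_integral_integrable[OF hi]])
      (use r1_bound[OF c] in auto)
  show "integral {1..} (\<lambda>t. norm (r1 c t)) \<le> K1 c * (1 / (real k - Re z))"
    unfolding integral_unique[OF hi, symmetric]
    using ai has_integral_integrable[OF hi] r1_bound[OF c]
    by (intro integral_le) (auto simp: absolutely_integrable_on_def)
qed

lemma far_eq:
  assumes b: "1 \<le> b"
  shows "integral {1..b} (g c) = Q1 c b - Q1 c 1 - integral {1..b} (r1 c)"
proof -
  have "((\<lambda>t. g c t + r1 c t) has_integral Q1 c b - Q1 c 1) {1..b}"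
    using b by (intro fundamental_theorem_of_calculus has_vector_derivative_at_within[OF Q1_deriv]) auto
  moreover have "(r1 c has_integral integral {1..b} (r1 c)) {1..b}"
    using b by (intro integrable_integral integrable_continuous_interval continuous_on_subset[OF r1_continuous]) auto
  ultimately have "((\<lambda>t. g c t + r1 c t - r1 c t) has_integral Q1 c b - Q1 c 1 - integral {1..b} (r1 c)) {1..b}"
    by (rule has_integral_diff)
  then show ?thesis by (simp add: integral_unique)
qed

text \<open>In \<open>near_eq\<close> and \<open>far_eq\<close> the moving boundary terms tend to 0,
  because k eps < Re z + 1 and Re z < k respectively, and the remainders are absolutely
  integrable.\<close>

lemma g_improper:
  assumes c: "0 < c"
  shows "\<exists>I. (g c has_integral I) {0<..}"
proof -
  have "((\<lambda>a. Q0 c a) \<longlongrightarrow> 0) (at_right 0)"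
  proof (rule Lim_null_comparison)
    show "\<forall>\<^sub>F a in at_right 0. norm (Q0 c a) \<le> c powr (eps - 1) / real k * a powr (Re z + 1 - real k * eps)"
      unfolding eventually_at using Q0_bound[OF c] by (intro exI[of _ 1]) auto
    have "((\<lambda>x::real. x powr (Re z + 1 - real k * eps)) \<longlongrightarrow> 0 powr (Re z + 1 - real k * eps)) (at_right 0)"
      using eps by (intro tendsto_intros) (auto simp: eventually_at intro!: exI[of _ 1])
    then have "((\<lambda>x::real. x powr (Re z + 1 - real k * eps)) \<longlongrightarrow> 0) (at_right 0)" by simp
    from tendsto_mult_right_zero[OF this]
    show "((\<lambda>a. c powr (eps - 1) / real k * a powr (Re z + 1 - real k * eps)) \<longlongrightarrow> 0) (at_right 0)" .
  qed
  then have "((\<lambda>a. Q0 c 1 - Q0 c a + integral {a..1} (r0 c)) \<longlongrightarrow> Q0 c 1 - 0 + integral {0<..1} (r0 c)) (at_right 0)"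
    using r0_integrable(1)[OF c]
    by (intro tendsto_intros integral_tendsto_at_right_Ioc) (auto simp: absolutely_integrable_on_def)
  then have 0: "((\<lambda>a. integral {a..1} (g c)) \<longlongrightarrow> Q0 c 1 - 0 + integral {0<..1} (r0 c)) (at_right 0)"
    by (rule Lim_transform_eventually) (auto simp: eventually_at near_eq[OF c] intro!: exI[of _ 1])
  have "((\<lambda>b. Q1 c b) \<longlongrightarrow> 0) at_top"
  proof (rule Lim_null_comparison)
    show "\<forall>\<^sub>F b in at_top. norm (Q1 c b) \<le> b powr (Re z - real k) * (1 / lam)"
      using eventually_gt_at_top[of 0] by eventually_elim (use Q1_bound in auto)
    have "((\<lambda>b::real. b powr (Re z - real k)) \<longlongrightarrow> 0) at_top" using z by (intro tendsto_neg_powr filterlim_ident) auto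
    from tendsto_mult_left_zero[OF this] show "((\<lambda>b. b powr (Re z - real k) * (1 / lam)) \<longlongrightarrow> 0) at_top" .
  qed
  then have "((\<lambda>b. Q1 c b - Q1 c 1 - integral {1..b} (r1 c)) \<longlongrightarrow> 0 - Q1 c 1 - integral {1..} (r1 c)) at_top"
    using r1_integrable(1)[OF c]
    by (intro tendsto_intros integral_tendsto_at_top_Ici) (auto simp: absolutely_integrable_on_def)
  then have 1: "((\<lambda>b. integral {1..b} (g c)) \<longlongrightarrow> 0 - Q1 c 1 - integral {1..} (r1 c)) at_top"
    by (rule Lim_transform_eventually) (auto simp: eventually_at_top_linorder far_eq intro!: exI[of _ 1])
  show ?thesis using improper_integral_Ioi[OF g_continuous 0 1] by blast
qed

definition I :: "real \<Rightarrow> complex" where "I c = integral {0<..} (g c)"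

lemma I: "0 < c \<Longrightarrow> (g c has_integral I c) {0<..}"
  using g_improper unfolding I_def by (auto simp: has_integral_iff)

definition trunc :: "nat \<Rightarrow> real \<Rightarrow> complex" where
  "trunc N c = integral {1 / real (Suc N)..real (Suc N)} (g c)"

end

lemma integral_trunc_tendsto:
  fixes g :: "real \<Rightarrow> 'a::euclidean_space"
  assumes "(g has_integral I) {0<..}" "continuous_on {0<..} g"
  shows "(\<lambda>N. integral {1 / real (Suc N)..real (Suc N)} g) \<longlonglongrightarrow> I"
proof -
  note sp = integrable_on_Ioi_split[OF assms]
  have 0: "filterlim (\<lambda>N. 1 / real (Suc N)) (at_right 0) sequentially"
    unfolding filterlim_at by (intro conjI always_eventually allI LIMSEQ_Suc[OF lim_1_over_n]) auto
  have "(\<lambda>N. integral {1 / real (Suc N)..1} g) \<longlonglongrightarrow> integral {0<..1} g"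
    by (rule filterlim_compose[OF integral_tendsto_at_right_Ioc[OF sp(1)] 0]) simp
  moreover have "(\<lambda>N. integral {1..real (Suc N)} g) \<longlonglongrightarrow> integral {1..} g"
    by (rule LIMSEQ_Suc[OF filterlim_compose[OF integral_tendsto_at_top_Ici[OF sp(2)] filterlim_real_sequentially]])
  ultimately have "(\<lambda>N. integral {1 / real (Suc N)..1} g + integral {1..real (Suc N)} g) \<longlonglongrightarrow> I"
    unfolding sp(3) by (rule tendsto_add)
  moreover have "integral {1 / real (Suc N)..1} g + integral {1..real (Suc N)} g = integral {1 / real (Suc N)..real (Suc N)} g" for N
  proof (rule Henstock_Kurzweil_Integration.integral_combine)
    show "g integrable_on {1 / real (Suc N)..real (Suc N)}"
      by (intro integrable_continuous_interval continuous_on_subset[OF assms(2)]) (auto intro: less_le_trans[of 0 "1 / real (Suc N)"])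
  qed auto
  ultimately show ?thesis by simp
qed

context voronoi_kernel
begin

lemma trunc_tendsto: "0 < c \<Longrightarrow> (\<lambda>N. trunc N c) \<longlonglongrightarrow> I c"
  unfolding trunc_def by (rule integral_trunc_tendsto[OF I g_continuous])

text \<open>The part on t <= 1 contributes c^(eps-1), the part on t >= 1 contributes 1 + c, both
  independently of N. Each is integrable against \<open>f\<close>, so this is the majorant for
  removing the truncation.\<close>

lemma trunc_bound:
  "\<exists>A B. \<forall>N c. 0 < c \<longrightarrow> norm (trunc N c) \<le> A * c powr (eps - 1) + B * (1 + c)"
proof -
  define A where "A = 2 / real k + K0 * (1 / (Re z - real k * eps + 1))"
  define B where "B = 2 / lam + max (norm (z - of_nat k)) (real k) / lam * (1 / (real k - Re z))"
  have b: "norm (trunc N c) \<le> A * c powr (eps - 1) + B * (1 + c)" if c: "0 < c" for N c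
  proof -
    let ?a = "1 / real (Suc N)" and ?b = "real (Suc N)"
    have a: "0 < ?a" "?a \<le> 1" "1 \<le> ?b" by auto
    have sub: "{?a..x} \<subseteq> {0<..x}" for x using less_le_trans[OF a(1)] by force
    have sub': "{?a..x} \<subseteq> {0<..}" for x using less_le_trans[OF a(1)] by force
    have "norm (integral {?a..1} (r0 c)) \<le> integral {?a..1} (\<lambda>t. norm (r0 c t))"
      by (intro integral_norm_le absolutely_integrable_continuous_real continuous_on_subset[OF r0_continuous sub'])
    also have "\<dots> \<le> integral {0<..1} (\<lambda>t. norm (r0 c t))"
      using r0_integrable(1)[OF c] a(1)
      by (intro integral_subset_le integrable_continuous_interval continuous_on_norm continuous_on_subset[OF r0_continuous sub'] sub)
        (auto simp: absolutely_integrable_on_def)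
    finally have r0: "norm (integral {?a..1} (r0 c)) \<le> K0 * c powr (eps - 1) * (1 / (Re z - real k * eps + 1))"
      using r0_integrable(2)[OF c] by linarith
    have Q0: "norm (Q0 c t) \<le> c powr (eps - 1) / real k" if "0 < t" "t \<le> 1" for t
    proof -
      have "norm (Q0 c t) \<le> c powr (eps - 1) / real k * t powr (Re z + 1 - real k * eps)" by (rule Q0_bound[OF c that(1)])
      also have "\<dots> \<le> c powr (eps - 1) / real k * 1"
        using that eps by (intro mult_left_mono powr_le1) auto
      finally show ?thesis by simp
    qed
    have near: "norm (integral {?a..1} (g c)) \<le> A * c powr (eps - 1)"
    proof -
      have "norm (integral {?a..1} (g c)) \<le> norm (Q0 c 1) + norm (Q0 c ?a) + norm (integral {?a..1} (r0 c))"
        unfolding near_eq[OF c a(1,2)]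
        by (intro order_trans[OF norm_triangle_ineq] add_mono norm_triangle_ineq4 order_refl)
      also have "\<dots> \<le> c powr (eps - 1) / real k + c powr (eps - 1) / real k + K0 * c powr (eps - 1) * (1 / (Re z - real k * eps + 1))"
        using a by (intro add_mono Q0 r0) auto
      also have "\<dots> = A * c powr (eps - 1)" by (simp add: A_def algebra_simps)
      finally show ?thesis .
    qed
    have "norm (integral {1..?b} (r1 c)) \<le> integral {1..?b} (\<lambda>t. norm (r1 c t))"
      by (intro integral_norm_le absolutely_integrable_continuous_real continuous_on_subset[OF r1_continuous]) auto
    also have "\<dots> \<le> integral {1..} (\<lambda>t. norm (r1 c t))"
      using r1_integrable(1)[OF c]
      by (intro integral_subset_le integrable_continuous_interval continuous_on_norm continuous_on_subset[OF r1_continuous])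
        (auto simp: absolutely_integrable_on_def)
    finally have r1: "norm (integral {1..?b} (r1 c)) \<le> K1 c * (1 / (real k - Re z))"
      using r1_integrable(2)[OF c] by linarith
    have K1: "K1 c * (1 / (real k - Re z)) \<le> max (norm (z - of_nat k)) (real k) / lam * (1 / (real k - Re z)) * (1 + c)"
    proof -
      have "norm (z - of_nat k) + c * real k \<le> max (norm (z - of_nat k)) (real k) * (1 + c)"
        using c by (simp add: distrib_left) (intro add_mono; simp add: mult.commute mult_right_mono)
      then have "K1 c \<le> max (norm (z - of_nat k)) (real k) * (1 + c) / lam" unfolding K1_def using lam by (intro divide_right_mono) auto
      then have "K1 c * (1 / (real k - Re z)) \<le> max (norm (z - of_nat k)) (real k) * (1 + c) / lam * (1 / (real k - Re z))"
        using z by (intro mult_right_mono) auto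
      then show ?thesis by (simp add: mult_ac)
    qed
    have Q1: "norm (Q1 c t) \<le> 1 / lam" if "1 \<le> t" for t
    proof -
      have "norm (Q1 c t) \<le> t powr (Re z - real k) / lam" using that by (intro Q1_bound) simp
      also have "t powr (Re z - real k) \<le> t powr 0" using that z by (intro powr_mono) auto
      finally show ?thesis using that lam by (simp add: divide_right_mono)
    qed
    have far: "norm (integral {1..?b} (g c)) \<le> B * (1 + c)"
    proof -
      have "norm (integral {1..?b} (g c)) \<le> norm (Q1 c ?b) + norm (Q1 c 1) + norm (integral {1..?b} (r1 c))"
        unfolding far_eq[OF a(3)]
        by (intro order_trans[OF norm_triangle_ineq4] add_mono norm_triangle_ineq4 order_refl)
      also have "\<dots> \<le> 1 / lam + 1 / lam + max (norm (z - of_nat k)) (real k) / lam * (1 / (real k - Re z)) * (1 + c)"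
        using r1 K1 by (intro add_mono Q1) auto
      also have "1 / lam + 1 / lam \<le> 2 / lam * (1 + c)" using c lam by (simp add: field_simps)
      finally show ?thesis by (simp add: B_def algebra_simps)
    qed
    have "trunc N c = integral {?a..1} (g c) + integral {1..?b} (g c)"
      unfolding trunc_def
    proof (rule Henstock_Kurzweil_Integration.integral_combine[symmetric])
      show "g c integrable_on {?a..?b}"
        by (intro integrable_continuous_interval continuous_on_subset[OF g_continuous sub'])
    qed auto
    then show ?thesis using near far norm_triangle_ineq[of "integral {?a..1} (g c)" "integral {1..?b} (g c)"] by simp
  qed
  then show ?thesis by blast
qed

text \<open>Dilating t by c^(1/k) normalises c t^(-k) to t^(-k) and moves c into the argument lam
  c^(1/k); the power of c is the Jacobian together with the factor from t^(z-k).\<close>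

lemma kernel_scaling:
  assumes c: "0 < c"
  shows "(kernel_H_integrand k z (lam * c powr (1 / real k)) has_integral of_real c powr (1 - (1 + z) / of_nat k) * I c) {0<..}"
proof -
  define d where "d = c powr (1 / real k)"
  have d: "d > 0" using c by (simp add: d_def)
  have dk: "d powr (- real k) = 1 / c"
    using c k by (simp add: d_def powr_powr powr_minus_divide)
  have cd: "complex_of_real c powr (1 - (1 + z) / of_nat k) = of_real d powr (of_nat k - z) / of_real d"
  proof -
    have "complex_of_real d powr (of_nat k - z - 1) = of_real c powr ((1 / of_nat k) * (of_nat k - z - 1))"
      using c by (simp add: d_def powr_def Ln_of_real exp_of_real[symmetric] mult_ac)
    also have "(1 / of_nat k) * (of_nat k - z - 1) = 1 - (1 + z) / of_nat k"
      using k by (simp add: diff_divide_distrib add_divide_distrib)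
    finally have "complex_of_real c powr (1 - (1 + z) / of_nat k) = complex_of_real d powr (of_nat k - z - 1)" ..
    also have "\<dots> = of_real d powr (of_nat k - z) / of_real d" using d by (simp add: powr_diff)
    finally show ?thesis .
  qed
  have "((\<lambda>t. of_real d powr (of_nat k - z) * g c (d * t)) has_integral of_real d powr (of_nat k - z) * (I c /\<^sub>R d)) {0<..}"
    by (intro has_integral_mult_right has_integral_scale_Ioi I g_continuous c d)
  moreover have "of_real d powr (of_nat k - z) * (I c /\<^sub>R d) = of_real c powr (1 - (1 + z) / of_nat k) * I c"
    unfolding cd by (simp add: scaleR_conv_of_real divide_inverse)
  ultimately have "((\<lambda>t. of_real d powr (of_nat k - z) * g c (d * t)) has_integral of_real c powr (1 - (1 + z) / of_nat k) * I c) {0<..}"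
    by (simp only:)
  then show ?thesis
  proof (rule has_integral_eq[rotated])
    fix t :: real assume "t \<in> {0<..}"
    then have t: "0 < t" by simp
    have "of_real (d * t) powr (z - of_nat k) = complex_of_real d powr (z - of_nat k) * of_real t powr (z - of_nat k)"
      using d t by (simp add: powr_times_real)
    moreover have "complex_of_real d powr (of_nat k - z) * of_real d powr (z - of_nat k) = 1"
      using d by (simp flip: powr_add)
    moreover have "c * (d * t) powr (- real k) = 1 / t ^ k"
      using d t c dk by (simp add: powr_mult powr_minus_divide powr_realpow)
    ultimately show "of_real d powr (of_nat k - z) * g c (d * t) = kernel_H_integrand k z (lam * c powr (1 / real k)) t"
      unfolding g_def kernel_H_integrand_def d_def[symmetric] by (simp add: mult.assoc[symmetric] del: of_real_mult)
  qed
qed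

end

section \<open>Pairing with the kernel\<close>

text \<open>Fubini for continuous functions on [0, N] x [a, b], then N to infinity under domination
  by the norm of \<open>g\<close>. The variable t must range over a compact interval, which is why
  the kernel integral is truncated first.\<close>

lemma rapid_cos_swap:
  fixes h :: "real \<Rightarrow> complex" and q :: "real \<Rightarrow> real"
  assumes g: "rapid g" and h: "continuous_on {a..b} h" and q: "continuous_on {a..b} q"
  shows "((\<lambda>y. g y * integral {a..b} (\<lambda>t. h t * of_real (cos (y * q t)))) has_integral
      integral {a..b} (\<lambda>t. h t * integral {0<..} (\<lambda>y. g y * of_real (cos (y * q t))))) {0<..}"
proof -
  let ?m = "\<lambda>y. integral {a..b} (\<lambda>t. h t * of_real (cos (y * q t)))"
  have q': "continuous_on (U \<times> {a..b}) (\<lambda>x. q (snd x))" and h': "continuous_on (U \<times> {a..b}) (\<lambda>x. h (snd x))" for U :: "real set"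
    by (intro continuous_on_compose2[OF q] continuous_on_compose2[OF h] continuous_intros; auto)+
  have "continuous_on (U \<times> cbox a b) (\<lambda>(y, t). h t * complex_of_real (cos (y * q t)))" for U :: "real set"
    unfolding case_prod_beta' cbox_interval by (intro continuous_intros q' h')
  from integral_continuous_on_param[OF this] have m_cont: "continuous_on U ?m" for U by simp
  have m_bound: "norm (?m y) \<le> integral {a..b} (\<lambda>t. norm (h t))" for y
  proof (rule integral_norm_bound_integral)
    show "(\<lambda>t. h t * of_real (cos (y * q t))) integrable_on {a..b}" "(\<lambda>t. norm (h t)) integrable_on {a..b}"
      by (intro integrable_continuous_interval continuous_intros h q)+
  qed (auto simp: norm_mult intro: mult_left_le)
  have gm: "(\<lambda>y. g y * ?m y) absolutely_integrable_on {0<..}"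
    by (rule rapid_times_integrable[OF g m_cont m_bound])
  have tail: "(\<lambda>N. integral {0..real N} r) \<longlonglongrightarrow> integral {0<..} r" if "r integrable_on {0<..}" for r :: "real \<Rightarrow> complex"
  proof -
    have "r integrable_on {0..}" using that by (rule integrable_spike_set) (auto intro: negligible_subset[of "{0}"])
    moreover have "integral {0..} r = integral {0<..} r"
      by (rule integral_spike_set) (auto intro: negligible_subset[of "{0}"])
    ultimately show ?thesis
      using filterlim_compose[OF integral_tendsto_at_top_Ici filterlim_real_sequentially, of r 0] by simp
  qed
  have gc: "(\<lambda>y. g y * of_real (cos (y * c))) absolutely_integrable_on {0<..}" for c
    using costr_integrable[OF g, of c] by (simp add: mult.commute)
  have swap: "integral {0..real N} (\<lambda>y. g y * ?m y) =
      integral {a..b} (\<lambda>t. h t * integral {0..real N} (\<lambda>y. g y * of_real (cos (y * q t))))" for N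
  proof -
    have "continuous_on (cbox (0, a) (real N, b)) (\<lambda>(y, t). h t * (g y * complex_of_real (cos (y * q t))))"
      unfolding case_prod_beta' cbox_Pair_eq unfolding cbox_interval
      by (intro continuous_intros q' h' continuous_on_compose2[OF rapid_continuous[OF g, of UNIV]]) auto
    from integral_swap_continuous[OF this]
    have "integral {0..real N} (\<lambda>y. integral {a..b} (\<lambda>t. h t * (g y * of_real (cos (y * q t))))) =
        integral {a..b} (\<lambda>t. h t * integral {0..real N} (\<lambda>y. g y * of_real (cos (y * q t))))" by simp
    moreover have "integral {a..b} (\<lambda>t. h t * (g y * of_real (cos (y * q t)))) = g y * ?m y" for y
      by (simp add: mult.left_commute[of "h _" "g y"])
    ultimately show ?thesis by simp
  qed
  have "(\<lambda>N. integral {a..b} (\<lambda>t. h t * integral {0..real N} (\<lambda>y. g y * of_real (cos (y * q t)))))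
      \<longlonglongrightarrow> integral {a..b} (\<lambda>t. h t * integral {0<..} (\<lambda>y. g y * of_real (cos (y * q t))))"
  proof (rule dominated_convergence(2))
    fix N
    have "continuous_on ({a..b} \<times> cbox 0 (real N)) (\<lambda>(t, y). g y * complex_of_real (cos (y * q t)))"
      unfolding case_prod_beta'
      by (intro continuous_intros continuous_on_compose2[OF rapid_continuous[OF g, of UNIV]] continuous_on_compose2[OF q]) auto
    from integral_continuous_on_param[OF this]
    have c: "continuous_on {a..b} (\<lambda>t. integral {0..real N} (\<lambda>y. g y * of_real (cos (y * q t))))" by simp
    show "(\<lambda>t. h t * integral {0..real N} (\<lambda>y. g y * of_real (cos (y * q t)))) integrable_on {a..b}"
      by (intro integrable_continuous_interval continuous_on_mult h c)
    show "(\<lambda>t. norm (h t) * integral {0<..} (\<lambda>y. norm (g y))) integrable_on {a..b}"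
      by (intro integrable_continuous_interval continuous_intros h)
    fix t assume t: "t \<in> {a..b}"
    have "norm (integral {0..real N} (\<lambda>y. g y * of_real (cos (y * q t)))) \<le> integral {0..real N} (\<lambda>y. norm (g y))"
      by (intro integral_norm_bound_integral integrable_continuous_interval continuous_intros rapid_continuous[OF g])
        (auto simp: norm_mult intro: mult_left_le)
    also have "\<dots> = integral {0<..real N} (\<lambda>y. norm (g y))"
      by (rule integral_spike_set) (auto intro: negligible_subset[of "{0}"])
    also have "\<dots> \<le> integral {0<..} (\<lambda>y. norm (g y))"
    proof (rule integral_subset_le)
      show "(\<lambda>y. norm (g y)) integrable_on {0<..real N}"
        using absolutely_integrable_on_subset_Ioi[OF rapid_integrable[OF g], of "{0<..real N}"]
        by (simp add: absolutely_integrable_on_def subset_iff)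
      show "(\<lambda>y. norm (g y)) integrable_on {0<..}" using rapid_integrable[OF g] by (auto simp: absolutely_integrable_on_def)
    qed auto
    finally show "norm (h t * integral {0..real N} (\<lambda>y. g y * of_real (cos (y * q t)))) \<le> norm (h t) * integral {0<..} (\<lambda>y. norm (g y))"
      unfolding norm_mult by (rule mult_left_mono) simp
  next
    fix t
    show "(\<lambda>N. h t * integral {0..real N} (\<lambda>y. g y * of_real (cos (y * q t)))) \<longlonglongrightarrow> h t * integral {0<..} (\<lambda>y. g y * of_real (cos (y * q t)))"
      using gc by (intro tendsto_mult tendsto_const tail) (auto simp: absolutely_integrable_on_def)
  qed
  moreover have "(\<lambda>N. integral {0..real N} (\<lambda>y. g y * ?m y)) \<longlonglongrightarrow> integral {0<..} (\<lambda>y. g y * ?m y)"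
    using gm by (intro tail) (auto simp: absolutely_integrable_on_def)
  ultimately have "integral {0<..} (\<lambda>y. g y * ?m y) = integral {a..b} (\<lambda>t. h t * integral {0<..} (\<lambda>y. g y * of_real (cos (y * q t))))"
    unfolding swap by (rule LIMSEQ_unique[rotated])
  then show ?thesis using gm by (auto simp: has_integral_iff absolutely_integrable_on_def)
qed

context schwartz_function
begin

lemma f_pairing_dominated:
  assumes "0 < e"
  shows "(\<lambda>y. norm (f y) * (C * (2 * pi * y) powr (e - 1) + K1 * (1 + 2 * pi * y))) integrable_on {0<..}"
proof -
  have r: "rapid f" by (rule f_rapid)
  have "(\<lambda>y. of_real ((2 * pi * y) powr (e - 1)) * f y) absolutely_integrable_on {0<..}"
    by (rule rapid_integrable_powr[OF r, of "e - 1" _ "(2 * pi) powr (e - 1)"])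
      (use assms in \<open>auto intro!: continuous_intros simp: powr_mult norm_mult\<close>)
  then have 1: "(\<lambda>y. C * norm (of_real ((2 * pi * y) powr (e - 1)) * f y)) integrable_on {0<..}"
    by (intro integrable_on_mult_right) (auto simp: absolutely_integrable_on_def)
  have 2: "(\<lambda>y. K1 * norm (f y)) integrable_on {0<..}"
    using rapid_integrable[OF r] by (intro integrable_on_mult_right) (auto simp: absolutely_integrable_on_def)
  have 3: "(\<lambda>y. (K1 * (2 * pi)) * norm (of_real (y ^ 1) * f y)) integrable_on {0<..}"
    using rapid_integrable[OF rapid_power[OF r, of 1]] by (intro integrable_on_mult_right) (auto simp: absolutely_integrable_on_def)
  show ?thesis
    by (rule integrable_eq[OF integrable_add[OF integrable_add[OF 1 2] 3]])
      (auto simp: norm_mult algebra_simps)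
qed

text \<open>For every truncation both sides agree by exchanging integrals. On the side of
  \<open>f\<close> the limit is taken under \<open>trunc_bound\<close>, on the side of
  \<open>J\<close> it is the definition of an improper integral; the factor 1/2 undoes the
  normalisation of \<open>costr\<close>.\<close>

lemma kernel_pairing:
  assumes z: "-1 < Re z" "Re z < real k" and lam: "0 < lam"
  shows "((\<lambda>y. f y * voronoi_kernel.I k z lam (2 * pi * y)) has_integral J z lam / 2) {0<..}"
proof -
  interpret K: voronoi_kernel k z lam using k z lam by unfold_locales
  let ?w = "\<lambda>t. of_real t powr z * v 0 t * of_real (cos (lam * t))"
  have r: "rapid f" by (rule f_rapid)
  have p0: "p 0 = f" by (simp add: p_def[abs_def] nth_vderiv_def)
  have swap: "((\<lambda>y. f y * K.trunc N (2 * pi * y)) has_integral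
      integral {1 / real (Suc N)..real (Suc N)} ?w / 2) {0<..}" for N
  proof -
    let ?a = "1 / real (Suc N)" and ?b = "real (Suc N)"
    let ?h = "\<lambda>t. of_real t powr (z - of_nat k) * of_real (cos (lam * t))" and ?q = "\<lambda>t. 2 * pi * t powr (- real k)"
    have a: "0 < ?a" by simp
    have sub: "{?a..?b} \<subseteq> {0<..}" using less_le_trans[OF a] by force
    have hc: "continuous_on {0<..} ?h" by (intro continuous_intros) (auto simp: complex_nonpos_Reals_iff)
    have qc: "continuous_on {0<..} ?q" by (intro continuous_intros) auto
    note sw = rapid_cos_swap[OF r continuous_on_subset[OF hc sub] continuous_on_subset[OF qc sub]]
    have m: "integral {?a..?b} (\<lambda>t. ?h t * of_real (cos (y * ?q t))) = K.trunc N (2 * pi * y)" for y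
      unfolding K.trunc_def by (intro integral_cong) (simp add: K.g_def mult_ac)
    have "integral {?a..?b} (\<lambda>t. ?h t * integral {0<..} (\<lambda>y. f y * of_real (cos (y * ?q t)))) = integral {?a..?b} (\<lambda>t. ?w t / 2)"
    proof (rule integral_cong)
      fix t assume "t \<in> {?a..?b}"
      then have t: "0 < t" using sub by auto
      have "complex_of_real t powr (z - of_nat k) = of_real t powr z * of_real (t powr (- real k))"
        using t powr_of_real[of t "- real k"] powr_add[of "complex_of_real t" z "- of_nat k"] by simp
      moreover have "2 * integral {0<..} (\<lambda>y. f y * of_real (cos (y * ?q t))) = costr f (t powr (- real k))"
        unfolding costr_def by (simp add: mult_ac)
      ultimately show "?h t * integral {0<..} (\<lambda>y. f y * of_real (cos (y * ?q t))) = ?w t / 2"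
        unfolding v_def p0 by (simp add: field_simps)
    qed
    also have "\<dots> = integral {?a..?b} ?w / 2"
      by (rule integral_divide)
    finally have eq: "integral {?a..?b} (\<lambda>t. ?h t * integral {0<..} (\<lambda>y. f y * of_real (cos (y * ?q t)))) = integral {?a..?b} ?w / 2" .
    show ?thesis using sw unfolding m eq .
  qed
  obtain C K1 where CK: "\<And>N c. 0 < c \<Longrightarrow> norm (K.trunc N c) \<le> C * c powr (K.eps - 1) + K1 * (1 + c)"
    using K.trunc_bound by blast
  have lim: "(\<lambda>N. f y * K.trunc N (2 * pi * y)) \<longlonglongrightarrow> f y * K.I (2 * pi * y)" if "y \<in> {0<..}" for y
    using that by (intro tendsto_mult tendsto_const K.trunc_tendsto) auto
  have b: "norm (f y * K.trunc N (2 * pi * y)) \<le> norm (f y) * (C * (2 * pi * y) powr (K.eps - 1) + K1 * (1 + 2 * pi * y))"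
    if "y \<in> {0<..}" for N y
    unfolding norm_mult using that by (intro mult_left_mono CK) auto
  note dc = dominated_convergence[OF has_integral_integrable[OF swap] f_pairing_dominated[OF K.eps(1), of C K1] b lim]
  have "(\<lambda>N. integral {1 / real (Suc N)..real (Suc N)} ?w / 2) \<longlonglongrightarrow> J z lam / 2"
  proof (intro tendsto_divide tendsto_const integral_trunc_tendsto J_improper)
    show "continuous_on {0<..} ?w"
      by (intro continuous_intros continuous_at_imp_continuous_on ballI has_vector_derivative_continuous[OF v_deriv]) 
        (auto simp: complex_nonpos_Reals_iff)
  qed (use z k lam in auto)
  then have "integral {0<..} (\<lambda>y. f y * K.I (2 * pi * y)) = J z lam / 2"
    using LIMSEQ_unique dc(2) unfolding integral_unique[OF swap] by blast
  then show ?thesis using dc(1) by (simp add: has_integral_iff)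
qed

section \<open>From the pairing to the series with the kernel H\<close>

lemma two_pi_powr: "complex_of_real (2 * pi) powr a * of_real (2 * pi) powr b = of_real (2 * pi) powr (a + b)"
  by (rule powr_add[symmetric])

lemma kernel_arg_eq:
  assumes "0 < y"
  shows "kernel_arg k n y = (2 * pi * real n powr (1 / real k)) * (2 * pi * y) powr (1 / real k)"
  using assms by (simp add: kernel_arg_def powr_add powr_mult)

text \<open>The weight y^((1+z)/k - 1) is exactly what cancels the power of y coming from
  \<open>kernel_scaling\<close> at c = 2 pi y; a power of 2 pi survives.\<close>

lemma kernel_H_eq:
  assumes z: "-1 < Re z" "Re z < real k" and n: "n \<ge> 1" and y: "0 < y"
  shows "kernel_H k z (kernel_arg k n y) * of_real y powr ((1 + z) / of_nat k - 1) =
    of_real (2 * pi) powr (1 - (1 + z) / of_nat k) *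
      voronoi_kernel.I k z (2 * pi * real n powr (1 / real k)) (2 * pi * y)"
proof -
  interpret K: voronoi_kernel k z "2 * pi * real n powr (1 / real k)" using k z n by unfold_locales auto
  have "kernel_H k z (kernel_arg k n y) = of_real (2 * pi * y) powr (1 - (1 + z) / of_nat k) * K.I (2 * pi * y)"
    unfolding kernel_H_def kernel_arg_eq[OF y] using y by (intro integral_unique K.kernel_scaling) simp
  also have "complex_of_real (2 * pi * y) powr (1 - (1 + z) / of_nat k) =
      of_real (2 * pi) powr (1 - (1 + z) / of_nat k) * of_real y powr (1 - (1 + z) / of_nat k)"
    using y powr_times_real[of "of_real (2 * pi)" "of_real y" "1 - (1 + z) / of_nat k"] by simp
  finally have "kernel_H k z (kernel_arg k n y) * of_real y powr ((1 + z) / of_nat k - 1) =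
      of_real (2 * pi) powr (1 - (1 + z) / of_nat k) * K.I (2 * pi * y) *
      (of_real y powr (1 - (1 + z) / of_nat k) * of_real y powr ((1 + z) / of_nat k - 1))"
    by (simp only: mult_ac)
  also have "complex_of_real y powr (1 - (1 + z) / of_nat k) * of_real y powr ((1 + z) / of_nat k - 1) = 1"
    using y by (simp flip: powr_add)
  finally show ?thesis by simp
qed

lemma kernel_H_pairing:
  assumes z: "-1 < Re z" "Re z < real k" and n: "n \<ge> 1"
  shows "((\<lambda>y. kernel_H k z (kernel_arg k n y) * of_real y powr ((1 + z) / of_nat k - 1) * f y) has_integral
     of_real (2 * pi) powr (1 - (1 + z) / of_nat k) * (J z (2 * pi * real n powr (1 / real k)) / 2)) {0<..}"
proof -
  have "0 < 2 * pi * real n powr (1 / real k)" using n by simp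
  from has_integral_mult_right[OF kernel_pairing[OF z this], of "of_real (2 * pi) powr (1 - (1 + z) / of_nat k)"]
  show ?thesis
    by (rule has_integral_eq[rotated]) (use kernel_H_eq[OF z n] in \<open>auto simp: mult_ac\<close>)
qed

lemma kernel_H_integrand_integrable:
  assumes z: "-1 < Re z" "Re z < real k" and x: "0 < x"
  shows "kernel_H_integrand k z x integrable_on {0<..}"
proof -
  interpret K: voronoi_kernel k z x using k z x by unfold_locales
  show ?thesis using K.kernel_scaling[of 1] by (auto simp: has_integral_iff)
qed


lemma kernel_series:
  assumes z: "-1 < Re z" "Re z < real k"
  defines "c \<equiv> of_real (2 * pi) powr (1 - (1 + z) / of_nat k) / 2"
  shows "(\<lambda>n. divisor_S k z (Suc n) * integral {0<..} (\<lambda>y. kernel_H k z (kernel_arg k (Suc n) y)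
           * of_real y powr ((1 + z) / of_nat k - 1) * f y)) sums (c * G z)"
proof -
  have "integral {0<..} (\<lambda>y. kernel_H k z (kernel_arg k (Suc n) y) * of_real y powr ((1 + z) / of_nat k - 1) * f y)
      = c * J z (2 * pi * real (Suc n) powr (1 / real k))" for n
    using integral_unique[OF kernel_H_pairing[OF z, of "Suc n"]] by (simp add: c_def del: of_nat_Suc)
  then show ?thesis using sums_mult[OF F_regroup[OF z], of c] by (simp only: mult.left_commute)
qed

lemma limit_at_0: "Lim (at_right 0) f = f 0"
  by (intro tendsto_Lim rapid_tendsto_at_right f_rapid) simp

lemma integral_log_combination:
  "integral {0<..} (\<lambda>t. f t * of_real ((real (k + 1) * euler_mascheroni + ln t) / real k)) =
     euler_mascheroni * integral {0<..} f +
     1 / of_nat k * (euler_mascheroni * integral {0<..} f + integral {0<..} (\<lambda>t. f t * of_real (ln t)))"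
proof -
  have "(\<lambda>t. f t * of_real (ln t)) integrable_on {0<..}"
  proof -
    \<comment> \<open>Chosen so that ?C (2 pi t)^(-1/2) = 2 t^(-1/2), the bound for -ln t; then
      \<open>f_pairing_dominated\<close> with exponent 1/2 gives the integrability of f(t) ln
      t.\<close>
    let ?C = "2 * (2 * pi) powr (1 / 2)"
    have b: "norm (f t * complex_of_real (ln t)) \<le> norm (f t) * (?C * (2 * pi * t) powr (1 / 2 - 1) + 1 * (1 + 2 * pi * t))"
      if t: "t \<in> {0<..}" for t
    proof -
      have "(2 * pi) powr (1 / 2) * (2 * pi * t) powr (1 / 2 - 1) = t powr (- (1 / 2))"
        using t by (simp add: powr_mult powr_minus field_simps)
      then have C: "?C * (2 * pi * t) powr (1 / 2 - 1) = 2 * t powr (- (1 / 2))" by simp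
      have l1: "- ln t \<le> 2 * t powr (- (1 / 2))"
        using ln_le_minus_one[of "t powr (- (1 / 2))"] t by (simp add: ln_powr)
      have l2: "ln t \<le> 2 * pi * t"
      proof -
        have "1 * t \<le> (2 * pi) * t" using t pi_gt3 by (intro mult_right_mono) auto
        moreover have "ln t \<le> t - 1" using ln_le_minus_one[of t] t by simp
        ultimately show ?thesis by linarith
      qed
      have "0 \<le> 2 * t powr (- (1 / 2))" "0 \<le> 2 * pi * t" using t by auto
      with l1 l2 have "\<bar>ln t\<bar> \<le> 2 * t powr (- (1 / 2)) + (1 + 2 * pi * t)" by (intro abs_leI) linarith+
      then have "\<bar>ln t\<bar> \<le> 2 * t powr (- (1 / 2)) + 1 * (1 + 2 * pi * t)" by (simp only: mult_1)
      then show ?thesis unfolding norm_mult norm_of_real C by (rule mult_left_mono) simp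
    qed
    have "(\<lambda>t. f t * complex_of_real (ln t)) \<in> borel_measurable (lebesgue_on {0<..})"
      by (intro continuous_on_imp_measurable_Ioi continuous_intros rapid_continuous[OF f_rapid]) auto
    from measurable_bounded_by_integrable_imp_absolutely_integrable[OF this _ f_pairing_dominated b]
    show ?thesis by (simp add: absolutely_integrable_on_def)
  qed
  moreover have "f integrable_on {0<..}"
    using rapid_integrable[OF f_rapid] by (simp add: absolutely_integrable_on_def)
  ultimately have "((\<lambda>t. of_real (real (k + 1) * euler_mascheroni / real k) * f t + 1 / of_nat k * (f t * of_real (ln t))) has_integral
      of_real (real (k + 1) * euler_mascheroni / real k) * integral {0<..} f + 1 / of_nat k * integral {0<..} (\<lambda>t. f t * of_real (ln t))) {0<..}"
    by (intro has_integral_add has_integral_mult_right integrable_integral)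
  then have "integral {0<..} (\<lambda>t. f t * of_real ((real (k + 1) * euler_mascheroni + ln t) / real k)) =
      of_real (real (k + 1) * euler_mascheroni / real k) * integral {0<..} f + 1 / of_nat k * integral {0<..} (\<lambda>t. f t * of_real (ln t))"
  proof (intro integral_unique, elim has_integral_eq[rotated])
    fix t :: real
    have "complex_of_real ((real (k + 1) * euler_mascheroni + ln t) / real k) =
        of_real (real (k + 1) * euler_mascheroni / real k) + 1 / of_nat k * of_real (ln t)"
      by (simp add: add_divide_distrib)
    then show "of_real (real (k + 1) * euler_mascheroni / real k) * f t + 1 / of_nat k * (f t * of_real (ln t)) =
        f t * of_real ((real (k + 1) * euler_mascheroni + ln t) / real k)"
      by (simp only: distrib_left mult_ac)
  qed
  moreover have "complex_of_real (real (k + 1) * euler_mascheroni / real k) = euler_mascheroni + 1 / of_nat k * euler_mascheroni"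
  proof -
    have "real (k + 1) * euler_mascheroni / real k = euler_mascheroni + 1 / real k * (euler_mascheroni :: real)"
      using k by (simp add: field_simps)
    then have "complex_of_real (real (k + 1) * euler_mascheroni / real k) = of_real (euler_mascheroni + 1 / real k * euler_mascheroni)"
      by (rule arg_cong)
    then show ?thesis by (simp add: of_real_euler_mascheroni)
  qed
  ultimately show ?thesis by (simp only: distrib_left distrib_right mult.assoc add.assoc)
qed

end

theorem theorem2p4:
  fixes k :: nat and f :: "real \<Rightarrow> complex"
  assumes "k \<ge> 1" and "f \<in> schwartz_space"
  shows "(\<forall>z::complex. -1 < Re z \<and> Re z < real k \<and> z \<noteq> of_nat k - 1 \<longrightarrow>
      (\<forall>x>0. kernel_H_integrand k z x integrable_on {0<..}) \<and>
      (\<forall>n\<ge>1. (\<lambda>y. kernel_H k z (kernel_arg k n y) * of_real y powr ((1 + z) / of_nat k - 1) * f y)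
         integrable_on {0<..}) \<and>
      summable (\<lambda>n. divisor_S k z (Suc n) *
         integral {0<..} (\<lambda>y. kernel_H k z (kernel_arg k (Suc n) y)
           * of_real y powr ((1 + z) / of_nat k - 1) * f y)) \<and>
      (\<lambda>n. divisor_sigma k z (Suc n) * f (real (Suc n))) sums
        (- (1 / 2) * riemann_zeta (- z) * Lim (at_right 0) f
         + riemann_zeta (of_nat k - z) * integral {0<..} f
         + 1 / of_nat k * mellin f ((1 + z) / of_nat k) * riemann_zeta ((1 + z) / of_nat k)
         + of_real (2 * pi) powr (of_nat (k + 1) * ((1 + z) / of_nat k) - z) / of_real (pi ^ 2)
           * (\<Sum>n. divisor_S k z (Suc n) *
                integral {0<..} (\<lambda>y. kernel_H k z (kernel_arg k (Suc n) y)
                  * of_real y powr ((1 + z) / of_nat k - 1) * f y))))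
    \<and> ((\<forall>x>0. kernel_H_integrand k (of_nat k - 1) x integrable_on {0<..}) \<and>
      (\<forall>n\<ge>1. (\<lambda>y. kernel_H k (of_nat k - 1) (kernel_arg k n y) * f y) integrable_on {0<..}) \<and>
      summable (\<lambda>n. divisor_S k (of_nat k - 1) (Suc n) *
         integral {0<..} (\<lambda>y. kernel_H k (of_nat k - 1) (kernel_arg k (Suc n) y) * f y)) \<and>
      (\<lambda>n. divisor_sigma k (of_nat k - 1) (Suc n) * f (real (Suc n))) sums
        (- (1 / 2) * riemann_zeta (1 - of_nat k) * Lim (at_right 0) f
         + integral {0<..} (\<lambda>t. f t *
             of_real ((real (k + 1) * euler_mascheroni + ln t) / real k))
         + 4 * (\<Sum>n. divisor_S k (of_nat k - 1) (Suc n) *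
                integral {0<..} (\<lambda>y. kernel_H k (of_nat k - 1) (kernel_arg k (Suc n) y) * f y))))"
proof -
  interpret schwartz_function k f using assms by unfold_locales
  have lam: "Lim (at_right 0) f = f 0" by (rule limit_at_0)
  show ?thesis
  proof (intro conjI allI impI; (elim conjE)?)
    fix z :: complex assume z: "-1 < Re z" "Re z < real k"
    show "kernel_H_integrand k z x integrable_on {0<..}" if "0 < x" for x
      using that by (rule kernel_H_integrand_integrable[OF z])
    show "(\<lambda>y. kernel_H k z (kernel_arg k n y) * of_real y powr ((1 + z) / of_nat k - 1) * f y) integrable_on {0<..}"
      if "1 \<le> n" for n using kernel_H_pairing[OF z that] by (rule has_integral_integrable)
    show "summable (\<lambda>n. divisor_S k z (Suc n) * integral {0<..} (\<lambda>y. kernel_H k z (kernel_arg k (Suc n) y)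
           * of_real y powr ((1 + z) / of_nat k - 1) * f y))"
      using kernel_series[OF z] by (rule sums_summable)
    assume z1: "z \<noteq> of_nat k - 1"
    \<comment> \<open>The exponents of 2 pi from the theorem and from \<open>kernel_series\<close>
      add up to 2, and 4 pi^2 / (2 pi^2) = 2 is the coefficient of \<open>G\<close>.\<close>
    have "complex_of_real (2 * pi) powr (of_nat (k + 1) * ((1 + z) / of_nat k) - z) / of_real (pi ^ 2)
        * (of_real (2 * pi) powr (1 - (1 + z) / of_nat k) / 2 * G z) = 2 * G z"
    proof -
      have "of_nat (k + 1) * ((1 + z) / of_nat k) - z + (1 - (1 + z) / of_nat k) = 2"
        using \<open>k \<ge> 1\<close> by (simp add: field_simps)
      then have "complex_of_real (2 * pi) powr (of_nat (k + 1) * ((1 + z) / of_nat k) - z) * of_real (2 * pi) powr (1 - (1 + z) / of_nat k)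
          = of_real (2 * pi) powr 2"
        unfolding two_pi_powr by (rule arg_cong)
      also have "complex_of_real (2 * pi) powr 2 = 4 * of_real (pi ^ 2)"
        using powr_nat[of "complex_of_real (2 * pi)" 2] by (simp add: power_mult_distrib)
      finally show ?thesis by (simp add: field_simps)
    qed
    note coeff = this
    have v: "Lsum z = poles z - 1 / 2 * riemann_zeta (- z) * f 0 + 2 * G z" by (rule voronoi_identity) (use z z1 in auto)
    have L: "(\<lambda>n. divisor_sigma k z (Suc n) * f (real (Suc n))) sums Lsum z" by (rule Lsum_sums) (use z in auto)
    show "(\<lambda>n. divisor_sigma k z (Suc n) * f (real (Suc n))) sums
        (- (1 / 2) * riemann_zeta (- z) * Lim (at_right 0) f
         + riemann_zeta (of_nat k - z) * integral {0<..} f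
         + 1 / of_nat k * mellin f ((1 + z) / of_nat k) * riemann_zeta ((1 + z) / of_nat k)
         + of_real (2 * pi) powr (of_nat (k + 1) * ((1 + z) / of_nat k) - z) / of_real (pi ^ 2)
           * (\<Sum>n. divisor_S k z (Suc n) *
                integral {0<..} (\<lambda>y. kernel_H k z (kernel_arg k (Suc n) y)
                  * of_real y powr ((1 + z) / of_nat k - 1) * f y)))"
      unfolding sums_unique[OF kernel_series[OF z], symmetric] lam coeff
      using L[unfolded v poles_def] by (simp add: algebra_simps del: of_nat_Suc)
  next
    let ?z = "of_nat k - 1 :: complex"
    have z: "-1 < Re ?z" "Re ?z < real k" using \<open>k \<ge> 1\<close> by auto
    \<comment> \<open>Here both the weight in y and the power of 2 pi become trivial, so each
      pairing is \<open>J\<close>/2 and the factor 4 gives 2 \<open>G\<close> again.\<close>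
    have s: "(1 + ?z) / of_nat k = 1" using \<open>k \<ge> 1\<close> by simp
    have e: "((\<lambda>y. kernel_H k ?z (kernel_arg k n y) * f y) has_integral J ?z (2 * pi * real n powr (1 / real k)) / 2) {0<..}"
      if "1 \<le> n" for n
    proof (rule has_integral_eq[rotated])
      show "((\<lambda>y. kernel_H k ?z (kernel_arg k n y) * of_real y powr ((1 + ?z) / of_nat k - 1) * f y) has_integral
          J ?z (2 * pi * real n powr (1 / real k)) / 2) {0<..}"
        using kernel_H_pairing[OF z that] unfolding s by simp
    qed (use s in auto)
    have S: "(\<lambda>n. divisor_S k ?z (Suc n) * integral {0<..} (\<lambda>y. kernel_H k ?z (kernel_arg k (Suc n) y) * f y)) sums (G ?z / 2)"
    proof -
      have "integral {0<..} (\<lambda>y. kernel_H k ?z (kernel_arg k (Suc n) y) * f y) = J ?z (2 * pi * real (Suc n) powr (1 / real k)) / 2" for n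
        by (rule integral_unique[OF e]) simp
      then show ?thesis using sums_divide[OF F_regroup[OF z], of 2] by (simp only: times_divide_eq_right)
    qed
    show "kernel_H_integrand k ?z x integrable_on {0<..}" if "0 < x" for x
      using that by (rule kernel_H_integrand_integrable[OF z])
    show "(\<lambda>y. kernel_H k ?z (kernel_arg k n y) * f y) integrable_on {0<..}" if "1 \<le> n" for n
      using e[OF that] by (rule has_integral_integrable)
    show "summable (\<lambda>n. divisor_S k ?z (Suc n) * integral {0<..} (\<lambda>y. kernel_H k ?z (kernel_arg k (Suc n) y) * f y))"
      using S by (rule sums_summable)
    have "riemann_zeta (1 - of_nat k) = riemann_zeta (- ?z)" by simp
    then show "(\<lambda>n. divisor_sigma k ?z (Suc n) * f (real (Suc n))) sums
        (- (1 / 2) * riemann_zeta (1 - of_nat k) * Lim (at_right 0) f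
         + integral {0<..} (\<lambda>t. f t * of_real ((real (k + 1) * euler_mascheroni + ln t) / real k))
         + 4 * (\<Sum>n. divisor_S k ?z (Suc n) * integral {0<..} (\<lambda>y. kernel_H k ?z (kernel_arg k (Suc n) y) * f y)))"
      unfolding sums_unique[OF S, symmetric] lam integral_log_combination
      using Lsum_sums[of ?z] voronoi_identity_double_pole by simp
  qed
qed

end
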